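(* Assume (H1), (H2), (H3). For any $x\in\mathbb X$, $y\in\mathbb R$, $l\geqslant1$, $m\geqslant1$ and $g\in\mathscr C^+(\mathbb X^{l+m}\times\mathbb R_+)$, \[ \begin{aligned} &\lim_{n\to\infty}n^{3/2}\,\mathbb E_x\big(g(X_1,\dots,X_l,X_{n-m+1},\dots,X_n,y+S_n)\,;\,\tau_y>n\big)\\ &=\frac{2}{\sqrt{2\pi}\,\sigma^3}\int_0^{+\infty}\sum_{x^*\in\mathbb X}\mathbb E_{x,x^*}\Big(g(X_1,\dots,X_l,X_m^*,\dots,X_1^*,z)\,V(X_l,y+S_l)\,V^*(X_m^*,z+S_m^* )\,;\,\tau_y>l,\ \tau_z^*>m\Big)\,\nu(x^* )\,dz. \end{aligned} \]
   Context: Let $\mathbb X$ be a finite set and $(X_n)_{n\geqslant0}$ a homogeneous Markov chain on $\mathbb X$ with transition matrix $\mathbf P$; $\mathbb P_x,\mathbb E_x$ denote probability and expectation when $X_0=x$; $\mathbf Pg(x)=\sum_{x'}g(x')\mathbf P(x,x')$. (H1): there exists $k_0\geqslant1$ with $\mathbf P^{k_0}g(x)>0$ for all $x$ and every non-negative, not identically zero $g$. Then $\mathbf P$ has a unique invariant probability $\nu$, positive everywhere; $\nu(g)=\sum_xg(x)\nu(x)$. Let $f:\mathbb X\to\mathbb R$, $S_0=0$, $S_n=\sum_{k=1}^nf(X_k)$, $\tau_y=\inf\{k\geqslant1: y+S_k\leqslant0\}$. (H2): $\nu(f)=0$. (H3): for every $(\theta,a)\in\mathbb R^2$ there exist $n\geqslant0$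 and $x_0,\dots,x_n$ with $\mathbf P(x_0,x_1)\cdots\mathbf P(x_{n-1},x_n)\mathbf P(x_n,x_0)>0$ and $f(x_0)+\dots+f(x_n)-(n+1)\theta\notin a\mathbb Z$. $\sigma^2=\nu(f^2)+2\sum_{n\geqslant1}\nu(f\mathbf P^nf)>0$. Under (H1)–(H3) the limit $\lim_n\sqrt n\,\mathbb P_x(\tau_y>n)$ exists and is finite, and $V(x,y):=\frac{\sqrt{2\pi}\sigma}{2}\lim_n\sqrt n\,\mathbb P_x(\tau_y>n)$. Dual chain: $\mathbf P^*(x,x^* )=\frac{\nu(x^* )}{\nu(x)}\mathbf P(x^*,x)$; $(X_n^* )$ is a Markov chain with transition matrix $\mathbf P^*$, independent of $(X_n)$; $S_0^*=0$, $S_n^*=-\sum_{k=1}^nf(X_k^* )$, $\tau^*_z=\inf\{k\geqslant1: z+S_k^*\leqslant0\}$; $\mathbb P^*_x$ refers to $X_0^*=x$; $V^*(x,z):=\frac{\sqrt{2\pi}\sigma}{2}\lim_n\sqrt n\,\mathbb P^*_x(\tau^*_z>n)$ (the dual chain satisfies (H1)–(H3) with $-f$, same $\nu$ and $\sigma$). $\mathbb E_{x,x^*}$ is expectation under $\mathbb P_x\times\mathbb P^*_{x^*}$ (i.e. $X_0=x$, $X_0^*=x^*$, chains independent). For $k\geqslant1$, $\mathscr C^+(\mathbb X^k\times\mathbb R_+)$ is the set of functions $g:\mathbb X^k\times\mathbb R_+\to\mathbb R_+$ such that $z\mapsto g(x_1,\dots,x_k,z)$ is continuous for every $(x_1,\dots,x_k)$,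 and there exists $\varepsilon>0$ with $\max_{x_1,\dots,x_k}\sup_{z\geqslant0}g(x_1,\dots,x_k,z)(1+z)^{2+\varepsilon}<\infty$. *)

theory Defs
  imports "HOL-Analysis.Analysis"
begin

definition stochastic :: "('x::finite \<Rightarrow> 'x \<Rightarrow> real) \<Rightarrow> bool" where
  "stochastic P \<longleftrightarrow> (\<forall>x x'. P x x' \<ge> 0) \<and> (\<forall>x. (\<Sum>x'\<in>UNIV. P x x') = 1)"

definition invariant_prob :: "('x::finite \<Rightarrow> 'x \<Rightarrow> real) \<Rightarrow> ('x \<Rightarrow> real) \<Rightarrow> bool" where
  "invariant_prob P \<nu> \<longleftrightarrow> (\<forall>x. \<nu> x \<ge> 0) \<and> (\<Sum>x\<in>UNIV. \<nu> x) = 1 \<and>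
     (\<forall>x'. (\<Sum>x\<in>UNIV. \<nu> x * P x x') = \<nu> x')"

definition Pop :: "('x::finite \<Rightarrow> 'x \<Rightarrow> real) \<Rightarrow> ('x \<Rightarrow> real) \<Rightarrow> 'x \<Rightarrow> real" where
  "Pop P g x = (\<Sum>x'\<in>UNIV. g x' * P x x')"

definition Ppow :: "('x::finite \<Rightarrow> 'x \<Rightarrow> real) \<Rightarrow> nat \<Rightarrow> ('x \<Rightarrow> real) \<Rightarrow> 'x \<Rightarrow> real" where
  "Ppow P n g = (Pop P ^^ n) g"

definition H1 :: "('x::finite \<Rightarrow> 'x \<Rightarrow> real) \<Rightarrow> bool" where
  "H1 P \<longleftrightarrow> (\<exists>k0\<ge>1. \<forall>g::'x \<Rightarrow> real. (\<forall>x. g x \<ge> 0) \<and> (\<exists>x. g x \<noteq> 0) \<longrightarrow>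
      (\<forall>x. Ppow P k0 g x > 0))"

definition H2 :: "('x::finite \<Rightarrow> real) \<Rightarrow> ('x \<Rightarrow> real) \<Rightarrow> bool" where
  "H2 \<nu> f \<longleftrightarrow> (\<Sum>x\<in>UNIV. f x * \<nu> x) = 0"

definition H3 :: "('x::finite \<Rightarrow> 'x \<Rightarrow> real) \<Rightarrow> ('x \<Rightarrow> real) \<Rightarrow> bool" where
  "H3 P f \<longleftrightarrow> (\<forall>\<theta> a::real. \<exists>n::nat. \<exists>xs::'x list. length xs = n + 1 \<and>
      (\<Prod>i<n. P (xs ! i) (xs ! Suc i)) * P (xs ! n) (xs ! 0) > 0 \<and>
      (\<Sum>i\<le>n. f (xs ! i)) - real (n + 1) * \<theta> \<notin> {a * of_int k | k. True})"

definition sigma_sq :: "('x::finite \<Rightarrow> 'x \<Rightarrow> real) \<Rightarrow> ('x \<Rightarrow> real) \<Rightarrow> ('x \<Rightarrow> real) \<Rightarrow> real" where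
  "sigma_sq P \<nu> f = (\<Sum>x\<in>UNIV. (f x)\<^sup>2 * \<nu> x) +
      2 * (\<Sum>n. (\<Sum>x\<in>UNIV. f x * Ppow P (Suc n) f x * \<nu> x))"

definition sigma :: "('x::finite \<Rightarrow> 'x \<Rightarrow> real) \<Rightarrow> ('x \<Rightarrow> real) \<Rightarrow> ('x \<Rightarrow> real) \<Rightarrow> real" where
  "sigma P \<nu> f = sqrt (sigma_sq P \<nu> f)"

text \<open>Trajectories: the list [X_1,...,X_n] of the first n steps after X_0 = x.
  Probability of a trajectory and expectations over the first n steps.\<close>
fun path_prob :: "('x \<Rightarrow> 'x \<Rightarrow> real) \<Rightarrow> 'x \<Rightarrow> 'x list \<Rightarrow> real" where
  "path_prob P x [] = 1"
| "path_prob P x (y # ys) = P x y * path_prob P y ys"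

definition paths :: "nat \<Rightarrow> 'x list set" where
  "paths n = {xs. length xs = n}"

definition Exp :: "('x::finite \<Rightarrow> 'x \<Rightarrow> real) \<Rightarrow> 'x \<Rightarrow> nat \<Rightarrow> ('x list \<Rightarrow> real) \<Rightarrow> real" where
  "Exp P x n F = (\<Sum>xs\<in>paths n. path_prob P x xs * F xs)"

definition Ssum :: "('x \<Rightarrow> real) \<Rightarrow> 'x list \<Rightarrow> nat \<Rightarrow> real" where
  "Ssum f xs k = (\<Sum>i<k. f (xs ! i))"

definition tau_gt :: "('x \<Rightarrow> real) \<Rightarrow> real \<Rightarrow> 'x list \<Rightarrow> nat \<Rightarrow> bool" where
  "tau_gt f y xs k \<longleftrightarrow> (\<forall>j\<in>{1..k}. y + Ssum f xs j > 0)"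

definition surv :: "('x::finite \<Rightarrow> 'x \<Rightarrow> real) \<Rightarrow> ('x \<Rightarrow> real) \<Rightarrow> 'x \<Rightarrow> real \<Rightarrow> nat \<Rightarrow> real" where
  "surv P f x y n = Exp P x n (\<lambda>xs. if tau_gt f y xs n then 1 else 0)"

text \<open>V(x,y) = sqrt(2 pi) sigma / 2 * lim_n sqrt n P_x(tau_y > n), for the chain (P, f) with
  parameter sigma.  The dual function V* is Vfun applied to the dual matrix and -f.\<close>
definition Vfun :: "('x::finite \<Rightarrow> 'x \<Rightarrow> real) \<Rightarrow> ('x \<Rightarrow> real) \<Rightarrow> real \<Rightarrow> 'x \<Rightarrow> real \<Rightarrow> real" where
  "Vfun P f s x y = sqrt (2 * pi) * s / 2 * lim (\<lambda>n. sqrt (real n) * surv P f x y n)"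

definition dual :: "('x \<Rightarrow> 'x \<Rightarrow> real) \<Rightarrow> ('x \<Rightarrow> real) \<Rightarrow> 'x \<Rightarrow> 'x \<Rightarrow> real" where
  "dual P \<nu> x x' = \<nu> x' / \<nu> x * P x' x"

definition Cplus :: "nat \<Rightarrow> ('x::finite list \<Rightarrow> real \<Rightarrow> real) \<Rightarrow> bool" where
  "Cplus k g \<longleftrightarrow>
     (\<forall>xs. length xs = k \<longrightarrow> continuous_on {0..} (g xs) \<and> (\<forall>z\<ge>0. g xs z \<ge> 0)) \<and>
     (\<exists>\<epsilon>>0. \<exists>C. \<forall>xs. length xs = k \<longrightarrow> (\<forall>z\<ge>0. g xs z * (1 + z) powr (2 + \<epsilon>) \<le> C))"

end

theory Submission
  imports Defs "HOL-Probability.Probability"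
begin

text \<open>
  Everything reduces to the functionals \<open>U n G w x y = E_x (P (X_n, w) G (y + S_n); \<tau>_y > n)\<close>,
  since the first \<open>l\<close> and the last \<open>m\<close> steps only contribute finite sums. Cut \<open>n\<close> into a
  long initial piece, a short middle piece and a long final piece. On the middle piece the killing
  is dropped and the (smoothed) local limit theorem replaces the kernel by a Gaussian one; time
  reversal turns the final piece into a killed walk of the dual chain. The Gaussian kernel
  antisymmetrised by reflection at the origin is an integral of products of sines, so that the
  limit is governed by \<open>E_x (sin (s (y + S_k)); \<tau>_y > k) / s\<close>. Approximate eigenvectors of the
  twisted kernel and optional stopping show that this quotient converges to
  \<open>V x y exp (- \<sigma>^2 \<kappa> / 2)\<close> when \<open>s^2 k\<close> tends to \<open>\<kappa>\<close>; the same fact, integrated against a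
  Fejer weight, gives the asymptotics of the survival probability. Fejer averages over
  small translations and monotonicity of the killed walk in its starting point yield upper and lower
  bounds for \<open>U\<close>, which close up on step functions around \<open>G\<close>.
\<close>

section \<open>Expectations along killed trajectories\<close>

text \<open>The position has no density, so no pointwise local limit theorem is available; only
  averages against a kernel with compactly supported Fourier transform are controlled, because (H3)
  yields contraction of the twisted kernel on bounded frequency ranges. Perturbation theory of
  eigenvalues is avoided: two Poisson correctors give a vector that solves the eigenvector equation
  up to |s|^3, and over about s^-2 steps the defect adds up to O(|s|). The order n^(-3/2) consists
  of one factor n^(-1/2) for survival in each outer piece and one for the Gaussian kernel of the
  middle piece. The share of time given to the middle piece does not affect the limit, since the
  three Gaussian exponents add up to that of the whole time. It must be small for two other reasons:
  the reflected Gaussian term and the paths that turn nonpositive in the middle must both be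
  negligible. For a given precision the share and the smoothing frequency \<open>T\<close> are fixed
  first, and n tends to infinity afterwards.\<close>

primrec mpow :: "('x::finite \<Rightarrow> 'x \<Rightarrow> 'a::comm_semiring_1) \<Rightarrow> nat \<Rightarrow> 'x \<Rightarrow> 'x \<Rightarrow> 'a" where
  "mpow A 0 x w = (if x = w then 1 else 0)"
| "mpow A (Suc n) x w = (\<Sum>v\<in>UNIV. A x v * mpow A n v w)"

text \<open>The phase is attached to the target state, in accordance with S_n = f(X_1) + ... +
  f(X_n): the (x, w) entry of the n-th power is E_x (exp (i s S_n); X_n = w). \<open>mpow\<close> is
  generic in the scalars so that the same lemmas serve \<open>P\<close> and its complex
  twist.\<close>

definition tilt :: "('x \<Rightarrow> 'x \<Rightarrow> real) \<Rightarrow> ('x \<Rightarrow> real) \<Rightarrow> real \<Rightarrow> 'x \<Rightarrow> 'x \<Rightarrow> complex" where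
  "tilt P f s x v = complex_of_real (P x v) * cis (s * f v)"

lemma mpow_add: "mpow A (m + n) x w = (\<Sum>v\<in>UNIV. mpow A m x v * mpow A n v w)"
proof (induction m arbitrary: x)
  case 0
  have "(\<Sum>v\<in>UNIV. (if x = v then 1 else 0) * mpow A n v w) = (\<Sum>v\<in>UNIV. if x = v then mpow A n v w else 0)"
    by (intro sum.cong) auto
  then show ?case by simp
next
  case (Suc m)
  have "mpow A (Suc m + n) x w = (\<Sum>u\<in>UNIV. \<Sum>v\<in>UNIV. A x u * (mpow A m u v * mpow A n v w))"
    by (simp add: Suc sum_distrib_left)
  also have "\<dots> = (\<Sum>v\<in>UNIV. \<Sum>u\<in>UNIV. A x u * mpow A m u v * mpow A n v w)"
    by (subst sum.swap) (simp add: mult.assoc)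
  finally show ?case by (simp add: sum_distrib_right)
qed

lemma mpow_1: "mpow A (Suc 0) x w = A x w"
proof -
  have "(\<Sum>v\<in>UNIV. A x v * (if v = w then 1 else 0)) = (\<Sum>v\<in>UNIV. if v = w then A x v else 0)"
    by (intro sum.cong) auto
  then show ?thesis by simp
qed

lemma mpow_Suc_right: "mpow A (Suc n) x w = (\<Sum>v\<in>UNIV. mpow A n x v * A v w)"
  using mpow_add[of A n "Suc 0" x w] unfolding mpow_1 by simp

text \<open>The diagonal weights telescope along a path. Used with \<open>d\<close> equal to \<nu>
  for the dual chain and with a complex \<open>d\<close> for the twisted dual kernel.\<close>

lemma mpow_dual:
  fixes d :: "'x::finite \<Rightarrow> 'a::field"
  assumes "\<And>x. d x \<noteq> 0"
  shows "mpow (\<lambda>x w. d w / d x * A w x) n x w = d w / d x * mpow A n w x"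
proof (induction n arbitrary: x)
  case 0 then show ?case using assms by simp
next
  case (Suc n)
  have "mpow (\<lambda>x w. d w / d x * A w x) (Suc n) x w
      = (\<Sum>v\<in>UNIV. d v / d x * A v x * (d w / d v * mpow A n w v))" by (simp only: mpow.simps Suc)
  also have "\<dots> = (\<Sum>v\<in>UNIV. d w / d x * (mpow A n w v * A v x))"
    using assms by (intro sum.cong) (auto simp: field_simps)
  finally show ?case by (simp only: mpow_Suc_right sum_distrib_left)
qed

lemma Ppow_mpow: "Ppow P n g x = (\<Sum>w\<in>UNIV. mpow P n x w * g w)"
proof (induction n arbitrary: x)
  case 0
  have "(\<Sum>w\<in>UNIV. (if x = w then 1 else 0) * g w) = (\<Sum>w\<in>UNIV. if x = w then g w else 0)"
    by (intro sum.cong) auto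
  then show ?case by (simp add: Ppow_def)
next
  case (Suc n)
  have "Ppow P (Suc n) g x = (\<Sum>v\<in>UNIV. \<Sum>w\<in>UNIV. mpow P n v w * g w * P x v)"
    using Suc by (simp add: Ppow_def Pop_def sum_distrib_right)
  also have "\<dots> = (\<Sum>w\<in>UNIV. \<Sum>v\<in>UNIV. P x v * mpow P n v w * g w)"
    by (subst sum.swap) (simp add: mult_ac)
  finally show ?case by (simp add: sum_distrib_right)
qed

text \<open>\<open>EE P f D n F x y\<close> is the expectation of \<open>F(X_n, y + S_n)\<close> on the event that the positions at times \<open>1,...,n\<close> lie in \<open>D\<close>.\<close>

primrec EE :: "('x::finite \<Rightarrow> 'x \<Rightarrow> real) \<Rightarrow> ('x \<Rightarrow> real) \<Rightarrow> real set \<Rightarrow> nat \<Rightarrow>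
    ('x \<Rightarrow> real \<Rightarrow> 'b::real_normed_vector) \<Rightarrow> 'x \<Rightarrow> real \<Rightarrow> 'b" where
  "EE P f D 0 F x y = F x y"
| "EE P f D (Suc n) F x y =
     (\<Sum>v\<in>UNIV. P x v *\<^sub>R (if y + f v \<in> D then EE P f D n F v (y + f v) else 0))"

lemma EE_add_time: "EE P f D (m + n) F x y = EE P f D m (EE P f D n F) x y"
  by (induction m arbitrary: x y) (auto intro!: sum.cong)

lemma EE_Suc_right: "EE P f D (Suc n) F x y = EE P f D n (EE P f D (Suc 0) F) x y"
  using EE_add_time[of P f D n "Suc 0" F x y] by simp

text \<open>The alternative \<open>z = y\<close> accounts for n = 0: the starting height is never
  tested against \<open>D\<close>, so the functional may be evaluated there outside
  \<open>D\<close>. The same pattern recurs in the comparison lemmas below.\<close>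

lemma EE_cong:
  assumes "\<And>x' z. z \<in> D \<or> z = y \<Longrightarrow> F x' z = G x' z"
  shows "EE P f D n F x y = EE P f D n G x y"
  using assms
proof (induction n arbitrary: x y)
  case (Suc n)
  have "y + f v \<in> D \<Longrightarrow> EE P f D n F v (y + f v) = EE P f D n G v (y + f v)" for v
    by (rule Suc.IH) (use Suc.prems in auto)
  then show ?case unfolding EE.simps by (intro sum.cong) auto
qed simp

lemma EE_linear:
  assumes "bounded_linear h"
  shows "h (EE P f D n F x y) = EE P f D n (\<lambda>x z. h (F x z)) x y"
proof -
  interpret bounded_linear h by fact
  show ?thesis by (induction n arbitrary: x y) (auto simp: sum scaleR zero intro!: sum.cong)
qed

lemma EE_add: "EE P f D n (\<lambda>x z. F x z + G x z) x y = EE P f D n F x y + EE P f D n G x y"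
  by (induction n arbitrary: x y) (auto simp: sum.distrib[symmetric] scaleR_add_right intro!: sum.cong)

lemma EE_scaleR: "EE P f D n (\<lambda>x z. c *\<^sub>R F x z) x y = c *\<^sub>R EE P f D n F x y"
  using EE_linear[OF bounded_linear_scaleR_right[of c], of P f D n F x y] by simp

lemma EE_cmult: "EE P f D n (\<lambda>x z. c * F x z) x y = c * (EE P f D n F x y :: 'b::real_normed_algebra)"
  using EE_linear[OF bounded_linear_mult_right[of c], of P f D n F x y] by simp

lemma EE_multc: "EE P f D n (\<lambda>x z. F x z * c) x y = (EE P f D n F x y :: 'b::real_normed_algebra) * c"
  using EE_linear[OF bounded_linear_mult_left[of c], of P f D n F x y] by simp

lemma EE_minus: "EE P f D n (\<lambda>x z. - F x z) x y = - EE P f D n F x y"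
  using EE_scaleR[of P f D n "-1" F x y] by simp

lemma EE_diff: "EE P f D n (\<lambda>x z. F x z - G x z) x y = EE P f D n F x y - EE P f D n G x y"
  using EE_add[of P f D n F "\<lambda>x z. - G x z" x y] by (simp add: EE_minus)

lemma EE_zero [simp]: "EE P f D n (\<lambda>x z. 0) x y = 0"
  by (induction n arbitrary: x y) (auto intro!: sum.neutral)

lemma EE_measurable:
  fixes F :: "'x::finite \<Rightarrow> real \<Rightarrow> real"
  assumes "\<And>x. F x \<in> borel_measurable borel" "D \<in> sets borel"
  shows "(\<lambda>y. EE P f D n F x y) \<in> borel_measurable borel"
proof (induction n arbitrary: x)
  case 0 then show ?case using assms by simp
next
  case (Suc n)
  have "(\<lambda>y. EE P f D n F v (y + f v)) \<in> borel_measurable borel" for v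
    by (rule measurable_compose[OF _ Suc]) simp
  moreover have "(\<lambda>y. y + f v \<in> D) \<in> measurable borel (count_space UNIV)" for v
    using assms(2) by measurable
  ultimately show ?case unfolding EE.simps
    by (intro borel_measurable_sum borel_measurable_scaleR measurable_If) (auto simp: pred_def)
qed

text \<open>No product measure is involved: at a fixed time the walk takes finitely many values, so
  \<open>EE\<close> is a finite linear combination and Fubini reduces to linearity of the
  integral.\<close>

lemma EE_integral:
  fixes H :: "'t \<Rightarrow> 'x::finite \<Rightarrow> real \<Rightarrow> 'b::{banach,second_countable_topology}"
  assumes "\<And>x z. integrable M (\<lambda>t. H t x z)"
  shows "integrable M (\<lambda>t. EE P f D n (H t) x y) \<and>
    EE P f D n (\<lambda>x z. \<integral>t. H t x z \<partial>M) x y = (\<integral>t. EE P f D n (H t) x y \<partial>M)"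
proof (induction n arbitrary: x y)
  case 0 then show ?case using assms by simp
next
  case (Suc n)
  have i: "integrable M (\<lambda>t. if y + f v \<in> D then EE P f D n (H t) v (y + f v) else 0)" for v
    by (cases "y + f v \<in> D") (simp_all add: Suc)
  have e: "(if y + f v \<in> D then EE P f D n (\<lambda>x z. \<integral>t. H t x z \<partial>M) v (y + f v) else 0)
      = (\<integral>t. (if y + f v \<in> D then EE P f D n (H t) v (y + f v) else 0) \<partial>M)" for v
    by (simp add: Suc)
  show ?case unfolding EE.simps e
    by (intro conjI Bochner_Integration.integrable_sum integrable_scaleR_right i,
        subst Bochner_Integration.integral_sum) (simp_all only: integral_scaleR_right integrable_scaleR_right i)
qed

locale nonneg_kernel =
  fixes P :: "'x::finite \<Rightarrow> 'x \<Rightarrow> real" and f :: "'x \<Rightarrow> real"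
  assumes P_nonneg: "P x v \<ge> 0" and P_sum: "(\<Sum>v\<in>UNIV. P x v) = 1"
begin

lemma EE_mono:
  fixes F G :: "'x \<Rightarrow> real \<Rightarrow> real"
  assumes "\<And>x' z. z \<in> D \<or> z = y \<Longrightarrow> F x' z \<le> G x' z"
  shows "EE P f D n F x y \<le> EE P f D n G x y"
  using assms
proof (induction n arbitrary: x y)
  case (Suc n)
  have "y + f v \<in> D \<Longrightarrow> EE P f D n F v (y + f v) \<le> EE P f D n G v (y + f v)" for v
    by (rule Suc.IH) (use Suc.prems in auto)
  then show ?case unfolding EE.simps by (intro sum_mono) (auto intro!: mult_left_mono simp: P_nonneg)
qed simp

lemma EE_nonneg:
  fixes F :: "'x \<Rightarrow> real \<Rightarrow> real"
  assumes "\<And>x' z. z \<in> D \<or> z = y \<Longrightarrow> 0 \<le> F x' z"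
  shows "0 \<le> EE P f D n F x y"
  using EE_mono[of D y "\<lambda>_ _. 0" F n x] assms by simp

lemma EE_norm: "norm (EE P f D n F x y) \<le> EE P f D n (\<lambda>x z. norm (F x z)) x y"
proof (induction n arbitrary: x y)
  case (Suc n)
  show ?case
    unfolding EE.simps
    by (rule sum_norm_le) (use Suc in \<open>auto intro!: mult_left_mono simp: P_nonneg\<close>)
qed simp

lemma EE_norm_le:
  assumes "\<And>x' z. z \<in> D \<or> z = y \<Longrightarrow> norm (F x' z) \<le> G x' z"
  shows "norm (EE P f D n F x y) \<le> EE P f D n G x y"
  using EE_norm[of D n F x y] EE_mono[of D y "\<lambda>x z. norm (F x z)" G n x] assms by fastforce

lemma EE_UNIV_const [simp]: "EE P f UNIV n (\<lambda>_ _. c) x y = c"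
  by (induction n arbitrary: x y) (auto simp: scaleR_left.sum[symmetric] P_sum)

lemma EE_le_UNIV:
  fixes F :: "'x \<Rightarrow> real \<Rightarrow> real"
  assumes "\<And>x' z. 0 \<le> F x' z"
  shows "EE P f D n F x y \<le> EE P f UNIV n F x y"
proof (induction n arbitrary: x y)
  case (Suc n)
  have nn: "0 \<le> EE P f UNIV n F x y" for x y by (rule EE_nonneg) (use assms in auto)
  show ?case unfolding EE.simps
    by (rule sum_mono) (use Suc nn in \<open>auto intro!: mult_left_mono simp: P_nonneg\<close>)
qed simp

text \<open>A trajectory that stays positive from y also stays positive from y + s, so raising the
  start only adds trajectories, with nonnegative weight. For n = 0 positivity of the start has to be
  assumed, since nothing has tested it.\<close>

lemma EE_shift_mono:
  fixes F G :: "'x \<Rightarrow> real \<Rightarrow> real"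
  assumes FG: "\<And>x z. 0 < z \<Longrightarrow> F x z \<le> G x (z + s)" and "0 \<le> s"
    and "\<And>x z. 0 < z \<Longrightarrow> 0 \<le> G x z" and "n = 0 \<Longrightarrow> 0 < y"
  shows "EE P f {0<..} n F x y \<le> EE P f {0<..} n G x (y + s)"
  using assms(4)
proof (induction n arbitrary: x y)
  case 0 then show ?case using FG by simp
next
  case (Suc n)
  have nn: "0 < y \<Longrightarrow> 0 \<le> EE P f {0<..} n G x y" for x y by (rule EE_nonneg) (use assms in auto)
  have eq: "y + s + f v = (y + f v) + s" for v by simp
  show ?case unfolding EE.simps
  proof (rule sum_mono, simp del: EE.simps, intro conjI impI mult_left_mono P_nonneg)
    fix v
    show "0 < y + f v \<Longrightarrow> EE P f {0<..} n F v (y + f v) \<le> EE P f {0<..} n G v (y + s + f v)"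
      unfolding eq by (rule Suc.IH) auto
    show "\<not> 0 < y + s + f v \<Longrightarrow> 0 < y + f v \<Longrightarrow> P x v * EE P f {0<..} n F v (y + f v) \<le> 0"
      using assms(2) by simp
    show "0 < y + s + f v \<Longrightarrow> 0 \<le> P x v * EE P f {0<..} n G v (y + s + f v)"
      using nn P_nonneg by simp
  qed
qed

lemma mpow_nonneg: "0 \<le> mpow P n x w"
  by (induction n arbitrary: x) (auto intro!: sum_nonneg simp: P_nonneg)

lemma mpow_row_sum: "(\<Sum>w\<in>UNIV. mpow P n x w) = 1"
proof (induction n arbitrary: x)
  case (Suc n)
  have "(\<Sum>w\<in>UNIV. mpow P (Suc n) x w) = (\<Sum>v\<in>UNIV. P x v * (\<Sum>w\<in>UNIV. mpow P n v w))"
    by (simp add: sum_distrib_left, rule sum.swap)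
  then show ?case by (simp add: Suc P_sum)
qed simp

text \<open>The exponential is multiplicative along the free walk: the position survives only as a
  scalar phase, and the state evolves by the twisted matrix.\<close>

lemma EE_cis:
  "EE P f UNIV n (\<lambda>x' z. cis (s * z) * g x') x y = cis (s * y) * (\<Sum>w\<in>UNIV. mpow (tilt P f s) n x w * g w)"
proof (induction n arbitrary: x y)
  case 0
  have "(\<Sum>w\<in>UNIV. (if x = w then 1 else 0) * g w) = (\<Sum>w\<in>UNIV. if x = w then g w else 0)"
    by (intro sum.cong) auto
  then show ?case by simp
next
  case (Suc n)
  have "EE P f UNIV (Suc n) (\<lambda>x' z. cis (s * z) * g x') x y =
     (\<Sum>v\<in>UNIV. cis (s * y) * (tilt P f s x v * (\<Sum>w\<in>UNIV. mpow (tilt P f s) n v w * g w)))"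
    unfolding EE.simps Suc tilt_def
    by (intro sum.cong) (simp_all add: scaleR_conv_of_real cis_mult[symmetric] distrib_left)
  also have "\<dots> = cis (s * y) * (\<Sum>v\<in>UNIV. \<Sum>w\<in>UNIV. tilt P f s x v * mpow (tilt P f s) n v w * g w)"
    by (simp add: sum_distrib_left mult.assoc)
  also have "\<dots> = cis (s * y) * (\<Sum>w\<in>UNIV. \<Sum>v\<in>UNIV. tilt P f s x v * mpow (tilt P f s) n v w * g w)"
    by (subst sum.swap) simp
  finally show ?case by (simp add: sum_distrib_right)
qed

lemma mpow_tilt_le: "cmod (mpow (tilt P f s) n x w) \<le> mpow P n x w"
proof (induction n arbitrary: x)
  case (Suc n)
  have "cmod (tilt P f s x v) = P x v" for v by (simp add: tilt_def norm_mult P_nonneg)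
  then show ?case unfolding mpow.simps
    by (intro sum_norm_le) (auto simp: norm_mult P_nonneg Suc intro!: mult_left_mono)
qed simp

end

section \<open>Poisson equation and approximate eigenvectors of the twisted kernel\<close>

text \<open>Ergodicity enters as absolute summability of the deviations from equilibrium: this makes
  the Poisson series converge and, through the vanishing of its terms, gives equidistribution of the
  end state.\<close>

locale mchain = nonneg_kernel P f for P :: "'x::finite \<Rightarrow> 'x \<Rightarrow> real" and f :: "'x \<Rightarrow> real" +
  fixes \<nu> :: "'x \<Rightarrow> real"
  assumes nu_pos: "0 < \<nu> x" and nu_sum: "(\<Sum>x\<in>UNIV. \<nu> x) = 1"
    and nu_inv: "(\<Sum>x\<in>UNIV. \<nu> x * P x w) = \<nu> w"
    and mixing: "summable (\<lambda>n. \<bar>mpow P n x w - \<nu> w\<bar>)"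
    and f_centered: "(\<Sum>x\<in>UNIV. f x * \<nu> x) = 0"
begin

lemma nu_le_1: "\<nu> x \<le> 1"
  using nu_sum member_le_sum[of x UNIV \<nu>] nu_pos by (auto intro: less_imp_le)

lemma nu_inv_fun: "(\<Sum>x\<in>UNIV. (\<Sum>v\<in>UNIV. P x v * g v) * \<nu> x) = (\<Sum>v\<in>UNIV. g v * \<nu> v)"
proof -
  have "(\<Sum>x\<in>UNIV. (\<Sum>v\<in>UNIV. P x v * g v) * \<nu> x) = (\<Sum>v\<in>UNIV. \<Sum>x\<in>UNIV. g v * (\<nu> x * P x v))"
    unfolding sum_distrib_right by (subst sum.swap) (simp add: mult_ac)
  then show ?thesis by (simp add: sum_distrib_left[symmetric] nu_inv)
qed

lemma Ppow_0: "Ppow P 0 g x = g x"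
  by (simp add: Ppow_def)

lemma Ppow_Suc: "Ppow P (Suc n) g x = (\<Sum>v\<in>UNIV. P x v * Ppow P n g v)"
  by (simp add: Ppow_def Pop_def mult.commute)

lemma Ppow_summable:
  assumes "(\<Sum>x\<in>UNIV. g x * \<nu> x) = 0"
  shows "summable (\<lambda>n. Ppow P n g x)"
proof -
  have "Ppow P n g x = (\<Sum>w\<in>UNIV. (mpow P n x w - \<nu> w) * g w)" for n
    using assms unfolding Ppow_mpow left_diff_distrib sum_subtractf by (simp add: mult.commute)
  then show ?thesis
    by (simp, intro summable_sum summable_mult2 summable_rabs_cancel[OF mixing])
qed

definition poisson :: "('x \<Rightarrow> real) \<Rightarrow> 'x \<Rightarrow> real" where
  "poisson g x = (\<Sum>n. Ppow P n g x)"

lemma poisson_eq: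
  assumes "(\<Sum>x\<in>UNIV. g x * \<nu> x) = 0"
  shows "poisson g x = g x + (\<Sum>v\<in>UNIV. P x v * poisson g v)"
    and "(\<Sum>v\<in>UNIV. P x v * poisson g v) = (\<Sum>n. Ppow P (Suc n) g x)"
proof -
  note s = Ppow_summable[OF assms]
  have "(\<Sum>v\<in>UNIV. P x v * poisson g v) = (\<Sum>v\<in>UNIV. \<Sum>n. P x v * Ppow P n g v)"
    unfolding poisson_def by (simp add: suminf_mult[OF s])
  also have "\<dots> = (\<Sum>n. \<Sum>v\<in>UNIV. P x v * Ppow P n g v)"
    by (rule suminf_sum[symmetric]) (intro summable_mult s)
  finally show *: "(\<Sum>v\<in>UNIV. P x v * poisson g v) = (\<Sum>n. Ppow P (Suc n) g x)"
    by (simp add: Ppow_Suc)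
  show "poisson g x = g x + (\<Sum>v\<in>UNIV. P x v * poisson g v)"
    unfolding * using suminf_split_head[OF s, of x] by (simp add: Ppow_0 poisson_def)
qed

text \<open>\<open>P\<close> applied to the solution of the Poisson equation for \<open>f\<close>.
  By \<open>r_eq\<close> this is the corrector that turns S_n + r(X_n) into a martingale.\<close>

definition r :: "'x \<Rightarrow> real" where "r x = (\<Sum>n. Ppow P (Suc n) f x)"

lemma r_eq: "r x = (\<Sum>v\<in>UNIV. P x v * (f v + r v))"
proof -
  have 1: "r x = (\<Sum>v\<in>UNIV. P x v * poisson f v)" for x
    unfolding r_def using poisson_eq(2)[OF f_centered] by simp
  have "poisson f v = f v + r v" for v
    using poisson_eq(1)[OF f_centered, of v] 1 by simp
  then show ?thesis using 1[of x] by simp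
qed

abbreviation sg2 :: real where "sg2 \<equiv> sigma_sq P \<nu> f"

lemma sg2_r: "sg2 = (\<Sum>x\<in>UNIV. (f x)\<^sup>2 * \<nu> x) + 2 * (\<Sum>x\<in>UNIV. f x * r x * \<nu> x)"
proof -
  have s: "summable (\<lambda>n. Ppow P (Suc n) f x)" for x
    using Ppow_summable[OF f_centered, of x] by (subst summable_Suc_iff)
  have "(\<Sum>n. \<Sum>x\<in>UNIV. f x * Ppow P (Suc n) f x * \<nu> x) = (\<Sum>x\<in>UNIV. \<Sum>n. f x * Ppow P (Suc n) f x * \<nu> x)"
    by (rule suminf_sum) (intro summable_mult summable_mult2 s)
  also have "\<dots> = (\<Sum>x\<in>UNIV. f x * r x * \<nu> x)"
    unfolding r_def by (simp add: suminf_mult2[symmetric] suminf_mult s summable_mult)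
  finally show ?thesis unfolding sigma_sq_def by simp
qed

text \<open>The stationary variance of the martingale increment \<open>f v + r v - r x\<close>. This
  form shows the sign of \<open>sg2\<close> and, when it vanishes, forces \<open>f\<close> to be a
  difference of values of \<open>r\<close> along every edge.\<close>

lemma sg2_variance:
  "sg2 = (\<Sum>x\<in>UNIV. \<Sum>v\<in>UNIV. \<nu> x * P x v * (f v + r v - r x)\<^sup>2)"
proof -
  have "(\<Sum>v\<in>UNIV. \<nu> x * P x v * (f v + r v - r x)\<^sup>2)
      = (\<Sum>v\<in>UNIV. P x v * (f v + r v)\<^sup>2) * \<nu> x - (r x)\<^sup>2 * \<nu> x" for x
  proof -
    have "(\<Sum>v\<in>UNIV. \<nu> x * P x v * (f v + r v - r x)\<^sup>2)
      = (\<Sum>v\<in>UNIV. P x v * (f v + r v)\<^sup>2 * \<nu> x - 2 * \<nu> x * r x * (P x v * (f v + r v)) + \<nu> x * (r x)\<^sup>2 * P x v)"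
      by (intro sum.cong) (auto simp: power2_eq_square algebra_simps)
    also have "\<dots> = (\<Sum>v\<in>UNIV. P x v * (f v + r v)\<^sup>2) * \<nu> x - 2 * \<nu> x * r x * r x + \<nu> x * (r x)\<^sup>2"
      by (simp add: sum.distrib sum_subtractf sum_distrib_left[symmetric] sum_distrib_right[symmetric] P_sum r_eq[symmetric])
    finally show ?thesis by (simp add: power2_eq_square algebra_simps)
  qed
  then have "(\<Sum>x\<in>UNIV. \<Sum>v\<in>UNIV. \<nu> x * P x v * (f v + r v - r x)\<^sup>2)
     = (\<Sum>x\<in>UNIV. (f x + r x)\<^sup>2 * \<nu> x) - (\<Sum>x\<in>UNIV. (r x)\<^sup>2 * \<nu> x)"
    by (simp add: sum_subtractf nu_inv_fun)
  also have "\<dots> = sg2"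
    unfolding sg2_r sum_subtractf[symmetric] sum_distrib_left sum.distrib[symmetric]
    by (intro sum.cong) (auto simp: power2_eq_square algebra_simps)
  finally show ?thesis by simp
qed

lemma sg2_nonneg: "0 \<le> sg2"
  unfolding sg2_variance by (intro sum_nonneg) (auto simp: P_nonneg nu_pos less_imp_le)

text \<open>Applying the twisted kernel to 1 + i s r leaves 1 + i s r - s^2 (\<open>g2\<close> +
  \<open>sg2\<close> / 2) up to cubic terms. Subtracting \<open>sg2\<close> / 2 centres the
  coefficient, so that a second Poisson corrector exists.\<close>

definition g2 :: "'x \<Rightarrow> real" where
  "g2 x = (\<Sum>v\<in>UNIV. P x v * ((f v)\<^sup>2 / 2 + f v * r v)) - sg2 / 2"

lemma g2_centered: "(\<Sum>x\<in>UNIV. g2 x * \<nu> x) = 0"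
proof -
  have "(\<Sum>x\<in>UNIV. g2 x * \<nu> x) = (\<Sum>v\<in>UNIV. ((f v)\<^sup>2 / 2 + f v * r v) * \<nu> v) - sg2 / 2 * (\<Sum>x\<in>UNIV. \<nu> x)"
    unfolding g2_def left_diff_distrib sum_subtractf nu_inv_fun by (simp add: sum_distrib_left)
  also have "(\<Sum>v\<in>UNIV. ((f v)\<^sup>2 / 2 + f v * r v) * \<nu> v) = sg2 / 2"
    unfolding sg2_r by (simp add: distrib_right sum.distrib add_divide_distrib sum_divide_distrib)
  finally show ?thesis by (simp add: nu_sum)
qed

definition q where "q = poisson g2"

lemma q_eq: "(\<Sum>v\<in>UNIV. P x v * q v) = q x - g2 x"
  using poisson_eq(1)[OF g2_centered, of x] by (simp add: q_def)

text \<open>Second-order candidate, around s = 0, for the leading eigenvector of the twisted kernel;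
  the matching eigenvalue is \<open>lam s\<close>.\<close>

definition ev :: "real \<Rightarrow> 'x \<Rightarrow> complex" where
  "ev s x = 1 + \<i> * of_real (s * r x) - of_real (s\<^sup>2 * q x)"

definition bd :: real where
  "bd = 1 + (\<Sum>x\<in>UNIV. \<bar>f x\<bar> + \<bar>r x\<bar> + \<bar>q x\<bar>) + sg2"

lemma bd_ge_1: "1 \<le> bd" and sg2_le_bd: "\<bar>sg2\<bar> \<le> bd"
  and bd_bounds: "\<bar>f x\<bar> \<le> bd" "\<bar>r x\<bar> \<le> bd" "\<bar>q x\<bar> \<le> bd"
proof -
  have "\<bar>f x\<bar> + \<bar>r x\<bar> + \<bar>q x\<bar> \<le> (\<Sum>x\<in>UNIV. \<bar>f x\<bar> + \<bar>r x\<bar> + \<bar>q x\<bar>)"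
    by (rule member_le_sum) auto
  moreover have "0 \<le> (\<Sum>x\<in>UNIV. \<bar>f x\<bar> + \<bar>r x\<bar> + \<bar>q x\<bar>)" by (intro sum_nonneg) auto
  ultimately show "1 \<le> bd" "\<bar>f x\<bar> \<le> bd" "\<bar>r x\<bar> \<le> bd" "\<bar>q x\<bar> \<le> bd" "\<bar>sg2\<bar> \<le> bd"
    using sg2_nonneg by (auto simp: bd_def)
qed

lemma ev_near_1: assumes "\<bar>s\<bar> \<le> 1" shows "cmod (ev s x - 1) \<le> 2 * bd * \<bar>s\<bar>"
proof -
  have "cmod (ev s x - 1) = cmod (\<i> * of_real (s * r x) - of_real (s\<^sup>2 * q x))"
    by (simp add: ev_def)
  also have "\<dots> \<le> \<bar>s * r x\<bar> + \<bar>s\<^sup>2 * q x\<bar>"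
    by (rule order.trans[OF norm_triangle_ineq4]) (simp only: norm_mult norm_of_real norm_ii mult_1)
  also have "\<bar>s * r x\<bar> \<le> \<bar>s\<bar> * bd" by (simp add: abs_mult bd_bounds mult_left_mono)
  also have "\<bar>s\<^sup>2 * q x\<bar> \<le> \<bar>s\<bar> * bd"
    unfolding abs_mult power2_eq_square using assms
    by (intro mult_mono bd_bounds mult_left_le) auto
  finally show ?thesis by (simp add: mult_ac)
qed

lemma ev_le: assumes "\<bar>s\<bar> \<le> 1" shows "cmod (ev s x) \<le> 3 * bd"
proof -
  have "cmod (ev s x) \<le> 1 + cmod (ev s x - 1)" using norm_triangle_ineq2[of "ev s x" 1] by simp
  also have "\<dots> \<le> bd + 2 * bd * 1"
    using ev_near_1[OF assms, of x] bd_ge_1 mult_left_mono[OF assms, of "2 * bd"] by linarith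
  finally show ?thesis by simp
qed

abbreviation lam :: "real \<Rightarrow> real" where "lam s \<equiv> 1 - sg2 * s\<^sup>2 / 2"

text \<open>Six units of \<open>bd\<close>^4 come from the truncated product in
  \<open>tilt_ev\<close>, and one unit each from the s^3 and s^4 terms of \<open>lam s\<close> times
  \<open>ev s x\<close>.\<close>

definition cerr :: real where "cerr = 8 * bd ^ 4"

text \<open>After a Taylor expansion of the phase, the coefficients of 1, s and s^2 cancel by row
  normalisation, by \<open>r_eq\<close> and by \<open>q_eq\<close>. What is left has order s^3 or
  s^4.\<close>

lemma tilt_ev:
  assumes s: "\<bar>s\<bar> \<le> 1"
  shows "cmod ((\<Sum>v\<in>UNIV. tilt P f s x v * ev s v) - of_real (lam s) * ev s x) \<le> cerr * \<bar>s\<bar> ^ 3"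
proof -
  \<comment> \<open>\<open>m v\<close> is the part of order at most s^2 in the product
    \<open>cis (s * f v) * ev s v\<close>.\<close>
  define m :: "'x \<Rightarrow> complex" where
    "m v = 1 + \<i> * of_real (s * (f v + r v)) - of_real (s\<^sup>2 * ((f v)\<^sup>2 / 2 + f v * r v + q v))" for v
  define R where "R v = cis (s * f v) - (1 + \<i> * of_real (s * f v) - of_real ((s * f v)\<^sup>2 / 2))" for v
  have bd1: "1 \<le> bd" by (rule bd_ge_1)
  have s43: "\<bar>s\<bar> ^ 4 \<le> \<bar>s\<bar> ^ 3" using s by (intro power_decreasing) auto
  have R: "cmod (R v) \<le> \<bar>s\<bar> ^ 3 * bd ^ 3 / 6" for v
  proof -
    have "cmod (R v) \<le> \<bar>s * f v\<bar> ^ 3 / 6"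
      using iexp_approx1[of "s * f v" 2]
      by (simp add: R_def cis_conv_exp numeral_2_eq_2 numeral_3_eq_3 power_mult_distrib algebra_simps)
    also have "\<bar>s * f v\<bar> ^ 3 \<le> \<bar>s\<bar> ^ 3 * bd ^ 3"
      unfolding power_mult_distrib abs_mult by (intro mult_left_mono power_mono bd_bounds) auto
    finally show ?thesis by simp
  qed
  have p2: "\<bar>a * b\<bar> \<le> bd\<^sup>2" if "\<bar>a\<bar> \<le> bd" "\<bar>b\<bar> \<le> bd" for a b
    unfolding abs_mult power2_eq_square using that by (intro mult_mono) auto
  have p3: "\<bar>a * b * c\<bar> \<le> bd ^ 3" if "\<bar>a\<bar> \<le> bd" "\<bar>b\<bar> \<le> bd" "\<bar>c\<bar> \<le> bd" for a b c
    unfolding abs_mult power3_eq_cube using that by (intro mult_mono) auto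
  have b24: "bd\<^sup>2 \<le> bd ^ 4" "bd ^ 3 \<le> bd ^ 4" using bd1 by (intro power_increasing; simp)+
  have tri: "cmod (a - b + c) \<le> cmod a + cmod b + cmod c" for a b c
    using norm_triangle_ineq[of "a - b" c] norm_triangle_ineq4[of a b] by linarith
  have tri2: "cmod (a + (b - c)) \<le> cmod a + (cmod b + cmod c)" for a b c
    using norm_triangle_ineq[of a "b - c"] norm_triangle_ineq4[of b c] by linarith
  have E: "cmod (cis (s * f v) * ev s v - m v) \<le> 6 * bd ^ 4 * \<bar>s\<bar> ^ 3" for v
  proof -
    have eq: "cis (s * f v) * ev s v - m v = R v * ev s v
        - \<i> * of_real (s ^ 3 * (f v * q v + f v * f v * r v / 2)) + of_real (s ^ 4 * (f v * f v * q v / 2))"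
    proof -
      define pl where "pl = 1 + \<i> * complex_of_real (s * f v) - of_real ((s * f v)\<^sup>2 / 2)"
      have "pl * ev s v - m v =
        - \<i> * of_real (s ^ 3 * (f v * q v + f v * f v * r v / 2)) + of_real (s ^ 4 * (f v * f v * q v / 2))"
        by (rule complex_eqI)
           (simp_all add: pl_def ev_def m_def power2_eq_square power3_eq_cube power4_eq_xxxx field_simps)
      moreover have "cis (s * f v) * ev s v - m v = R v * ev s v + (pl * ev s v - m v)"
        unfolding R_def pl_def by (simp only: left_diff_distrib) simp
      ultimately show ?thesis by simp
    qed
    have 1: "cmod (cis (s * f v) * ev s v - m v) \<le> cmod (R v) * cmod (ev s v)
        + \<bar>s ^ 3 * (f v * q v + f v * f v * r v / 2)\<bar> + \<bar>s ^ 4 * (f v * f v * q v / 2)\<bar>"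
      unfolding eq
      by (rule order.trans[OF tri]) (simp only: norm_mult norm_of_real norm_ii mult_1 order_refl)
    have "cmod (R v) * cmod (ev s v) \<le> (\<bar>s\<bar> ^ 3 * bd ^ 3 / 6) * (3 * bd)"
      by (intro mult_mono R ev_le s) (use bd1 in auto)
    moreover have nn: "0 \<le> bd ^ 4 * \<bar>s\<bar> ^ 3" by (intro mult_nonneg_nonneg) (use bd1 in auto)
    moreover have "(\<bar>s\<bar> ^ 3 * bd ^ 3 / 6) * (3 * bd) = (bd ^ 4 * \<bar>s\<bar> ^ 3) / 2"
      by (simp add: power3_eq_cube power4_eq_xxxx)
    ultimately have 2: "cmod (R v) * cmod (ev s v) \<le> bd ^ 4 * \<bar>s\<bar> ^ 3" by linarith
    have "\<bar>f v * q v + f v * f v * r v / 2\<bar> \<le> bd ^ 4 + bd ^ 4"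
      using p2[of "f v" "q v"] p3[of "f v" "f v" "r v"] bd_bounds[of v] b24 by auto
    then have 3: "\<bar>s ^ 3 * (f v * q v + f v * f v * r v / 2)\<bar> \<le> \<bar>s\<bar> ^ 3 * (bd ^ 4 + bd ^ 4)"
      unfolding abs_mult[of "s ^ 3"] power_abs by (intro mult_left_mono) auto
    have "\<bar>f v * f v * q v / 2\<bar> \<le> bd ^ 4"
      using p3[of "f v" "f v" "q v"] bd_bounds[of v] b24 by auto
    then have 4: "\<bar>s ^ 4 * (f v * f v * q v / 2)\<bar> \<le> \<bar>s\<bar> ^ 3 * bd ^ 4"
      unfolding abs_mult[of "s ^ 4"] power_abs using s43 by (intro mult_mono) auto
    show ?thesis using 1 2 3 4 nn by (simp only: distrib_left mult.commute[of _ "\<bar>s\<bar> ^ 3"] mult.left_commute[of 6])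
  qed
  have sm: "(\<Sum>v\<in>UNIV. of_real (P x v) * m v) =
     1 + \<i> * of_real (s * r x) - of_real (s\<^sup>2 * (g2 x + sg2 / 2 + (q x - g2 x)))"
  proof -
    have "Re (\<Sum>v\<in>UNIV. of_real (P x v) * m v) =
        (\<Sum>v\<in>UNIV. P x v) - s\<^sup>2 * ((\<Sum>v\<in>UNIV. P x v * ((f v)\<^sup>2 / 2 + f v * r v)) + (\<Sum>v\<in>UNIV. P x v * q v))"
      unfolding sum_distrib_left sum.distrib[symmetric] sum_subtractf[symmetric] Re_sum
      by (intro sum.cong) (auto simp: m_def algebra_simps)
    moreover have "Im (\<Sum>v\<in>UNIV. of_real (P x v) * m v) = s * (\<Sum>v\<in>UNIV. P x v * (f v + r v))"
      unfolding sum_distrib_left Im_sum by (intro sum.cong) (auto simp: m_def algebra_simps)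
    ultimately show ?thesis
      by (intro complex_eqI) (simp_all add: P_sum q_eq r_eq[symmetric] g2_def)
  qed
  have m: "(\<Sum>v\<in>UNIV. of_real (P x v) * m v) - of_real (lam s) * ev s x
     = \<i> * of_real (s ^ 3 * (sg2 * r x / 2)) - of_real (s ^ 4 * (sg2 * q x / 2))"
    unfolding sm by (intro complex_eqI)
       (simp_all add: ev_def power2_eq_square power3_eq_cube power4_eq_xxxx field_simps)
  have eq: "(\<Sum>v\<in>UNIV. tilt P f s x v * ev s v) - of_real (lam s) * ev s x =
     (\<Sum>v\<in>UNIV. of_real (P x v) * (cis (s * f v) * ev s v - m v))
       + (\<i> * of_real (s ^ 3 * (sg2 * r x / 2)) - of_real (s ^ 4 * (sg2 * q x / 2)))"
    unfolding m[symmetric] by (simp add: tilt_def right_diff_distrib sum_subtractf mult.assoc)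
  have 1: "cmod ((\<Sum>v\<in>UNIV. tilt P f s x v * ev s v) - of_real (lam s) * ev s x)
      \<le> cmod (\<Sum>v\<in>UNIV. of_real (P x v) * (cis (s * f v) * ev s v - m v))
       + (\<bar>s ^ 3 * (sg2 * r x / 2)\<bar> + \<bar>s ^ 4 * (sg2 * q x / 2)\<bar>)"
    unfolding eq
    by (rule order.trans[OF tri2]) (simp only: norm_mult norm_of_real norm_ii mult_1 order_refl)
  have "cmod (\<Sum>v\<in>UNIV. of_real (P x v) * (cis (s * f v) * ev s v - m v)) \<le> (\<Sum>v\<in>UNIV. P x v * (6 * bd ^ 4 * \<bar>s\<bar> ^ 3))"
    by (rule sum_norm_le) (auto simp: norm_mult P_nonneg intro!: mult_left_mono E)
  also have "\<dots> = 6 * bd ^ 4 * \<bar>s\<bar> ^ 3" by (simp only: sum_distrib_right[symmetric] P_sum mult_1)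
  finally have 2: "cmod (\<Sum>v\<in>UNIV. of_real (P x v) * (cis (s * f v) * ev s v - m v)) \<le> 6 * bd ^ 4 * \<bar>s\<bar> ^ 3" .
  have "\<bar>sg2 * r x / 2\<bar> \<le> bd ^ 4"
    using p2[of sg2 "r x"] bd_bounds[of x] sg2_le_bd b24 by auto
  then have 3: "\<bar>s ^ 3 * (sg2 * r x / 2)\<bar> \<le> \<bar>s\<bar> ^ 3 * bd ^ 4"
    unfolding abs_mult[of "s ^ 3"] power_abs by (intro mult_left_mono) auto
  have "\<bar>sg2 * q x / 2\<bar> \<le> bd ^ 4"
    using p2[of sg2 "q x"] bd_bounds[of x] sg2_le_bd b24 by auto
  then have 4: "\<bar>s ^ 4 * (sg2 * q x / 2)\<bar> \<le> \<bar>s\<bar> ^ 3 * bd ^ 4"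
    unfolding abs_mult[of "s ^ 4"] power_abs using s43 by (intro mult_mono) auto
  show ?thesis using 1 2 3 4 unfolding cerr_def by (simp add: algebra_simps)
qed

end

section \<open>Gaussian decay of the twisted kernel\<close>

text \<open>Turns contraction over blocks of length N into exponential decay in the time itself; the
  incomplete last block costs the factor 1 / \<rho>.\<close>

lemma power_div_le:
  fixes \<rho> :: real
  assumes "0 < \<rho>" "\<rho> < 1" "0 < N"
  shows "\<rho> ^ (m div N) \<le> (1 / \<rho>) * exp (ln \<rho> * (real m / real N))"
proof -
  have "\<rho> ^ (m div N) = exp (ln \<rho> * real (m div N))"
    using assms(1) by (simp add: exp_of_nat2_mult)
  also have "\<dots> \<le> exp (ln \<rho> * (m / N - 1))"
  proof -
    have "real m / real N - 1 \<le> real (m div N)"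
    proof -
      have "m \<le> N + N * (m div N)" using dividend_less_times_div[OF assms(3), of m] by simp
      then have "real m \<le> real N + real N * real (m div N)" by (metis of_nat_add of_nat_le_iff of_nat_mult)
      then show ?thesis using assms(3) by (simp add: field_simps)
    qed
    then show ?thesis using assms by (intro iffD2[OF exp_le_cancel_iff] mult_left_mono_neg) auto
  qed
  also have "\<dots> = (1 / \<rho>) * exp (ln \<rho> * (m / N))"
    using assms by (simp add: right_diff_distrib exp_diff)
  finally show ?thesis .
qed

context nonneg_kernel
begin

abbreviation M :: "real \<Rightarrow> nat \<Rightarrow> 'x \<Rightarrow> 'x \<Rightarrow> complex" where "M s \<equiv> mpow (tilt P f s)"

text \<open>Its supremum over x is the operator norm of the n-th twisted power for the sup norm,
  whence the submultiplicativity in \<open>rowsum_add_le\<close>.\<close>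

definition rowsum :: "real \<Rightarrow> nat \<Rightarrow> 'x \<Rightarrow> real" where
  "rowsum s n x = (\<Sum>w\<in>UNIV. cmod (M s n x w))"

lemma rowsum_nonneg: "0 \<le> rowsum s n x"
  unfolding rowsum_def by (intro sum_nonneg) auto

lemma rowsum_le_1: "rowsum s n x \<le> 1"
  unfolding rowsum_def mpow_row_sum[of n x, symmetric] by (intro sum_mono mpow_tilt_le)

lemma M_le_1: "cmod (M s n x w) \<le> 1"
proof -
  have "cmod (M s n x w) \<le> rowsum s n x" unfolding rowsum_def by (intro member_le_sum) auto
  then show ?thesis using rowsum_le_1[of s n x] by linarith
qed

lemma rowsum_add: "rowsum s (m + n) x \<le> (\<Sum>v\<in>UNIV. cmod (M s m x v) * rowsum s n v)"
proof -
  have "rowsum s (m + n) x \<le> (\<Sum>w\<in>UNIV. \<Sum>v\<in>UNIV. cmod (M s m x v) * cmod (M s n v w))"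
    unfolding rowsum_def by (intro sum_mono) (auto simp: mpow_add norm_mult intro!: sum_norm_le)
  also have "\<dots> = (\<Sum>v\<in>UNIV. \<Sum>w\<in>UNIV. cmod (M s m x v) * cmod (M s n v w))" by (rule sum.swap)
  finally show ?thesis unfolding rowsum_def by (simp add: sum_distrib_left)
qed

lemma rowsum_add_le:
  assumes "\<And>v. rowsum s n v \<le> c"
  shows "rowsum s (m + n) x \<le> rowsum s m x * c"
proof -
  have "rowsum s (m + n) x \<le> (\<Sum>v\<in>UNIV. cmod (M s m x v) * c)"
    by (rule order.trans[OF rowsum_add]) (intro sum_mono mult_left_mono assms, auto)
  then show ?thesis by (simp add: rowsum_def sum_distrib_right)
qed

lemma rowsum_antimono: "m \<le> n \<Longrightarrow> rowsum s n x \<le> rowsum s m x"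
  using rowsum_add_le[of s "n - m" 1 m x] rowsum_le_1 by auto

lemma rowsum_power:
  assumes "\<And>x. rowsum s N x \<le> \<rho>"
  shows "rowsum s (N * k) x \<le> \<rho> ^ k"
proof (induction k arbitrary: x)
  case 0 then show ?case using rowsum_le_1 by simp
next
  case (Suc k)
  have "rowsum s (N + N * k) x \<le> rowsum s N x * \<rho> ^ k" by (rule rowsum_add_le) (rule Suc)
  also have "\<dots> \<le> \<rho> * \<rho> ^ k"
    by (intro mult_right_mono assms) (rule order.trans[OF rowsum_nonneg Suc])
  finally show ?case by simp
qed

lemma rowsum_exp:
  assumes "\<And>x. rowsum s N x \<le> \<rho>" "0 < \<rho>" "\<rho> < 1" "0 < N"
  shows "rowsum s m x \<le> (1 / \<rho>) * exp (ln \<rho> * (m / N))"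
proof -
  have "rowsum s m x \<le> rowsum s (N * (m div N)) x" by (intro rowsum_antimono) simp
  also have "\<dots> \<le> \<rho> ^ (m div N)" by (intro rowsum_power assms)
  also have "\<dots> \<le> (1 / \<rho>) * exp (ln \<rho> * (m / N))" by (intro power_div_le assms)
  finally show ?thesis .
qed

lemma M_continuous: "continuous_on UNIV (\<lambda>s. M s n x w)"
proof (induction n arbitrary: x)
  case (Suc n)
  have "continuous_on UNIV (\<lambda>s. tilt P f s x v)" for v
    unfolding tilt_def by (intro continuous_intros)
  then show ?case unfolding mpow.simps by (intro continuous_intros Suc)
qed simp

lemma rowsum_continuous: "continuous_on UNIV (\<lambda>s. rowsum s n x)"
  unfolding rowsum_def by (intro continuous_intros M_continuous)

text \<open>Each of the p phase factors differs from 1 by at most F |s|, and all entries of the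
  remaining products are bounded by 1.\<close>

lemma M_near_P:
  assumes F: "\<And>x. \<bar>f x\<bar> \<le> F"
  shows "cmod (M s p x w - of_real (mpow P p x w)) \<le> p * F * \<bar>s\<bar>"
proof (induction p arbitrary: x)
  case (Suc p)
  have t: "cmod (tilt P f s x v * M s p v w - of_real (P x v * mpow P p v w)) \<le> P x v * ((p + 1) * F * \<bar>s\<bar>)" for v
  proof -
    have "cmod (cis (s * f v) - 1) \<le> \<bar>s * f v\<bar>"
      using iexp_approx1[of "s * f v" 0] by (simp add: cis_conv_exp)
    also have "\<dots> \<le> F * \<bar>s\<bar>" using mult_left_mono[OF F[of v], of "\<bar>s\<bar>"] by (simp add: abs_mult mult.commute)
    finally have 1: "cmod (cis (s * f v) - 1) \<le> F * \<bar>s\<bar>" .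
    have eq: "tilt P f s x v * M s p v w - of_real (P x v * mpow P p v w) =
       of_real (P x v) * ((cis (s * f v) - 1) * M s p v w + (M s p v w - of_real (mpow P p v w)))"
      by (simp add: tilt_def algebra_simps)
    have "cmod ((cis (s * f v) - 1) * M s p v w) \<le> F * \<bar>s\<bar> * 1"
      unfolding norm_mult using 1 M_le_1[of s p v w] by (intro mult_mono) (auto intro: order.trans[OF norm_ge_zero 1])
    then have "cmod ((cis (s * f v) - 1) * M s p v w + (M s p v w - of_real (mpow P p v w))) \<le> (p + 1) * F * \<bar>s\<bar>"
      using Suc[of v] norm_triangle_ineq[of "(cis (s * f v) - 1) * M s p v w" "M s p v w - of_real (mpow P p v w)"]
      by (simp add: algebra_simps)
    then show ?thesis unfolding eq norm_mult by (simp add: P_nonneg mult_left_mono)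
  qed
  have "M s (Suc p) x w - of_real (mpow P (Suc p) x w) =
     (\<Sum>v\<in>UNIV. tilt P f s x v * M s p v w - of_real (P x v * mpow P p v w))"
    by (simp add: sum_subtractf)
  then have "cmod (M s (Suc p) x w - of_real (mpow P (Suc p) x w)) \<le> (\<Sum>v\<in>UNIV. P x v * ((p + 1) * F * \<bar>s\<bar>))"
    by (simp only:) (intro sum_norm_le t)
  also have "\<dots> = (p + 1) * F * \<bar>s\<bar>" by (simp only: sum_distrib_right[symmetric] P_sum mult_1)
  finally show ?case by (simp add: add.commute)
qed simp

end

context mchain
begin

text \<open>The twisted kernel is a sup-norm contraction and \<open>lam s\<close> lies in [0, 1], so
  the one-step defects simply add up. For n of order s^-2 the total is O(|s|).\<close>

lemma ev_iterate:
  assumes s: "\<bar>s\<bar> \<le> 1" and l: "0 \<le> lam s"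
  shows "cmod ((\<Sum>w\<in>UNIV. M s n x w * ev s w) - of_real (lam s ^ n) * ev s x) \<le> n * cerr * \<bar>s\<bar> ^ 3"
proof (induction n arbitrary: x)
  case 0
  have "(\<Sum>w\<in>UNIV. (if x = w then 1 else 0) * ev s w) = (\<Sum>w\<in>UNIV. if x = w then ev s w else 0)"
    by (intro sum.cong) auto
  then show ?case by simp
next
  case (Suc n)
  define a where "a n x = (\<Sum>w\<in>UNIV. M s n x w * ev s w)" for n x
  have rec: "a (Suc n) x = (\<Sum>v\<in>UNIV. tilt P f s x v * a n v)"
    unfolding a_def mpow.simps sum_distrib_right sum_distrib_left
    by (subst sum.swap) (simp add: mult.assoc)
  have l1: "lam s \<le> 1" using sg2_nonneg by simp
  have eq: "a (Suc n) x - of_real (lam s ^ Suc n) * ev s x =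
     (\<Sum>v\<in>UNIV. tilt P f s x v * (a n v - of_real (lam s ^ n) * ev s v))
     + of_real (lam s ^ n) * ((\<Sum>v\<in>UNIV. tilt P f s x v * ev s v) - of_real (lam s) * ev s x)"
  proof -
    have "(\<Sum>v\<in>UNIV. tilt P f s x v * (a n v - z ^ n * ev s v))
       + z ^ n * ((\<Sum>v\<in>UNIV. tilt P f s x v * ev s v) - z * ev s x)
       = (\<Sum>v\<in>UNIV. tilt P f s x v * a n v) - z ^ Suc n * ev s x" for z
      by (simp add: right_diff_distrib sum_subtractf sum_distrib_left mult_ac)
    then show ?thesis unfolding rec by (simp only: of_real_power)
  qed
  have t: "cmod (tilt P f s x v) = P x v" for v by (simp add: tilt_def norm_mult P_nonneg)
  have "cmod (\<Sum>v\<in>UNIV. tilt P f s x v * (a n v - of_real (lam s ^ n) * ev s v))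
      \<le> (\<Sum>v\<in>UNIV. P x v * (n * cerr * \<bar>s\<bar> ^ 3))"
    using Suc unfolding a_def by (intro sum_norm_le) (simp add: norm_mult t P_nonneg mult_left_mono)
  also have "\<dots> = n * cerr * \<bar>s\<bar> ^ 3" by (simp only: sum_distrib_right[symmetric] P_sum mult_1)
  finally have 1: "cmod (\<Sum>v\<in>UNIV. tilt P f s x v * (a n v - of_real (lam s ^ n) * ev s v)) \<le> n * cerr * \<bar>s\<bar> ^ 3" .
  have "\<bar>lam s ^ n\<bar> \<le> 1" using l l1 by (simp add: power_abs power_le_one)
  then have 2: "cmod (of_real (lam s ^ n) * ((\<Sum>v\<in>UNIV. tilt P f s x v * ev s v) - of_real (lam s) * ev s x)) \<le> 1 * (cerr * \<bar>s\<bar> ^ 3)"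
    unfolding norm_mult norm_of_real by (intro mult_mono tilt_ev s) auto
  have "cmod (a (Suc n) x - of_real (lam s ^ Suc n) * ev s x) \<le> n * cerr * \<bar>s\<bar> ^ 3 + 1 * (cerr * \<bar>s\<bar> ^ 3)"
    unfolding eq by (rule order.trans[OF norm_triangle_ineq]) (intro add_mono 1 2)
  then show ?case unfolding a_def by (simp add: algebra_simps)
qed

lemma M_sum_near:
  assumes s: "\<bar>s\<bar> \<le> 1" and l: "0 \<le> lam s"
  shows "cmod ((\<Sum>w\<in>UNIV. M s n x w) - of_real (lam s ^ n)) \<le> n * cerr * \<bar>s\<bar> ^ 3 + 4 * bd * \<bar>s\<bar>"
proof -
  have l1: "lam s \<le> 1" using sg2_nonneg by simp
  have eq: "(\<Sum>w\<in>UNIV. M s n x w) - of_real (lam s ^ n) =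
     ((\<Sum>w\<in>UNIV. M s n x w * ev s w) - of_real (lam s ^ n) * ev s x)
     + (of_real (lam s ^ n) * (ev s x - 1) - (\<Sum>w\<in>UNIV. M s n x w * (ev s w - 1)))"
    by (simp add: right_diff_distrib sum_subtractf)
  have "cmod (\<Sum>w\<in>UNIV. M s n x w * (ev s w - 1)) \<le> (\<Sum>w\<in>UNIV. cmod (M s n x w) * (2 * bd * \<bar>s\<bar>))"
    by (intro sum_norm_le) (simp add: norm_mult mult_left_mono ev_near_1[OF s])
  also have "\<dots> = rowsum s n x * (2 * bd * \<bar>s\<bar>)" by (simp only: rowsum_def sum_distrib_right)
  also have "\<dots> \<le> 1 * (2 * bd * \<bar>s\<bar>)" using bd_ge_1 by (intro mult_right_mono rowsum_le_1) auto
  finally have 1: "cmod (\<Sum>w\<in>UNIV. M s n x w * (ev s w - 1)) \<le> 2 * bd * \<bar>s\<bar>" by simp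
  have "\<bar>lam s ^ n\<bar> \<le> 1" using l l1 by (simp add: power_abs power_le_one)
  then have 2: "cmod (of_real (lam s ^ n) * (ev s x - 1)) \<le> 1 * (2 * bd * \<bar>s\<bar>)"
    unfolding norm_mult norm_of_real by (intro mult_mono ev_near_1 s) auto
  have tri: "cmod (a + (b - c)) \<le> cmod a + (cmod b + cmod c)" for a b c :: complex
    using norm_triangle_ineq[of a "b - c"] norm_triangle_ineq4[of b c] by linarith
  show ?thesis unfolding eq
    by (rule order.trans[OF tri], rule order.trans[OF add_mono[OF ev_iterate[OF s l] add_mono[OF 2 1]]]) simp
qed

definition mixd :: "nat \<Rightarrow> real" where "mixd p = (\<Sum>v\<in>UNIV. \<Sum>w\<in>UNIV. \<bar>mpow P p v w - \<nu> w\<bar>)"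

lemma mixd_le: "\<bar>mpow P p v w - \<nu> w\<bar> \<le> mixd p"
proof -
  have "\<bar>mpow P p v w - \<nu> w\<bar> \<le> (\<Sum>w\<in>UNIV. \<bar>mpow P p v w - \<nu> w\<bar>)" by (intro member_le_sum) auto
  also have "\<dots> \<le> mixd p" unfolding mixd_def
    by (rule member_le_sum[of v UNIV "\<lambda>v. \<Sum>w\<in>UNIV. \<bar>mpow P p v w - \<nu> w\<bar>"]) (auto intro!: sum_nonneg)
  finally show ?thesis .
qed

lemma mixd_tendsto: "mixd \<longlonglongrightarrow> 0"
proof -
  have "(\<lambda>p. \<Sum>v\<in>UNIV. \<Sum>w\<in>UNIV. \<bar>mpow P p v w - \<nu> w\<bar>) \<longlonglongrightarrow> (\<Sum>v\<in>(UNIV::'x set). \<Sum>w\<in>(UNIV::'x set). 0)"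
    by (intro tendsto_sum summable_LIMSEQ_zero[OF mixing])
  then show ?thesis unfolding mixd_def by simp
qed

text \<open>The first n steps produce the scalar \<open>lam s ^ n\<close> up to small errors; the
  last p steps, at almost zero frequency, equidistribute the end state. Hence the separate
  parameters n and p.\<close>

lemma M_near:
  assumes s: "\<bar>s\<bar> \<le> 1" and l: "0 \<le> lam s"
  shows "cmod (M s (n + p) x w - of_real (\<nu> w * lam s ^ n))
    \<le> mixd p + p * bd * \<bar>s\<bar> + n * cerr * \<bar>s\<bar> ^ 3 + 4 * bd * \<bar>s\<bar>"
proof -
  define e where "e = mixd p + p * bd * \<bar>s\<bar>"
  have d: "cmod (M s p v w - of_real (\<nu> w)) \<le> e" for v
  proof -
    have "cmod (of_real (mpow P p v w) - of_real (\<nu> w) :: complex) \<le> mixd p"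
      using mixd_le[of p v w] by (metis norm_of_real of_real_diff)
    moreover have "cmod (M s p v w - of_real (mpow P p v w)) \<le> p * bd * \<bar>s\<bar>"
      by (intro M_near_P bd_bounds)
    ultimately show ?thesis
      using norm_triangle_ineq[of "M s p v w - of_real (mpow P p v w)" "of_real (mpow P p v w) - of_real (\<nu> w)"]
      by (simp add: e_def)
  qed
  have e0: "0 \<le> e" using d[of undefined] norm_ge_zero order.trans by blast
  have eq: "M s (n + p) x w - of_real (\<nu> w * lam s ^ n) =
    (\<Sum>v\<in>UNIV. M s n x v * (M s p v w - of_real (\<nu> w))) + of_real (\<nu> w) * ((\<Sum>v\<in>UNIV. M s n x v) - of_real (lam s ^ n))"
    by (simp add: mpow_add right_diff_distrib sum_subtractf sum_distrib_left mult_ac)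
  have "cmod (\<Sum>v\<in>UNIV. M s n x v * (M s p v w - of_real (\<nu> w))) \<le> (\<Sum>v\<in>UNIV. cmod (M s n x v) * e)"
    by (intro sum_norm_le) (simp add: norm_mult mult_left_mono d)
  also have "\<dots> = rowsum s n x * e" by (simp only: rowsum_def sum_distrib_right)
  also have "\<dots> \<le> 1 * e" using e0 by (intro mult_right_mono rowsum_le_1) auto
  finally have 1: "cmod (\<Sum>v\<in>UNIV. M s n x v * (M s p v w - of_real (\<nu> w))) \<le> e" by simp
  have 2: "cmod (of_real (\<nu> w) * ((\<Sum>v\<in>UNIV. M s n x v) - of_real (lam s ^ n))) \<le> 1 * (n * cerr * \<bar>s\<bar> ^ 3 + 4 * bd * \<bar>s\<bar>)"
    unfolding norm_mult norm_of_real using nu_pos[of w] nu_le_1[of w]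
    by (intro mult_mono M_sum_near s l) auto
  show ?thesis unfolding eq
    by (rule order.trans[OF norm_triangle_ineq], rule order.trans[OF add_mono[OF 1 2]]) (simp add: e_def)
qed

lemma lam_power_le: "0 \<le> lam s \<Longrightarrow> lam s ^ n \<le> exp (- sg2 * s\<^sup>2 / 2 * n)"
proof -
  assume "0 \<le> lam s"
  moreover have "lam s \<le> exp (- sg2 * s\<^sup>2 / 2)" using exp_ge_add_one_self[of "- sg2 * s\<^sup>2 / 2"] by simp
  ultimately have "lam s ^ n \<le> exp (- sg2 * s\<^sup>2 / 2) ^ n" by (intro power_mono)
  then show ?thesis by (simp add: exp_of_nat_mult[symmetric] mult.commute)
qed

lemma lam_nonneg: assumes "\<bar>s\<bar> \<le> 1 / bd" shows "0 \<le> lam s"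
proof -
  have "\<bar>s\<bar> * bd \<le> 1" using assms bd_ge_1 by (simp add: field_simps)
  moreover have "\<bar>s\<bar> \<le> 1" using mult_left_mono[OF bd_ge_1, of "\<bar>s\<bar>"] calculation by simp
  ultimately have "(\<bar>s\<bar> * bd) * \<bar>s\<bar> \<le> 1 * 1" using bd_ge_1 by (intro mult_mono) auto
  moreover have "sg2 * s\<^sup>2 \<le> bd * s\<^sup>2" using sg2_le_bd by (intro mult_right_mono) auto
  ultimately show ?thesis by (simp add: power2_eq_square mult_ac)
qed

text \<open>At time n + p with n about B / s^2 every row sum is at most 1/2. Submultiplicativity
  gives a factor 1/2 per block of length at most (B + 1 + p) / s^2, which is Gaussian decay in
  s.\<close>

lemma decay_near_0:
  assumes "0 < sg2"
  shows "\<exists>s0>0. \<exists>C>0. \<exists>c>0. \<forall>s n x. \<bar>s\<bar> \<le> s0 \<longrightarrow> rowsum s n x \<le> C * exp (- c * n * s\<^sup>2)"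
proof -
  define X where "X = real (CARD('x))"
  have X: "1 \<le> X" unfolding X_def by simp
  \<comment> \<open>Budget for the bound 1/2: 1/8 for the mixing defect summed over all states, 1/8
    for \<open>lam s ^ n\<close>, and 1/4 for the terms linear in |s|.\<close>
  obtain p where p: "X * mixd p \<le> 1 / 8"
  proof -
    have "eventually (\<lambda>p. mixd p < 1 / (8 * X)) sequentially"
      using mixd_tendsto X by (intro order_tendstoD) auto
    then obtain p where "mixd p < 1 / (8 * X)" by (auto dest: eventually_happens)
    then show ?thesis using X by (intro that[of p]) (simp add: field_simps)
  qed
  \<comment> \<open>Solves exp (- sg2 B / 2) = 1/8.\<close>
  define B where "B = 2 * ln 8 / sg2"
  have B: "0 < B" unfolding B_def using assms by simp
  \<comment> \<open>Total coefficient of |s| in the error of \<open>M_near\<close> summed over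
    states, once n |s|^3 has been replaced by (B + 1) |s|.\<close>
  define K where "K = X * (p * bd + (B + 1) * cerr + 4 * bd)"
  have cerr: "0 \<le> cerr" unfolding cerr_def using bd_ge_1 by simp
  have K: "0 < K" unfolding K_def using X bd_ge_1 B cerr
    by (intro mult_pos_pos add_nonneg_pos add_nonneg_nonneg mult_nonneg_nonneg) auto
  define s0 where "s0 = min (1 / bd) (1 / (4 * K))"
  have s0: "0 < s0" "s0 \<le> 1" unfolding s0_def using bd_ge_1 K by (auto simp: min_def field_simps)
  define c where "c = ln 2 / (B + 1 + p)"
  have c: "0 < c" unfolding c_def using B by auto
  have "rowsum s m x \<le> 2 * exp (- c * m * s\<^sup>2)" if s: "\<bar>s\<bar> \<le> s0" for s m x
  proof (cases "s = 0")
    case True then show ?thesis using rowsum_le_1[of 0 m x] by simp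
  next
    case False
    have s1: "\<bar>s\<bar> \<le> 1" and sb: "\<bar>s\<bar> \<le> 1 / bd" and sK: "\<bar>s\<bar> \<le> 1 / (4 * K)" using s s0 by (auto simp: s0_def)
    have l: "0 \<le> lam s" by (rule lam_nonneg[OF sb])
    define n where "n = nat \<lceil>B / s\<^sup>2\<rceil>"
    have s2: "0 < s\<^sup>2" "s\<^sup>2 \<le> 1" using False s1 by (auto simp: abs_square_le_1)
    have n1: "B / s\<^sup>2 \<le> n" unfolding n_def by (rule real_nat_ceiling_ge)
    have n2: "n \<le> B / s\<^sup>2 + 1"
    proof -
      have "0 \<le> B / s\<^sup>2" using B s2 by simp
      then have "real n = of_int \<lceil>B / s\<^sup>2\<rceil>" unfolding n_def by simp
      then show ?thesis using of_int_ceiling_le_add_one[of "B / s\<^sup>2"] by linarith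
    qed
    have "lam s ^ n \<le> exp (- sg2 * s\<^sup>2 / 2 * n)" by (rule lam_power_le[OF l])
    also have "\<dots> \<le> exp (- ln 8)"
    proof -
      have "B \<le> s\<^sup>2 * n" using n1 s2 by (simp add: field_simps)
      then have "sg2 * B \<le> sg2 * (s\<^sup>2 * n)" using assms by simp
      moreover have "sg2 * B = 2 * ln 8" unfolding B_def using assms by simp
      ultimately show ?thesis by (simp add: mult.assoc)
    qed
    also have "\<dots> = 1 / 8" by (simp add: exp_minus)
    finally have ln: "lam s ^ n \<le> 1 / 8" .
    have ns: "n * \<bar>s\<bar> ^ 3 \<le> (B + 1) * \<bar>s\<bar>"
    proof -
      have "n * \<bar>s\<bar> ^ 3 \<le> (B / s\<^sup>2 + 1) * \<bar>s\<bar> ^ 3" using n2 by (intro mult_right_mono) auto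
      also have "\<dots> = B * \<bar>s\<bar> + \<bar>s\<bar> ^ 3"
      proof -
        have "\<bar>s\<bar> ^ 3 = s\<^sup>2 * \<bar>s\<bar>" by (simp add: power3_eq_cube power2_eq_square abs_mult_self_eq)
        then show ?thesis using s2 by (simp add: field_simps)
      qed
      also have "\<bar>s\<bar> ^ 3 \<le> \<bar>s\<bar> ^ 1" using s1 by (intro power_decreasing) auto
      finally show ?thesis by (simp add: algebra_simps)
    qed
    have half: "rowsum s (n + p) x \<le> 1 / 2" for x
    proof -
      define e where "e = mixd p + p * bd * \<bar>s\<bar> + n * cerr * \<bar>s\<bar> ^ 3 + 4 * bd * \<bar>s\<bar>"
      have "cmod (M s (n + p) x w) \<le> \<nu> w * lam s ^ n + e" for w
      proof -
        have "cmod (of_real (\<nu> w * lam s ^ n) :: complex) = \<nu> w * lam s ^ n"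
          using nu_pos[of w] l by (simp add: norm_mult norm_power less_imp_le del: of_real_diff of_real_mult of_real_power)
        then show ?thesis using M_near[OF s1 l, of n p x w]
          norm_triangle_ineq2[of "M s (n + p) x w" "of_real (\<nu> w * lam s ^ n)"]
          unfolding e_def by linarith
      qed
      then have "rowsum s (n + p) x \<le> (\<Sum>w\<in>UNIV. \<nu> w * lam s ^ n + e)"
        unfolding rowsum_def by (intro sum_mono)
      also have "\<dots> = lam s ^ n + X * e"
        by (simp add: sum.distrib sum_distrib_right[symmetric] nu_sum X_def)
      also have "X * e \<le> 1 / 8 + K * \<bar>s\<bar>"
      proof -
        have "n * cerr * \<bar>s\<bar> ^ 3 \<le> (B + 1) * \<bar>s\<bar> * cerr"
          using mult_right_mono[OF ns cerr] by (simp add: mult_ac)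
        then have "X * e \<le> X * (mixd p + p * bd * \<bar>s\<bar> + (B + 1) * \<bar>s\<bar> * cerr + 4 * bd * \<bar>s\<bar>)"
          unfolding e_def using X by (intro mult_left_mono) auto
        also have "\<dots> = X * mixd p + K * \<bar>s\<bar>" unfolding K_def by (simp add: algebra_simps)
        finally show ?thesis using p by linarith
      qed
      also have "K * \<bar>s\<bar> \<le> 1 / 4" using sK K by (simp add: field_simps)
      finally show ?thesis using ln by simp
    qed
    have "0 < B / s\<^sup>2" using B s2 by simp
    then have np: "0 < n + p" using n1 by (cases "n = 0") auto
    have "rowsum s m x \<le> (1 / (1 / 2)) * exp (ln (1 / 2) * (m / (n + p)))"
      by (intro rowsum_exp half np) auto
    also have "\<dots> \<le> 2 * exp (- c * m * s\<^sup>2)"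
    proof -
      have "(n + p) * s\<^sup>2 \<le> B + 1 + p"
      proof -
        have "n * s\<^sup>2 \<le> (B / s\<^sup>2 + 1) * s\<^sup>2" using n2 s2 by (intro mult_right_mono) auto
        also have "\<dots> = B + s\<^sup>2" using s2 by (simp add: field_simps)
        finally have "n * s\<^sup>2 \<le> B + 1" using s2 by simp
        moreover have "p * s\<^sup>2 \<le> real p * 1" using s2 by (intro mult_left_mono) auto
        ultimately show ?thesis by (simp add: algebra_simps)
      qed
      moreover have np': "0 < real n + real p" using np by linarith
      ultimately have "s\<^sup>2 \<le> (B + 1 + p) / (real n + real p)"
        by (simp add: pos_le_divide_eq mult.commute)
      then have "s\<^sup>2 / (B + 1 + p) \<le> (B + 1 + p) / (real n + real p) / (B + 1 + p)"
        using B by (intro divide_right_mono) auto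
      then have "s\<^sup>2 / (B + 1 + p) \<le> 1 / (n + p)" using B by simp
      then have "ln 2 * m * (s\<^sup>2 / (B + 1 + p)) \<le> ln 2 * m * (1 / (n + p))" by (intro mult_left_mono) auto
      then have "c * m * s\<^sup>2 \<le> ln 2 * (m / (n + p))" unfolding c_def by (simp add: mult_ac)
      then show ?thesis by (simp add: ln_div)
    qed
    finally show ?thesis .
  qed
  then show ?thesis using s0 c by (intro exI[of _ s0] exI[of _ 2] exI[of _ c] conjI) auto
qed

end

section \<open>Frequencies away from zero: consequences of the non-lattice hypothesis\<close>

lemma mpow_pos_step:
  fixes P :: "'x::finite \<Rightarrow> 'x \<Rightarrow> real"
  assumes "0 < mpow P (Suc n) x w" "\<And>x v. 0 \<le> P x v"
  obtains v where "0 < mpow P n x v" "0 < P v w"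
proof -
  have nn: "0 \<le> mpow P n x v" for v
    using assms(2) by (induction n arbitrary: x) (auto intro!: sum_nonneg)
  have "\<exists>v. mpow P n x v * P v w \<noteq> 0"
  proof (rule ccontr)
    assume "\<not> ?thesis"
    then have "mpow P (Suc n) x w = 0" unfolding mpow_Suc_right by (intro sum.neutral) auto
    then show False using assms(1) by simp
  qed
  then obtain v where "mpow P n x v * P v w \<noteq> 0" by auto
  then show ?thesis using that[of v] nn[of v] assms(2)[of v w] by (auto simp: less_le)
qed

lemma cycle_edges_pos:
  fixes P :: "'x::finite \<Rightarrow> 'x \<Rightarrow> real"
  assumes "(\<Prod>i<n. P (xs ! i) (xs ! Suc i)) * P (xs ! n) (xs ! 0) > 0" "\<And>x v. 0 \<le> P x v"
  shows "\<And>i. i < n \<Longrightarrow> 0 < P (xs ! i) (xs ! Suc i)" "0 < P (xs ! n) (xs ! 0)"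
proof -
  have "(\<Prod>i<n. P (xs ! i) (xs ! Suc i)) \<noteq> 0" "P (xs ! n) (xs ! 0) \<noteq> 0"
    using assms(1) by (metis mult_zero_left less_irrefl, metis mult_zero_right less_irrefl)
  then show "\<And>i. i < n \<Longrightarrow> 0 < P (xs ! i) (xs ! Suc i)" "0 < P (xs ! n) (xs ! 0)"
    using assms(2) by (auto simp: less_le)
qed

context mchain
begin

text \<open>Zero variance makes \<open>f v = r x - r v\<close> on every edge, so \<open>f\<close>
  sums to zero along every cycle; this contradicts (H3) at \<theta> = 0, a = 0.\<close>

lemma sg2_pos_H3:
  assumes "H3 P f"
  shows "0 < sg2"
proof (rule ccontr)
  assume "\<not> 0 < sg2"
  then have z: "sg2 = 0" using sg2_nonneg by simp
  have e: "f v = r x - r v" if "0 < P x v" for x v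
  proof -
    have nn: "0 \<le> \<nu> x * P x v * (f v + r v - r x)\<^sup>2" for x v
      using nu_pos P_nonneg by (simp add: less_imp_le)
    have "(\<Sum>v\<in>UNIV. \<nu> x * P x v * (f v + r v - r x)\<^sup>2) = 0" for x
      using z unfolding sg2_variance by (subst (asm) sum_nonneg_eq_0_iff) (auto intro!: sum_nonneg nn)
    then have "\<nu> x * P x v * (f v + r v - r x)\<^sup>2 = 0"
      by (subst (asm) sum_nonneg_eq_0_iff) (auto intro!: nn)
    then show ?thesis using that nu_pos[of x] by auto
  qed
  obtain n xs where c: "(\<Prod>i<n. P (xs ! i) (xs ! Suc i)) * P (xs ! n) (xs ! 0) > 0"
     "(\<Sum>i\<le>n. f (xs ! i)) - real (n + 1) * 0 \<notin> {0 * of_int k | k. True}"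
    using assms unfolding H3_def by blast
  note p = cycle_edges_pos[OF c(1) P_nonneg]
  have "(\<Sum>i\<le>n. f (xs ! i)) = f (xs ! 0) + (\<Sum>i<n. f (xs ! Suc i))"
    by (rule sum.atMost_shift)
  also have "(\<Sum>i<n. f (xs ! Suc i)) = (\<Sum>i<n. r (xs ! i) - r (xs ! Suc i))"
    by (intro sum.cong) (auto simp: e p)
  also have "\<dots> = r (xs ! 0) - r (xs ! n)" by (rule sum_lessThan_telescope')
  also have "f (xs ! 0) = r (xs ! n) - r (xs ! 0)" by (rule e[OF p(2)])
  finally show False using c(2) by simp
qed

text \<open>Without contraction some row keeps full modulus for ever. Equality in the triangle
  inequality then makes the phases multiplicative along edges up to a constant drift per step, and
  closing a cycle places its \<open>f\<close>-sum, corrected by the drift \<theta> per step, in (2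
  pi / s) Z, against (H3).\<close>

lemma rowsum_lt_1:
  assumes pos: "\<And>x w. 0 < mpow P k0 x w" and H3: "H3 P f" and s: "s \<noteq> 0"
  shows "\<exists>n. \<forall>x. rowsum s n x < 1"
proof (rule ccontr)
  assume neg: "\<nexists>n. \<forall>x. rowsum s n x < 1"
  \<comment> \<open>If every row dropped below 1 at some time of its own, monotonicity in n would
    bring all rows below 1 at the largest of these finitely many times.\<close>
  have "\<exists>x0. \<forall>n. rowsum s n x0 = 1"
  proof (rule ccontr)
    assume "\<nexists>x0. \<forall>n. rowsum s n x0 = 1"
    then have "\<forall>x. \<exists>n. rowsum s n x < 1" using rowsum_le_1 by (meson order.not_eq_order_implies_strict)
    then obtain N where N: "\<And>x. rowsum s (N x) x < 1" by metis
    define m where "m = Max (range N)"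
    have "rowsum s m x < 1" for x
      using rowsum_antimono[of "N x" m s x] N[of x] by (simp add: m_def)
    then show False using neg by auto
  qed
  then obtain x0 where x0: "\<And>n. rowsum s n x0 = 1" by auto
  have abs_eq: "cmod (M s n x0 w) = mpow P n x0 w" for n w
  proof -
    have "(\<Sum>w\<in>UNIV. mpow P n x0 w - cmod (M s n x0 w)) = 0"
      using x0[of n] mpow_row_sum[of n x0] by (simp add: sum_subtractf rowsum_def)
    then have "mpow P n x0 w - cmod (M s n x0 w) = 0"
      by (subst (asm) sum_nonneg_eq_0_iff) (auto simp: mpow_tilt_le)
    then show ?thesis by simp
  qed
  have pos': "0 < mpow P n x0 w" if "k0 \<le> n" for n w
  proof -
    have "mpow P (n - k0 + k0) x0 w = (\<Sum>v\<in>UNIV. mpow P (n - k0) x0 v * mpow P k0 v w)" by (rule mpow_add)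
    also have "\<dots> > 0"
    proof -
      obtain v where "mpow P (n - k0) x0 v \<noteq> 0"
        using mpow_row_sum[of "n - k0" x0] by (metis sum.neutral zero_neq_one)
      then have "0 < mpow P (n - k0) x0 v" using mpow_nonneg[of "n - k0" x0 v] by simp
      then show ?thesis using pos
        by (intro sum_pos2[of UNIV v]) (auto intro!: mult_nonneg_nonneg mpow_nonneg)
    qed
    finally show ?thesis using that by simp
  qed
  define ph where "ph n v = M s n x0 v / of_real (mpow P n x0 v)" for n v
  have ph1: "cmod (ph n v) = 1" if "k0 \<le> n" for n v
    using pos'[OF that, of v] by (simp add: ph_def norm_divide abs_eq)
  \<comment> \<open>The entry at time n + 1 is a sum whose modulus equals the sum of the moduli of
    its terms, so every nonzero term has the phase c of the sum; \<open>0 < P v w\<close> permits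
    the division.\<close>
  have ph_step: "ph (Suc n) w = ph n v * cis (s * f w)" if n: "k0 \<le> n" and vw: "0 < P v w" for n v w
  proof -
    define c where "c = ph (Suc n) w"
    define z where "z v = cnj c * (M s n x0 v * tilt P f s v w)" for v
    have c1: "cmod c = 1" unfolding c_def using n by (intro ph1) auto
    then have cc: "cnj c * c = 1" by (metis complex_norm_square mult.commute of_real_1 power_one)
    have za: "cmod (z v) = mpow P n x0 v * P v w" for v
      using c1 by (simp add: z_def norm_mult abs_eq tilt_def P_nonneg)
    have "(\<Sum>v\<in>UNIV. z v) = cnj c * M s (Suc n) x0 w"
      unfolding z_def mpow_Suc_right by (simp add: sum_distrib_left)
    also have "\<dots> = cnj c * c * of_real (mpow P (Suc n) x0 w)"
      using pos'[of "Suc n" w] n unfolding c_def ph_def by (simp del: mpow.simps)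
    finally have "(\<Sum>v\<in>UNIV. z v) = of_real (\<Sum>v\<in>UNIV. cmod (z v))"
      unfolding cc za mpow_Suc_right by simp
    then have "(\<Sum>v\<in>UNIV. cmod (z v) - Re (z v)) = 0"
      by (metis Re_complex_of_real Re_sum diff_self sum_subtractf)
    then have "cmod (z v) - Re (z v) = 0"
      by (subst (asm) sum_nonneg_eq_0_iff) (auto simp: complex_Re_le_cmod)
    then have "z v = of_real (cmod (z v))"
      using cmod_power2[of "z v"] by (intro complex_eqI) auto
    then have "c * z v = c * of_real (mpow P n x0 v * P v w)" unfolding za by simp
    moreover have "c * z v = M s n x0 v * tilt P f s v w"
    proof -
      have "c * z v = (cnj c * c) * (M s n x0 v * tilt P f s v w)" by (simp only: z_def mult_ac)
      then show ?thesis unfolding cc by simp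
    qed
    ultimately have "M s n x0 v * cis (s * f w) * of_real (P v w) = c * of_real (mpow P n x0 v) * of_real (P v w)"
      by (simp add: tilt_def mult_ac)
    then have "M s n x0 v * cis (s * f w) = c * of_real (mpow P n x0 v)" using vw by simp
    then show ?thesis using pos'[OF n, of v] by (simp add: c_def ph_def field_simps)
  qed
  have ph0: "ph n v \<noteq> 0" if "k0 \<le> n" for n v using ph1[OF that, of v] by auto
  \<comment> \<open>Phase gained per unit of time. It is transported unchanged along edges; two
    states reach a common state in k0 steps, so it is the same at all states, and therefore constant
    in time.\<close>
  define ra where "ra n v = ph (Suc n) v / ph n v" for n v
  have ra_step: "ra (Suc n) w = ra n v" if "k0 \<le> n" "0 < P v w" for n v w
    unfolding ra_def using ph_step[of "Suc n" v w] ph_step[of n v w] that by simp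
  have ra_steps: "ra (n + k) w = ra n v" if "k0 \<le> n" "0 < mpow P k v w" for n k v w
    using that(2)
  proof (induction k arbitrary: w)
    case 0 then show ?case by (simp split: if_splits)
  next
    case (Suc k)
    obtain u where "0 < mpow P k v u" "0 < P u w" by (rule mpow_pos_step[OF Suc.prems P_nonneg])
    then show ?case using Suc.IH[of u] ra_step[of "n + k" u w] that(1) by simp
  qed
  have ra_const: "ra n v = ra n v'" if "k0 \<le> n" for n v v'
    using ra_steps[OF that pos[of v undefined]] ra_steps[OF that pos[of v' undefined]] by simp
  define c where "c = ra k0 x0"
  have ra_c: "ra n v = c" if "k0 \<le> n" for n v
    using that
  proof (induction n arbitrary: v rule: dec_induct)
    case base show ?case unfolding c_def by (rule ra_const) simp
  next
    case (step n)
    obtain w where "P v w \<noteq> 0" using P_sum[of v] by (metis sum.neutral zero_neq_one)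
    then have "0 < P v w" using P_nonneg[of v w] by simp
    then have "ra (Suc n) w = ra n v" using step by (intro ra_step) auto
    then show ?case using step.IH ra_const[of "Suc n" v w] step by simp
  qed
  have c1: "cmod c = 1" unfolding c_def ra_def by (simp add: norm_divide ph1)
  have phc: "ph (k0 + n) v = ph k0 v * c ^ n" for n v
  proof (induction n)
    case (Suc n)
    have "ra (k0 + n) v = c" by (rule ra_c) simp
    then have "ph (Suc (k0 + n)) v = c * ph (k0 + n) v" using ph0[of "k0 + n" v] by (simp add: ra_def field_simps)
    then show ?case using Suc by simp
  qed simp
  \<comment> \<open>The constant drift c is written as cis (s \<theta>), and (H3) is then used for
    this \<theta> and a = 2 pi / s.\<close>
  define \<theta> where "\<theta> = Arg c / s"
  have c_cis: "c = cis (s * \<theta>)" using c1 s cis_Arg[of c] by (simp add: \<theta>_def sgn_div_norm) (metis c1 cis_Arg div_by_1 norm_zero of_real_1 sgn_eq zero_neq_one)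
  obtain n xs where cy: "(\<Prod>i<n. P (xs ! i) (xs ! Suc i)) * P (xs ! n) (xs ! 0) > 0"
     "(\<Sum>i\<le>n. f (xs ! i)) - real (n + 1) * \<theta> \<notin> {(2 * pi / s) * of_int k | k. True}"
    using H3 unfolding H3_def by blast
  note p = cycle_edges_pos[OF cy(1) P_nonneg]
  have path: "i \<le> n \<Longrightarrow> ph (k0 + i) (xs ! i) = ph k0 (xs ! 0) * cis (s * (\<Sum>j<i. f (xs ! Suc j)))" for i
  proof (induction i)
    case (Suc i)
    have "ph (Suc (k0 + i)) (xs ! Suc i) = ph (k0 + i) (xs ! i) * cis (s * f (xs ! Suc i))"
      using Suc.prems by (intro ph_step p) auto
    then show ?case using Suc by (simp add: cis_mult distrib_left mult.assoc)
  qed simp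
  define S where "S = (\<Sum>i\<le>n. f (xs ! i))"
  have S: "S = f (xs ! 0) + (\<Sum>i<n. f (xs ! Suc i))" unfolding S_def by (rule sum.atMost_shift)
  have "ph (Suc (k0 + n)) (xs ! 0) = ph (k0 + n) (xs ! n) * cis (s * f (xs ! 0))"
    by (intro ph_step p) auto
  also have "\<dots> = ph k0 (xs ! 0) * cis (s * S)"
    using path[of n] unfolding S by (simp add: cis_mult distrib_left mult.assoc add.commute)
  finally have "ph k0 (xs ! 0) * c ^ Suc n = ph k0 (xs ! 0) * cis (s * S)"
    using phc[of "Suc n" "xs ! 0"] by (simp only: add_Suc_right)
  then have "cis (real (Suc n) * (s * \<theta>)) = cis (s * S)"
    using ph0[of k0 "xs ! 0"] unfolding c_cis Complex.DeMoivre by simp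
  then have "cis (s * S - real (Suc n) * (s * \<theta>)) = 1"
    using cis_divide[of "s * S" "real (Suc n) * (s * \<theta>)"] by simp
  then have "cos (s * S - real (Suc n) * (s * \<theta>)) = 1" by (metis cis.sel(1) one_complex.sel(1))
  then obtain k :: int where "s * S - real (Suc n) * (s * \<theta>) = of_int k * (2 * pi)"
    by (auto simp: cos_one_2pi_int)
  then have "S - real (n + 1) * \<theta> = (2 * pi / s) * of_int k" using s by (simp add: field_simps)
  then show False using cy(2) unfolding S_def by auto
qed

text \<open>Row sums are continuous in s and nonincreasing in n: compactness of the frequency
  annulus gives one time N for all frequencies, and the maximum over the annulus gives one bound
  below 1.\<close>

lemma decay_away:
  assumes pos: "\<And>x w. 0 < mpow P k0 x w" and H3: "H3 P f" and s0: "0 < s0"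
  shows "\<exists>N \<rho>. 0 < N \<and> 0 < \<rho> \<and> \<rho> < 1 \<and> (\<forall>s x. s0 \<le> \<bar>s\<bar> \<and> \<bar>s\<bar> \<le> R \<longrightarrow> rowsum s N x \<le> \<rho>)"
proof -
  define K where "K = {s. s0 \<le> \<bar>s\<bar> \<and> \<bar>s\<bar> \<le> R}"
  have "K = {-R..-s0} \<union> {s0..R}" unfolding K_def using s0 by auto
  then have K: "compact K" by auto
  define U where "U n = {s. \<forall>x. rowsum s n x < 1}" for n
  have U: "open (U n)" for n
  proof -
    have "U n = (\<Inter>x. {s. rowsum s n x < 1})" unfolding U_def by auto
    moreover have "open {s. rowsum s n x < 1}" for x
      by (rule open_Collect_less[OF rowsum_continuous continuous_on_const])
    ultimately show ?thesis by auto
  qed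
  have "K \<subseteq> (\<Union>n. U n)"
    using rowsum_lt_1[OF pos H3] s0 unfolding U_def K_def by fastforce
  then obtain T where T: "finite T" "K \<subseteq> (\<Union>n\<in>T. U n)"
    using compactE_image[OF K, of UNIV U] U by auto
  define N where "N = Suc (Max (insert 0 T))"
  have lt: "rowsum s N x < 1" if sK: "s \<in> K" for s x
  proof -
    obtain n where n: "n \<in> T" "rowsum s n x < 1" 
      using subsetD[OF T(2) sK] unfolding U_def by auto
    have "n \<le> Max (insert 0 T)" using T n by (intro Max_ge) auto
    then have "n \<le> N" unfolding N_def by simp
    then show ?thesis using rowsum_antimono[of n N s x] n by simp
  qed
  have "\<exists>\<rho><1. \<forall>s\<in>K. rowsum s N x \<le> \<rho>" for x
  proof (cases "K = {}")
    case True then show ?thesis by (intro exI[of _ 0]) auto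
  next
    case False
    obtain t where "t \<in> K" "\<forall>s\<in>K. rowsum s N x \<le> rowsum t N x"
      using continuous_attains_sup[OF K False, of "\<lambda>s. rowsum s N x"]
        continuous_on_subset[OF rowsum_continuous] by auto
    then show ?thesis using lt by auto
  qed
  then obtain \<rho> where \<rho>: "\<And>x. \<rho> x < 1" "\<And>x s. s \<in> K \<Longrightarrow> rowsum s N x \<le> \<rho> x" by metis
  \<comment> \<open>The lower cut at 1/2 keeps the rate positive, since its logarithm is taken
    later.\<close>
  define \<rho>' where "\<rho>' = max (1/2) (Max (range \<rho>))"
  have "\<rho>' < 1" unfolding \<rho>'_def using \<rho>(1) by auto
  moreover have "0 < \<rho>'" unfolding \<rho>'_def by (simp add: less_max_iff_disj)
  moreover have "\<rho> x \<le> \<rho>'" for x unfolding \<rho>'_def by (simp add: le_max_iff_disj)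
  ultimately show ?thesis using \<rho>(2) unfolding K_def
    by (intro exI[of _ N] exI[of _ \<rho>']) (fastforce simp: N_def intro: order.trans)
qed

lemma decay_H3:
  assumes pos: "\<And>x w. 0 < mpow P k0 x w" and H3: "H3 P f"
  shows "\<exists>C>0. \<exists>c>0. \<forall>s n x. \<bar>s\<bar> \<le> R \<longrightarrow> rowsum s n x \<le> C * exp (- c * n * s\<^sup>2)"
proof -
  obtain s0 C c where 1: "0 < s0" "0 < C" "0 < c"
    "\<And>s n x. \<bar>s\<bar> \<le> s0 \<Longrightarrow> rowsum s n x \<le> C * exp (- c * n * s\<^sup>2)"
    using decay_near_0[OF sg2_pos_H3[OF H3]] by auto
  define R' where "R' = max R 1"
  obtain N \<rho> where 2: "0 < N" "0 < \<rho>" "\<rho> < 1" "\<And>s x. s0 \<le> \<bar>s\<bar> \<Longrightarrow> \<bar>s\<bar> \<le> R' \<Longrightarrow> rowsum s N x \<le> \<rho>"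
    using decay_away[OF pos H3 1(1), of R'] by auto
  \<comment> \<open>A fixed exponential rate is weakened to a multiple of s^2: on the range
    considered s^2 is at most R'^2.\<close>
  define d where "d = - ln \<rho> / N / R'\<^sup>2"
  have R': "1 \<le> R'" unfolding R'_def by simp
  have lnr: "ln \<rho> < 0" using 2 by simp
  have d: "0 < d" unfolding d_def using 2 lnr R' by (intro divide_pos_pos) auto
  have "rowsum s n x \<le> max C (1 / \<rho>) * exp (- min c d * n * s\<^sup>2)" if s: "\<bar>s\<bar> \<le> R" for s n x
  proof (cases "\<bar>s\<bar> \<le> s0")
    case True
    have "rowsum s n x \<le> C * exp (- c * n * s\<^sup>2)" by (rule 1(4)[OF True])
    also have "\<dots> \<le> max C (1 / \<rho>) * exp (- min c d * n * s\<^sup>2)"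
      using 1(2) by (intro mult_mono) (auto intro!: mult_right_mono)
    finally show ?thesis .
  next
    case False
    have "rowsum s n x \<le> (1 / \<rho>) * exp (ln \<rho> * (n / N))"
      using False s by (intro rowsum_exp 2) (auto simp: R'_def)
    also have "\<dots> \<le> max C (1 / \<rho>) * exp (- min c d * n * s\<^sup>2)"
    proof (intro mult_mono)
      have "s\<^sup>2 \<le> R'\<^sup>2" using s R' by (intro power2_le_iff_abs_le[THEN iffD2]) (auto simp: R'_def)
      then have "d * n * s\<^sup>2 \<le> d * n * R'\<^sup>2" using d by (intro mult_left_mono) auto
      also have "\<dots> = - (ln \<rho> * (n / N))" unfolding d_def using R' by simp
      finally have "d * n * s\<^sup>2 \<le> - (ln \<rho> * (n / N))" .
      moreover have "min c d * n * s\<^sup>2 \<le> d * n * s\<^sup>2" by (intro mult_right_mono) auto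
      ultimately show "exp (ln \<rho> * (n / N)) \<le> exp (- min c d * n * s\<^sup>2)" by simp
    qed (use 1 2 in \<open>auto simp: le_max_iff_disj\<close>)
    finally show ?thesis .
  qed
  then show ?thesis using 1 2 d
    by (intro exI[of _ "max C (1 / \<rho>)"] exI[of _ "min c d"] conjI) (auto simp: less_max_iff_disj)
qed

end

section \<open>Centred non-lattice walks and their duals\<close>

text \<open>(H3) is kept only through two consequences, positive variance and Gaussian decay on
  bounded frequency ranges. Unlike cycle conditions, both pass to the dual chain by a diagonal
  conjugation.\<close>

locale mwalk = mchain P f \<nu> for P :: "'x::finite \<Rightarrow> 'x \<Rightarrow> real" and f \<nu> +
  assumes sg2_pos: "0 < sg2"
    and decay: "\<exists>C>0. \<exists>c>0. \<forall>s n x. \<bar>s\<bar> \<le> R \<longrightarrow> rowsum s n x \<le> C * exp (- c * n * s\<^sup>2)"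

section \<open>Positivity and geometric mixing from (H1)\<close>

lemma H1_mpow_pos:
  assumes "H1 P"
  shows "\<exists>k0\<ge>1. \<forall>x w. 0 < mpow P k0 x w"
proof -
  obtain k0 where k0: "1 \<le> k0" "\<And>g x. (\<forall>x. g x \<ge> 0) \<Longrightarrow> (\<exists>x. g x \<noteq> 0) \<Longrightarrow> Ppow P k0 g x > 0"
    using assms unfolding H1_def by blast
  have "0 < mpow P k0 x w" for x w
  proof -
    have "0 < Ppow P k0 (\<lambda>u. if u = w then 1 else 0) x" by (intro k0(2)) auto
    also have "Ppow P k0 (\<lambda>u. if u = w then 1 else 0) x = mpow P k0 x w"
    proof -
      have "(\<Sum>u\<in>UNIV. mpow P k0 x u * (if u = w then 1 else 0)) = (\<Sum>u\<in>UNIV. if u = w then mpow P k0 x u else 0)"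
        by (intro sum.cong) auto
      then show ?thesis unfolding Ppow_mpow by simp
    qed
    finally show ?thesis .
  qed
  then show ?thesis using k0(1) by blast
qed

lemma Ppow_add: "Ppow P (m + n) g = Ppow P m (Ppow P n g)"
  by (simp add: Ppow_def funpow_add)

context nonneg_kernel
begin

lemma inv_mpow:
  assumes "\<And>w. (\<Sum>x\<in>UNIV. \<nu> x * P x w) = \<nu> w"
  shows "(\<Sum>x\<in>UNIV. \<nu> x * mpow P n x w) = \<nu> w"
proof (induction n)
  case 0
  have "(\<Sum>x\<in>UNIV. \<nu> x * (if x = w then 1 else 0)) = (\<Sum>x\<in>UNIV. if x = w then \<nu> x else 0)"
    by (intro sum.cong) auto
  then show ?case by simp
next
  case (Suc n)
  have "(\<Sum>x\<in>UNIV. \<nu> x * mpow P (Suc n) x w) = (\<Sum>v\<in>UNIV. \<Sum>x\<in>UNIV. \<nu> x * P x v * mpow P n v w)"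
    unfolding mpow.simps sum_distrib_left by (subst sum.swap) (simp add: mult.assoc)
  also have "\<dots> = (\<Sum>v\<in>UNIV. \<nu> v * mpow P n v w)" by (simp add: sum_distrib_right[symmetric] assms)
  finally show ?case using Suc by simp
qed

lemma Ppow_bound: assumes "\<And>x. \<bar>g x\<bar> \<le> G" shows "\<bar>Ppow P n g x\<bar> \<le> G"
proof -
  have "\<bar>Ppow P n g x\<bar> \<le> (\<Sum>w\<in>UNIV. mpow P n x w * G)"
    unfolding Ppow_mpow
    by (rule order.trans[OF sum_abs]) (intro sum_mono, simp add: abs_mult mpow_nonneg assms mult_left_mono)
  then show ?thesis by (simp add: sum_distrib_right[symmetric] mpow_row_sum)
qed

text \<open>Doeblin's argument: all entries of the k0-th power dominate \<epsilon> \<nu>, so on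
  centred functions that power equals a nonnegative kernel of total mass 1 - \<epsilon> and
  contracts the sup norm by this factor.\<close>

lemma mixing_of_pos:
  assumes pos: "\<And>x w. 0 < mpow P k0 x w" and k0: "1 \<le> k0"
    and inv: "\<And>w. (\<Sum>x\<in>UNIV. \<nu> x * P x w) = \<nu> w"
    and nn: "\<And>x. 0 \<le> \<nu> x" and s1: "(\<Sum>x\<in>UNIV. \<nu> x) = 1"
  shows "0 < \<nu> w" and "summable (\<lambda>n. \<bar>mpow P n x w - \<nu> w\<bar>)"
proof -
  obtain u where "\<nu> u \<noteq> 0" using s1 by (metis sum.neutral zero_neq_one)
  then have u: "0 < \<nu> u" using nn[of u] by simp
  have nu_pos: "0 < \<nu> w" for w
  proof -
    have "0 < (\<Sum>x\<in>UNIV. \<nu> x * mpow P k0 x w)"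
      using u pos nn by (intro sum_pos2[of UNIV u]) (auto simp: mpow_nonneg)
    then show ?thesis unfolding inv_mpow[OF inv] .
  qed
  then show "0 < \<nu> w" .
  \<comment> \<open>Half of the smallest entry ensures \<epsilon> < 1, so that \<rho> = 1 -
    \<epsilon> is positive even for a single state.\<close>
  define \<epsilon> where "\<epsilon> = Min (range (\<lambda>(x, w). mpow P k0 x w)) / 2"
  have e1: "2 * \<epsilon> \<le> mpow P k0 x w" for x w
  proof -
    have "Min (range (\<lambda>(x, w). mpow P k0 x w)) \<le> mpow P k0 x w"
      by (rule Min_le) (auto intro: rev_image_eqI[of "(x, w)"])
    then show ?thesis unfolding \<epsilon>_def by simp
  qed
  have e0: "0 < \<epsilon>" unfolding \<epsilon>_def using pos by (auto simp: Min_gr_iff)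
  have "mpow P k0 x w \<le> 1" for x w
    using mpow_row_sum[of k0 x] member_le_sum[of w UNIV "mpow P k0 x"] mpow_nonneg by auto
  then have e2: "\<epsilon> < 1" using e1[of undefined undefined] e0 by (smt (verit))
  define \<rho> where "\<rho> = 1 - \<epsilon>"
  have rho: "0 < \<rho>" "\<rho> < 1" unfolding \<rho>_def using e0 e2 by auto
  have nu1: "\<nu> w \<le> 1" for w using s1 member_le_sum[of w UNIV \<nu>] nn by auto
  have contr: "\<bar>Ppow P k0 g x\<bar> \<le> \<rho> * G" if "(\<Sum>w\<in>UNIV. \<nu> w * g w) = 0" "\<And>x. \<bar>g x\<bar> \<le> G" for g G x
  proof -
    have q: "0 \<le> mpow P k0 x w - \<epsilon> * \<nu> w" for w
    proof -
      have "\<epsilon> * \<nu> w \<le> \<epsilon> * 1" using e0 nu1 by (intro mult_left_mono) auto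
      then show ?thesis using e1[of x w] e0 by linarith
    qed
    have "Ppow P k0 g x = (\<Sum>w\<in>UNIV. (mpow P k0 x w - \<epsilon> * \<nu> w) * g w)"
      using that(1) unfolding Ppow_mpow left_diff_distrib sum_subtractf
      by (simp add: mult.assoc sum_distrib_left[symmetric])
    then have "\<bar>Ppow P k0 g x\<bar> \<le> (\<Sum>w\<in>UNIV. (mpow P k0 x w - \<epsilon> * \<nu> w) * G)"
      by (simp only:) (rule order.trans[OF sum_abs], intro sum_mono, simp add: abs_mult abs_of_nonneg[OF q], intro mult_left_mono that q)
    also have "\<dots> = \<rho> * G"
      by (simp only: sum_distrib_right[symmetric] sum_subtractf sum_distrib_left[symmetric] mpow_row_sum s1 \<rho>_def mult_1_right)
    finally show ?thesis .
  qed
  have nuP: "(\<Sum>w\<in>UNIV. \<nu> w * Ppow P n g w) = (\<Sum>w\<in>UNIV. \<nu> w * g w)" for n g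
  proof -
    have "(\<Sum>w\<in>UNIV. \<nu> w * Ppow P n g w) = (\<Sum>v\<in>UNIV. \<Sum>w\<in>UNIV. \<nu> w * mpow P n w v * g v)"
      unfolding Ppow_mpow sum_distrib_left by (subst sum.swap) (simp add: mult.assoc)
    then show ?thesis by (simp add: sum_distrib_right[symmetric] inv_mpow[OF inv])
  qed
  have geo: "\<bar>Ppow P (k0 * k) g x\<bar> \<le> \<rho> ^ k * G" if "(\<Sum>w\<in>UNIV. \<nu> w * g w) = 0" "\<And>x. \<bar>g x\<bar> \<le> G" for g G x k
  proof (induction k arbitrary: x)
    case 0 then show ?case using that by (simp add: Ppow_def)
  next
    case (Suc k)
    have "\<bar>Ppow P k0 (Ppow P (k0 * k) g) x\<bar> \<le> \<rho> * (\<rho> ^ k * G)"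
      by (intro contr Suc) (simp add: nuP that)
    then show ?case by (simp add: Ppow_add mult.assoc)
  qed
  have bnd: "\<bar>mpow P n x w - \<nu> w\<bar> \<le> \<rho> ^ (n div k0)" for n
  proof -
    define g where "g = (\<lambda>u. (if u = w then 1 else 0) - \<nu> w)"
    have "(\<Sum>u\<in>UNIV. \<nu> u * (if u = w then 1 else 0)) = (\<Sum>u\<in>UNIV. if u = w then \<nu> u else 0)"
      by (intro sum.cong) auto
    then have g0: "(\<Sum>u\<in>UNIV. \<nu> u * g u) = 0"
      by (simp add: g_def right_diff_distrib sum_subtractf sum_distrib_right[symmetric] s1)
    have g1: "\<bar>g u\<bar> \<le> 1" for u using nu1[of w] nn[of w] by (auto simp: g_def)
    have "(\<Sum>u\<in>UNIV. mpow P n x u * (if u = w then 1 else 0)) = (\<Sum>u\<in>UNIV. if u = w then mpow P n x u else 0)"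
      by (intro sum.cong) auto
    then have "mpow P n x w - \<nu> w = Ppow P n g x"
      by (simp add: Ppow_mpow g_def right_diff_distrib sum_subtractf sum_distrib_right[symmetric] mpow_row_sum)
    also have "\<dots> = Ppow P (k0 * (n div k0)) (Ppow P (n mod k0) g) x"
      by (simp add: Ppow_add[symmetric])
    also have "\<bar>\<dots>\<bar> \<le> \<rho> ^ (n div k0) * 1"
      by (intro geo Ppow_bound g1) (simp add: nuP g0)
    finally show ?thesis by simp
  qed
  have sm: "summable (\<lambda>n. (1 / \<rho>) * exp (ln \<rho> / k0) ^ n)"
    using rho k0 by (intro summable_mult summable_geometric) (simp add: divide_neg_pos)
  have "\<bar>mpow P n x w - \<nu> w\<bar> \<le> (1 / \<rho>) * exp (ln \<rho> / k0) ^ n" for n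
  proof -
    have "\<rho> ^ (n div k0) \<le> (1 / \<rho>) * exp (ln \<rho> * (real n / real k0))"
      using rho k0 by (intro power_div_le) auto
    also have "exp (ln \<rho> * (real n / real k0)) = exp (ln \<rho> / k0) ^ n"
      by (simp add: exp_of_nat_mult[symmetric] mult.commute)
    finally show ?thesis using bnd[of n] by linarith
  qed
  then show "summable (\<lambda>n. \<bar>mpow P n x w - \<nu> w\<bar>)"
    by (intro summable_comparison_test'[OF sm, of 0]) (simp only: real_norm_def abs_idempotent)
qed

end

lemma mwalk_of_hyps:
  assumes "stochastic P" "invariant_prob P \<nu>" "H1 P" "H2 \<nu> f" "H3 P f"
  shows "mwalk P f \<nu>"
proof -
  interpret nonneg_kernel P f using assms(1) by unfold_locales (auto simp: stochastic_def)
  obtain k0 where k0: "1 \<le> k0" "\<And>x w. 0 < mpow P k0 x w" using H1_mpow_pos[OF assms(3)] by auto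
  have inv: "(\<Sum>x\<in>UNIV. \<nu> x * P x w) = \<nu> w" "0 \<le> \<nu> w" "(\<Sum>x\<in>UNIV. \<nu> x) = 1" for w
    using assms(2) unfolding invariant_prob_def by auto
  interpret mchain P f \<nu>
    using mixing_of_pos[OF k0(2,1) inv] inv assms(4) by unfold_locales (auto simp: H2_def)
  show ?thesis
    using sg2_pos_H3[OF assms(5)] decay_H3[OF k0(2) assms(5)] by unfold_locales auto
qed

context mwalk
begin

lemma mpow_dual_P: "mpow (dual P \<nu>) n x w = \<nu> w / \<nu> x * mpow P n w x"
  using mpow_dual[of \<nu> P n x w] nu_pos by (simp add: dual_def[abs_def] less_imp_neq[THEN not_sym])

text \<open>Everything follows from the dual matrix being the \<nu>-conjugated transpose of
  \<open>P\<close>: its powers, its mixing and the stationary covariances are those of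
  \<open>P\<close> with the two states exchanged.\<close>

lemma dual_mwalk: "mwalk (dual P \<nu>) (\<lambda>u. - f u) \<nu>" and sg2_dual: "sigma_sq (dual P \<nu>) \<nu> (\<lambda>u. - f u) = sg2"
proof -
  have nz: "\<nu> x \<noteq> 0" for x using nu_pos[of x] by simp
  interpret d: nonneg_kernel "dual P \<nu>" "\<lambda>u. - f u"
  proof
    fix x v
    show "0 \<le> dual P \<nu> x v" unfolding dual_def using nu_pos P_nonneg by (simp add: less_imp_le)
    have "(\<Sum>v\<in>UNIV. dual P \<nu> x v) = (\<Sum>v\<in>UNIV. \<nu> v * P v x) / \<nu> x"
      unfolding dual_def sum_divide_distrib by (intro sum.cong) auto
    then show "(\<Sum>v\<in>UNIV. dual P \<nu> x v) = 1" using nu_inv[of x] nz[of x] by simp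
  qed
  interpret d: mchain "dual P \<nu>" "\<lambda>u. - f u" \<nu>
  proof
    fix x w
    show "0 < \<nu> x" "(\<Sum>x\<in>UNIV. \<nu> x) = 1" by (rule nu_pos nu_sum)+
    have "(\<Sum>x\<in>UNIV. \<nu> x * dual P \<nu> x w) = (\<Sum>x\<in>UNIV. \<nu> w * P w x)"
      unfolding dual_def using nz by (intro sum.cong) auto
    then show "(\<Sum>x\<in>UNIV. \<nu> x * dual P \<nu> x w) = \<nu> w" by (simp add: sum_distrib_left[symmetric] P_sum)
    show "(\<Sum>x\<in>UNIV. - f x * \<nu> x) = 0" using f_centered by (simp add: sum_negf)
    have "\<bar>mpow (dual P \<nu>) n x w - \<nu> w\<bar> = \<nu> w / \<nu> x * \<bar>mpow P n w x - \<nu> x\<bar>" for n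
    proof -
      have "mpow (dual P \<nu>) n x w - \<nu> w = \<nu> w / \<nu> x * (mpow P n w x - \<nu> x)"
        using nz[of x] by (simp add: mpow_dual_P right_diff_distrib)
      then show ?thesis by (simp add: abs_mult abs_of_pos[OF nu_pos])
    qed
    then show "summable (\<lambda>n. \<bar>mpow (dual P \<nu>) n x w - \<nu> w\<bar>)" using mixing[of w x] by (simp add: summable_mult)
  qed
  have "(\<Sum>x\<in>UNIV. (- f x) * Ppow (dual P \<nu>) n (\<lambda>u. - f u) x * \<nu> x) = (\<Sum>x\<in>UNIV. f x * Ppow P n f x * \<nu> x)" for n
  proof -
    have "(\<Sum>x\<in>UNIV. (- f x) * Ppow (dual P \<nu>) n (\<lambda>u. - f u) x * \<nu> x) =
        (\<Sum>x\<in>UNIV. \<Sum>w\<in>UNIV. f x * mpow P n w x * f w * \<nu> w)"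
      unfolding Ppow_mpow mpow_dual_P using nz
      by (intro sum.cong) (auto simp: sum_distrib_left sum_distrib_right field_simps sum_negf)
    also have "\<dots> = (\<Sum>w\<in>UNIV. \<Sum>x\<in>UNIV. f x * mpow P n w x * f w * \<nu> w)" by (rule sum.swap)
    also have "\<dots> = (\<Sum>x\<in>UNIV. f x * Ppow P n f x * \<nu> x)"
      unfolding Ppow_mpow by (intro sum.cong) (auto simp: sum_distrib_left sum_distrib_right mult_ac)
    finally show ?thesis .
  qed
  then show eq: "sigma_sq (dual P \<nu>) \<nu> (\<lambda>u. - f u) = sg2" unfolding sigma_sq_def by simp
  show "mwalk (dual P \<nu>) (\<lambda>u. - f u) \<nu>"
  proof
    show "0 < d.sg2" unfolding eq by (rule sg2_pos)
    fix R :: real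
    obtain C c where Cc: "0 < C" "0 < c" "\<And>s n x. \<bar>s\<bar> \<le> R \<Longrightarrow> rowsum s n x \<le> C * exp (- c * n * s\<^sup>2)"
      using decay[of R] by auto
    define K where "K = (\<Sum>x\<in>UNIV. 1 / \<nu> x)"
    have K: "1 / \<nu> x \<le> K" for x unfolding K_def by (rule member_le_sum) (auto simp: nu_pos less_imp_le)
    have K0: "0 < K" using K[of undefined] nu_pos[of undefined] by (smt (verit) divide_pos_pos)
    have "d.rowsum s n x \<le> (K * CARD('x) * C) * exp (- c * n * s\<^sup>2)" if s: "\<bar>s\<bar> \<le> R" for s n x
    proof -
      \<comment> \<open>Transposition moves the phase from the target to the source state. The unit
        factor in \<open>d\<close> moves it back, so the twisted dual kernel at s is a conjugated
        transpose of the original one at -s.\<close>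
      define d where "d w = of_real (\<nu> w) * cis (- s * f w)" for w
      have dn: "cmod (d w) = \<nu> w" for w using nu_pos[of w] by (simp add: d_def norm_mult)
      have dz: "d w \<noteq> 0" for w using dn[of w] nz[of w] by auto
      have "tilt (dual P \<nu>) (\<lambda>u. - f u) s = (\<lambda>x w. d w / d x * tilt P f (- s) w x)"
        using nz by (intro ext) (simp add: tilt_def dual_def d_def field_simps)
      then have e: "cmod (mpow (tilt (dual P \<nu>) (\<lambda>u. - f u) s) n x w) = \<nu> w / \<nu> x * cmod (M (- s) n w x)" for w
        using mpow_dual[of d "tilt P f (- s)" n x w, OF dz] by (simp add: norm_mult norm_divide dn)
      have b: "cmod (mpow (tilt (dual P \<nu>) (\<lambda>u. - f u) s) n x w) \<le> K * (C * exp (- c * n * s\<^sup>2))" for w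
        unfolding e
      proof (rule mult_mono)
        have "\<nu> w / \<nu> x \<le> 1 / \<nu> x" using nu_le_1[of w] nu_pos[of x] by (simp add: divide_right_mono)
        then show "\<nu> w / \<nu> x \<le> K" using K[of x] by simp
        have "cmod (M (- s) n w x) \<le> rowsum (- s) n w" unfolding rowsum_def by (rule member_le_sum) auto
        then show "cmod (M (- s) n w x) \<le> C * exp (- c * n * s\<^sup>2)" using Cc(3)[of "- s" n w] s by simp
      qed (use K0 in auto)
      have "d.rowsum s n x \<le> (\<Sum>w\<in>(UNIV::'x set). K * (C * exp (- c * n * s\<^sup>2)))"
        unfolding d.rowsum_def by (rule sum_mono) (rule b)
      then show ?thesis by (simp add: mult_ac)
    qed
    then show "\<exists>C>0. \<exists>c>0. \<forall>s n x. \<bar>s\<bar> \<le> R \<longrightarrow> d.rowsum s n x \<le> C * exp (- c * n * s\<^sup>2)"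
      using Cc K0 by (intro exI[of _ "K * CARD('x) * C"] exI[of _ c]) auto
  qed
qed

end

section \<open>The Fejer kernel and Gaussian integrals\<close>

text \<open>A probability density whose Fourier transform is the triangle \<open>tent T\<close>,
  hence supported in [-T, T]; the value at 0 is the limit of the quotient.\<close>

definition fejer :: "real \<Rightarrow> real \<Rightarrow> real" where
  "fejer T s = (if s = 0 then T / (2 * pi) else (1 - cos (T * s)) / (pi * T * s\<^sup>2))"

lemma one_minus_cos_le: "1 - cos u \<le> u\<^sup>2 / 2" for u :: real
proof -
  have "sin (u / 2) ^ 2 \<le> (u / 2)\<^sup>2"
    using abs_sin_x_le_abs_x[of "u / 2"] by (simp only: abs_le_square_iff)
  moreover have "cos u = 1 - 2 * sin (u / 2) ^ 2" using cos_double_sin[of "u / 2"] by simp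
  ultimately show ?thesis by (simp add: power_divide)
qed

lemma fejer_nonneg: "0 < T \<Longrightarrow> 0 \<le> fejer T s"
  by (simp add: fejer_def)

lemma fejer_le: assumes "0 < T" shows "fejer T s \<le> T / (2 * pi)"
proof (cases "s = 0")
  case False
  have "(1 - cos (T * s)) / (pi * T * s\<^sup>2) \<le> ((T * s)\<^sup>2 / 2) / (pi * T * s\<^sup>2)"
    using assms by (intro divide_right_mono one_minus_cos_le) auto
  also have "\<dots> = T / (2 * pi)" using False assms by (simp add: power2_eq_square field_simps)
  finally show ?thesis using False by (simp add: fejer_def)
qed (simp add: fejer_def)

lemma fejer_measurable [measurable]: "fejer T \<in> borel_measurable borel"
  unfolding fejer_def[abs_def] by measurable

lemma fejer_scale: "0 < T \<Longrightarrow> fejer T s = T * fejer 1 (T * s)"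
  by (auto simp: fejer_def power2_eq_square field_simps)

text \<open>The primitive of 2 \<open>fejer 1\<close> that vanishes at 0. It is odd and increases
  from -1 to 1: the sign function smoothed by the Fejer density.\<close>

definition fejer_cdf :: "real \<Rightarrow> real" where
  "fejer_cdf u = 2 / pi * (Si u - (1 - cos u) / u)"

lemma fejer_cdf_0: "fejer_cdf 0 = 0"
  by (simp add: fejer_cdf_def Si_def zero_ereal_def[symmetric])

lemma fejer_cdf_minus: "fejer_cdf (- u) = - fejer_cdf u"
proof -
  have "Si (- u) = - Si u" using Si_neg[of u] Si_neg[of "- u"] by (cases "0 \<le> u") auto
  then show ?thesis by (simp add: fejer_cdf_def algebra_simps)
qed

lemma one_minus_cos_limit: "((\<lambda>h. (1 - cos h) / h / h) \<longlongrightarrow> 1 / 2) (at (0::real))"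
proof -
  have "((\<lambda>h. (1 / 2) * (sin (h / 2) / (h / 2))\<^sup>2) \<longlongrightarrow> (1 / 2) * 1\<^sup>2) (at (0::real))"
  proof (intro tendsto_intros)
    have "filterlim (\<lambda>h. h / 2) (at 0) (at (0::real))"
      by (rule filterlim_atI) (auto intro!: tendsto_eq_intros simp: eventually_at_filter)
    then show "((\<lambda>h. sin (h / 2) / (h / 2)) \<longlongrightarrow> 1) (at (0::real))"
      by (rule filterlim_compose[OF sinc_at_0])
  qed
  moreover have "(\<lambda>h::real. (1 / 2) * (sin (h / 2) / (h / 2))\<^sup>2) = (\<lambda>h. (1 - cos h) / h / h)"
  proof
    fix h :: real
    show "(1 / 2) * (sin (h / 2) / (h / 2))\<^sup>2 = (1 - cos h) / h / h"
      using cos_double_sin[of "h / 2"] by (simp add: power_divide power2_eq_square)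
  qed
  ultimately show ?thesis by (simp only: power_one mult_1_right)
qed

lemma fejer_ge_near_0: "\<exists>\<delta>>0. \<delta> \<le> 1 \<and> (\<forall>u. \<bar>u\<bar> \<le> \<delta> \<longrightarrow> 1 / (4 * pi) \<le> fejer 1 u)"
proof -
  have "\<forall>\<^sub>F h in at (0::real). 1 / 4 < (1 - cos h) / h / h"
    using one_minus_cos_limit by (rule order_tendstoD) simp
  then obtain d where d: "0 < d" "\<And>h::real. h \<noteq> 0 \<Longrightarrow> \<bar>h\<bar> < d \<Longrightarrow> 1 / 4 < (1 - cos h) / h / h"
    by (auto simp: eventually_at dist_real_def)
  have "1 / (4 * pi) \<le> fejer 1 u" if "\<bar>u\<bar> \<le> min (d / 2) 1" for u
  proof (cases "u = 0")
    case False
    have "1 / 4 \<le> (1 - cos u) / u / u" using d(2)[OF False] that d(1) by simp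
    then have "(1 / 4) / pi \<le> ((1 - cos u) / u / u) / pi" by (intro divide_right_mono) auto
    then show ?thesis using False by (simp add: fejer_def power2_eq_square mult_ac)
  qed (simp add: fejer_def frac_le)
  then show ?thesis using d(1) by (intro exI[of _ "min (d / 2) 1"]) auto
qed

lemma DERIV_fejer_cdf: "DERIV fejer_cdf u :> 2 * fejer 1 u"
proof (cases "u = 0")
  case False
  have "((\<lambda>u. 2 / pi * (Si u - (1 - cos u) / u)) has_real_derivative
      2 / pi * (sinc u - (sin u * u - (1 - cos u)) / (u * u))) (at u)"
    using False by (auto intro!: derivative_eq_intros DERIV_Si simp: mult_ac)
  moreover have "2 / pi * (sinc u - (sin u * u - (1 - cos u)) / (u * u)) = 2 * fejer 1 u"
  proof -
    have "(sin u * u - (1 - cos u)) / (u * u) = sin u / u - (1 - cos u) / (u * u)"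
      using False by (simp add: diff_divide_distrib)
    then show ?thesis using False by (simp add: fejer_def power2_eq_square)
  qed
  ultimately show ?thesis unfolding fejer_cdf_def[abs_def] by simp
next
  case True
  have "((\<lambda>h. (1 - cos h) / h / h) \<longlongrightarrow> 1 / 2) (at (0::real))" by (rule one_minus_cos_limit)
  then have "((\<lambda>h. (1 - cos h) / h) has_real_derivative 1 / 2) (at 0)"
    by (simp add: has_field_derivative_iff)
  then have "((\<lambda>u. 2 / pi * (Si u - (1 - cos u) / u)) has_real_derivative 2 / pi * (sinc 0 - 1 / 2)) (at 0)"
    by (intro DERIV_cmult DERIV_diff DERIV_Si)
  then show ?thesis unfolding True fejer_cdf_def[abs_def] by (simp add: fejer_def)
qed

lemma fejer_cdf_at_top: "(fejer_cdf \<longlongrightarrow> 1) at_top"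
proof -
  have "((\<lambda>u::real. (1 - cos u) / u) \<longlongrightarrow> 0) at_top"
  proof (rule Lim_null_comparison)
    show "((\<lambda>u::real. 2 / u) \<longlongrightarrow> 0) at_top"
      by (intro tendsto_divide_0[OF tendsto_const] filterlim_at_top_imp_at_infinity filterlim_ident)
    show "\<forall>\<^sub>F u::real in at_top. norm ((1 - cos u) / u) \<le> 2 / u"
      using eventually_gt_at_top[of 0]
    proof eventually_elim
      case (elim u)
      have "\<bar>1 - cos u\<bar> \<le> 2" using cos_ge_minus_one[of u] cos_le_one[of u] by linarith
      then show ?case using elim by (simp add: divide_right_mono)
    qed
  qed
  then have "((\<lambda>u. 2 / pi * (Si u - (1 - cos u) / u)) \<longlongrightarrow> 2 / pi * (pi / 2 - 0)) at_top"
    by (intro tendsto_intros Si_at_top)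
  then show ?thesis unfolding fejer_cdf_def[abs_def] by simp
qed

lemma fejer_cdf_mono:
  assumes "u \<le> v" shows "fejer_cdf u \<le> fejer_cdf v"
proof (rule DERIV_nonneg_imp_nondecreasing[of u v fejer_cdf, OF assms])
  fix x
  have "0 \<le> 2 * fejer 1 x" by (simp add: fejer_nonneg)
  then show "\<exists>y. (fejer_cdf has_real_derivative y) (at x) \<and> 0 \<le> y" using DERIV_fejer_cdf by blast
qed

lemma fejer_cdf_le_1: "fejer_cdf u \<le> 1"
proof (rule tendsto_lowerbound[OF fejer_cdf_at_top])
  show "\<forall>\<^sub>F v in at_top. fejer_cdf u \<le> fejer_cdf v"
    using eventually_ge_at_top[of u] by eventually_elim (rule fejer_cdf_mono)
qed simp

lemma fejer_cdf_nonneg: "0 \<le> u \<Longrightarrow> 0 \<le> fejer_cdf u"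
  using fejer_cdf_mono[of 0 u] by (simp add: fejer_cdf_0)

text \<open>Adding 4 / (pi u) makes the function nonincreasing, because 1 - cos is at most 2, while
  its limit at infinity is still 1.\<close>

lemma fejer_cdf_ge:
  assumes "0 < u" shows "1 - 4 / (pi * u) \<le> fejer_cdf u"
proof -
  let ?G = "\<lambda>u. fejer_cdf u + 4 / pi * (1 / u)"
  have dec: "?G v \<le> ?G u" if "u \<le> v" for v
  proof (rule DERIV_nonpos_imp_nonincreasing[OF that])
    fix x assume "u \<le> x" "x \<le> v"
    then have x: "0 < x" using assms by simp
    have "(?G has_real_derivative 2 * fejer 1 x + 4 / pi * (- 1 / x\<^sup>2)) (at x)"
      using x by (auto intro!: derivative_eq_intros DERIV_fejer_cdf simp: power2_eq_square)
    moreover have "2 * fejer 1 x + 4 / pi * (- 1 / x\<^sup>2) \<le> 0"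
    proof -
      have "2 * fejer 1 x + 4 / pi * (- 1 / x\<^sup>2) = (2 * (1 - cos x) - 4) / (pi * x\<^sup>2)"
        using x by (simp add: fejer_def field_simps)
      also have "\<dots> \<le> 0" using cos_ge_minus_one[of x] by (intro divide_nonpos_nonneg) auto
      finally show ?thesis .
    qed
    ultimately show "\<exists>y. (?G has_real_derivative y) (at x) \<and> y \<le> 0" by blast
  qed
  have "(?G \<longlongrightarrow> 1 + 4 / pi * 0) at_top"
    by (intro tendsto_intros fejer_cdf_at_top tendsto_divide_0[OF tendsto_const] filterlim_at_top_imp_at_infinity filterlim_ident)
  then have "1 + 4 / pi * 0 \<le> ?G u"
  proof (rule tendsto_upperbound)
    show "\<forall>\<^sub>F v in at_top. ?G v \<le> ?G u"
      using eventually_ge_at_top[of u] by eventually_elim (rule dec)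
  qed simp
  then show ?thesis by simp
qed

lemma fejer_has_integral:
  assumes "0 < T" shows "has_bochner_integral lborel (fejer T) 1"
proof -
  have "(\<integral>\<^sup>+x. ennreal (2 * fejer 1 x) * indicator {0..} x \<partial>lborel) = ennreal (1 - fejer_cdf 0)"
    by (rule nn_integral_FTC_atLeast) (auto intro!: DERIV_fejer_cdf fejer_nonneg fejer_cdf_at_top)
  moreover have "(\<integral>\<^sup>+x. ennreal (indicator {0..} x *\<^sub>R (2 * fejer 1 x)) \<partial>lborel) =
      (\<integral>\<^sup>+x. ennreal (2 * fejer 1 x) * indicator {0..} x \<partial>lborel)"
    by (intro nn_integral_cong) (auto split: split_indicator)
  ultimately have "has_bochner_integral lborel (\<lambda>x. indicator {0..} x *\<^sub>R (2 * fejer 1 x)) 1"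
    by (intro has_bochner_integral_nn_integral) (auto simp: fejer_cdf_0 fejer_nonneg)
  then have "has_bochner_integral lborel (\<lambda>x. 2 * fejer 1 x) (2 *\<^sub>R 1)"
    by (rule has_bochner_integral_even_function) (simp add: fejer_def)
  then have "has_bochner_integral lborel (\<lambda>x. (1/2) * (2 * fejer 1 x)) ((1/2) * (2 *\<^sub>R 1))"
    by (intro has_bochner_integral_mult_right) auto
  then have 1: "has_bochner_integral lborel (fejer 1) 1" by simp
  have "has_bochner_integral lborel (\<lambda>x. fejer 1 (0 + T * x)) (1 /\<^sub>R \<bar>T\<bar>)"
    by (rule lborel_has_bochner_integral_real_affine_iff[THEN iffD1, OF _ 1]) (use assms in auto)
  then have "has_bochner_integral lborel (\<lambda>x. T * fejer 1 (T * x)) (T * (1 /\<^sub>R \<bar>T\<bar>))"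
    by (intro has_bochner_integral_mult_right) auto
  then show ?thesis using assms by (simp add: fejer_scale[symmetric])
qed

lemma fejer_integrable: "0 < T \<Longrightarrow> integrable lborel (fejer T)"
  and fejer_integral: "0 < T \<Longrightarrow> (\<integral>s. fejer T s \<partial>lborel) = 1"
  using fejer_has_integral by (auto simp: has_bochner_integral_iff)

lemma fejer_mass:
  assumes "0 < T" "0 < a"
  shows "1 - 4 / (pi * T * a) \<le> (\<integral>s. indicator {- a..a} s * fejer T s \<partial>lborel)"
proof -
  have "(\<integral>\<^sup>+x. ennreal (fejer T x) * indicator {- a..a} x \<partial>lborel) = ennreal (fejer_cdf (T * a) / 2 - fejer_cdf (T * (- a)) / 2)"
  proof (rule nn_integral_FTC_Icc[where F = "\<lambda>x. fejer_cdf (T * x) / 2"])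
    fix x
    have "((\<lambda>x. fejer_cdf (T * x) / 2) has_real_derivative (2 * fejer 1 (T * x)) * T / 2) (at x)"
      by (auto intro!: derivative_eq_intros DERIV_chain2[OF DERIV_fejer_cdf])
    moreover have "(2 * fejer 1 (T * x)) * T / 2 = fejer T x" using fejer_scale[OF assms(1), of x] by simp
    ultimately show "((\<lambda>x. fejer_cdf (T * x) / 2) has_real_derivative fejer T x) (at x)"
      by (simp only:)
  qed (use assms in \<open>auto simp: fejer_nonneg\<close>)
  moreover have "(\<integral>\<^sup>+x. ennreal (indicator {- a..a} x * fejer T x) \<partial>lborel) =
      (\<integral>\<^sup>+x. ennreal (fejer T x) * indicator {- a..a} x \<partial>lborel)"
    by (intro nn_integral_cong) (auto split: split_indicator)
  ultimately have "has_bochner_integral lborel (\<lambda>x. indicator {- a..a} x * fejer T x) (fejer_cdf (T * a))"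
    using assms by (intro has_bochner_integral_nn_integral)
      (auto simp: fejer_cdf_minus fejer_nonneg fejer_cdf_nonneg)
  then have "(\<integral>s. indicator {- a..a} s * fejer T s \<partial>lborel) = fejer_cdf (T * a)"
    by (rule has_bochner_integral_integral_eq)
  then show ?thesis using fejer_cdf_ge[of "T * a"] assms by (simp add: mult.assoc)
qed

definition tent :: "real \<Rightarrow> real \<Rightarrow> real" where
  "tent T t = indicator {-T..T} t * (1 - \<bar>t\<bar> / T)"

lemma tent_measurable [measurable]: "tent T \<in> borel_measurable borel"
  unfolding tent_def[abs_def] by measurable

lemma tent_bounds: "0 < T \<Longrightarrow> 0 \<le> tent T t" "0 < T \<Longrightarrow> tent T t \<le> indicator {-T..T} t"
  "0 < T \<Longrightarrow> tent T t \<le> 1"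
  by (auto simp: tent_def field_simps split: split_indicator)

lemma tent_minus: "tent T (- t) = tent T t"
  by (auto simp: tent_def indicator_def)

lemma tent_tendsto: "((\<lambda>T. tent T t) \<longlongrightarrow> 1) at_top"
proof (rule Lim_transform_eventually)
  have "((\<lambda>T::real. \<bar>t\<bar> / T) \<longlongrightarrow> 0) at_top"
    by (intro tendsto_divide_0[OF tendsto_const] filterlim_at_top_imp_at_infinity filterlim_ident)
  then show "((\<lambda>T. 1 - \<bar>t\<bar> / T) \<longlongrightarrow> 1) at_top"
    using tendsto_diff[OF tendsto_const, of _ 0 at_top 1] by fastforce
  show "\<forall>\<^sub>F T in at_top. 1 - \<bar>t\<bar> / T = tent T t"
    using eventually_ge_at_top[of "\<bar>t\<bar>"] by eventually_elim (auto simp: tent_def indicator_def)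
qed

lemma fejer_fourier:
  assumes T: "0 < T"
  shows "has_bochner_integral lborel (\<lambda>t. tent T t * cos (t * s)) (2 * pi * fejer T s)"
proof -
  have "has_bochner_integral lborel (\<lambda>t. indicator {0..T} t *\<^sub>R ((1 - t / T) * cos (t * s))) (pi * fejer T s)"
  proof (cases "s = 0")
    case True
    have "has_bochner_integral lborel (\<lambda>t. (1 - t / T) * indicator {0..T} t)
        ((\<lambda>t. t - t\<^sup>2 / (2 * T)) T - (\<lambda>t. t - t\<^sup>2 / (2 * T)) 0)"
    proof (intro has_bochner_integral_FTC_Icc_real)
      fix x
      have "((\<lambda>t. t - t\<^sup>2 / (2 * T)) has_real_derivative 1 - 2 * x / (2 * T)) (at x)"
        using T by (auto intro!: derivative_eq_intros)
      then show "((\<lambda>t. t - t\<^sup>2 / (2 * T)) has_real_derivative 1 - x / T) (at x)" by simp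
      show "isCont (\<lambda>t. 1 - t / T) x" using T by (intro continuous_intros) auto
    qed (use T in simp)
    then show ?thesis using T True by (simp add: fejer_def power2_eq_square mult.commute field_simps)
  next
    case False
    have "has_bochner_integral lborel (\<lambda>t. ((1 - t / T) * cos (t * s)) * indicator {0..T} t)
        ((\<lambda>t. (1 - t / T) * sin (t * s) / s - cos (t * s) / (T * s\<^sup>2)) T
         - (\<lambda>t. (1 - t / T) * sin (t * s) / s - cos (t * s) / (T * s\<^sup>2)) 0)"
    proof (intro has_bochner_integral_FTC_Icc_real)
      fix x
      have "((\<lambda>t. (1 - t / T) * sin (t * s) / s - cos (t * s) / (T * s\<^sup>2)) has_real_derivative
         (- (1 / T) * sin (x * s) + (1 - x / T) * (cos (x * s) * s)) / s - (- sin (x * s) * s) / (T * s\<^sup>2)) (at x)"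
        using T False by (auto intro!: derivative_eq_intros)
      moreover have "(- (1 / T) * sin (x * s) + (1 - x / T) * (cos (x * s) * s)) / s - (- sin (x * s) * s) / (T * s\<^sup>2)
         = (1 - x / T) * cos (x * s)"
        using T False by (simp add: power2_eq_square field_simps)
      ultimately show "((\<lambda>t. (1 - t / T) * sin (t * s) / s - cos (t * s) / (T * s\<^sup>2)) has_real_derivative
         (1 - x / T) * cos (x * s)) (at x)" by simp
      show "isCont (\<lambda>t. (1 - t / T) * cos (t * s)) x" using T by (intro continuous_intros) auto
    qed (use T in simp)
    moreover have "pi * fejer T s = (1 - cos (T * s)) / (T * s\<^sup>2)" using False by (simp add: fejer_def)
    ultimately show ?thesis using T False by (simp add: mult.commute diff_divide_distrib)
  qed
  also have "(\<lambda>t. indicator {0..T} t *\<^sub>R ((1 - t / T) * cos (t * s))) = (\<lambda>t. indicator {0..} t *\<^sub>R (tent T t * cos (t * s)))"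
    using T by (auto simp: fun_eq_iff tent_def indicator_def)
  finally have "has_bochner_integral lborel (\<lambda>t. tent T t * cos (t * s)) (2 *\<^sub>R (pi * fejer T s))"
    by (rule has_bochner_integral_even_function) (simp add: tent_minus)
  then show ?thesis by (simp add: mult.assoc)
qed

text \<open>The link between sine functionals and survival: integrating sin (t b) / t against the
  triangle recovers a smoothed indicator of b > 0.\<close>

lemma fejer_sine:
  assumes T: "0 < T" and b: "0 < b"
  shows "has_bochner_integral lborel (\<lambda>t. tent T t * (sin (t * b) / t)) (pi * fejer_cdf (T * b))"
proof -
  have "has_bochner_integral lborel (\<lambda>t. (b * sinc (t * b) - sin (t * b) / T) * indicator {0..T} t)
      ((\<lambda>t. Si (t * b) + cos (t * b) / (T * b)) T - (\<lambda>t. Si (t * b) + cos (t * b) / (T * b)) 0)"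
  proof (intro has_bochner_integral_FTC_Icc_real)
    fix x
    have "((\<lambda>t. Si (t * b) + cos (t * b) / (T * b)) has_real_derivative
        sinc (x * b) * b + (- sin (x * b) * b) / (T * b)) (at x)"
      using T b by (auto intro!: derivative_eq_intros DERIV_chain2[OF DERIV_Si])
    then show "((\<lambda>t. Si (t * b) + cos (t * b) / (T * b)) has_real_derivative
        b * sinc (x * b) - sin (x * b) / T) (at x)" using T b by (simp add: mult.commute)
    have "isCont (\<lambda>x. sinc (x * b)) x"
      by (rule isCont_o2[OF _ isCont_sinc]) (intro continuous_intros)
    then show "isCont (\<lambda>x. b * sinc (x * b) - sin (x * b) / T) x"
      using T by (intro continuous_intros) auto
  qed (use T in simp)
  moreover have "(\<lambda>t. Si (t * b) + cos (t * b) / (T * b)) T - (\<lambda>t. Si (t * b) + cos (t * b) / (T * b)) 0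
      = pi / 2 * fejer_cdf (T * b)"
  proof -
    have "Si 0 = 0" by (simp add: Si_def zero_ereal_def[symmetric])
    moreover have "pi / 2 * fejer_cdf u = Si u - (1 - cos u) / u" for u by (simp add: fejer_cdf_def)
    ultimately show ?thesis using T b by (simp add: diff_divide_distrib)
  qed
  ultimately have "has_bochner_integral lborel (\<lambda>t. (b * sinc (t * b) - sin (t * b) / T) * indicator {0..T} t) (pi / 2 * fejer_cdf (T * b))"
    by (simp only:)
  then have "has_bochner_integral lborel (\<lambda>t. indicator {0..} t *\<^sub>R (tent T t * (sin (t * b) / t))) (pi / 2 * fejer_cdf (T * b))"
  proof (rule has_bochner_integral_cong_AE[THEN iffD1, rotated -1])
    show "AE t in lborel. (b * sinc (t * b) - sin (t * b) / T) * indicator {0..T} t = indicator {0..} t *\<^sub>R (tent T t * (sin (t * b) / t))"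
      using AE_lborel_singleton[of 0]
    proof eventually_elim
      case (elim t)
      then show ?case using T b by (auto simp: tent_def field_simps split: split_indicator)
    qed
  qed measurable
  then have "has_bochner_integral lborel (\<lambda>t. tent T t * (sin (t * b) / t)) (2 *\<^sub>R (pi / 2 * fejer_cdf (T * b)))"
    by (rule has_bochner_integral_even_function) (simp add: tent_minus)
  then show ?thesis by simp
qed

section \<open>Gaussian moments and Fourier transforms\<close>

lemma gauss_normal_density:
  assumes "0 < \<kappa>"
  shows "exp (- \<kappa> * t\<^sup>2 / 2) = sqrt (2 * pi) / sqrt \<kappa> * normal_density 0 (1 / sqrt \<kappa>) t"
proof -
  have "sqrt (2 * pi * (1 / sqrt \<kappa>)\<^sup>2) = sqrt (2 * pi) / sqrt \<kappa>"
    using assms by (simp add: real_sqrt_divide power_divide)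
  moreover have "- (t - 0)\<^sup>2 / (2 * (1 / sqrt \<kappa>)\<^sup>2) = - \<kappa> * t\<^sup>2 / 2"
    using assms by (simp add: power_divide)
  ultimately show ?thesis unfolding normal_density_def using assms by simp
qed

lemma gauss_integrable_moment:
  assumes "0 < \<kappa>"
  shows "integrable lborel (\<lambda>t::real. exp (- \<kappa> * t\<^sup>2 / 2) * t ^ k)"
  unfolding gauss_normal_density[OF assms] mult.assoc
  using integrable_normal_moment[of "1 / sqrt \<kappa>" 0 k] assms by (intro integrable_mult_right) simp

lemma gauss_integrable: "0 < \<kappa> \<Longrightarrow> integrable lborel (\<lambda>t::real. exp (- \<kappa> * t\<^sup>2 / 2))"
  using gauss_integrable_moment[of \<kappa> 0] by simp

lemma gauss_second_moment:
  assumes "0 < \<kappa>"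
  shows "(\<integral>t. exp (- \<kappa> * t\<^sup>2 / 2) * t\<^sup>2 \<partial>lborel) = sqrt (2 * pi) / sqrt \<kappa> ^ 3"
proof -
  define \<sigma> where "\<sigma> = 1 / sqrt \<kappa>"
  have s: "0 < \<sigma>" using assms by (simp add: \<sigma>_def)
  have "(\<integral>x. normal_density 0 \<sigma> x * (x - 0) ^ (2 * 1) \<partial>lborel) = fact (2 * 1) / ((2 / \<sigma>\<^sup>2) ^ 1 * fact 1)"
    using normal_moment_even[OF s, of 0 1] by (rule has_bochner_integral_integral_eq)
  then have "(\<integral>x. normal_density 0 \<sigma> x * x\<^sup>2 \<partial>lborel) = 1 / \<kappa>"
    using assms by (simp add: \<sigma>_def power_divide)
  then show ?thesis unfolding gauss_normal_density[OF assms] mult.assoc integral_mult_right_zero \<sigma>_def[symmetric]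
    using assms by (simp add: power3_eq_cube \<sigma>_def)
qed

lemma gauss_integral:
  assumes "0 < \<kappa>"
  shows "(\<integral>t. exp (- \<kappa> * t\<^sup>2 / 2) \<partial>lborel) = sqrt (2 * pi) / sqrt \<kappa>"
  unfolding gauss_normal_density[OF assms] integral_mult_right_zero
  using integral_normal_density[of "1 / sqrt \<kappa>" 0] assms by simp

lemma gauss_cos_integrable:
  assumes "0 < \<kappa>" shows "integrable lborel (\<lambda>t::real. exp (- \<kappa> * t\<^sup>2 / 2) * cos (t * u))"
proof (rule Bochner_Integration.integrable_bound[OF gauss_integrable[OF assms]])
  show "AE t in lborel. norm (exp (- \<kappa> * t\<^sup>2 / 2) * cos (t * u)) \<le> norm (exp (- \<kappa> * t\<^sup>2 / 2))"
    by (intro AE_I2) (simp add: abs_mult mult_left_le)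
qed measurable

lemma gauss_fourier:
  assumes "0 < \<kappa>"
  shows "(\<integral>t. exp (- \<kappa> * t\<^sup>2 / 2) * cos (t * u) \<partial>lborel) = sqrt (2 * pi) / sqrt \<kappa> * exp (- u\<^sup>2 / (2 * \<kappa>))"
proof -
  have std: "(\<integral>t. std_normal_density t * cos (v * t) \<partial>lborel) = exp (- v\<^sup>2 / 2)" for v
  proof -
    have "complex_of_real (exp (- (v\<^sup>2) / 2)) = (CLINT t|density lborel std_normal_density. iexp (v * t))"
      using char_std_normal_distribution unfolding char_def by metis
    also have "\<dots> = (CLINT t|lborel. std_normal_density t *\<^sub>R iexp (v * t))"
      by (rule integral_density) (auto simp: normal_density_nonneg)
    finally have "exp (- v\<^sup>2 / 2) = Re (CLINT t|lborel. std_normal_density t *\<^sub>R iexp (v * t))"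
      by (metis Re_complex_of_real)
    also have "\<dots> = (\<integral>t. Re (std_normal_density t *\<^sub>R iexp (v * t)) \<partial>lborel)"
    proof (rule integral_Re[symmetric])
      show "complex_integrable lborel (\<lambda>t. std_normal_density t *\<^sub>R iexp (v * t))"
        by (rule Bochner_Integration.integrable_bound[OF integrable_normal_density[of 1 0]]) (auto simp: normal_density_nonneg)
    qed
    also have "\<dots> = (\<integral>t. std_normal_density t * cos (v * t) \<partial>lborel)"
      by (simp add: Re_exp)
    finally show ?thesis by simp
  qed
  have k: "0 < sqrt \<kappa>" using assms by simp
  have "(\<integral>t. std_normal_density t * cos (u / sqrt \<kappa> * t) \<partial>lborel)
     = \<bar>sqrt \<kappa>\<bar> *\<^sub>R (\<integral>t. std_normal_density (0 + sqrt \<kappa> * t) * cos (u / sqrt \<kappa> * (0 + sqrt \<kappa> * t)) \<partial>lborel)"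
    using k by (intro lborel_integral_real_affine) auto
  also have "(\<integral>t. std_normal_density (0 + sqrt \<kappa> * t) * cos (u / sqrt \<kappa> * (0 + sqrt \<kappa> * t)) \<partial>lborel)
     = (\<integral>t. (1 / sqrt (2 * pi)) * (exp (- \<kappa> * t\<^sup>2 / 2) * cos (t * u)) \<partial>lborel)"
    using assms by (intro Bochner_Integration.integral_cong) (auto simp: std_normal_density_def power_mult_distrib mult_ac)
  finally have e1: "exp (- (u / sqrt \<kappa>)\<^sup>2 / 2) =
      sqrt \<kappa> * (1 / sqrt (2 * pi) * (\<integral>t. exp (- \<kappa> * t\<^sup>2 / 2) * cos (t * u) \<partial>lborel))"
    unfolding std integral_mult_right_zero using k by simp
  have e2: "- u\<^sup>2 / (2 * \<kappa>) = - (u / sqrt \<kappa>)\<^sup>2 / 2" using assms by (simp add: power_divide)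
  have "sqrt (2 * pi) / sqrt \<kappa> * (sqrt \<kappa> * (1 / sqrt (2 * pi) * I)) = I" for I
    using k by simp
  then show ?thesis unfolding e2 e1 by (rule sym)
qed

section \<open>Concentration of the free walk\<close>

context nonneg_kernel
begin

lemma EE_cos:
  "EE P f UNIV n (\<lambda>x' z. if x' = w then cos (t * (z + a)) else 0) x y = Re (cis (t * (y + a)) * M t n x w)"
proof -
  have "(\<lambda>x' z. if x' = w then cos (t * (z + a)) else 0) = (\<lambda>x' z. Re (cis (t * z) * (if x' = w then cis (t * a) else 0)))"
    by (auto simp: fun_eq_iff cis_mult distrib_left cos_add)
  then have "EE P f UNIV n (\<lambda>x' z. if x' = w then cos (t * (z + a)) else 0) x y
     = Re (EE P f UNIV n (\<lambda>x' z. cis (t * z) * (if x' = w then cis (t * a) else 0)) x y)"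
    by (simp only: EE_linear[OF bounded_linear_Re])
  also have "\<dots> = Re (cis (t * y) * (\<Sum>v\<in>UNIV. M t n x v * (if v = w then cis (t * a) else 0)))"
    unfolding EE_cis ..
  also have "(\<Sum>v\<in>UNIV. M t n x v * (if v = w then cis (t * a) else 0)) = (\<Sum>v\<in>UNIV. if v = w then M t n x v * cis (t * a) else 0)"
    by (intro sum.cong) auto
  also have "\<dots> = M t n x w * cis (t * a)" by simp
  finally show ?thesis by (simp add: distrib_left cis_mult[symmetric] mult_ac del: times_complex.sel)
qed

lemma EE_cos_le: "\<bar>EE P f UNIV n (\<lambda>_ z. cos (t * z)) x y\<bar> \<le> rowsum t n x"
proof -
  have eq: "(\<lambda>(_::'x) z. cos (t * z)) = (\<lambda>x' z. Re (cis (t * z) * 1))" by simp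
  have "EE P f UNIV n (\<lambda>_ z. cos (t * z)) x y = Re (cis (t * y) * (\<Sum>w\<in>UNIV. M t n x w))"
    unfolding eq EE_linear[OF bounded_linear_Re, symmetric] EE_cis by simp
  also have "\<bar>\<dots>\<bar> \<le> cmod (cis (t * y) * (\<Sum>w\<in>UNIV. M t n x w))" by (rule abs_Re_le_cmod)
  also have "\<dots> \<le> rowsum t n x" unfolding rowsum_def norm_mult by (simp add: norm_sum)
  finally show ?thesis .
qed

definition exit1 :: "('x \<Rightarrow> real \<Rightarrow> 'b::real_normed_vector) \<Rightarrow> 'x \<Rightarrow> real \<Rightarrow> 'b" where
  "exit1 F x y = (\<Sum>v\<in>UNIV. P x v *\<^sub>R (if y + f v \<le> 0 then F v (y + f v) else 0))"

abbreviation ED :: "nat \<Rightarrow> ('x \<Rightarrow> real \<Rightarrow> 'b::real_normed_vector) \<Rightarrow> 'x \<Rightarrow> real \<Rightarrow> 'b" where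
  "ED \<equiv> EE P f {0<..}"

abbreviation EU :: "nat \<Rightarrow> ('x \<Rightarrow> real \<Rightarrow> 'b::real_normed_vector) \<Rightarrow> 'x \<Rightarrow> real \<Rightarrow> 'b" where
  "EU \<equiv> EE P f UNIV"

lemma ED_exit1: "ED (Suc 0) F x y = EU (Suc 0) F x y - exit1 F x y"
  unfolding exit1_def EE.simps sum_subtractf[symmetric] scaleR_diff_right[symmetric]
  by (intro sum.cong) auto

text \<open>One step of optional stopping: the last step is taken freely and the part that has just
  left the positive half-line is subtracted.\<close>

lemma ED_Suc_exit: "ED (Suc n) F x y = ED n (EU (Suc 0) F) x y - ED n (exit1 F) x y"
  unfolding EE_Suc_right[of P f _ n] EE_diff[symmetric] by (intro EE_cong) (rule ED_exit1)

definition qn :: "nat \<Rightarrow> 'x \<Rightarrow> real \<Rightarrow> real" where "qn n x y = ED n (\<lambda>_ _. 1) x y"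

lemma qn_0: "qn 0 x y = 1" by (simp add: qn_def)

lemma qn_nonneg: "0 \<le> qn n x y" unfolding qn_def by (rule EE_nonneg) simp

lemma qn_le_1: "qn n x y \<le> 1"
  unfolding qn_def using EE_le_UNIV[of "\<lambda>_ _. 1" "{0<..}" n x y] by simp

lemma qn_Suc: "qn (Suc n) x y = qn n x y - ED n (exit1 (\<lambda>_ _. 1)) x y"
proof -
  have "EU (Suc 0) (\<lambda>_ _. 1 :: real) = (\<lambda>_ _. 1)" by (intro ext) (rule EE_UNIV_const)
  then show ?thesis unfolding qn_def ED_Suc_exit[of n] by (simp only:)
qed

lemma exit1_nonneg: "(\<And>x z. 0 \<le> F x z) \<Longrightarrow> (0::real) \<le> exit1 F x y"
  unfolding exit1_def by (intro sum_nonneg) (auto simp: P_nonneg)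

lemma qn_antimono: "m \<le> n \<Longrightarrow> qn n x y \<le> qn m x y"
proof (induction n rule: dec_induct)
  case (step n)
  have "0 \<le> ED n (exit1 (\<lambda>_ _. 1 :: real)) x y" by (intro EE_nonneg exit1_nonneg) auto
  then show ?case using step by (simp add: qn_Suc)
qed simp

lemma ED_le_qn:
  assumes "\<And>x' z. 0 < z \<or> z = y \<Longrightarrow> F x' z \<le> B"
  shows "ED n F x y \<le> B * qn n x y"
proof -
  have "ED n F x y \<le> ED n (\<lambda>_ _. B * 1) x y" by (rule EE_mono) (use assms in auto)
  then show ?thesis unfolding qn_def EE_cmult .
qed

lemma qn_mono: assumes "y \<le> y'" shows "qn n x y \<le> qn n x y'"
proof (cases n)
  case (Suc m)
  have "ED n (\<lambda>_ _. 1) x y \<le> ED n (\<lambda>_ _. 1 :: real) x (y + (y' - y))"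
    by (rule EE_shift_mono) (use assms Suc in auto)
  then show ?thesis by (simp add: qn_def)
qed (simp add: qn_0)

end

lemma power_one_minus_tendsto:
  fixes x :: "nat \<Rightarrow> real" and N :: "nat \<Rightarrow> nat"
  assumes "x \<longlonglongrightarrow> 0" "(\<lambda>i. x i * real (N i)) \<longlonglongrightarrow> c"
  shows "(\<lambda>i. (1 - x i) ^ N i) \<longlonglongrightarrow> exp (- c)"
proof -
  have ev: "\<forall>\<^sub>F i in sequentially. \<bar>x i\<bar> \<le> 1 / 2"
  proof -
    have "\<forall>\<^sub>F i in sequentially. dist (x i) 0 < 1 / 2" using assms(1) by (rule tendstoD) simp
    then show ?thesis by eventually_elim (simp add: dist_real_def)
  qed
  have "(\<lambda>i. real (N i) * ln (1 - x i) + x i * real (N i)) \<longlonglongrightarrow> 0"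
  proof (rule Lim_null_comparison)
    show "\<forall>\<^sub>F i in sequentially. norm (real (N i) * ln (1 - x i) + x i * real (N i)) \<le> 2 * (\<bar>x i * real (N i)\<bar> * \<bar>x i\<bar>)"
      using ev
    proof eventually_elim
      case (elim i)
      have "\<bar>ln (1 + - x i) - (- x i)\<bar> \<le> 2 * (- x i)\<^sup>2"
        using elim by (intro abs_ln_one_plus_x_minus_x_bound) simp
      then have "real (N i) * \<bar>ln (1 - x i) + x i\<bar> \<le> real (N i) * (2 * (x i)\<^sup>2)"
        by (intro mult_left_mono) auto
      moreover have "real (N i) * \<bar>ln (1 - x i) + x i\<bar> = \<bar>real (N i) * ln (1 - x i) + x i * real (N i)\<bar>"
      proof -
        have "real (N i) * ln (1 - x i) + x i * real (N i) = real (N i) * (ln (1 - x i) + x i)"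
          by (simp add: algebra_simps)
        then show ?thesis by (simp only: abs_mult abs_of_nat)
      qed
      moreover have "2 * (\<bar>x i * real (N i)\<bar> * \<bar>x i\<bar>) = real (N i) * (2 * (x i)\<^sup>2)"
        by (simp add: abs_mult power2_eq_square)
      ultimately show ?case by (simp only: real_norm_def)
    qed
    show "(\<lambda>i. 2 * (\<bar>x i * real (N i)\<bar> * \<bar>x i\<bar>)) \<longlonglongrightarrow> 0"
      using tendsto_mult[OF tendsto_rabs[OF assms(2)] tendsto_rabs[OF assms(1)]]
      by (intro tendsto_mult_right_zero) simp
  qed
  from tendsto_diff[OF this assms(2)]
  have "(\<lambda>i. real (N i) * ln (1 - x i)) \<longlonglongrightarrow> - c" by simp
  then have "(\<lambda>i. exp (real (N i) * ln (1 - x i))) \<longlonglongrightarrow> exp (- c)" by (intro tendsto_intros)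
  then show ?thesis
  proof (rule Lim_transform_eventually)
    show "\<forall>\<^sub>F i in sequentially. exp (real (N i) * ln (1 - x i)) = (1 - x i) ^ N i"
      using ev by eventually_elim (auto simp: exp_of_nat_mult)
  qed
qed

context mchain
begin

lemma lam_tendsto:
  assumes "s \<longlonglongrightarrow> 0" "(\<lambda>i. (s i)\<^sup>2 * real (N i)) \<longlonglongrightarrow> \<kappa>"
  shows "(\<lambda>i. lam (s i) ^ N i) \<longlonglongrightarrow> exp (- sg2 * \<kappa> / 2)"
proof -
  have 1: "(\<lambda>i. sg2 * (s i)\<^sup>2 / 2) \<longlonglongrightarrow> 0"
    using assms(1) by (auto intro!: tendsto_eq_intros)
  have "(\<lambda>i. sg2 / 2 * ((s i)\<^sup>2 * real (N i))) \<longlonglongrightarrow> sg2 / 2 * \<kappa>" by (intro tendsto_intros assms)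
  then have 2: "(\<lambda>i. sg2 * (s i)\<^sup>2 / 2 * real (N i)) \<longlonglongrightarrow> sg2 * \<kappa> / 2" by (simp add: mult_ac)
  from power_one_minus_tendsto[OF 1 2] show ?thesis by simp
qed

lemma ev_small: assumes "s \<longlonglongrightarrow> 0" shows "\<forall>\<^sub>F i in sequentially. \<bar>s i\<bar> \<le> 1 / bd \<and> \<bar>s i\<bar> \<le> 1 \<and> 0 \<le> lam (s i)"
proof -
  have "\<forall>\<^sub>F i in sequentially. dist (s i) 0 < 1 / bd" using assms bd_ge_1 by (intro tendstoD) auto
  then show ?thesis
  proof eventually_elim
    case (elim i)
    moreover have "1 / bd \<le> 1" using bd_ge_1 by simp
    ultimately show ?case using lam_nonneg[of "s i"] by (simp add: dist_real_def)
  qed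
qed

text \<open>The central limit theorem for the twisted powers, jointly with the end state. The number
  p of mixing steps is fixed before i tends to infinity, so removing p steps changes neither the
  scaling nor the limit.\<close>

lemma M_tendsto:
  assumes s: "s \<longlonglongrightarrow> 0" and N: "filterlim N at_top sequentially" and sN: "(\<lambda>i. (s i)\<^sup>2 * real (N i)) \<longlonglongrightarrow> \<kappa>"
  shows "(\<lambda>i. M (s i) (N i) x w) \<longlonglongrightarrow> of_real (\<nu> w * exp (- sg2 * \<kappa> / 2))"
proof (rule tendstoI)
  fix e :: real assume e: "0 < e"
  have "\<forall>\<^sub>F p in sequentially. mixd p < e / 3" using mixd_tendsto e by (intro order_tendstoD) auto
  then obtain p where p: "mixd p < e / 3" by (auto dest: eventually_happens)
  have sp: "(\<lambda>i. (s i)\<^sup>2 * real (N i - p)) \<longlonglongrightarrow> \<kappa>"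
  proof (rule Lim_transform_eventually)
    have "(\<lambda>i. (s i)\<^sup>2 * real (N i) - (s i)\<^sup>2 * real p) \<longlonglongrightarrow> \<kappa> - 0\<^sup>2 * real p"
      by (intro tendsto_intros sN s)
    then show "(\<lambda>i. (s i)\<^sup>2 * real (N i) - (s i)\<^sup>2 * real p) \<longlonglongrightarrow> \<kappa>" by simp
    have "\<forall>\<^sub>F i in sequentially. p \<le> N i" using N unfolding filterlim_at_top by auto
    then show "\<forall>\<^sub>F i in sequentially. (s i)\<^sup>2 * real (N i) - (s i)\<^sup>2 * real p = (s i)\<^sup>2 * real (N i - p)"
      by eventually_elim (simp add: of_nat_diff right_diff_distrib)
  qed
  define E where "E i = p * bd * \<bar>s i\<bar> + real (N i - p) * cerr * \<bar>s i\<bar> ^ 3 + 4 * bd * \<bar>s i\<bar>" for i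
  have "(\<lambda>i. p * bd * \<bar>s i\<bar> + cerr * (((s i)\<^sup>2 * real (N i - p)) * \<bar>s i\<bar>) + 4 * bd * \<bar>s i\<bar>) \<longlonglongrightarrow>
     p * bd * \<bar>0\<bar> + cerr * (\<kappa> * \<bar>0\<bar>) + 4 * bd * \<bar>0\<bar>" by (intro tendsto_intros s sp)
  moreover have Eq: "E = (\<lambda>i. p * bd * \<bar>s i\<bar> + cerr * (((s i)\<^sup>2 * real (N i - p)) * \<bar>s i\<bar>) + 4 * bd * \<bar>s i\<bar>)"
  proof
    fix i
    have c: "\<bar>s i\<bar> ^ 3 = (s i)\<^sup>2 * \<bar>s i\<bar>" by (simp add: power3_eq_cube power2_eq_square abs_mult_self_eq)
    show "E i = p * bd * \<bar>s i\<bar> + cerr * (((s i)\<^sup>2 * real (N i - p)) * \<bar>s i\<bar>) + 4 * bd * \<bar>s i\<bar>"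
      unfolding E_def c by (simp only: mult_ac)
  qed
  ultimately have "E \<longlonglongrightarrow> 0" unfolding Eq by simp
  then have E: "\<forall>\<^sub>F i in sequentially. E i < e / 3" using e by (intro order_tendstoD) auto
  have "(\<lambda>i. \<nu> w * lam (s i) ^ (N i - p)) \<longlonglongrightarrow> \<nu> w * exp (- sg2 * \<kappa> / 2)"
    by (intro tendsto_intros lam_tendsto s sp)
  then have L: "\<forall>\<^sub>F i in sequentially. dist (\<nu> w * lam (s i) ^ (N i - p)) (\<nu> w * exp (- sg2 * \<kappa> / 2)) < e / 3"
    using e by (intro tendstoD) auto
  have "\<forall>\<^sub>F i in sequentially. p \<le> N i" using N unfolding filterlim_at_top by auto
  then show "\<forall>\<^sub>F i in sequentially. dist (M (s i) (N i) x w) (of_real (\<nu> w * exp (- sg2 * \<kappa> / 2))) < e"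
    using E L ev_small[OF s]
  proof eventually_elim
    case (elim i)
    have "cmod (M (s i) (N i - p + p) x w - of_real (\<nu> w * lam (s i) ^ (N i - p))) \<le> mixd p + E i"
      using M_near[of "s i" "N i - p" p x w] elim unfolding E_def by linarith
    then have "dist (M (s i) (N i) x w) (of_real (\<nu> w * lam (s i) ^ (N i - p))) \<le> mixd p + E i"
      using elim by (simp add: dist_norm)
    moreover have "dist (of_real (\<nu> w * lam (s i) ^ (N i - p)) :: complex) (of_real (\<nu> w * exp (- sg2 * \<kappa> / 2))) < e / 3"
      using elim by (simp only: dist_of_real)
    ultimately show ?case using p elim
      dist_triangle[of "M (s i) (N i) x w" "of_real (\<nu> w * exp (- sg2 * \<kappa> / 2))" "of_real (\<nu> w * lam (s i) ^ (N i - p))"]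
      by linarith
  qed
qed

lemma EU_martingale: "EU (Suc 0) (\<lambda>x z. z + r x) x y = y + r x"
proof -
  have "EU (Suc 0) (\<lambda>x z. z + r x) x y = (\<Sum>v\<in>UNIV. P x v * y + P x v * (f v + r v))"
    by (simp add: algebra_simps)
  also have "\<dots> = y + r x"
    unfolding sum.distrib r_eq[symmetric] sum_distrib_right[symmetric] P_sum by simp
  finally show ?thesis .
qed

text \<open>Optional stopping for z + r x. A step from a nonnegative height lands above
  -\<open>bd\<close>, so the martingale is at least -2 \<open>bd\<close> at exit and killing can
  raise its mean by at most that much.\<close>

lemma ED_first_moment:
  assumes "0 \<le> y"
  shows "ED n (\<lambda>_ z. z) x y \<le> y + 4 * bd"
proof -
  have "ED n (\<lambda>x z. z + r x) x y \<le> y + r x + 2 * bd * (1 - qn n x y)"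
  proof (induction n)
    case 0 then show ?case by (simp add: qn_0)
  next
    case (Suc n)
    have "ED (Suc n) (\<lambda>x z. z + r x) x y = ED n (\<lambda>x z. z + r x) x y - ED n (exit1 (\<lambda>x z. z + r x)) x y"
    proof -
      have "EU (Suc 0) (\<lambda>x z. z + r x) = (\<lambda>x y. y + r x)" by (intro ext) (rule EU_martingale)
      then show ?thesis unfolding ED_Suc_exit by (simp only:)
    qed
    moreover have "- (2 * bd) * ED n (exit1 (\<lambda>_ _. 1)) x y \<le> ED n (exit1 (\<lambda>x z. z + r x)) x y"
      unfolding EE_cmult[symmetric]
    proof (rule EE_mono)
      fix x' z assume "z \<in> {0<..} \<or> z = y"
      then have z: "0 \<le> z" using assms by auto
      have b: "- (2 * bd) \<le> z + f v + r v" for v using z bd_bounds[of v] by linarith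
      show "- (2 * bd) * exit1 (\<lambda>_ _. 1) x' z \<le> exit1 (\<lambda>x z. z + r x) x' z"
        unfolding exit1_def sum_distrib_left
      proof (rule sum_mono)
        fix v
        show "- (2 * bd) * (P x' v *\<^sub>R (if z + f v \<le> 0 then 1 else 0)) \<le> P x' v *\<^sub>R (if z + f v \<le> 0 then z + f v + r v else 0)"
          using mult_left_mono[OF b[of v] P_nonneg[of x' v]] by (simp add: mult_ac)
      qed
    qed
    moreover have "2 * bd * (1 - qn (Suc n) x y) = 2 * bd * (1 - qn n x y) - (- (2 * bd) * ED n (exit1 (\<lambda>_ _. 1)) x y)"
      unfolding qn_Suc by (simp add: algebra_simps)
    ultimately show ?case using Suc by linarith
  qed
  moreover have "ED n (\<lambda>x z. z + r x) x y = ED n (\<lambda>_ z. z) x y + ED n (\<lambda>x _. r x) x y" by (rule EE_add)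
  moreover have "- bd * qn n x y \<le> ED n (\<lambda>x _. r x) x y"
    unfolding qn_def EE_cmult[symmetric] using bd_bounds by (intro EE_mono) (simp, smt (verit))
  moreover have "bd * qn n x y \<le> bd * 1" using bd_ge_1 qn_le_1 by (intro mult_left_mono) auto
  moreover have "2 * bd * (1 - qn n x y) \<le> 2 * bd * 1" using bd_ge_1 qn_nonneg[of n x y] by (intro mult_left_mono) auto
  ultimately show ?thesis using bd_bounds(2)[of x] by simp
qed

end

context mwalk
begin

text \<open>Esseen's inequality: the indicator of the window is dominated by a multiple of a Fejer
  kernel, whose expectation is an integral of the characteristic function over a bounded frequency
  range; the Gaussian decay there gives n^(-1/2).\<close>

lemma concentration:
  "\<exists>C>0. \<forall>n\<ge>1. \<forall>L\<ge>1. \<forall>x y. EU n (\<lambda>_ z. indicator {-L..L} z :: real) x y \<le> C * L / sqrt n"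
proof -
  obtain C c where Cc: "0 < C" "0 < c" "\<And>s n x. \<bar>s\<bar> \<le> 1 \<Longrightarrow> rowsum s n x \<le> C * exp (- c * n * s\<^sup>2)"
    using decay[of 1] by auto
  obtain \<delta> where d: "0 < \<delta>" "\<delta> \<le> 1" "\<And>u. \<bar>u\<bar> \<le> \<delta> \<Longrightarrow> 1 / (4 * pi) \<le> fejer 1 u"
    using fejer_ge_near_0 by auto
  define K where "K = 2 * C * (sqrt (2 * pi) / sqrt (2 * c)) / \<delta>"
  have K: "0 < K" unfolding K_def using Cc d by auto
  have "EU n (\<lambda>_ z. indicator {-L..L} z :: real) x y \<le> K * L / sqrt n" if n: "1 \<le> n" and L: "1 \<le> L" for n L x y
  proof -
    \<comment> \<open>With this scale the window is exactly the region where the Fejer density is at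
      least half its maximum, and T stays at most 1, so one decay constant serves all L.\<close>
    define T where "T = \<delta> / L"
    have T: "0 < T" "T \<le> 1" unfolding T_def using d L by (auto simp: field_simps)
    have ind: "indicator {-L..L} z \<le> (4 * pi / T) * (1 / (2 * pi) * (\<integral>t. tent T t * cos (t * z) \<partial>lborel))" for z :: real
    proof -
      have eq: "(4 * pi / T) * (1 / (2 * pi) * (\<integral>t. tent T t * cos (t * z) \<partial>lborel)) = 4 * pi * fejer 1 (T * z)"
        unfolding has_bochner_integral_integral_eq[OF fejer_fourier[OF T(1), of z]] fejer_scale[OF T(1), of z]
        using T by simp
      show ?thesis
      proof (cases "\<bar>z\<bar> \<le> L")
        case True
        have "\<bar>T * z\<bar> \<le> T * L" unfolding abs_mult using T True by (intro mult_mono) auto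
        also have "\<dots> = \<delta>" unfolding T_def using L by simp
        finally have "4 * pi * (1 / (4 * pi)) \<le> 4 * pi * fejer 1 (T * z)" by (intro mult_left_mono d) auto
        then show ?thesis unfolding eq by (simp add: indicator_def)
      next
        case False
        then show ?thesis unfolding eq by (auto simp: indicator_def fejer_nonneg)
      qed
    qed
    have "EU n (\<lambda>_ z. indicator {-L..L} z :: real) x y \<le>
        EU n (\<lambda>_ z. (4 * pi / T) * (1 / (2 * pi) * (\<integral>t. tent T t * cos (t * z) \<partial>lborel))) x y"
      by (intro EE_mono ind)
    also have "\<dots> = (2 / T) * EU n (\<lambda>_ z. \<integral>t. tent T t * cos (t * z) \<partial>lborel) x y"
      unfolding EE_cmult by simp
    finally have main: "EU n (\<lambda>_ z. indicator {-L..L} z :: real) x y \<le>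
        (2 / T) * EU n (\<lambda>_ z. \<integral>t. tent T t * cos (t * z) \<partial>lborel) x y" .
    have "EU n (\<lambda>_ z. \<integral>t. tent T t * cos (t * z) \<partial>lborel) x y = (\<integral>t. EU n (\<lambda>_ z. tent T t * cos (t * z)) x y \<partial>lborel)"
      using fejer_fourier[OF T(1)] by (intro conjunct2[OF EE_integral]) (auto simp: has_bochner_integral_iff)
    also have "\<dots> \<le> (\<integral>t. C * exp (- (2 * c * n) * t\<^sup>2 / 2) \<partial>lborel)"
    proof (rule integral_mono)
      show "integrable lborel (\<lambda>t. EU n (\<lambda>_ z. tent T t * cos (t * z)) x y)"
        using fejer_fourier[OF T(1)] by (intro conjunct1[OF EE_integral]) (auto simp: has_bochner_integral_iff)
      show "integrable lborel (\<lambda>t. C * exp (- (2 * c * n) * t\<^sup>2 / 2))"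
        using Cc n by (intro integrable_mult_right gauss_integrable) auto
      fix t
      show "EU n (\<lambda>_ z. tent T t * cos (t * z)) x y \<le> C * exp (- (2 * c * n) * t\<^sup>2 / 2)"
      proof (cases "\<bar>t\<bar> \<le> 1")
        case True
        have "EU n (\<lambda>_ z. tent T t * cos (t * z)) x y = tent T t * EU n (\<lambda>_ z. cos (t * z)) x y" by (rule EE_cmult)
        also have "\<dots> \<le> 1 * (C * exp (- c * n * t\<^sup>2))"
        proof -
          have "tent T t * EU n (\<lambda>_ z. cos (t * z)) x y \<le> \<bar>tent T t\<bar> * \<bar>EU n (\<lambda>_ z. cos (t * z)) x y\<bar>"
            by (metis abs_ge_self abs_mult)
          also have "\<dots> \<le> 1 * (C * exp (- c * n * t\<^sup>2))"
            using tent_bounds[OF T(1), of t] by (intro mult_mono order.trans[OF EE_cos_le Cc(3)] True) auto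
          finally show ?thesis .
        qed
        finally show ?thesis by (simp add: mult.assoc)
      next
        case False
        then have "tent T t = 0" using T by (auto simp: tent_def indicator_def)
        then show ?thesis using Cc by simp
      qed
    qed
    also have "\<dots> = C * (sqrt (2 * pi) / sqrt (2 * c * n))"
    proof -
      have "0 < 2 * c * n" using Cc n by simp
      then show ?thesis unfolding integral_mult_right_zero by (simp only: gauss_integral)
    qed
    finally have "(2 / T) * EU n (\<lambda>_ z. \<integral>t. tent T t * cos (t * z) \<partial>lborel) x y
        \<le> (2 / T) * (C * (sqrt (2 * pi) / sqrt (2 * c * n)))"
      using T by (intro mult_left_mono) auto
    with main have "EU n (\<lambda>_ z. indicator {-L..L} z :: real) x y \<le> (2 / T) * (C * (sqrt (2 * pi) / sqrt (2 * c * n)))"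
      by linarith
    also have "\<dots> = K * L / sqrt n" unfolding K_def T_def using L d n by (simp add: real_sqrt_mult mult_ac)
    finally show ?thesis .
  qed
  then show ?thesis using K by auto
qed

end

section \<open>Survival probabilities\<close>

context nonneg_kernel
begin

text \<open>After at least one step the functional is evaluated only inside \<open>D\<close>, so the
  start drops out of the comparison.\<close>

lemma EE_mono_pos:
  fixes F G :: "'x \<Rightarrow> real \<Rightarrow> real"
  assumes "\<And>x' z. z \<in> D \<Longrightarrow> F x' z \<le> G x' z" "0 < n"
  shows "EE P f D n F x y \<le> EE P f D n G x y"
proof -
  obtain m where n: "n = Suc m" using assms(2) by (cases n) auto
  have "EE P f D m F v (y + f v) \<le> EE P f D m G v (y + f v)" if "y + f v \<in> D" for v
    by (rule EE_mono) (use that assms in auto)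
  then show ?thesis unfolding n EE.simps by (intro sum_mono) (auto intro!: mult_left_mono simp: P_nonneg)
qed

end

lemma sum_inverse_sqrt: "(\<Sum>n<N. 1 / sqrt (real (Suc n))) \<le> 2 * sqrt (real N)"
proof (induction N)
  case (Suc N)
  have "1 / sqrt (real (Suc N)) \<le> 2 * (sqrt (real (Suc N)) - sqrt (real N))"
  proof -
    define a b where "a = sqrt (real (Suc N))" and "b = sqrt (real N)"
    have ab: "0 < a" "0 \<le> b" "b \<le> a" "a * a - b * b = 1" by (auto simp: a_def b_def)
    have "1 = (a - b) * (a + b)" using ab(4) by (simp add: algebra_simps)
    also have "\<dots> \<le> (a - b) * (2 * a)" using ab by (intro mult_left_mono) auto
    finally have "1 / a \<le> 2 * (a - b)" using ab by (simp add: field_simps)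
    then show ?thesis by (simp add: a_def b_def)
  qed
  then show ?case using Suc by simp
qed simp

context mwalk
begin

abbreviation win :: "real \<Rightarrow> 'x \<Rightarrow> real \<Rightarrow> real" where "win L \<equiv> (\<lambda>_ z. indicator {0<..L} z)"

text \<open>The killing is kept for the first m steps and dropped for the last k, where the free
  concentration bound holds uniformly in the starting point.\<close>

lemma window_split:
  "\<exists>C>0. \<forall>m. \<forall>k\<ge>1. \<forall>L\<ge>1. \<forall>x y. ED (m + k) (win L) x y \<le> C * L / sqrt k * qn m x y"
proof -
  obtain C where C: "0 < C" "\<And>n L x y. 1 \<le> n \<Longrightarrow> 1 \<le> L \<Longrightarrow> EU n (\<lambda>_ z. indicator {-L..L} z :: real) x y \<le> C * L / sqrt n"
    using concentration by auto
  have "ED (m + k) (win L) x y \<le> C * L / sqrt k * qn m x y" if k: "1 \<le> k" and L: "1 \<le> L" for m k L x y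
  proof -
    have b: "ED k (win L) x' z \<le> C * L / sqrt k" for x' z
    proof -
      have "ED k (win L) x' z \<le> EU k (win L) x' z" by (rule EE_le_UNIV) simp
      also have "\<dots> \<le> EU k (\<lambda>_ z. indicator {-L..L} z) x' z"
        using L by (intro EE_mono) (auto split: split_indicator)
      also have "\<dots> \<le> C * L / sqrt k" by (rule C(2)[OF k L])
      finally show ?thesis .
    qed
    show ?thesis unfolding EE_add_time by (rule ED_le_qn) (rule b)
  qed
  then show ?thesis using C(1) by auto
qed

lemma half_bounds:
  fixes n :: nat
  assumes "2 \<le> n"
  shows "1 \<le> n div 2" "1 \<le> n - n div 2" "sqrt (real n) / 2 \<le> sqrt (real (n div 2))"
    "sqrt (real n) / sqrt 2 \<le> sqrt (real (n - n div 2))"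
    "n div 2 + (n - n div 2) = n"
proof -
  show "1 \<le> n div 2" "1 \<le> n - n div 2" "n div 2 + (n - n div 2) = n" using assms by auto
  have "n \<le> 4 * (n div 2)" using assms by linarith
  then have "real n / 4 \<le> real (n div 2)" by linarith
  then have "sqrt (real n / 4) \<le> sqrt (real (n div 2))" by (rule real_sqrt_le_mono)
  then show "sqrt (real n) / 2 \<le> sqrt (real (n div 2))" by (simp add: real_sqrt_divide)
  have "n \<le> 2 * (n - n div 2)" by linarith
  then have "real n / 2 \<le> real (n - n div 2)" by linarith
  then have "sqrt (real n / 2) \<le> sqrt (real (n - n div 2))" by (rule real_sqrt_le_mono)
  then show "sqrt (real n) / sqrt 2 \<le> sqrt (real (n - n div 2))" by (simp add: real_sqrt_divide)
qed

text \<open>Survivors either end below \<epsilon> sqrt n, which concentration over the second half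
  bounds by 1/4 of the survival probability at n div 2, or lie above, which the first moment bounds
  by a multiple of 1 / sqrt n. Induction by halving n absorbs the first term.\<close>

lemma qn_bound: "\<exists>K>0. \<forall>n\<ge>1. \<forall>x y. qn n x y \<le> K * (1 + max y 0) / sqrt n"
proof -
  obtain C where C: "0 < C" "\<And>m k L x y. 1 \<le> k \<Longrightarrow> 1 \<le> L \<Longrightarrow> ED (m + k) (win L) x y \<le> C * L / sqrt k * qn m x y"
    using window_split by auto
  \<comment> \<open>Makes C L / sqrt k at most sqrt 2 / 6, which is below 1/4; doubling in the
    passage from sqrt n to sqrt m still leaves a factor 1/2.\<close>
  define \<epsilon> where "\<epsilon> = 1 / (6 * C)"
  have e: "0 < \<epsilon>" unfolding \<epsilon>_def using C by simp
  \<comment> \<open>Beyond n0 the window length \<epsilon> sqrt n is at least 1, as concentration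
    requires; smaller n are covered by the additive term sqrt n0.\<close>
  define n0 where "n0 = nat \<lceil>1 / \<epsilon>\<^sup>2\<rceil> + 2"
  define K where "K = 8 * bd / \<epsilon> + sqrt n0"
  have K: "0 < K" unfolding K_def using bd_ge_1 e by (intro add_pos_nonneg divide_pos_pos) auto
  have main: "sqrt n * qn n x y \<le> 2 * ((y + 4 * bd) / \<epsilon>) + sqrt n0" if y: "0 \<le> y" and "1 \<le> n" for n x y
    using that(2)
  proof (induction n rule: less_induct)
    case (less n)
    define A where "A = (y + 4 * bd) / \<epsilon>"
    have A: "0 \<le> A" unfolding A_def using y bd_ge_1 e by auto
    show ?case
    proof (cases "n < n0")
      case True
      have "sqrt n * qn n x y \<le> sqrt n0 * 1" using True by (intro mult_mono qn_le_1 qn_nonneg) auto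
      then show ?thesis using A unfolding A_def[symmetric] by linarith
    next
      case False
      then have n2: "2 \<le> n" unfolding n0_def by simp
      define m k where "m = n div 2" and "k = n - n div 2"
      note h = half_bounds[OF n2, folded m_def k_def]
      define L where "L = \<epsilon> * sqrt n"
      have "1 / \<epsilon>\<^sup>2 \<le> real (nat \<lceil>1 / \<epsilon>\<^sup>2\<rceil>)" by (rule real_nat_ceiling_ge)
      also have "\<dots> \<le> n" using False unfolding n0_def by simp
      finally have "sqrt (1 / \<epsilon>\<^sup>2) \<le> sqrt n" by (rule real_sqrt_le_mono)
      then have L1: "1 \<le> L" unfolding L_def using e by (simp add: real_sqrt_divide field_simps)
      \<comment> \<open>Markov's inequality on the event of survival: above the window, 1 is at most
        z / L.\<close>
      have "qn n x y \<le> ED n (\<lambda>x z. win L x z + (1 / L) * z) x y"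
        unfolding qn_def using L1 n2
        by (intro EE_mono_pos) (auto split: split_indicator simp: field_simps)
      also have "\<dots> = ED n (win L) x y + (1 / L) * ED n (\<lambda>_ z. z) x y" by (simp only: EE_add EE_cmult)
      also have "\<dots> \<le> C * L / sqrt k * qn m x y + (1 / L) * (y + 4 * bd)"
        using C(2)[OF h(2) L1, of m x y] h(5) L1 y by (intro add_mono mult_left_mono ED_first_moment) auto
      also have "C * L / sqrt k * qn m x y \<le> 1 / 4 * qn m x y"
      proof (rule mult_right_mono[OF _ qn_nonneg])
        have "C * L / sqrt k \<le> C * L / (sqrt n / sqrt 2)"
          using h(2,4) C(1) L1 n2 by (intro divide_left_mono mult_pos_pos) auto
        also have "\<dots> = sqrt 2 / 6" unfolding L_def \<epsilon>_def using C n2 by (simp add: field_simps)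
        also have "\<dots> \<le> 1 / 4"
        proof -
          have "sqrt 2 \<le> sqrt ((3 / 2)\<^sup>2)" by (intro real_sqrt_le_mono) (simp add: power2_eq_square)
          then show ?thesis by simp
        qed
        finally show "C * L / sqrt k \<le> 1 / 4" .
      qed
      finally have i0: "qn n x y \<le> 1 / 4 * qn m x y + (1 / L) * (y + 4 * bd)" by simp
      have "sqrt n * qn n x y \<le> sqrt n * (1 / 4 * qn m x y + (1 / L) * (y + 4 * bd))"
        using i0 by (intro mult_left_mono) auto
      moreover have "sqrt n * (1 / 4 * qn m x y + (1 / L) * (y + 4 * bd)) = (1 / 4) * (sqrt n * qn m x y) + A"
        unfolding A_def L_def using n2 e by (simp add: field_simps)
      moreover have "sqrt n * qn m x y \<le> 2 * (sqrt m * qn m x y)"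
        using h(3) mult_right_mono[OF _ qn_nonneg[of m x y], of "sqrt n" "2 * sqrt m"] by simp
      moreover have "sqrt m * qn m x y \<le> 2 * A + sqrt n0"
        unfolding A_def using n2 h by (intro less.IH) (auto simp: m_def)
      moreover have "0 \<le> sqrt (real n0)" by simp
      ultimately show ?thesis unfolding A_def[symmetric] using A by argo
    qed
  qed
  have "qn n x y \<le> K * (1 + max y 0) / sqrt n" if n: "1 \<le> n" for n x y
  proof -
    define y' where "y' = max y 0"
    have y': "0 \<le> y'" by (simp add: y'_def)
    have "qn n x y \<le> qn n x y'" by (rule qn_mono) (simp add: y'_def)
    moreover have "sqrt n * qn n x y' \<le> K * (1 + y')"
    proof -
      have "2 * ((y' + 4 * bd) / \<epsilon>) \<le> 8 * bd / \<epsilon> * (1 + y')"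
      proof -
        have "1 * y' \<le> bd * y'" using bd_ge_1 y' by (intro mult_right_mono) auto
        then have "2 * (y' + 4 * bd) \<le> 8 * bd * (1 + y')" using y' by (simp add: algebra_simps)
        then have "2 * (y' + 4 * bd) / \<epsilon> \<le> 8 * bd * (1 + y') / \<epsilon>" using e by (intro divide_right_mono) auto
        then show ?thesis by simp
      qed
      moreover have "sqrt n0 * 1 \<le> sqrt n0 * (1 + y')" using y' by (intro mult_left_mono) auto
      ultimately show ?thesis using main[OF y' n, of x] unfolding K_def by (simp add: distrib_right)
    qed
    ultimately have "sqrt n * qn n x y \<le> K * (1 + y')" using n by (meson mult_left_mono order.trans real_sqrt_ge_zero of_nat_0_le_iff)
    then show ?thesis using n unfolding y'_def by (simp add: field_simps)
  qed
  then show ?thesis using K by auto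
qed

text \<open>Survival over the first half and concentration over the second half each contribute one
  factor n^(-1/2).\<close>

lemma window_bound: "\<exists>K>0. \<forall>n\<ge>2. \<forall>L\<ge>1. \<forall>x y. ED n (win L) x y \<le> K * (1 + max y 0) * L / n"
proof -
  obtain C where C: "0 < C" "\<And>m k L x y. 1 \<le> k \<Longrightarrow> 1 \<le> L \<Longrightarrow> ED (m + k) (win L) x y \<le> C * L / sqrt k * qn m x y"
    using window_split by auto
  obtain K where K: "0 < K" "\<And>n x y. 1 \<le> n \<Longrightarrow> qn n x y \<le> K * (1 + max y 0) / sqrt n"
    using qn_bound by auto
  have "ED n (win L) x y \<le> (4 * C * K) * (1 + max y 0) * L / n" if n: "2 \<le> n" and L: "1 \<le> L" for n L x y
  proof -
    define m k where "m = n div 2" and "k = n - n div 2"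
    note h = half_bounds[OF n, folded m_def k_def]
    have sn: "0 < sqrt n" using n by simp
    have k2: "sqrt n / 2 \<le> sqrt k"
    proof -
      have "sqrt n / 2 \<le> sqrt n / sqrt 2" by (intro divide_left_mono) (auto simp: real_le_lsqrt)
      then show ?thesis using h(4) by linarith
    qed
    have "ED n (win L) x y \<le> C * L / sqrt k * qn m x y" using C(2)[OF h(2) L, of m x y] h(5) by simp
    also have "\<dots> \<le> C * L / (sqrt n / 2) * (K * (1 + max y 0) / (sqrt n / 2))"
    proof (rule mult_mono)
      show "C * L / sqrt k \<le> C * L / (sqrt n / 2)" using k2 C L sn h by (intro divide_left_mono mult_pos_pos) auto
      have "qn m x y \<le> K * (1 + max y 0) / sqrt m" by (rule K(2)[OF h(1)])
      also have "\<dots> \<le> K * (1 + max y 0) / (sqrt n / 2)"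
        using h(1,3) K sn by (intro divide_left_mono mult_pos_pos mult_nonneg_nonneg) auto
      finally show "qn m x y \<le> K * (1 + max y 0) / (sqrt n / 2)" .
    qed (use C L sn qn_nonneg in auto)
    also have "\<dots> = (4 * C * K) * (1 + max y 0) * L / (sqrt n * sqrt n)" by (simp add: field_simps)
    finally show ?thesis by simp
  qed
  then show ?thesis using C K by (intro exI[of _ "4 * C * K"]) auto
qed

lemma qn_tendsto_0: "(\<lambda>n. qn n x y) \<longlonglongrightarrow> 0"
proof -
  obtain K where K: "0 < K" "\<And>n x y. 1 \<le> n \<Longrightarrow> qn n x y \<le> K * (1 + max y 0) / sqrt n"
    using qn_bound by auto
  show ?thesis
  proof (rule Lim_null_comparison)
    show "(\<lambda>n. K * (1 + max y 0) / sqrt n) \<longlonglongrightarrow> 0"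
      by (intro tendsto_divide_0[OF tendsto_const] filterlim_at_top_imp_at_infinity
          filterlim_compose[OF sqrt_at_top filterlim_real_sequentially])
    show "\<forall>\<^sub>F n in sequentially. norm (qn n x y) \<le> K * (1 + max y 0) / sqrt n"
      using eventually_ge_at_top[of 1] by eventually_elim (simp add: qn_nonneg K(2))
  qed
qed

text \<open>Index n refers to exit at time n + 1: n surviving steps followed by one step that
  leaves. \<open>exP\<close> below is the corresponding exit probability.\<close>

definition exM :: "'x \<Rightarrow> real \<Rightarrow> nat \<Rightarrow> real" where
  "exM x y n = ED n (exit1 (\<lambda>x z. z + r x)) x y"

text \<open>The harmonic function, written as starting value minus expected exit value of the martingale \<open>z + r x\<close>; it is identified with the paper's \<open>V\<close> only through the survival asymptotics.\<close>

definition V0 :: "'x \<Rightarrow> real \<Rightarrow> real" where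
  "V0 x y = y + r x - (\<Sum>n. exM x y n)"

definition exP :: "'x \<Rightarrow> real \<Rightarrow> nat \<Rightarrow> real" where
  "exP x y n = ED n (exit1 (\<lambda>_ _. 1)) x y"

lemma exP_eq: "exP x y n = qn n x y - qn (Suc n) x y"
  unfolding exP_def qn_Suc by simp

lemma exP_nonneg: "0 \<le> exP x y n"
  unfolding exP_eq using qn_antimono[of n "Suc n" x y] by simp

lemma exP_sums: "exP x y sums 1"
  using telescope_sums'[OF qn_tendsto_0[of x y]] by (simp add: exP_eq[abs_def] qn_0)

lemma exP_sum_le: "(\<Sum>n<N. exP x y n) \<le> 1"
  using sum_le_suminf[OF sums_summable[OF exP_sums[of x y]], of "{..<N}"] exP_nonneg sums_unique[OF exP_sums[of x y]] by auto

text \<open>Exit from a positive height overshoots by at most \<open>bd\<close>; exit at the first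
  step starts at y itself, which may be negative. Both cases stay within |y| + \<open>bd\<close>, so
  only values of F there matter.\<close>

lemma ED_exit1_bound:
  assumes "\<And>x' z. \<bar>z\<bar> \<le> \<bar>y\<bar> + bd \<Longrightarrow> norm (F x' z) \<le> B"
  shows "norm (ED n (exit1 F) x y) \<le> B * exP x y n"
  unfolding exP_def EE_cmult[symmetric]
proof (rule EE_norm_le)
  fix x' z assume z: "z \<in> {0<..} \<or> z = y"
  have "norm (exit1 F x' z) \<le> (\<Sum>v\<in>UNIV. P x' v * (if z + f v \<le> 0 then B else 0))"
    unfolding exit1_def
  proof (rule sum_norm_le)
    fix v
    have "\<bar>z + f v\<bar> \<le> \<bar>y\<bar> + bd" if "z + f v \<le> 0" using z that bd_bounds(1)[of v] by auto
    then show "norm (P x' v *\<^sub>R (if z + f v \<le> 0 then F v (z + f v) else 0)) \<le> P x' v * (if z + f v \<le> 0 then B else 0)"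
      using assms by (auto simp: P_nonneg intro!: mult_left_mono)
  qed
  also have "\<dots> = B * exit1 (\<lambda>_ _. 1) x' z"
    unfolding exit1_def sum_distrib_left by (intro sum.cong) auto
  finally show "norm (exit1 F x' z) \<le> B * exit1 (\<lambda>_ _. 1) x' z" .
qed

lemma exM_bound: "\<bar>exM x y n\<bar> \<le> (\<bar>y\<bar> + 2 * bd) * exP x y n"
proof -
  have "norm (exM x y n) \<le> (\<bar>y\<bar> + 2 * bd) * exP x y n" unfolding exM_def
  proof (rule ED_exit1_bound)
    fix x' z assume "\<bar>z\<bar> \<le> \<bar>y\<bar> + bd"
    then show "norm (z + r x') \<le> \<bar>y\<bar> + 2 * bd" using bd_bounds(2)[of x'] by simp
  qed
  then show ?thesis by simp
qed

lemma exM_summable: "summable (exM x y)"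
  using exM_bound by (intro summable_comparison_test'[OF summable_mult[OF sums_summable[OF exP_sums[of x y]], of "\<bar>y\<bar> + 2 * bd"], of 0]) auto

text \<open>On bounded heights the approximate eigenfunction linearises to 1 + i s (z + r x): the
  martingale behind \<open>V0\<close> is its first-order term at s = 0.\<close>

lemma ev_expand:
  assumes s: "\<bar>s\<bar> \<le> 1" and z: "\<bar>z\<bar> \<le> A"
  shows "cmod (cis (s * z) * ev s x - (1 + \<i> * of_real (s * (z + r x)))) \<le> (2 * bd * A\<^sup>2 + 2 * bd * A + bd) * s\<^sup>2"
proof -
  define R where "R = cis (s * z) - (1 + \<i> * of_real (s * z))"
  have A: "0 \<le> A" using z by linarith
  have zA: "z\<^sup>2 \<le> A\<^sup>2" using z A by (simp add: abs_le_square_iff[symmetric])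
  have R: "cmod R \<le> (s * z)\<^sup>2 / 2"
    using iexp_approx1[of "s * z" 1] by (simp add: R_def cis_conv_exp power2_eq_square)
  have "cis (s * z) * ev s x - (1 + \<i> * of_real (s * (z + r x))) =
     R * ev s x + \<i> * of_real (s * z) * (ev s x - 1) + (- of_real (s\<^sup>2 * q x))"
    unfolding R_def by (simp add: ev_def algebra_simps)
  then have "cmod (cis (s * z) * ev s x - (1 + \<i> * of_real (s * (z + r x)))) \<le>
     cmod (R * ev s x) + cmod (\<i> * of_real (s * z) * (ev s x - 1)) + cmod (- complex_of_real (s\<^sup>2 * q x))"
    by (simp only:) (rule order.trans[OF norm_triangle_ineq add_right_mono[OF norm_triangle_ineq]])
  also have "\<dots> = cmod R * cmod (ev s x) + \<bar>s * z\<bar> * cmod (ev s x - 1) + \<bar>s\<^sup>2 * q x\<bar>"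
    by (simp only: norm_mult norm_ii norm_of_real norm_minus_cancel mult_1)
  also have "\<dots> \<le> ((s\<^sup>2 * A\<^sup>2) / 2) * (3 * bd) + (\<bar>s\<bar> * A) * (2 * bd * \<bar>s\<bar>) + s\<^sup>2 * bd"
  proof (intro add_mono mult_mono)
    show "cmod R \<le> s\<^sup>2 * A\<^sup>2 / 2" using R zA mult_left_mono[OF zA, of "s\<^sup>2"] by (simp add: power_mult_distrib)
    show "\<bar>s * z\<bar> \<le> \<bar>s\<bar> * A" unfolding abs_mult using z by (intro mult_left_mono) auto
    show "\<bar>s\<^sup>2 * q x\<bar> \<le> s\<^sup>2 * bd" unfolding abs_mult using bd_bounds(3)[of x] by (simp add: mult_left_mono)
  qed (use A bd_ge_1 ev_le[OF s] ev_near_1[OF s] in auto)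
  also have "\<dots> = (3 / 2 * (bd * A\<^sup>2) + 2 * bd * A + bd) * s\<^sup>2"
    by (simp add: algebra_simps power2_eq_square abs_mult_self_eq)
  also have "\<dots> \<le> (2 * bd * A\<^sup>2 + 2 * bd * A + bd) * s\<^sup>2"
    using bd_ge_1 by (intro mult_right_mono) auto
  finally show ?thesis .
qed

text \<open>The function cis (s z) \<open>ev s x\<close> is almost an eigenfunction of the free
  step, so its killed expectation obeys a linear recursion with exit terms. Solving it and taking
  imaginary parts leaves three errors: \<open>ev\<close> replaced by 1 at the end, the linearisation
  at the start and at exit, and the accumulated eigenvector defect weighted by survival.\<close>

lemma sine_estimate:
  fixes s y :: real
  assumes s: "\<bar>s\<bar> \<le> 1" and l: "0 \<le> lam s"
  defines "D \<equiv> 2 * bd * (\<bar>y\<bar> + bd)\<^sup>2 + 2 * bd * (\<bar>y\<bar> + bd) + bd"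
  shows "\<bar>ED N (\<lambda>_ z. sin (s * z)) x y - s * (lam s ^ N * (y + r x) - (\<Sum>n<N. lam s ^ (N - 1 - n) * exM x y n))\<bar>
     \<le> 2 * bd * \<bar>s\<bar> * qn N x y + 2 * D * s\<^sup>2 + cerr * \<bar>s\<bar> ^ 3 * (\<Sum>n<N. qn n x y)"
proof -
  have l1: "lam s \<le> 1" using sg2_nonneg by simp
  define Z where "Z = (\<lambda>x z. cis (s * z) * ev s x)"
  define a where "a n = ED n Z x y" for n
  define b where "b n = ED n (exit1 Z) x y" for n
  \<comment> \<open>Defect of the eigenvector equation at step n; by \<open>tilt_ev\<close> it is
    cubic in s, and only surviving trajectories contribute.\<close>
  define e where "e n = ED n (\<lambda>x z. EU (Suc 0) Z x z - lam s *\<^sub>R Z x z) x y" for n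
  have D: "0 \<le> D" unfolding D_def using bd_ge_1 by (intro add_nonneg_nonneg mult_nonneg_nonneg) auto
  have e: "cmod (e n) \<le> cerr * \<bar>s\<bar> ^ 3 * qn n x y" for n
    unfolding e_def qn_def EE_cmult[symmetric]
  proof (rule EE_norm_le)
    fix x' z
    have "EU (Suc 0) Z x' z = cis (s * z) * (\<Sum>v\<in>UNIV. tilt P f s x' v * ev s v)"
      unfolding Z_def EE_cis mpow_1 ..
    then have eq: "EU (Suc 0) Z x' z - lam s *\<^sub>R Z x' z = cis (s * z) * ((\<Sum>v\<in>UNIV. tilt P f s x' v * ev s v) - of_real (lam s) * ev s x')"
      by (simp only: Z_def scaleR_conv_of_real right_diff_distrib mult.left_commute)
    show "cmod (EU (Suc 0) Z x' z - lam s *\<^sub>R Z x' z) \<le> cerr * \<bar>s\<bar> ^ 3 * 1"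
      unfolding eq norm_mult using tilt_ev[OF s, of x'] by simp
  qed
  have step: "a (Suc n) = lam s *\<^sub>R a n + e n - b n" for n
    unfolding a_def b_def e_def ED_Suc_exit EE_diff EE_scaleR by (simp del: EE.simps)
  \<comment> \<open>Variation of constants for the recursion in \<open>step\<close>.\<close>
  have a_eq: "a N = lam s ^ N *\<^sub>R a 0 - (\<Sum>n<N. lam s ^ (N - 1 - n) *\<^sub>R (b n - e n))" for N
  proof (induction N)
    case (Suc N)
    have "(\<Sum>n<N. lam s ^ (N - n) *\<^sub>R (b n - e n)) = lam s *\<^sub>R (\<Sum>n<N. lam s ^ (N - 1 - n) *\<^sub>R (b n - e n))"
      unfolding scaleR_sum_right scaleR_scaleR
    proof (intro sum.cong refl)
      fix n assume "n \<in> {..<N}"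
      then have "N - n = Suc (N - 1 - n)" by auto
      then show "lam s ^ (N - n) *\<^sub>R (b n - e n) = (lam s * lam s ^ (N - 1 - n)) *\<^sub>R (b n - e n)" by simp
    qed
    then show ?case unfolding step Suc by (simp add: scaleR_diff_right)
  qed simp
  define \<beta> where "\<beta> n = exM x y n" for n
  have Zn: "cmod (cis (s * z) * ev s x' - (1 + \<i> * of_real (s * (z + r x')))) \<le> D * s\<^sup>2" if "\<bar>z\<bar> \<le> \<bar>y\<bar> + bd" for x' z
    unfolding D_def by (rule ev_expand[OF s that])
  have Imz: "\<bar>Im (Z x' z) - s * (z + r x')\<bar> \<le> D * s\<^sup>2" if "\<bar>z\<bar> \<le> \<bar>y\<bar> + bd" for x' z
  proof -
    have "Im (Z x' z - (1 + \<i> * of_real (s * (z + r x')))) = Im (Z x' z) - s * (z + r x')" by simp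
    then show ?thesis using abs_Im_le_cmod[of "Z x' z - (1 + \<i> * of_real (s * (z + r x')))"] Zn[OF that, of x']
      unfolding Z_def by linarith
  qed
  have b: "\<bar>Im (b n) - s * \<beta> n\<bar> \<le> D * s\<^sup>2 * exP x y n" for n
  proof -
    have "Im (b n) - s * \<beta> n = ED n (exit1 (\<lambda>x z. Im (Z x z) - s * (z + r x))) x y"
    proof -
      have "exit1 (\<lambda>x z. Im (Z x z) - s * (z + r x)) = (\<lambda>x' z. Im (exit1 Z x' z) - s * exit1 (\<lambda>x z. z + r x) x' z)"
        by (intro ext, unfold exit1_def Im_sum sum_distrib_left sum_subtractf[symmetric]) (intro sum.cong, auto simp: algebra_simps)
      then show ?thesis unfolding b_def \<beta>_def exM_def
        by (simp only: EE_linear[OF bounded_linear_Im] EE_cmult[symmetric] EE_diff[symmetric])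
    qed
    also have "norm \<dots> \<le> D * s\<^sup>2 * exP x y n"
      by (rule ED_exit1_bound) (use Imz in auto)
    finally show ?thesis by simp
  qed
  have lp: "\<bar>lam s ^ n\<bar> \<le> 1" for n using l l1 by (simp add: power_abs power_le_one)
  have "Im (a N) = lam s ^ N * Im (Z x y) - (\<Sum>n<N. lam s ^ (N - 1 - n) * (Im (b n) - Im (e n)))"
    unfolding a_eq[of N] by (simp add: a_def Im_sum)
  then have eq: "Im (a N) - s * (lam s ^ N * (y + r x) - (\<Sum>n<N. lam s ^ (N - 1 - n) * \<beta> n)) =
     lam s ^ N * (Im (Z x y) - s * (y + r x)) - (\<Sum>n<N. lam s ^ (N - 1 - n) * ((Im (b n) - s * \<beta> n) - Im (e n)))"
    by (simp add: algebra_simps sum_subtractf sum.distrib sum_distrib_left)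
  have 1: "\<bar>lam s ^ N * (Im (Z x y) - s * (y + r x))\<bar> \<le> 1 * (D * s\<^sup>2)"
    unfolding abs_mult[of "lam s ^ N"] using bd_ge_1 by (intro mult_mono lp Imz) auto
  have "\<bar>\<Sum>n<N. lam s ^ (N - 1 - n) * ((Im (b n) - s * \<beta> n) - Im (e n))\<bar> \<le>
      (\<Sum>n<N. 1 * (D * s\<^sup>2 * exP x y n + cerr * \<bar>s\<bar> ^ 3 * qn n x y))"
  proof (rule order.trans[OF sum_abs], rule sum_mono)
    fix n
    have "\<bar>(Im (b n) - s * \<beta> n) - Im (e n)\<bar> \<le> D * s\<^sup>2 * exP x y n + cerr * \<bar>s\<bar> ^ 3 * qn n x y"
      using b[of n] e[of n] abs_Im_le_cmod[of "e n"] by linarith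
    then show "\<bar>lam s ^ (N - 1 - n) * ((Im (b n) - s * \<beta> n) - Im (e n))\<bar> \<le> 1 * (D * s\<^sup>2 * exP x y n + cerr * \<bar>s\<bar> ^ 3 * qn n x y)"
      unfolding abs_mult[of "lam s ^ _"] by (intro mult_mono lp) auto
  qed
  also have "\<dots> = D * s\<^sup>2 * (\<Sum>n<N. exP x y n) + cerr * \<bar>s\<bar> ^ 3 * (\<Sum>n<N. qn n x y)"
    by (simp add: sum.distrib sum_distrib_left)
  also have "\<dots> \<le> D * s\<^sup>2 * 1 + cerr * \<bar>s\<bar> ^ 3 * (\<Sum>n<N. qn n x y)"
    using D by (intro add_right_mono mult_left_mono exP_sum_le) auto
  finally have 2: "\<bar>\<Sum>n<N. lam s ^ (N - 1 - n) * ((Im (b n) - s * \<beta> n) - Im (e n))\<bar> \<le>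
     D * s\<^sup>2 + cerr * \<bar>s\<bar> ^ 3 * (\<Sum>n<N. qn n x y)" by simp
  have 3: "\<bar>ED N (\<lambda>_ z. sin (s * z)) x y - Im (a N)\<bar> \<le> 2 * bd * \<bar>s\<bar> * qn N x y"
  proof -
    have "ED N (\<lambda>_ z. sin (s * z)) x y - Im (a N) = ED N (\<lambda>x z. sin (s * z) - Im (Z x z)) x y"
      unfolding a_def EE_linear[OF bounded_linear_Im] EE_diff ..
    also have "norm \<dots> \<le> ED N (\<lambda>_ _. 2 * bd * \<bar>s\<bar> * 1) x y"
    proof (rule EE_norm_le)
      fix x' z
      have "sin (s * z) - Im (Z x' z) = - Im (cis (s * z) * (ev s x' - 1))"
        unfolding Z_def by (simp add: algebra_simps)
      then have "\<bar>sin (s * z) - Im (Z x' z)\<bar> \<le> cmod (cis (s * z) * (ev s x' - 1))"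
        using abs_Im_le_cmod[of "cis (s * z) * (ev s x' - 1)"] by linarith
      also have "\<dots> \<le> 2 * bd * \<bar>s\<bar>" unfolding norm_mult using ev_near_1[OF s, of x'] by simp
      finally show "norm (sin (s * z) - Im (Z x' z)) \<le> 2 * bd * \<bar>s\<bar> * 1" by simp
    qed
    finally show ?thesis unfolding EE_cmult qn_def by simp
  qed
  show ?thesis using 1 2 3 eq unfolding \<beta>_def by linarith
qed

end

section \<open>Asymptotics of sine functionals and of the survival probability\<close>

text \<open>Interchange of two limits: \<open>T\<close> is fixed first, and the error is then
  uniform over all large n.\<close>

lemma tendsto_by_approx:
  fixes x :: "nat \<Rightarrow> real" and a :: "nat \<Rightarrow> nat \<Rightarrow> real"
  assumes a: "\<And>T. 1 \<le> T \<Longrightarrow> (\<lambda>n. a T n) \<longlonglongrightarrow> L T" and L: "L \<longlonglongrightarrow> L0" and err: "err \<longlonglongrightarrow> 0"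
    and le: "\<And>T. 1 \<le> T \<Longrightarrow> \<forall>\<^sub>F n in sequentially. \<bar>x n - a T n\<bar> \<le> err T"
  shows "x \<longlonglongrightarrow> L0"
proof (rule tendstoI)
  fix e :: real assume e: "0 < e"
  have "\<forall>\<^sub>F T in sequentially. dist (L T) L0 < e / 3" by (rule tendstoD[OF L]) (use e in simp)
  moreover have "\<forall>\<^sub>F T in sequentially. err T < e / 3" by (rule order_tendstoD[OF err]) (use e in simp)
  ultimately have "\<forall>\<^sub>F T in sequentially. dist (L T) L0 < e / 3 \<and> err T < e / 3" by (rule eventually_conj)
  with eventually_ge_at_top[of "1::nat"] have "\<forall>\<^sub>F T in sequentially. 1 \<le> T \<and> dist (L T) L0 < e / 3 \<and> err T < e / 3"
    by eventually_elim auto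
  then obtain T where T: "1 \<le> T" "dist (L T) L0 < e / 3" "err T < e / 3" by (auto dest: eventually_happens)
  have "\<forall>\<^sub>F n in sequentially. dist (a T n) (L T) < e / 3" using e by (intro tendstoD[OF a[OF T(1)]]) auto
  with le[OF T(1)] show "\<forall>\<^sub>F n in sequentially. dist (x n) L0 < e"
  proof eventually_elim
    case (elim n)
    then show ?case using T unfolding dist_real_def by linarith
  qed
qed

lemma EE_measurable_param:
  fixes H :: "'t \<Rightarrow> 'x::finite \<Rightarrow> real \<Rightarrow> real"
  assumes "\<And>x z. (\<lambda>t. H t x z) \<in> borel_measurable M"
  shows "(\<lambda>t. EE P f D n (H t) x y) \<in> borel_measurable M"
proof (induction n arbitrary: x y)
  case 0 then show ?case using assms by simp
next
  case (Suc n)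
  have "(\<lambda>t. if y + f v \<in> D then EE P f D n (H t) v (y + f v) else 0) \<in> borel_measurable M" for v
    by (cases "y + f v \<in> D") (simp_all add: Suc)
  then show ?case unfolding EE.simps by (intro borel_measurable_sum borel_measurable_scaleR borel_measurable_const)
qed

lemma fejer_sine_all:
  assumes T: "0 < T"
  shows "has_bochner_integral lborel (\<lambda>t. tent T t * (sin (t * b) / t)) (pi * fejer_cdf (T * b))"
proof -
  consider "0 < b" | "b = 0" | "b < 0" by linarith
  then show ?thesis
  proof cases
    case 1 then show ?thesis by (rule fejer_sine[OF T])
  next
    case 2 then show ?thesis by (simp add: fejer_cdf_0 has_bochner_integral_zero)
  next
    case 3
    have "has_bochner_integral lborel (\<lambda>t. - (tent T t * (sin (t * (- b)) / t))) (- (pi * fejer_cdf (T * (- b))))"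
      using 3 by (intro has_bochner_integral_minus fejer_sine[OF T]) simp
    then show ?thesis by (simp add: fejer_cdf_minus)
  qed
qed

context mwalk
begin

lemma scaled_shift_tendsto:
  assumes s: "s \<longlonglongrightarrow> 0" and N: "filterlim N at_top sequentially" and sN: "(\<lambda>i. (s i)\<^sup>2 * real (N i)) \<longlonglongrightarrow> \<kappa>"
  shows "(\<lambda>i. (s i)\<^sup>2 * real (N i - p)) \<longlonglongrightarrow> \<kappa>"
proof (rule Lim_transform_eventually)
  have "(\<lambda>i. (s i)\<^sup>2 * real (N i) - (s i)\<^sup>2 * real p) \<longlonglongrightarrow> \<kappa> - 0\<^sup>2 * real p"
    by (intro tendsto_intros sN s)
  then show "(\<lambda>i. (s i)\<^sup>2 * real (N i) - (s i)\<^sup>2 * real p) \<longlonglongrightarrow> \<kappa>" by simp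
  have "\<forall>\<^sub>F i in sequentially. p \<le> N i" using N unfolding filterlim_at_top by auto
  then show "\<forall>\<^sub>F i in sequentially. (s i)\<^sup>2 * real (N i) - (s i)\<^sup>2 * real p = (s i)\<^sup>2 * real (N i - p)"
    by eventually_elim (simp add: of_nat_diff right_diff_distrib)
qed

lemma sum_qn_bound: "\<exists>K>0. \<forall>N. \<forall>x y. (\<Sum>n<N. qn n x y) \<le> 1 + K * (1 + max y 0) * sqrt N"
proof -
  obtain K where K: "0 < K" "\<And>n x y. 1 \<le> n \<Longrightarrow> qn n x y \<le> K * (1 + max y 0) / sqrt n"
    using qn_bound by auto
  have "(\<Sum>n<N. qn n x y) \<le> 1 + (2 * K) * (1 + max y 0) * sqrt N" for N x y
  proof (cases N)
    case 0 then show ?thesis by simp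
  next
    case (Suc m)
    have "(\<Sum>n<N. qn n x y) = qn 0 x y + (\<Sum>n<m. qn (Suc n) x y)" unfolding Suc by (rule sum.lessThan_Suc_shift)
    also have "(\<Sum>n<m. qn (Suc n) x y) \<le> (\<Sum>n<m. K * (1 + max y 0) * (1 / sqrt (real (Suc n))))"
      using K(2)[of "Suc _" x y] by (intro sum_mono) simp
    also have "\<dots> = K * (1 + max y 0) * (\<Sum>n<m. 1 / sqrt (real (Suc n)))" by (simp only: sum_distrib_left)
    also have "\<dots> \<le> K * (1 + max y 0) * (2 * sqrt m)"
      using K(1) by (intro mult_left_mono sum_inverse_sqrt) auto
    also have "\<dots> \<le> K * (1 + max y 0) * (2 * sqrt N)"
      using K(1) by (intro mult_left_mono) (auto simp: Suc)
    finally show ?thesis by (simp add: qn_0 mult_ac)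
  qed
  then show ?thesis using K(1) by (intro exI[of _ "2 * K"]) auto
qed

text \<open>In \<open>sine_estimate\<close> divided by s the errors vanish because the sum of
  survival probabilities grows only like sqrt N. In the exit sum each power of \<open>lam\<close>
  tends to the same exponential, which factors out of the series defining \<open>V0\<close>.\<close>

lemma sine_tendsto:
  assumes s: "s \<longlonglongrightarrow> 0" and s0: "\<And>i. s i \<noteq> 0"
    and N: "filterlim N at_top sequentially" and sN: "(\<lambda>i. (s i)\<^sup>2 * real (N i)) \<longlonglongrightarrow> \<kappa>"
  shows "(\<lambda>i. ED (N i) (\<lambda>_ z. sin (s i * z)) x y / s i) \<longlonglongrightarrow> V0 x y * exp (- sg2 * \<kappa> / 2)"
proof -
  define m where "m i = lam (s i) ^ N i * (y + r x) - (\<Sum>n<N i. lam (s i) ^ (N i - 1 - n) * exM x y n)" for i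
  define E where "E = exp (- sg2 * \<kappa> / 2)"
  have l1: "lam s \<le> 1" for s using sg2_nonneg by simp
  have sum: "(\<lambda>i. \<Sum>n<N i. lam (s i) ^ (N i - 1 - n) * exM x y n) \<longlonglongrightarrow> (\<Sum>n. E * exM x y n)"
  proof -
    \<comment> \<open>The finite exit sum is padded with zeros to a series, so that dominated
      convergence applies with the summable exit probabilities as majorant.\<close>
    define a where "a k i = (if k < N i then lam (s i) ^ (N i - 1 - k) * exM x y k else 0)" for k i
    have "(\<lambda>i. suminf (\<lambda>k. a k i)) \<longlonglongrightarrow> suminf (\<lambda>k. E * exM x y k)"
    proof (rule tannerys_theorem[THEN conjunct2, THEN conjunct2])
      fix k
      have "(\<lambda>i. lam (s i) ^ (N i - (1 + k)) * exM x y k) \<longlonglongrightarrow> E * exM x y k"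
        unfolding E_def by (intro tendsto_intros lam_tendsto s scaled_shift_tendsto N sN)
      then show "(\<lambda>i. a k i) \<longlonglongrightarrow> E * exM x y k"
      proof (rule Lim_transform_eventually)
        have "\<forall>\<^sub>F i in sequentially. Suc k \<le> N i" using N unfolding filterlim_at_top by auto
        then show "\<forall>\<^sub>F i in sequentially. lam (s i) ^ (N i - (1 + k)) * exM x y k = a k i"
          by eventually_elim (simp add: a_def)
      qed
    next
      show "summable (\<lambda>k. (\<bar>y\<bar> + 2 * bd) * exP x y k)" by (intro summable_mult sums_summable[OF exP_sums])
      have "norm (a k i) \<le> (\<bar>y\<bar> + 2 * bd) * exP x y k" if "0 \<le> lam (s i)" for k i
      proof (cases "k < N i")
        case True
        have "\<bar>lam (s i) ^ (N i - 1 - k)\<bar> \<le> 1" using that l1 by (simp add: power_abs power_le_one)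
        then have "\<bar>lam (s i) ^ (N i - 1 - k)\<bar> * \<bar>exM x y k\<bar> \<le> 1 * ((\<bar>y\<bar> + 2 * bd) * exP x y k)"
          by (intro mult_mono exM_bound) auto
        then show ?thesis using True by (simp add: a_def abs_mult)
      next
        case False
        then show ?thesis using bd_ge_1 exP_nonneg[of x y k] by (simp add: a_def)
      qed
      moreover have "\<forall>\<^sub>F i in sequentially. 0 \<le> lam (s i)" using ev_small[OF s] by eventually_elim auto
      ultimately show "\<forall>\<^sub>F (k, i) in at_top \<times>\<^sub>F sequentially. norm (a k i) \<le> (\<bar>y\<bar> + 2 * bd) * exP x y k"
        unfolding eventually_prod_filter
        by (intro exI[of _ "\<lambda>_. True"] exI[of _ "\<lambda>i. 0 \<le> lam (s i)"]) auto
    qed simp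
    moreover have "suminf (\<lambda>k. a k i) = (\<Sum>n<N i. lam (s i) ^ (N i - 1 - n) * exM x y n)" for i
    proof -
      have "suminf (\<lambda>k. a k i) = (\<Sum>k<N i. a k i)" by (rule suminf_finite) (auto simp: a_def)
      then show ?thesis by (simp add: a_def)
    qed
    ultimately show ?thesis by simp
  qed
  have "m \<longlonglongrightarrow> E * (y + r x) - (\<Sum>n. E * exM x y n)"
    unfolding m_def E_def by (intro tendsto_intros lam_tendsto s sN sum[unfolded E_def])
  also have "E * (y + r x) - (\<Sum>n. E * exM x y n) = V0 x y * E"
    unfolding V0_def by (simp add: suminf_mult[OF exM_summable] algebra_simps)
  finally have mlim: "m \<longlonglongrightarrow> V0 x y * E" .
  obtain K where K: "0 < K" "\<And>N x y. (\<Sum>n<N. qn n x y) \<le> 1 + K * (1 + max y 0) * sqrt N"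
    using sum_qn_bound by auto
  define D where "D = 2 * bd * (\<bar>y\<bar> + bd)\<^sup>2 + 2 * bd * (\<bar>y\<bar> + bd) + bd"
  \<comment> \<open>The error bound of \<open>sine_estimate\<close>, divided by |s|.\<close>
  define Er where "Er i = 2 * bd * qn (N i) x y + 2 * D * \<bar>s i\<bar> + cerr * (s i)\<^sup>2 * (1 + K * (1 + max y 0) * sqrt (N i))" for i
  have cerr: "0 \<le> cerr" unfolding cerr_def using bd_ge_1 by simp
  have "Er \<longlonglongrightarrow> 0"
  proof -
    have sq: "(\<lambda>i. (s i)\<^sup>2 * sqrt (N i)) \<longlonglongrightarrow> 0"
    proof -
      have "(\<lambda>i. (s i)\<^sup>2 * real (N i) / sqrt (N i)) \<longlonglongrightarrow> 0"
        by (rule tendsto_divide_0[OF sN]) (intro filterlim_at_top_imp_at_infinity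
          filterlim_compose[OF sqrt_at_top] filterlim_compose[OF filterlim_real_sequentially N])
      moreover have "(s i)\<^sup>2 * real (N i) / sqrt (N i) = (s i)\<^sup>2 * sqrt (N i)" for i
        using real_div_sqrt[of "real (N i)"] by (simp only: times_divide_eq_right[symmetric] of_nat_0_le_iff)
      ultimately show ?thesis by (simp only:)
    qed
    have "Er = (\<lambda>i. 2 * bd * qn (N i) x y + 2 * D * \<bar>s i\<bar> + cerr * ((s i)\<^sup>2 + K * (1 + max y 0) * ((s i)\<^sup>2 * sqrt (N i))))"
      unfolding Er_def by (auto simp: algebra_simps)
    moreover have "\<dots> \<longlonglongrightarrow> 2 * bd * 0 + 2 * D * \<bar>0\<bar> + cerr * (0\<^sup>2 + K * (1 + max y 0) * 0)"
      by (intro tendsto_intros s sq filterlim_compose[OF qn_tendsto_0 N])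
    ultimately show ?thesis by simp
  qed
  have "(\<lambda>i. ED (N i) (\<lambda>_ z. sin (s i * z)) x y / s i - m i) \<longlonglongrightarrow> 0"
  proof (rule Lim_null_comparison[OF _ \<open>Er \<longlonglongrightarrow> 0\<close>])
    show "\<forall>\<^sub>F i in sequentially. norm (ED (N i) (\<lambda>_ z. sin (s i * z)) x y / s i - m i) \<le> Er i"
      using ev_small[OF s]
    proof eventually_elim
      case (elim i)
      have "\<bar>ED (N i) (\<lambda>_ z. sin (s i * z)) x y - s i * m i\<bar> \<le>
        2 * bd * \<bar>s i\<bar> * qn (N i) x y + 2 * D * (s i)\<^sup>2 + cerr * \<bar>s i\<bar> ^ 3 * (\<Sum>n<N i. qn n x y)"
        unfolding m_def D_def using elim by (intro sine_estimate) auto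
      also have "\<dots> \<le> 2 * bd * \<bar>s i\<bar> * qn (N i) x y + 2 * D * (s i)\<^sup>2 + cerr * \<bar>s i\<bar> ^ 3 * (1 + K * (1 + max y 0) * sqrt (N i))"
        using cerr by (intro add_left_mono mult_left_mono K) auto
      also have "\<dots> = \<bar>s i\<bar> * Er i"
      proof -
        have "2 * bd * a * Q + 2 * D * a\<^sup>2 + cerr * a ^ 3 * R = a * (2 * bd * Q + 2 * D * a + cerr * a\<^sup>2 * R)" for a Q R
          by (simp add: power3_eq_cube power2_eq_square algebra_simps)
        from this[of "\<bar>s i\<bar>"] show ?thesis unfolding Er_def by (simp only: power2_abs)
      qed
      finally have "\<bar>ED (N i) (\<lambda>_ z. sin (s i * z)) x y - s i * m i\<bar> / \<bar>s i\<bar> \<le> Er i"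
        using s0[of i] by (simp add: divide_le_eq mult.commute)
      moreover have "ED (N i) (\<lambda>_ z. sin (s i * z)) x y / s i - m i = (ED (N i) (\<lambda>_ z. sin (s i * z)) x y - s i * m i) / s i"
        using s0[of i] by (simp add: diff_divide_distrib)
      ultimately show ?case by (simp add: abs_divide)
    qed
  qed
  from tendsto_add[OF this mlim] show ?thesis unfolding E_def by simp
qed

lemma ED_first_moment':
  assumes "0 < n" shows "ED n (\<lambda>_ z. z) x y \<le> max y 0 + 4 * bd"
proof -
  have "ED n (\<lambda>_ z. z) x y \<le> ED n (\<lambda>_ z. z) x (y + (max y 0 - y))"
    by (rule EE_shift_mono) (use assms in auto)
  also have "\<dots> \<le> max y 0 + 4 * bd" using ED_first_moment[of "max y 0" n x] by simp
  finally show ?thesis .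
qed

text \<open>Combines |sin u| \<le> |u| with the first moment of the killed walk. Uniform in n, it
  dominates the quotient by s at all frequencies.\<close>

lemma sin_div_bound:
  assumes n: "0 < n"
  shows "\<bar>ED n (\<lambda>_ z. sin (s * z)) x y\<bar> \<le> \<bar>s\<bar> * (max y 0 + 4 * bd)"
proof -
  have a: "ED n (\<lambda>_ z. sin (s * z)) x y \<le> ED n (\<lambda>_ z. \<bar>s\<bar> * z) x y"
  proof (rule EE_mono_pos[OF _ n])
    fix z :: real assume "z \<in> {0<..}"
    then show "sin (s * z) \<le> \<bar>s\<bar> * z" using abs_sin_x_le_abs_x[of "s * z"] by (auto simp: abs_mult)
  qed
  have b: "ED n (\<lambda>_ z. - (\<bar>s\<bar> * z)) x y \<le> ED n (\<lambda>_ z. sin (s * z)) x y"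
  proof (rule EE_mono_pos[OF _ n])
    fix z :: real assume "z \<in> {0<..}"
    then show "- (\<bar>s\<bar> * z) \<le> sin (s * z)" using abs_sin_x_le_abs_x[of "s * z"] by (auto simp: abs_mult)
  qed
  have "\<bar>s\<bar> * ED n (\<lambda>_ z. z) x y \<le> \<bar>s\<bar> * (max y 0 + 4 * bd)" by (intro mult_left_mono ED_first_moment' n) auto
  then show ?thesis using a b unfolding EE_minus EE_cmult by linarith
qed

text \<open>The constant 1 on survivors is replaced by the smoothed sign of z / sqrt n, which is an
  integral of sine functionals at frequencies t / sqrt n; these converge by
  \<open>sine_tendsto\<close>, and letting T grow leaves a Gaussian integral. The replacement error
  is large only near the boundary, where \<open>window_bound\<close> applies.\<close>

lemma survival_limit: "(\<lambda>n. sqrt n * qn n x y) \<longlonglongrightarrow> 2 / (sqrt (2 * pi) * sqrt sg2) * V0 x y"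
proof -
  define \<kappa> where "\<kappa> T = (1 / pi) * (\<integral>t. tent T t * (V0 x y * exp (- sg2 * t\<^sup>2 / 2)) \<partial>lborel)" for T
  define A where "A T n = sqrt n * ED n (\<lambda>_ z. fejer_cdf (T * (z / sqrt n))) x y" for T and n :: nat
  have A_lim: "(\<lambda>n. A T n) \<longlonglongrightarrow> \<kappa> T" if T: "0 < T" for T
  proof -
    define h where "h n t = tent T t * (sqrt n * (ED n (\<lambda>_ z. sin (t / sqrt n * z)) x y / t))" for n :: nat and t
    have A_eq: "A T n = (1 / pi) * (\<integral>t. h n t \<partial>lborel)" for n
    proof -
      have "ED n (\<lambda>_ z. fejer_cdf (T * (z / sqrt n))) x y = ED n (\<lambda>_ z. (1 / pi) * (\<integral>t. tent T t * (sin (t * (z / sqrt n)) / t) \<partial>lborel)) x y"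
        by (simp only: has_bochner_integral_integral_eq[OF fejer_sine_all[OF T]]) simp
      also have "\<dots> = (1 / pi) * ED n (\<lambda>_ z. \<integral>t. tent T t * (sin (t * (z / sqrt n)) / t) \<partial>lborel) x y"
        by (rule EE_cmult)
      also have "ED n (\<lambda>_ z. \<integral>t. tent T t * (sin (t * (z / sqrt n)) / t) \<partial>lborel) x y
          = (\<integral>t. ED n (\<lambda>_ z. tent T t * (sin (t * (z / sqrt n)) / t)) x y \<partial>lborel)"
        by (rule EE_integral[THEN conjunct2]) (rule integrable.intros[OF fejer_sine_all[OF T]])
      also have "(\<lambda>t. ED n (\<lambda>_ z. tent T t * (sin (t * (z / sqrt n)) / t)) x y) = (\<lambda>t. tent T t * (ED n (\<lambda>_ z. sin (t / sqrt n * z)) x y / t))"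
      proof
        fix t
        have "ED n (\<lambda>_ z. tent T t * (sin (t * (z / sqrt n)) / t)) x y = ED n (\<lambda>_ z. (tent T t / t) * sin (t / sqrt n * z)) x y"
          by (simp add: mult_ac)
        then show "ED n (\<lambda>_ z. tent T t * (sin (t * (z / sqrt n)) / t)) x y = tent T t * (ED n (\<lambda>_ z. sin (t / sqrt n * z)) x y / t)"
          unfolding EE_cmult by simp
      qed
      finally show ?thesis unfolding A_def h_def
        by (simp add: integral_mult_right_zero[symmetric] mult_ac del: integral_mult_right_zero)
    qed
    have "(\<lambda>n. \<integral>t. h n t \<partial>lborel) \<longlonglongrightarrow> (\<integral>t. tent T t * (V0 x y * exp (- sg2 * t\<^sup>2 / 2)) \<partial>lborel)"
    proof (rule integral_dominated_convergence)
      show "integrable lborel (\<lambda>t. indicator {-T..T} t * (max y 0 + 4 * bd))"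
        by (intro integrable_mult_left integrable_real_indicator) (auto simp: emeasure_lborel_Icc_eq)
      show "h n \<in> borel_measurable lborel" for n
      proof -
        have [measurable]: "(\<lambda>t. ED n (\<lambda>_ z. sin (t / sqrt n * z)) x y) \<in> borel_measurable lborel"
          by (rule EE_measurable_param) simp
        show ?thesis unfolding h_def by measurable
      qed
      show "AE t in lborel. (\<lambda>n. h n t) \<longlonglongrightarrow> tent T t * (V0 x y * exp (- sg2 * t\<^sup>2 / 2))"
        using AE_lborel_singleton[of 0]
      proof eventually_elim
        case (elim t)
        \<comment> \<open>Indices start at 1 so that the frequency t / sqrt n is nonzero, as
          \<open>sine_tendsto\<close> demands.\<close>
        have lim: "(\<lambda>i. ED (Suc i) (\<lambda>_ z. sin (t / sqrt (Suc i) * z)) x y / (t / sqrt (Suc i))) \<longlonglongrightarrow> V0 x y * exp (- sg2 * t\<^sup>2 / 2)"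
        proof (rule sine_tendsto)
          show "(\<lambda>i. t / sqrt (Suc i)) \<longlonglongrightarrow> 0"
            by (intro tendsto_divide_0[OF tendsto_const] filterlim_at_top_imp_at_infinity
              filterlim_compose[OF sqrt_at_top] filterlim_compose[OF filterlim_real_sequentially filterlim_Suc])
          show "filterlim Suc at_top sequentially" by (rule filterlim_Suc)
          show "(\<lambda>i. (t / sqrt (Suc i))\<^sup>2 * real (Suc i)) \<longlonglongrightarrow> t\<^sup>2"
            by (simp add: power_divide del: of_nat_Suc)
        qed (use elim in auto)
        have "u / (t / sqrt (real (Suc i))) = sqrt (real (Suc i)) * (u / t)" for u :: real and i by simp
        from tendsto_mult_left[OF lim[unfolded this], of "tent T t"]
        have "(\<lambda>i. h (Suc i) t) \<longlonglongrightarrow> tent T t * (V0 x y * exp (- sg2 * t\<^sup>2 / 2))" unfolding h_def .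
        then show ?case by (rule LIMSEQ_imp_Suc)
      qed
      show "AE t in lborel. norm (h n t) \<le> indicator {-T..T} t * (max y 0 + 4 * bd)" for n
      proof (rule AE_I2)
        fix t
        have "\<bar>sqrt n * (ED n (\<lambda>_ z. sin (t / sqrt n * z)) x y / t)\<bar> \<le> max y 0 + 4 * bd"
        proof (cases "n = 0 \<or> t = 0")
          case True then show ?thesis using bd_ge_1 by auto
        next
          case False
          have "\<bar>sqrt n * (ED n (\<lambda>_ z. sin (t / sqrt n * z)) x y / t)\<bar> = sqrt n / \<bar>t\<bar> * \<bar>ED n (\<lambda>_ z. sin (t / sqrt n * z)) x y\<bar>"
            by (simp add: abs_mult)
          also have "\<dots> \<le> sqrt n / \<bar>t\<bar> * (\<bar>t / sqrt n\<bar> * (max y 0 + 4 * bd))"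
            using False by (intro mult_left_mono sin_div_bound) auto
          also have "\<dots> = max y 0 + 4 * bd" using False by simp
          finally show ?thesis .
        qed
        then show "norm (h n t) \<le> indicator {-T..T} t * (max y 0 + 4 * bd)"
          unfolding h_def real_norm_def abs_mult[of "tent T t"] using tent_bounds[OF T, of t] by (intro mult_mono) auto
      qed
    qed (measurable)
    then show ?thesis unfolding A_eq \<kappa>_def by (intro tendsto_intros)
  qed
  have \<kappa>_lim: "(\<lambda>T. \<kappa> (real T)) \<longlonglongrightarrow> 2 / (sqrt (2 * pi) * sqrt sg2) * V0 x y"
  proof -
    have "(\<lambda>T. \<integral>t. tent (real (Suc T)) t * (V0 x y * exp (- sg2 * t\<^sup>2 / 2)) \<partial>lborel) \<longlonglongrightarrow> (\<integral>t. V0 x y * exp (- sg2 * t\<^sup>2 / 2) \<partial>lborel)"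
    proof (rule integral_dominated_convergence)
      show "integrable lborel (\<lambda>t. \<bar>V0 x y\<bar> * exp (- sg2 * t\<^sup>2 / 2))"
        using sg2_pos by (intro integrable_mult_right gauss_integrable)
      show "AE t in lborel. (\<lambda>T. tent (real (Suc T)) t * (V0 x y * exp (- sg2 * t\<^sup>2 / 2))) \<longlonglongrightarrow> V0 x y * exp (- sg2 * t\<^sup>2 / 2)"
      proof (rule AE_I2)
        fix t
        have "(\<lambda>T. tent (real (Suc T)) t * (V0 x y * exp (- sg2 * t\<^sup>2 / 2))) \<longlonglongrightarrow> 1 * (V0 x y * exp (- sg2 * t\<^sup>2 / 2))"
          by (intro tendsto_intros filterlim_compose[OF tent_tendsto]
            filterlim_compose[OF filterlim_real_sequentially filterlim_Suc])
        then show "(\<lambda>T. tent (real (Suc T)) t * (V0 x y * exp (- sg2 * t\<^sup>2 / 2))) \<longlonglongrightarrow> V0 x y * exp (- sg2 * t\<^sup>2 / 2)" by simp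
      qed
      show "AE t in lborel. norm (tent (real (Suc T)) t * (V0 x y * exp (- sg2 * t\<^sup>2 / 2))) \<le> \<bar>V0 x y\<bar> * exp (- sg2 * t\<^sup>2 / 2)" for T
        using tent_bounds[of "real (Suc T)"] by (intro AE_I2) (auto simp: abs_mult intro!: mult_left_le_one_le)
    qed measurable
    then have "(\<lambda>T. \<kappa> (real (Suc T))) \<longlonglongrightarrow> (1 / pi) * (V0 x y * (sqrt (2 * pi) / sqrt sg2))"
      unfolding \<kappa>_def integral_mult_right_zero gauss_integral[OF sg2_pos] by (intro tendsto_intros)
    also have "(1 / pi) * (V0 x y * (sqrt (2 * pi) / sqrt sg2)) = 2 / (sqrt (2 * pi) * sqrt sg2) * V0 x y"
    proof -
      have e: "sqrt (2 * pi) / pi = 2 / sqrt (2 * pi)" by (simp add: field_simps)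
      have "(1 / pi) * (V0 x y * (sqrt (2 * pi) / sqrt sg2)) = (sqrt (2 * pi) / pi) * (V0 x y / sqrt sg2)" by simp
      also have "\<dots> = 2 / (sqrt (2 * pi) * sqrt sg2) * V0 x y" unfolding e by simp
      finally show ?thesis .
    qed
    finally show ?thesis by (rule LIMSEQ_imp_Suc)
  qed
  obtain K where K: "0 < K" "\<And>n x y. 1 \<le> n \<Longrightarrow> qn n x y \<le> K * (1 + max y 0) / sqrt n"
    using qn_bound by auto
  obtain W where W: "0 < W" "\<And>n L x y. 2 \<le> n \<Longrightarrow> 1 \<le> L \<Longrightarrow> ED n (win L) x y \<le> W * (1 + max y 0) * L / n"
    using window_bound by auto
  define B where "B = (W + 4 * K) * (1 + max y 0)"
  show ?thesis
  proof (rule tendsto_by_approx[where a = "\<lambda>T. A (real T)" and err = "\<lambda>T. B / sqrt T"])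
    show "(\<lambda>n. A (real T) n) \<longlonglongrightarrow> \<kappa> (real T)" if "1 \<le> T" for T using that by (intro A_lim) auto
    show "(\<lambda>T. \<kappa> (real T)) \<longlonglongrightarrow> 2 / (sqrt (2 * pi) * sqrt sg2) * V0 x y" by (rule \<kappa>_lim)
    show "(\<lambda>T. B / sqrt (real T)) \<longlonglongrightarrow> 0"
      by (intro tendsto_divide_0[OF tendsto_const] filterlim_at_top_imp_at_infinity
              filterlim_compose[OF sqrt_at_top filterlim_real_sequentially])
    fix T :: nat assume T: "1 \<le> T"
    \<comment> \<open>Balances the two errors: the window of height \<epsilon> sqrt n contributes
      order \<epsilon>, and beyond it the smoothed sign misses 1 by at most order 1 / (T
      \<epsilon>).\<close>
    define \<epsilon> where "\<epsilon> = 1 / sqrt T"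
    have e: "0 < \<epsilon>" using T by (simp add: \<epsilon>_def)
    show "\<forall>\<^sub>F n in sequentially. \<bar>sqrt n * qn n x y - A (real T) n\<bar> \<le> B / sqrt T"
      using eventually_ge_at_top[of "max 2 T"]
    proof eventually_elim
      case (elim n)
      then have n: "2 \<le> n" "T \<le> n" by auto
      have L1: "1 \<le> \<epsilon> * sqrt n" using T n by (simp add: \<epsilon>_def)
      have eq: "sqrt n * qn n x y - A T n = sqrt n * ED n (\<lambda>_ z. 1 - fejer_cdf (T * (z / sqrt n))) x y"
        unfolding A_def qn_def EE_diff by (simp add: right_diff_distrib)
      have nn: "0 \<le> ED n (\<lambda>_ z. 1 - fejer_cdf (T * (z / sqrt n))) x y"
        by (rule EE_nonneg) (simp add: fejer_cdf_le_1)
      have "ED n (\<lambda>_ z. 1 - fejer_cdf (T * (z / sqrt n))) x y \<le> ED n (\<lambda>x z. win (\<epsilon> * sqrt n) x z + 4 / sqrt T * 1) x y"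
      proof (rule EE_mono_pos)
        fix z :: real assume "z \<in> {0<..}"
        then have z: "0 < z" by simp
        show "1 - fejer_cdf (T * (z / sqrt n)) \<le> indicator {0<..\<epsilon> * sqrt n} z + 4 / sqrt T * 1"
        proof (cases "z \<le> \<epsilon> * sqrt n")
          case True
          have "0 \<le> fejer_cdf (T * (z / sqrt n))" using z by (intro fejer_cdf_nonneg) auto
          moreover have "0 \<le> 4 / sqrt T" by simp
          moreover have "indicator {0<..\<epsilon> * sqrt n} z = (1::real)" using True z by simp
          ultimately show ?thesis by linarith
        next
          case False
          define u where "u = T * (z / sqrt n)"
          have "\<epsilon> \<le> z / sqrt n" using False n by (simp add: field_simps)
          then have "T * \<epsilon> \<le> u" unfolding u_def by (intro mult_left_mono) auto
          moreover have "T * \<epsilon> = sqrt T" unfolding \<epsilon>_def using T by (simp add: real_div_sqrt)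
          ultimately have u: "sqrt T \<le> u" by simp
          have sT: "0 < sqrt T" using T by simp
          have "1 - fejer_cdf u \<le> 4 / (pi * u)" using fejer_cdf_ge[of u] u sT by linarith
          also have "\<dots> \<le> 4 / (1 * sqrt T)"
          proof (rule divide_left_mono)
            have u0: "0 < u" using less_le_trans[OF sT u] .
            show "1 * sqrt T \<le> pi * u" by (rule mult_mono) (use u u0 pi_gt3 in auto)
            show "0 < pi * u * (1 * sqrt T)" using u0 sT by simp
          qed simp
          finally show ?thesis unfolding u_def by (simp add: add_increasing)
        qed
      qed (use n in simp)
      also have "\<dots> = ED n (win (\<epsilon> * sqrt n)) x y + 4 / sqrt T * qn n x y"
        unfolding EE_add EE_cmult qn_def ..
      also have "\<dots> \<le> W * (1 + max y 0) * (\<epsilon> * sqrt n) / n + 4 / sqrt T * (K * (1 + max y 0) / sqrt n)"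
        using n L1 by (intro add_mono W mult_left_mono K) auto
      also have "\<dots> = (B / sqrt T) / sqrt n"
      proof -
        have "sqrt n / n = 1 / sqrt n" using n by (simp add: real_div_sqrt field_simps)
        then have "W * (1 + max y 0) * (\<epsilon> * sqrt n) / n = W * (1 + max y 0) * \<epsilon> / sqrt n"
          by (metis (no_types, opaque_lifting) mult.assoc mult.right_neutral times_divide_eq_right)
        then show ?thesis unfolding B_def \<epsilon>_def by (simp add: add_divide_distrib algebra_simps)
      qed
      finally have "sqrt n * ED n (\<lambda>_ z. 1 - fejer_cdf (T * (z / sqrt n))) x y \<le> sqrt n * ((B / sqrt T) / sqrt n)"
        by (intro mult_left_mono) auto
      also have "\<dots> = B / sqrt T" using n by simp
      finally have "sqrt n * ED n (\<lambda>_ z. 1 - fejer_cdf (T * (z / sqrt n))) x y \<le> B / sqrt T" .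
      then show ?case unfolding eq using nn by simp
    qed
  qed
qed

end

section \<open>A smoothed local limit theorem\<close>

lemma EE_integrable:
  fixes F :: "'x::finite \<Rightarrow> real \<Rightarrow> real"
  assumes F: "\<And>x. integrable lborel (F x)" and D: "D \<in> sets borel"
  shows "integrable lborel (\<lambda>y. EE P f D n F x y)"
proof (induction n arbitrary: x)
  case 0 then show ?case using F by simp
next
  case (Suc n)
  have "integrable lborel (\<lambda>y. if y + f v \<in> D then EE P f D n F v (y + f v) else 0)" for v
  proof -
    have "integrable lborel (\<lambda>z. indicator D z * EE P f D n F v z)"
      by (rule Bochner_Integration.integrable_bound[OF Suc[of v]])
         (use D borel_measurable_integrable[OF Suc[of v]] in \<open>auto split: split_indicator\<close>)
    then have "integrable lborel (\<lambda>y. indicator D (f v + 1 * y) * EE P f D n F v (f v + 1 * y))"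
      by (intro lborel_integrable_real_affine) auto
    moreover have "(\<lambda>y. indicator D (f v + 1 * y) * EE P f D n F v (f v + 1 * y)) =
        (\<lambda>y. if y + f v \<in> D then EE P f D n F v (y + f v) else 0)"
      by (auto simp: fun_eq_iff add.commute indicator_def)
    ultimately show ?thesis by simp
  qed
  then show ?case unfolding EE.simps by (intro Bochner_Integration.integrable_sum integrable_scaleR_right)
qed

lemma integral_shift: "(\<integral>x. g (x + c) \<partial>lborel) = (\<integral>x. g x \<partial>lborel)" for g :: "real \<Rightarrow> real" and c :: real
  using lborel_integral_real_affine[of 1 g c] by (simp add: add.commute)

lemma integrable_shift: "integrable lborel g \<Longrightarrow> integrable lborel (\<lambda>x. g (x + c))" for g :: "real \<Rightarrow> real" and c :: real
  using lborel_integrable_real_affine[of g 1 c] by (simp add: add.commute)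

lemma integrable_mult_bounded:
  fixes g h :: "real \<Rightarrow> real"
  assumes "integrable lborel g" "h \<in> borel_measurable borel" "\<And>x. \<bar>h x\<bar> \<le> B"
  shows "integrable lborel (\<lambda>x. h x * g x)"
proof (rule Bochner_Integration.integrable_bound)
  show "integrable lborel (\<lambda>x. B * g x)" using assms by simp
  show "(\<lambda>x. h x * g x) \<in> borel_measurable lborel"
    using assms(2) borel_measurable_integrable[OF assms(1)] by measurable
  have B: "0 \<le> B" using assms(3)[of 0] by linarith
  show "AE x in lborel. norm (h x * g x) \<le> norm (B * g x)"
    using assms(3) B by (intro AE_I2) (simp add: abs_mult mult_right_mono)
qed

definition gk :: "real \<Rightarrow> real \<Rightarrow> real" where
  "gk \<kappa> u = exp (- u\<^sup>2 / (2 * \<kappa>)) / sqrt (2 * pi * \<kappa>)"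

lemma gk_fourier:
  assumes "0 < \<kappa>"
  shows "gk \<kappa> u = 1 / (2 * pi) * (\<integral>t. exp (- \<kappa> * t\<^sup>2 / 2) * cos (t * u) \<partial>lborel)"
proof -
  have "1 / (2 * pi) * (sqrt (2 * pi) / sqrt \<kappa>) = 1 / sqrt (2 * pi * \<kappa>)"
  proof -
    have "sqrt (2 * pi) * sqrt (2 * pi) = 2 * pi" by simp
    then have "sqrt (2 * pi) / (2 * pi) = 1 / sqrt (2 * pi)" by (metis divide_divide_eq_left divide_self_if divide_eq_0_iff real_sqrt_eq_zero_cancel_iff pi_neq_zero mult_eq_0_iff zero_neq_numeral)
    then show ?thesis by (simp add: real_sqrt_mult)
  qed
  then have e: "1 / (2 * pi) * (sqrt (2 * pi) / sqrt \<kappa> * E) = 1 / sqrt (2 * pi * \<kappa>) * E" for E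
    by (metis mult.assoc)
  show ?thesis unfolding gk_def gauss_fourier[OF assms] e by simp
qed

lemma gk_nonneg: "0 < \<kappa> \<Longrightarrow> 0 \<le> gk \<kappa> u" by (simp add: gk_def)

lemma gk_measurable [measurable]: "gk \<kappa> \<in> borel_measurable borel" unfolding gk_def[abs_def] by measurable

lemma gk_le: "0 < \<kappa> \<Longrightarrow> gk \<kappa> u \<le> 1 / sqrt (2 * pi * \<kappa>)"
  unfolding gk_def by (intro divide_right_mono) auto

context nonneg_kernel
begin

text \<open>Density in u of the free position after j steps plus an independent Fejer variable
  centred at a, on the event that the end state is w.\<close>

definition Kf :: "real \<Rightarrow> real \<Rightarrow> nat \<Rightarrow> 'x \<Rightarrow> 'x \<Rightarrow> real \<Rightarrow> real \<Rightarrow> real" where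
  "Kf T a j x w y u = EU j (\<lambda>x' z. if x' = w then fejer T (u - z - a) else 0) x y"

lemma Kf_fourier:
  assumes T: "0 < T"
  shows "integrable lborel (\<lambda>t. tent T t * Re (cis (t * (y + (a - u))) * M t j x w))"
    and "Kf T a j x w y u = 1 / (2 * pi) * (\<integral>t. tent T t * Re (cis (t * (y + (a - u))) * M t j x w) \<partial>lborel)"
proof -
  define H where "H t x' z = tent T t * (if x' = w then cos (t * (z + (a - u))) else 0)" for t x' z
  have int: "integrable lborel (\<lambda>t. H t x' z)" for x' z
    unfolding H_def using integrable.intros[OF fejer_fourier[OF T, of "z + (a - u)"]] by (cases "x' = w") auto
  have E: "EU j (H t) x y = tent T t * Re (cis (t * (y + (a - u))) * M t j x w)" for t
    unfolding H_def EE_cmult EE_cos ..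
  from EE_integral[OF int, where P=P and f=f and D=UNIV and n=j and x=x and y=y]
  have 1: "integrable lborel (\<lambda>t. EU j (H t) x y)"
    and 2: "EU j (\<lambda>x z. \<integral>t. H t x z \<partial>lborel) x y = (\<integral>t. EU j (H t) x y \<partial>lborel)" by auto
  show "integrable lborel (\<lambda>t. tent T t * Re (cis (t * (y + (a - u))) * M t j x w))" using 1 unfolding E .
  have "(if x' = w then fejer T (u - z - a) else 0) = 1 / (2 * pi) * (\<integral>t. H t x' z \<partial>lborel)" for x' z
  proof -
    have "fejer T (u - z - a) = fejer T (- (z + (a - u)))" by (simp add: algebra_simps)
    also have "\<dots> = fejer T (z + (a - u))" by (simp only: fejer_def power2_minus mult_minus_right cos_minus neg_equal_0_iff_equal)
    finally show ?thesis unfolding H_def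
      using has_bochner_integral_integral_eq[OF fejer_fourier[OF T, of "z + (a - u)"]] by (cases "x' = w") auto
  qed
  then have "Kf T a j x w y u = EU j (\<lambda>x' z. 1 / (2 * pi) * (\<integral>t. H t x' z \<partial>lborel)) x y"
    unfolding Kf_def by (simp only:)
  then show "Kf T a j x w y u = 1 / (2 * pi) * (\<integral>t. tent T t * Re (cis (t * (y + (a - u))) * M t j x w) \<partial>lborel)"
    unfolding EE_cmult 2 E .
qed

lemma Kf_nonneg: "0 < T \<Longrightarrow> 0 \<le> Kf T a j x w y u"
  unfolding Kf_def by (rule EE_nonneg) (simp add: fejer_nonneg)

lemma Kf_le: assumes "0 < T" shows "Kf T a j x w y u \<le> T / (2 * pi)"
proof -
  have "Kf T a j x w y u \<le> EU j (\<lambda>_ _. T / (2 * pi)) x y"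
    unfolding Kf_def by (rule EE_mono) (use assms fejer_le[OF assms] in auto)
  then show ?thesis by simp
qed

lemma Kf_measurable: "(\<lambda>u. Kf T a j x w y u) \<in> borel_measurable borel"
  unfolding Kf_def by (rule EE_measurable_param) simp

text \<open>By translation invariance of the free walk, averaging over shifts of the starting point
  is the same as adding an independent Fejer variable to the final position.\<close>

lemma smoothing:
  fixes F :: "'x \<Rightarrow> real \<Rightarrow> real"
  assumes T: "0 < T" and F: "\<And>x. integrable lborel (F x)"
  shows "(\<integral>s. fejer T (s - a) * EU j F x (y + s) \<partial>lborel) = (\<Sum>w\<in>UNIV. \<integral>u. Kf T a j x w y u * F w u \<partial>lborel)"
proof (induction j arbitrary: x y)
  case 0
  have "(\<Sum>w\<in>UNIV. \<integral>u. Kf T a 0 x w y u * F w u \<partial>lborel) = (\<Sum>w\<in>UNIV. if w = x then (\<integral>u. fejer T (u - y - a) * F x u \<partial>lborel) else 0)"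
    unfolding Kf_def by (intro sum.cong) auto
  also have "\<dots> = (\<integral>u. fejer T (u - y - a) * F x u \<partial>lborel)" by simp
  also have "\<dots> = (\<integral>s. fejer T (s + y - y - a) * F x (s + y) \<partial>lborel)"
    by (rule integral_shift[symmetric])
  finally show ?case by (simp add: add.commute)
next
  case (Suc j)
  have iE: "integrable lborel (\<lambda>s. fejer T (s - a) * EU j F v (y + f v + s))" for v
  proof (rule integrable_mult_bounded)
    show "integrable lborel (\<lambda>s. EU j F v (y + f v + s))"
      using integrable_shift[OF EE_integrable[OF F, where D=UNIV and P=P and f=f and n=j and x=v], where c="y + f v"] by (simp add: add.commute)
    show "\<bar>fejer T (s - a)\<bar> \<le> T / (2 * pi)" for s using fejer_nonneg[OF T] fejer_le[OF T] by simp
  qed simp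
  have iK: "integrable lborel (\<lambda>u. Kf T a j v w z u * F w u)" for v w z
    by (rule integrable_mult_bounded[OF F Kf_measurable]) (use Kf_nonneg[OF T] Kf_le[OF T] in simp)
  have "(\<integral>s. fejer T (s - a) * EU (Suc j) F x (y + s) \<partial>lborel) = (\<integral>s. (\<Sum>v\<in>UNIV. P x v * (fejer T (s - a) * EU j F v (y + f v + s))) \<partial>lborel)"
    by (intro Bochner_Integration.integral_cong) (auto simp: sum_distrib_left algebra_simps intro!: sum.cong)
  also have "\<dots> = (\<Sum>v\<in>UNIV. P x v * (\<integral>s. fejer T (s - a) * EU j F v (y + f v + s) \<partial>lborel))"
    by (subst Bochner_Integration.integral_sum) (auto intro!: iE integrable_mult_right)
  also have "\<dots> = (\<Sum>v\<in>UNIV. \<Sum>w\<in>UNIV. P x v * (\<integral>u. Kf T a j v w (y + f v) u * F w u \<partial>lborel))"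
    unfolding Suc by (simp add: sum_distrib_left)
  also have "\<dots> = (\<Sum>w\<in>UNIV. \<Sum>v\<in>UNIV. P x v * (\<integral>u. Kf T a j v w (y + f v) u * F w u \<partial>lborel))" by (rule sum.swap)
  also have "\<dots> = (\<Sum>w\<in>UNIV. \<integral>u. Kf T a (Suc j) x w y u * F w u \<partial>lborel)"
  proof (intro sum.cong refl)
    fix w
    have "(\<integral>u. Kf T a (Suc j) x w y u * F w u \<partial>lborel) = (\<integral>u. (\<Sum>v\<in>UNIV. P x v * (Kf T a j v w (y + f v) u * F w u)) \<partial>lborel)"
      unfolding Kf_def by (simp add: sum_distrib_right mult.assoc)
    also have "\<dots> = (\<Sum>v\<in>UNIV. P x v * (\<integral>u. Kf T a j v w (y + f v) u * F w u \<partial>lborel))"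
      by (subst Bochner_Integration.integral_sum) (auto intro!: iK integrable_mult_right)
    finally show "(\<Sum>v\<in>UNIV. P x v * (\<integral>u. Kf T a j v w (y + f v) u * F w u \<partial>lborel)) = (\<integral>u. Kf T a (Suc j) x w y u * F w u \<partial>lborel)" by simp
  qed
  finally show ?case .
qed

end

context mwalk
begin

text \<open>The triangle weight restricts the Fourier integral to |t| \<le> T, where Gaussian decay
  with a single pair of constants is available.\<close>

lemma Kf_sqrt_bound:
  assumes T: "0 < T"
  shows "\<exists>C>0. \<forall>j\<ge>1. \<forall>a x w y u. Kf T a j x w y u \<le> C / sqrt j"
proof -
  obtain C c where Cc: "0 < C" "0 < c" "\<And>s n x. \<bar>s\<bar> \<le> T \<Longrightarrow> rowsum s n x \<le> C * exp (- c * n * s\<^sup>2)"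
    using decay[of T] by auto
  define K where "K = C * (sqrt (2 * pi) / sqrt (2 * c))"
  have K: "0 < K" unfolding K_def using Cc by auto
  have "Kf T a j x w y u \<le> K / sqrt j" if j: "1 \<le> j" for a j x w y u
  proof -
    have "(\<integral>t. tent T t * Re (cis (t * (y + (a - u))) * M t j x w) \<partial>lborel) \<le> (\<integral>t. C * exp (- (2 * c * j) * t\<^sup>2 / 2) \<partial>lborel)"
    proof (rule integral_mono[OF Kf_fourier(1)[OF T]])
      show "integrable lborel (\<lambda>t. C * exp (- (2 * c * j) * t\<^sup>2 / 2))"
        using Cc j by (intro integrable_mult_right gauss_integrable) auto
      fix t
      show "tent T t * Re (cis (t * (y + (a - u))) * M t j x w) \<le> C * exp (- (2 * c * j) * t\<^sup>2 / 2)"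
      proof (cases "\<bar>t\<bar> \<le> T")
        case True
        have "\<bar>Re (cis (t * (y + (a - u))) * M t j x w)\<bar> \<le> cmod (cis (t * (y + (a - u))) * M t j x w)" by (rule abs_Re_le_cmod)
        also have "\<dots> \<le> rowsum t j x" unfolding norm_mult rowsum_def
          using member_le_sum[of w UNIV "\<lambda>w. cmod (M t j x w)"] by simp
        also have "\<dots> \<le> C * exp (- c * j * t\<^sup>2)" by (rule Cc(3)[OF True])
        finally have "\<bar>tent T t\<bar> * \<bar>Re (cis (t * (y + (a - u))) * M t j x w)\<bar> \<le> 1 * (C * exp (- c * j * t\<^sup>2))"
          using tent_bounds[OF T, of t] by (intro mult_mono) auto
        then have "\<bar>tent T t * Re (cis (t * (y + (a - u))) * M t j x w)\<bar> \<le> C * exp (- c * j * t\<^sup>2)"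
          by (simp only: abs_mult mult_1)
        moreover have "C * exp (- c * j * t\<^sup>2) = C * exp (- (2 * c * j) * t\<^sup>2 / 2)" by (simp add: mult.assoc)
        ultimately show ?thesis by linarith
      next
        case False
        then have "tent T t = 0" using T by (auto simp: tent_def indicator_def)
        then show ?thesis using Cc by simp
      qed
    qed
    also have "\<dots> = C * (sqrt (2 * pi) / sqrt (2 * c * j))"
    proof -
      have "0 < 2 * c * j" using Cc j by simp
      then show ?thesis unfolding integral_mult_right_zero by (simp only: gauss_integral)
    qed
    also have "\<dots> = K / sqrt j" unfolding K_def by (simp add: real_sqrt_mult)
    finally have le: "(\<integral>t. tent T t * Re (cis (t * (y + (a - u))) * M t j x w) \<partial>lborel) \<le> K / sqrt j" .
    have "Kf T a j x w y u \<le> 1 / (2 * pi) * (K / sqrt j)"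
      unfolding Kf_fourier(2)[OF T] by (intro mult_left_mono le) auto
    also have "\<dots> \<le> 1 * (K / sqrt j)" using K pi_gt3 by (intro mult_right_mono) auto
    finally show ?thesis by simp
  qed
  then show ?thesis using K by auto
qed

text \<open>After rescaling frequencies by sqrt j, the integrands converge by
  \<open>M_tendsto\<close> under a Gaussian majorant. Positions enter only through a phase of
  modulus one, which makes the bound uniform in y and u.\<close>

lemma local_limit:
  assumes T: "0 < T"
  shows "\<exists>\<epsilon>. \<epsilon> \<longlonglongrightarrow> 0 \<and> (\<forall>j\<ge>1. \<forall>x w y u. \<bar>Kf T a j x w y u - \<nu> w * gk (sg2 * j) (u - y)\<bar> \<le> \<nu> w * \<epsilon> j / sqrt j)"
proof -
  obtain C c where Cc: "0 < C" "0 < c" "\<And>s n x. \<bar>s\<bar> \<le> T \<Longrightarrow> rowsum s n x \<le> C * exp (- c * n * s\<^sup>2)"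
    using decay[of T] by auto
  define D where "D j x w t = cmod (of_real (tent T t) * (cis (t * a) * M t j x w) - of_real (\<nu> w * exp (- (sg2 * j) * t\<^sup>2 / 2)))" for j x w t
  define W where "W \<theta> = C * exp (- (2 * c) * \<theta>\<^sup>2 / 2) + exp (- sg2 * \<theta>\<^sup>2 / 2)" for \<theta> :: real
  have Wint: "integrable lborel W" unfolding W_def using Cc sg2_pos
    by (intro Bochner_Integration.integrable_add integrable_mult_right gauss_integrable) auto
  have [measurable]: "(\<lambda>s. M s n x w) \<in> borel_measurable borel" for n x w
    by (intro borel_measurable_continuous_onI M_continuous)
  have [measurable]: "(\<lambda>s. M (s / sqrt k) n x w) \<in> borel_measurable borel" for n x w k
    by (rule measurable_compose[of "\<lambda>s. s / sqrt k" borel borel "\<lambda>s. M s n x w"]) auto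
  have Dm [measurable]: "D j x w \<in> borel_measurable borel" for j x w
    unfolding D_def[abs_def] cis_conv_exp by measurable
  have Dle: "D j x w (\<theta> / sqrt j) \<le> W \<theta>" if j: "1 \<le> j" for j x w \<theta>
  proof -
    define t where "t = \<theta> / sqrt j"
    have jt: "real j * t\<^sup>2 = \<theta>\<^sup>2" unfolding t_def using j by (simp add: power_divide)
    have 1: "cmod (of_real (tent T t) * (cis (t * a) * M t j x w)) \<le> C * exp (- (2 * c) * \<theta>\<^sup>2 / 2)"
    proof (cases "\<bar>t\<bar> \<le> T")
      case True
      have "cmod (M t j x w) \<le> rowsum t j x" unfolding rowsum_def
        using member_le_sum[of w UNIV "\<lambda>w. cmod (M t j x w)"] by simp
      also have "\<dots> \<le> C * exp (- c * j * t\<^sup>2)" by (rule Cc(3)[OF True])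
      also have "\<dots> = C * exp (- (2 * c) * \<theta>\<^sup>2 / 2)" unfolding jt[symmetric] by (simp add: mult.assoc)
      finally have "\<bar>tent T t\<bar> * cmod (M t j x w) \<le> 1 * (C * exp (- (2 * c) * \<theta>\<^sup>2 / 2))"
        using tent_bounds[OF T, of t] by (intro mult_mono) auto
      then show ?thesis by (simp add: norm_mult)
    next
      case False
      then have "tent T t = 0" using T by (auto simp: tent_def indicator_def)
      then show ?thesis using Cc by simp
    qed
    have "cmod (of_real (\<nu> w * exp (- (sg2 * j) * t\<^sup>2 / 2))) = \<nu> w * exp (- sg2 * \<theta>\<^sup>2 / 2)"
      unfolding norm_of_real using nu_pos[of w] jt by (simp add: abs_mult mult.assoc)
    also have "\<dots> \<le> 1 * exp (- sg2 * \<theta>\<^sup>2 / 2)" by (intro mult_right_mono nu_le_1) auto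
    finally have 2: "cmod (of_real (\<nu> w * exp (- (sg2 * j) * t\<^sup>2 / 2))) \<le> exp (- sg2 * \<theta>\<^sup>2 / 2)" by simp
    show ?thesis unfolding D_def W_def t_def[symmetric]
      by (rule order.trans[OF norm_triangle_ineq4 add_mono[OF 1 2]])
  qed
  have D0: "0 \<le> D j x w t" for j x w t unfolding D_def by simp
  define I where "I j x w = (\<integral>\<theta>. D j x w (\<theta> / sqrt j) \<partial>lborel)" for j x w
  have Ilim: "(\<lambda>j. I j x w) \<longlonglongrightarrow> 0" for x w
  proof -
    have "(\<lambda>j. \<integral>\<theta>. D (Suc j) x w (\<theta> / sqrt (Suc j)) \<partial>lborel) \<longlonglongrightarrow> integral\<^sup>L lborel (\<lambda>\<theta>::real. 0)"
    proof (rule integral_dominated_convergence)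
      show "integrable lborel W" by (rule Wint)
      show "AE \<theta> in lborel. (\<lambda>j. D (Suc j) x w (\<theta> / sqrt (Suc j))) \<longlonglongrightarrow> 0"
      proof (rule AE_I2)
        fix \<theta> :: real
        define s where "s j = \<theta> / sqrt (real (Suc j))" for j
        have s: "s \<longlonglongrightarrow> 0" unfolding s_def
          by (intro tendsto_divide_0[OF tendsto_const] filterlim_at_top_imp_at_infinity
              filterlim_compose[OF sqrt_at_top] filterlim_compose[OF filterlim_real_sequentially filterlim_Suc])
        have sj: "(s j)\<^sup>2 * real (Suc j) = \<theta>\<^sup>2" for j unfolding s_def by (simp add: power_divide del: of_nat_Suc)
        have M: "(\<lambda>j. M (s j) (Suc j) x w) \<longlonglongrightarrow> of_real (\<nu> w * exp (- sg2 * \<theta>\<^sup>2 / 2))"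
          by (rule M_tendsto[OF s filterlim_Suc]) (simp add: sj del: of_nat_Suc)
        have tt: "(\<lambda>j. tent T (s j)) \<longlonglongrightarrow> 1"
        proof (rule Lim_transform_eventually)
          have "(\<lambda>j. 1 - \<bar>s j\<bar> / T) \<longlonglongrightarrow> 1 - \<bar>0\<bar> / T" using T by (intro tendsto_intros s) auto
          then show "(\<lambda>j. 1 - \<bar>s j\<bar> / T) \<longlonglongrightarrow> 1" by simp
          have "\<forall>\<^sub>F j in sequentially. dist (s j) 0 < T" by (rule tendstoD[OF s T])
          then show "\<forall>\<^sub>F j in sequentially. 1 - \<bar>s j\<bar> / T = tent T (s j)"
            by eventually_elim (auto simp: tent_def indicator_def dist_real_def)
        qed
        have cc: "(\<lambda>j. cis (s j * a)) \<longlonglongrightarrow> cis (0 * a)"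
          using s by (intro isCont_tendsto_compose[OF _ tendsto_mult_right[OF s]]) (auto simp: cis_conv_exp intro!: continuous_intros)
        have e: "exp (- (sg2 * real (Suc j)) * (s j)\<^sup>2 / 2) = exp (- sg2 * \<theta>\<^sup>2 / 2)" for j
          using sj[of j] by (simp add: mult_ac del: of_nat_Suc)
        have "(\<lambda>j. cmod (of_real (tent T (s j)) * (cis (s j * a) * M (s j) (Suc j) x w) - of_real (\<nu> w * exp (- sg2 * \<theta>\<^sup>2 / 2))))
           \<longlonglongrightarrow> cmod (of_real 1 * (cis (0 * a) * of_real (\<nu> w * exp (- sg2 * \<theta>\<^sup>2 / 2))) - of_real (\<nu> w * exp (- sg2 * \<theta>\<^sup>2 / 2)))"
          by (intro tendsto_intros tt cc M)
        then show "(\<lambda>j. D (Suc j) x w (\<theta> / sqrt (Suc j))) \<longlonglongrightarrow> 0"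
          unfolding D_def s_def[symmetric] e by simp
      qed
      show "AE \<theta> in lborel. norm (D (Suc j) x w (\<theta> / sqrt (Suc j))) \<le> W \<theta>" for j
        using Dle[of "Suc j" x w] D0 by (intro AE_I2) simp
    qed (auto)
    then have "(\<lambda>j. I (Suc j) x w) \<longlonglongrightarrow> 0" unfolding I_def by simp
    then show ?thesis by (rule LIMSEQ_imp_Suc)
  qed
  \<comment> \<open>Dividing by \<nu> w puts the error in the form \<nu> w \<epsilon> j / sqrt j, so
    that \<open>Lam_approx\<close> can add it up over end states by duality.\<close>
  define \<epsilon> where "\<epsilon> j = (\<Sum>x\<in>UNIV. \<Sum>w\<in>UNIV. I j x w / \<nu> w)" for j
  have "\<epsilon> \<longlonglongrightarrow> (\<Sum>x\<in>(UNIV::'x set). \<Sum>w\<in>(UNIV::'x set). 0 / \<nu> w)"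
    unfolding \<epsilon>_def using nu_pos by (intro tendsto_intros Ilim) (simp add: less_imp_neq[THEN not_sym])
  then have e0: "\<epsilon> \<longlonglongrightarrow> 0" by simp
  have I0: "0 \<le> I j x w" for j x w unfolding I_def by (rule Bochner_Integration.integral_nonneg) (rule D0)
  have main: "\<bar>Kf T a j x w y u - \<nu> w * gk (sg2 * j) (u - y)\<bar> \<le> \<nu> w * \<epsilon> j / sqrt j" if j: "1 \<le> j" for j x w y u
  proof -
    have kp: "0 < sg2 * j" using sg2_pos j by simp
    have i2: "integrable lborel (\<lambda>t. \<nu> w * (exp (- (sg2 * j) * t\<^sup>2 / 2) * cos (t * (u - y))))"
      by (intro integrable_mult_right gauss_cos_integrable kp)
    have Di: "integrable lborel (D j x w)"
    proof -
      have "integrable lborel (\<lambda>\<theta>. D j x w (0 + (1 / sqrt j) * \<theta>))"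
      proof (rule Bochner_Integration.integrable_bound[OF Wint])
        show "AE \<theta> in lborel. norm (D j x w (0 + (1 / sqrt j) * \<theta>)) \<le> norm (W \<theta>)"
        proof (rule AE_I2)
          fix \<theta>
          have "D j x w (\<theta> / sqrt j) \<le> \<bar>W \<theta>\<bar>" by (rule order.trans[OF Dle[OF j] abs_ge_self])
          then show "norm (D j x w (0 + (1 / sqrt j) * \<theta>)) \<le> norm (W \<theta>)" using D0 by simp
        qed
      qed measurable
      then show ?thesis using j by (subst (asm) lborel_integrable_real_affine_iff) auto
    qed
    have "I j x w = sqrt j * (\<integral>t. D j x w t \<partial>lborel)"
      unfolding I_def using lborel_integral_real_affine[of "sqrt j" "\<lambda>\<theta>. D j x w (\<theta> / sqrt j)" 0] j by simp
    then have Ieq: "(\<integral>t. D j x w t \<partial>lborel) = I j x w / sqrt j" using j by (simp add: field_simps)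
    have eq0: "Kf T a j x w y u - \<nu> w * gk (sg2 * j) (u - y) =
      1 / (2 * pi) * (\<integral>t. tent T t * Re (cis (t * (y + (a - u))) * M t j x w) - \<nu> w * (exp (- (sg2 * j) * t\<^sup>2 / 2) * cos (t * (u - y))) \<partial>lborel)"
      unfolding Kf_fourier(2)[OF T] gk_fourier[OF kp]
      by (subst Bochner_Integration.integral_diff[OF Kf_fourier(1)[OF T] i2]) (simp add: right_diff_distrib)
    have "\<bar>Kf T a j x w y u - \<nu> w * gk (sg2 * j) (u - y)\<bar> \<le> 1 / (2 * pi) * (\<integral>t. D j x w t \<partial>lborel)"
      unfolding eq0 abs_mult
    proof (rule mult_mono)
      show "\<bar>\<integral>t. tent T t * Re (cis (t * (y + (a - u))) * M t j x w) - \<nu> w * (exp (- (sg2 * j) * t\<^sup>2 / 2) * cos (t * (u - y))) \<partial>lborel\<bar>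
        \<le> (\<integral>t. D j x w t \<partial>lborel)"
      proof (rule order.trans[OF integral_abs_bound], rule integral_mono)
        show "integrable lborel (\<lambda>t. \<bar>tent T t * Re (cis (t * (y + (a - u))) * M t j x w) - \<nu> w * (exp (- (sg2 * j) * t\<^sup>2 / 2) * cos (t * (u - y)))\<bar>)"
          by (intro integrable_abs Bochner_Integration.integrable_diff Kf_fourier(1)[OF T] i2)
        fix t
        have eq1: "tent T t * Re (cis (t * (y + (a - u))) * M t j x w) - \<nu> w * (exp (- (sg2 * j) * t\<^sup>2 / 2) * cos (t * (u - y))) =
          Re (cis (t * (y - u)) * (of_real (tent T t) * (cis (t * a) * M t j x w) - of_real (\<nu> w * exp (- (sg2 * j) * t\<^sup>2 / 2))))"
        proof -
          have c1: "cis (t * (y + (a - u))) = cis (t * (y - u)) * cis (t * a)" by (simp add: cis_mult algebra_simps)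
          have c2: "cos (t * (u - y)) = Re (cis (t * (y - u)))" using cos_minus[of "t * (u - y)"] by (simp add: algebra_simps)
          have R1: "Re (of_real p * z) = p * Re z" for p z by simp
          have eq: "cis (t * (y - u)) * (of_real (tent T t) * (cis (t * a) * M t j x w) - of_real (\<nu> w * exp (- (sg2 * j) * t\<^sup>2 / 2)))
            = of_real (tent T t) * (cis (t * (y - u)) * cis (t * a) * M t j x w) - of_real (\<nu> w * exp (- (sg2 * j) * t\<^sup>2 / 2)) * cis (t * (y - u))"
            by (simp only: right_diff_distrib mult_ac)
          show ?thesis unfolding eq minus_complex.sel R1 unfolding c1 c2 by (simp only: mult.assoc)
        qed
        show "\<bar>tent T t * Re (cis (t * (y + (a - u))) * M t j x w) - \<nu> w * (exp (- (sg2 * j) * t\<^sup>2 / 2) * cos (t * (u - y)))\<bar> \<le> D j x w t"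
          unfolding eq1 by (rule order.trans[OF abs_Re_le_cmod]) (simp add: norm_mult[of "cis _"] D_def)
      qed (rule Di)
    qed auto
    also have "\<dots> \<le> 1 * (I j x w / sqrt j)" unfolding Ieq using I0 pi_gt3 by (intro mult_right_mono) auto
    finally have "\<bar>Kf T a j x w y u - \<nu> w * gk (sg2 * j) (u - y)\<bar> \<le> I j x w / sqrt j" by simp
    moreover have "I j x w \<le> \<nu> w * \<epsilon> j"
    proof -
      have "I j x w / \<nu> w \<le> (\<Sum>w\<in>UNIV. I j x w / \<nu> w)"
        by (rule member_le_sum) (auto simp: I0 nu_pos less_imp_le)
      also have "\<dots> \<le> \<epsilon> j" unfolding \<epsilon>_def
        by (rule member_le_sum[of x UNIV "\<lambda>x. \<Sum>w\<in>UNIV. I j x w / \<nu> w"]) (auto intro!: sum_nonneg simp: I0 nu_pos less_imp_le)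
      finally show ?thesis using nu_pos[of w] by (simp add: field_simps)
    qed
    then have "I j x w / sqrt j \<le> \<nu> w * \<epsilon> j / sqrt j" by (intro divide_right_mono) auto
    ultimately show ?thesis by linarith
  qed
  then show ?thesis using e0 by blast
qed

end

section \<open>Duality and a priori bounds for the killed walk\<close>

text \<open>Terminal weights on the positive half-line; the factor 1 + |z| matches the linear growth
  in the start of the survival bounds and of the harmonic functions.\<close>

definition adm :: "(real \<Rightarrow> real) \<Rightarrow> bool" where
  "adm G \<longleftrightarrow> G \<in> borel_measurable borel \<and> (\<forall>z. 0 \<le> G z) \<and> (\<forall>z\<le>0. G z = 0) \<and> integrable lborel (\<lambda>z. (1 + \<bar>z\<bar>) * G z)"

definition mass :: "(real \<Rightarrow> real) \<Rightarrow> real" where "mass G = (\<integral>z. (1 + \<bar>z\<bar>) * G z \<partial>lborel)"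

text \<open>Encodes that \<open>G\<close> is dominated by every translate of \<open>G'\<close> by at most \<open>h\<close>; averaging over the translations with a Fejer kernel turns this into two-sided smooth bounds.\<close>

definition shifts :: "real \<Rightarrow> (real \<Rightarrow> real) \<Rightarrow> (real \<Rightarrow> real) \<Rightarrow> bool" where
  "shifts h G G' \<longleftrightarrow> (\<forall>z s. 0 < z \<longrightarrow> 0 \<le> s \<longrightarrow> s \<le> h \<longrightarrow> G z \<le> G' (z + s))"

lemma shiftsD: "shifts h G G' \<Longrightarrow> 0 < z \<Longrightarrow> 0 \<le> s \<Longrightarrow> s \<le> h \<Longrightarrow> G z \<le> G' (z + s)"
  by (auto simp: shifts_def)

lemma admD:
  assumes "adm G"
  shows "G \<in> borel_measurable borel" "\<And>z. 0 \<le> G z" "\<And>z. z \<le> 0 \<Longrightarrow> G z = 0" "integrable lborel (\<lambda>z. (1 + \<bar>z\<bar>) * G z)"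
    "integrable lborel G" "0 \<le> mass G"
proof -
  show 1: "G \<in> borel_measurable borel" "\<And>z. 0 \<le> G z" "\<And>z. z \<le> 0 \<Longrightarrow> G z = 0" "integrable lborel (\<lambda>z. (1 + \<bar>z\<bar>) * G z)"
    using assms by (auto simp: adm_def)
  show "integrable lborel G"
    by (rule Bochner_Integration.integrable_bound[OF 1(4)]) (use 1(1,2) in \<open>auto intro!: AE_I2 mult_right_mono simp: abs_mult algebra_simps\<close>)
  show "0 \<le> mass G" unfolding mass_def by (rule Bochner_Integration.integral_nonneg) (use 1(2) in auto)
qed

lemma adm_weighted:
  assumes G: "adm G" and h: "h \<in> borel_measurable borel" and b: "\<And>z. 0 \<le> z \<Longrightarrow> \<bar>h z\<bar> \<le> B * (1 + \<bar>z\<bar>)"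
  shows "integrable lborel (\<lambda>z. G z * h z)" "\<bar>\<integral>z. G z * h z \<partial>lborel\<bar> \<le> B * mass G"
proof -
  have le: "\<bar>G z * h z\<bar> \<le> B * ((1 + \<bar>z\<bar>) * G z)" for z
  proof (cases "0 \<le> z")
    case True
    have "G z * \<bar>h z\<bar> \<le> G z * (B * (1 + \<bar>z\<bar>))" using b[OF True] admD(2)[OF G] by (intro mult_left_mono) auto
    then show ?thesis using admD(2)[OF G, of z] by (simp add: abs_mult mult_ac)
  next
    case False then show ?thesis using admD(3)[OF G, of z] by simp
  qed
  have i: "integrable lborel (\<lambda>z. B * ((1 + \<bar>z\<bar>) * G z))" using admD(4)[OF G] by simp
  show 1: "integrable lborel (\<lambda>z. G z * h z)"
  proof (rule Bochner_Integration.integrable_bound[OF i])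
    show "(\<lambda>z. G z * h z) \<in> borel_measurable lborel" using admD(1)[OF G] h by simp
    show "AE z in lborel. norm (G z * h z) \<le> norm (B * ((1 + \<bar>z\<bar>) * G z))"
    proof (rule AE_I2)
      fix z
      show "norm (G z * h z) \<le> norm (B * ((1 + \<bar>z\<bar>) * G z))"
        unfolding real_norm_def by (rule order.trans[OF le abs_ge_self])
    qed
  qed
  have "\<bar>\<integral>z. G z * h z \<partial>lborel\<bar> \<le> (\<integral>z. \<bar>G z * h z\<bar> \<partial>lborel)" by (rule integral_abs_bound)
  also have "\<dots> \<le> (\<integral>z. B * ((1 + \<bar>z\<bar>) * G z) \<partial>lborel)" by (intro integral_mono integrable_abs 1 i le)
  also have "\<dots> = B * mass G" unfolding mass_def by simp
  finally show "\<bar>\<integral>z. G z * h z \<partial>lborel\<bar> \<le> B * mass G" .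
qed

context nonneg_kernel
begin

text \<open>Killing acts from time 1 on only, so a killed functional need not vanish at a
  nonpositive start. The explicit cut restores the test at the time where two pieces meet.\<close>

abbreviation pos :: "('x \<Rightarrow> real \<Rightarrow> real) \<Rightarrow> 'x \<Rightarrow> real \<Rightarrow> real" where
  "pos F \<equiv> (\<lambda>x z. indicator {0<..} z * F x z)"

lemma ED_le_EU_pos:
  assumes "\<And>x z. 0 \<le> F x z" "0 < j"
  shows "ED j F x y \<le> EU j (pos F) x y"
proof -
  have "ED j F x y \<le> ED j (pos F) x y" by (rule EE_mono_pos) (use assms in auto)
  also have "\<dots> \<le> EU j (pos F) x y" by (rule EE_le_UNIV) (use assms in auto)
  finally show ?thesis .
qed

text \<open>Decomposition at the first nonpositive position: from there the rest of the free
  functional is at most B, whatever number of steps remains.\<close>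

lemma exit_bound:
  assumes F: "\<And>x z. 0 \<le> F x z" and B: "\<And>i x v. i \<le> j \<Longrightarrow> v \<le> 0 \<Longrightarrow> EU i (pos F) x v \<le> B" and B0: "0 \<le> B"
  shows "EU j (pos F) x y \<le> ED j (pos F) x y + B"
  using B
proof (induction j arbitrary: x y)
  case 0 then show ?case using B0 by simp
next
  case (Suc j)
  have "P x v * EU j (pos F) v (y + f v) \<le> P x v * ((if 0 < y + f v then ED j (pos F) v (y + f v) else 0) + B)" for v
  proof (rule mult_left_mono[OF _ P_nonneg])
    show "EU j (pos F) v (y + f v) \<le> (if 0 < y + f v then ED j (pos F) v (y + f v) else 0) + B"
    proof (cases "0 < y + f v")
      case True
      have "EU j (pos F) v (y + f v) \<le> ED j (pos F) v (y + f v) + B" by (rule Suc.IH) (use Suc.prems in auto)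
      then show ?thesis using True by simp
    next
      case False
      then show ?thesis using Suc.prems[of j "y + f v" v] by simp
    qed
  qed
  then have "EU (Suc j) (pos F) x y \<le> (\<Sum>v\<in>UNIV. P x v * ((if 0 < y + f v then ED j (pos F) v (y + f v) else 0) + B))"
    unfolding EE.simps by (intro sum_mono) simp
  also have "\<dots> = ED (Suc j) (pos F) x y + B"
    by (simp add: distrib_left sum.distrib sum_distrib_right[symmetric] P_sum)
  finally show ?case .
qed

text \<open>The factor \<open>P x' w\<close> is the transition into the first state w of the final
  block. The increment \<open>f w\<close> and the later killing are left to
  \<open>G\<close>.\<close>

definition U :: "nat \<Rightarrow> (real \<Rightarrow> real) \<Rightarrow> 'x \<Rightarrow> 'x \<Rightarrow> real \<Rightarrow> real" where
  "U k G w x y = ED k (\<lambda>x' z. P x' w * G z) x y"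

lemma U_nonneg: "(\<And>z. 0 \<le> G z) \<Longrightarrow> 0 \<le> U k G w x y"
  unfolding U_def by (rule EE_nonneg) (simp add: P_nonneg)

lemma U_add: "U (m + k) G w x y = ED m (U k G w) x y"
  unfolding U_def EE_add_time ..

lemma U_integrable: "integrable lborel G \<Longrightarrow> integrable lborel (\<lambda>y. U k G w x y)"
  unfolding U_def by (rule EE_integrable) auto

lemma U_shift_mono:
  assumes "\<And>z. 0 < z \<Longrightarrow> G z \<le> G' (z + s)" "0 \<le> s" "\<And>z. 0 \<le> G' z" "0 < k"
  shows "U k G w x y \<le> U k G' w x (y + s)"
  unfolding U_def by (rule EE_shift_mono) (use assms in \<open>auto intro!: mult_left_mono P_nonneg mult_nonneg_nonneg\<close>)

lemma pos_U_integrable: "integrable lborel G \<Longrightarrow> integrable lborel (pos (U k G w) x)"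
  by (rule integrable_mult_bounded[OF U_integrable, of _ _ 1]) (auto simp: indicator_def)

text \<open>Free for j steps, killed for the last k, with the starting height averaged by a Fejer
  density centred at a.\<close>

definition Lam :: "real \<Rightarrow> real \<Rightarrow> nat \<Rightarrow> nat \<Rightarrow> (real \<Rightarrow> real) \<Rightarrow> 'x \<Rightarrow> 'x \<Rightarrow> real \<Rightarrow> real" where
  "Lam T a j k G w x y = (\<integral>s. fejer T (s - a) * EU j (pos (U k G w)) x (y + s) \<partial>lborel)"

lemma Lam_eq:
  assumes "0 < T" "integrable lborel G"
  shows "Lam T a j k G w x y = (\<Sum>v\<in>UNIV. \<integral>u. Kf T a j x v y u * pos (U k G w) v u \<partial>lborel)"
  unfolding Lam_def by (rule smoothing[OF assms(1) pos_U_integrable[OF assms(2)]])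

lemma EU_pos_integrable:
  assumes "0 < T" "integrable lborel G"
  shows "integrable lborel (\<lambda>s. fejer T (s - a) * EU j (pos (U k G w)) x (y + s))"
proof (rule integrable_mult_bounded)
  show "integrable lborel (\<lambda>s. EU j (pos (U k G w)) x (y + s))"
    using integrable_shift[OF EE_integrable[OF pos_U_integrable[OF assms(2)], where D=UNIV and P=P and f=f and n=j and x=x], where c=y]
    by (simp add: add.commute)
  show "\<bar>fejer T (s - a)\<bar> \<le> T / (2 * pi)" for s using fejer_nonneg[OF assms(1)] fejer_le[OF assms(1)] by simp
qed simp

lemma fejer_window:
  assumes T: "0 < T" and h: "0 < h"
  shows "1 - 8 / (pi * T * h) \<le> (\<integral>s. indicator {0..h} s * fejer T (s - h / 2) \<partial>lborel)"
    and "1 - 8 / (pi * T * h) \<le> (\<integral>s. indicator {-h..0} s * fejer T (s - (- h / 2)) \<partial>lborel)"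
proof -
  define A where "A = (\<integral>s. indicator {- (h/2)..h/2} s * fejer T s \<partial>lborel)"
  have A: "1 - 8 / (pi * T * h) \<le> A" using fejer_mass[OF T, of "h / 2"] h unfolding A_def by simp
  have "A = (\<integral>s. indicator {- (h/2)..h/2} (s + - (h / 2)) * fejer T (s + - (h / 2)) \<partial>lborel)"
    unfolding A_def by (rule integral_shift[symmetric])
  also have "\<dots> = (\<integral>s. indicator {0..h} s * fejer T (s - h / 2) \<partial>lborel)"
    by (intro Bochner_Integration.integral_cong) (auto simp: indicator_def field_simps)
  finally show "1 - 8 / (pi * T * h) \<le> (\<integral>s. indicator {0..h} s * fejer T (s - h / 2) \<partial>lborel)" using A by simp
  have "A = (\<integral>s. indicator {- (h/2)..h/2} (s + h / 2) * fejer T (s + h / 2) \<partial>lborel)"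
    unfolding A_def by (rule integral_shift[symmetric])
  also have "\<dots> = (\<integral>s. indicator {-h..0} s * fejer T (s - (- h / 2)) \<partial>lborel)"
    by (intro Bochner_Integration.integral_cong) (auto simp: indicator_def field_simps)
  finally show "1 - 8 / (pi * T * h) \<le> (\<integral>s. indicator {-h..0} s * fejer T (s - (- h / 2)) \<partial>lborel)" using A by simp
qed

lemma fejer_shift_integrable: "0 < T \<Longrightarrow> integrable lborel (\<lambda>s. fejer T (s - a))"
  and fejer_shift_integral: "0 < T \<Longrightarrow> (\<integral>s. fejer T (s - a) \<partial>lborel) = 1"
  using integrable_shift[OF fejer_integrable, of T "- a"] integral_shift[of "fejer T" "- a"] fejer_integral[of T] by auto

text \<open>For shifts s in [0, h], raising the start and passing from \<open>G\<close> to
  \<open>G'\<close> increases \<open>U\<close>, and so does dropping the killing over j steps. The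
  average over s keeps at least the Fejer mass of [0, h].\<close>

lemma smooth_upper:
  assumes T: "0 < T" and h: "0 < h" and G: "adm G" and G': "adm G'"
    and R: "shifts h G G'" and j: "0 < j"
  shows "(1 - 8 / (pi * T * h)) * U (j + k) G w x y \<le> Lam T (h / 2) j k G' w x y"
proof -
  note g' = admD[OF G'] and g = admD[OF G]
  define u where "u = U (j + k) G w x y"
  have u0: "0 \<le> u" unfolding u_def by (rule U_nonneg) (rule g(2))
  have iw: "integrable lborel (\<lambda>s. indicator {0..h} s * fejer T (s - h / 2))"
    by (rule integrable_mult_bounded[OF fejer_shift_integrable[OF T], of _ 1]) (auto simp: indicator_def)
  have "(1 - 8 / (pi * T * h)) * u \<le> (\<integral>s. indicator {0..h} s * fejer T (s - h / 2) \<partial>lborel) * u"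
    using fejer_window(1)[OF T h] u0 by (intro mult_right_mono) auto
  also have "\<dots> = (\<integral>s. (indicator {0..h} s * fejer T (s - h / 2)) * u \<partial>lborel)" by simp
  also have "\<dots> \<le> Lam T (h / 2) j k G' w x y" unfolding Lam_def
  proof (rule integral_mono)
    show "integrable lborel (\<lambda>s. (indicator {0..h} s * fejer T (s - h / 2)) * u)" using iw by simp
    show "integrable lborel (\<lambda>s. fejer T (s - h / 2) * EU j (pos (U k G' w)) x (y + s))"
      by (rule EU_pos_integrable[OF T g'(5)])
    fix s
    have nn: "0 \<le> EU j (pos (U k G' w)) x (y + s)" by (rule EE_nonneg) (simp add: U_nonneg g'(2))
    show "(indicator {0..h} s * fejer T (s - h / 2)) * u \<le> fejer T (s - h / 2) * EU j (pos (U k G' w)) x (y + s)"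
    proof (cases "s \<in> {0..h}")
      case True
      have "u \<le> U (j + k) G' w x (y + s)" unfolding u_def
        by (rule U_shift_mono) (use shiftsD[OF R] True g'(2) j in auto)
      also have "\<dots> \<le> EU j (pos (U k G' w)) x (y + s)" unfolding U_add
        by (rule ED_le_EU_pos) (use U_nonneg g'(2) j in auto)
      finally show ?thesis using True fejer_nonneg[OF T] by (simp add: mult_left_mono)
    next
      case False
      then show ?thesis using nn fejer_nonneg[OF T] by simp
    qed
  qed
  finally show ?thesis unfolding u_def .
qed

text \<open>The mirror image with shifts in [-h, 0]. Two losses appear: \<open>B\<close> for
  trajectories that turn nonpositive during the free steps, and \<open>S\<close> times the Fejer
  mass outside the window, where no comparison with the original start is possible.\<close>

lemma smooth_lower:
  assumes T: "0 < T" and h: "0 < h" and G: "adm G" and G': "adm G'"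
    and R: "shifts h G' G" and j: "0 < j"
    and S: "\<And>x y. U (j + k) G' w x y \<le> S" and B0: "0 \<le> B"
    and B: "\<And>i x v. i \<le> j \<Longrightarrow> v \<le> 0 \<Longrightarrow> EU i (pos (U k G' w)) x v \<le> B"
  shows "Lam T (- h / 2) j k G' w x y - B - 8 / (pi * T * h) * S \<le> U (j + k) G w x y"
proof -
  note g' = admD[OF G'] and g = admD[OF G]
  define u where "u = U (j + k) G w x y"
  have u0: "0 \<le> u" unfolding u_def by (rule U_nonneg) (rule g(2))
  have S0: "0 \<le> S" using S[of x y] U_nonneg[of G' "j + k" w x y] g'(2) by (meson order.trans)
  define fe where "fe s = fejer T (s - (- h / 2))" for s
  have fe0: "0 \<le> fe s" for s unfolding fe_def by (rule fejer_nonneg[OF T])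
  have ife: "integrable lborel fe" "(\<integral>s. fe s \<partial>lborel) = 1"
    unfolding fe_def[abs_def] using fejer_shift_integrable[OF T, of "- h / 2"] fejer_shift_integral[OF T, of "- h / 2"] by auto
  have iw: "integrable lborel (\<lambda>s. indicator {-h..0} s * fe s)"
    by (rule integrable_mult_bounded[OF ife(1), of _ 1]) (auto simp: indicator_def)
  define m where "m = (\<integral>s. indicator {-h..0} s * fe s \<partial>lborel)"
  have m: "1 - 8 / (pi * T * h) \<le> m" unfolding m_def fe_def by (rule fejer_window(2)[OF T h])
  have m1: "m \<le> 1" unfolding m_def ife(2)[symmetric]
    by (rule integral_mono[OF iw ife(1)]) (use fe0 in \<open>auto simp: indicator_def\<close>)
  have "Lam T (- h / 2) j k G' w x y \<le> (\<integral>s. (fe s * B + S * fe s) + ((indicator {-h..0} s * fe s) * (u - S)) \<partial>lborel)"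
    unfolding Lam_def fe_def[symmetric]
  proof (rule integral_mono)
    show "integrable lborel (\<lambda>s. fe s * EU j (pos (U k G' w)) x (y + s))"
      unfolding fe_def by (rule EU_pos_integrable[OF T g'(5)])
    show "integrable lborel (\<lambda>s. (fe s * B + S * fe s) + ((indicator {-h..0} s * fe s) * (u - S)))"
      using iw ife(1) by simp
    fix s
    have "EU j (pos (U k G' w)) x (y + s) \<le> ED j (pos (U k G' w)) x (y + s) + B"
      by (rule exit_bound) (use B B0 U_nonneg g'(2) in auto)
    also have "ED j (pos (U k G' w)) x (y + s) \<le> U (j + k) G' w x (y + s)" unfolding U_add
      by (rule EE_mono_pos) (use j in \<open>auto simp: indicator_def\<close>)
    finally have 1: "EU j (pos (U k G' w)) x (y + s) \<le> U (j + k) G' w x (y + s) + B" by simp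
    have "U (j + k) G' w x (y + s) \<le> S + indicator {-h..0} s * (u - S)"
    proof (cases "s \<in> {-h..0}")
      case True
      have "U (j + k) G' w x (y + s) \<le> U (j + k) G w x (y + s + - s)"
        by (rule U_shift_mono) (use shiftsD[OF R, of _ "- s"] True g(2) j in auto)
      then show ?thesis using True by (simp add: u_def)
    next
      case False then show ?thesis using S by simp
    qed
    then have "fe s * EU j (pos (U k G' w)) x (y + s) \<le> fe s * (S + indicator {-h..0} s * (u - S) + B)"
      using 1 fe0 by (intro mult_left_mono) auto
    then show "fe s * EU j (pos (U k G' w)) x (y + s) \<le> (fe s * B + S * fe s) + ((indicator {-h..0} s * fe s) * (u - S))"
      by (simp add: algebra_simps)
  qed
  also have "\<dots> = B + S + m * (u - S)"
    using iw ife by (simp add: m_def)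
  also have "\<dots> = B + (1 - m) * S + m * u" by (simp add: algebra_simps)
  also have "\<dots> \<le> B + 8 / (pi * T * h) * S + 1 * u"
    using m m1 S0 u0 by (intro add_mono mult_right_mono) auto
  finally show ?thesis unfolding u_def by simp
qed

end

context mwalk
begin

abbreviation EDd :: "nat \<Rightarrow> ('x \<Rightarrow> real \<Rightarrow> real) \<Rightarrow> 'x \<Rightarrow> real \<Rightarrow> real" where
  "EDd \<equiv> EE (dual P \<nu>) (\<lambda>u. - f u) {0<..}"

text \<open>Time reversal under \<nu> times Lebesgue measure: the first killed step is peeled off
  and becomes the last killed step of the dual walk started from (w, z). The additional dual
  transition without displacement mirrors the factor \<open>P x' w\<close> in
  \<open>U\<close>.\<close>

lemma duality_gen:
  fixes H :: "'x \<Rightarrow> real \<Rightarrow> real"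
  assumes G: "adm G" and H: "\<And>x. H x \<in> borel_measurable borel" "\<And>x z. \<bar>H x z\<bar> \<le> B"
  shows "(\<Sum>x\<in>UNIV. \<nu> x * (\<integral>y. H x y * pos (U k G w) x y \<partial>lborel)) =
    \<nu> w * (\<integral>z. G z * EDd k (\<lambda>x z. \<Sum>v\<in>UNIV. dual P \<nu> x v * H v z) w z \<partial>lborel)"
  using H
proof (induction k arbitrary: H)
  case 0
  note g = admD[OF G]
  have i: "integrable lborel (\<lambda>z. H v z * G z)" for v by (rule integrable_mult_bounded[OF g(5) 0(1,2)])
  have pG: "indicator {0<..} z * G z = G z" for z using g(3)[of z] by (auto simp: indicator_def)
  have "(\<Sum>x\<in>UNIV. \<nu> x * (\<integral>y. H x y * pos (U 0 G w) x y \<partial>lborel)) = (\<Sum>x\<in>UNIV. \<nu> x * P x w * (\<integral>y. H x y * G y \<partial>lborel))"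
  proof (intro sum.cong refl)
    fix x
    have "H x y * pos (U 0 G w) x y = P x w * (H x y * G y)" for y
    proof -
      have "H x y * pos (U 0 G w) x y = P x w * (H x y * (indicator {0<..} y * G y))" by (simp add: U_def mult_ac)
      then show ?thesis unfolding pG .
    qed
    then have "(\<integral>y. H x y * pos (U 0 G w) x y \<partial>lborel) = (\<integral>y. P x w * (H x y * G y) \<partial>lborel)"
      by (simp only:)
    then show "\<nu> x * (\<integral>y. H x y * pos (U 0 G w) x y \<partial>lborel) = \<nu> x * P x w * (\<integral>y. H x y * G y \<partial>lborel)" by simp
  qed
  also have "\<dots> = (\<Sum>x\<in>UNIV. \<nu> w * (\<integral>y. dual P \<nu> w x * (H x y * G y) \<partial>lborel))"
    using nu_pos[of w] by (simp add: dual_def)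
  also have "\<dots> = \<nu> w * (\<integral>y. (\<Sum>x\<in>UNIV. dual P \<nu> w x * (H x y * G y)) \<partial>lborel)"
    by (subst Bochner_Integration.integral_sum) (auto simp: sum_distrib_left i)
  also have "(\<lambda>y. \<Sum>x\<in>UNIV. dual P \<nu> w x * (H x y * G y)) = (\<lambda>z. G z * EDd 0 (\<lambda>x z. \<Sum>v\<in>UNIV. dual P \<nu> x v * H v z) w z)"
    by (auto simp: sum_distrib_left mult_ac fun_eq_iff)
  finally show ?case .
next
  case (Suc k)
  interpret d: mwalk "dual P \<nu>" "\<lambda>u. - f u" \<nu> by (rule dual_mwalk)
  note g = admD[OF G]
  \<comment> \<open>One killed dual step with weight \<open>H\<close>: position z - f v, tested for
    positivity.\<close>
  define H' where "H' v z = indicator {0<..} (z - f v) * (\<Sum>x\<in>UNIV. dual P \<nu> v x * H x (z - f v))" for v z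
  have B0: "0 \<le> B" using Suc.prems(2)[of undefined 0] by linarith
  have m: "(\<lambda>z. H x (z - c)) \<in> borel_measurable borel" for x c
    by (rule measurable_compose[OF _ Suc.prems(1)]) simp
  have H'm: "H' v \<in> borel_measurable borel" for v
    unfolding H'_def[abs_def] by (intro borel_measurable_times borel_measurable_sum m borel_measurable_const) simp
  have H'b: "\<bar>H' v z\<bar> \<le> B" for v z
  proof -
    have "\<bar>\<Sum>x\<in>UNIV. dual P \<nu> v x * H x (z - f v)\<bar> \<le> (\<Sum>x\<in>UNIV. dual P \<nu> v x * B)"
      by (rule order.trans[OF sum_abs]) (intro sum_mono, simp add: abs_mult d.P_nonneg Suc.prems(2) mult_left_mono)
    also have "\<dots> = B" by (simp add: sum_distrib_right[symmetric] d.P_sum)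
    finally show ?thesis unfolding H'_def using B0 by (auto simp: indicator_def)
  qed
  have iU: "integrable lborel (\<lambda>z. indicator {0<..} (z - c) * (H x (z - c) * pos (U k G w) v z))" for x v c
    by (intro integrable_mult_bounded[of _ _ 1] integrable_mult_bounded[OF pos_U_integrable[OF g(5)] m Suc.prems(2)]) (auto simp: indicator_def)
  have step: "\<nu> x * (\<integral>y. H x y * pos (U (Suc k) G w) x y \<partial>lborel) =
     (\<Sum>v\<in>UNIV. \<nu> v * dual P \<nu> v x * (\<integral>z. indicator {0<..} (z - f v) * (H x (z - f v) * pos (U k G w) v z) \<partial>lborel))" for x
  proof -
    have sh: "(\<integral>y. indicator {0<..} y * (H x y * pos (U k G w) v (y + f v)) \<partial>lborel) =
       (\<integral>z. indicator {0<..} (z - f v) * (H x (z - f v) * pos (U k G w) v z) \<partial>lborel)" for v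
      using integral_shift[of "\<lambda>z. indicator {0<..} (z - f v) * (H x (z - f v) * pos (U k G w) v z)" "f v"] by simp
    have ish: "integrable lborel (\<lambda>y. indicator {0<..} y * (H x y * pos (U k G w) v (y + f v)))" for v
    proof -
      have "integrable lborel (\<lambda>y. (\<lambda>z. indicator {0<..} (z - f v) * (H x (z - f v) * pos (U k G w) v z)) (y + f v))"
        by (rule integrable_shift[OF iU])
      then show ?thesis by simp
    qed
    have "(\<integral>y. H x y * pos (U (Suc k) G w) x y \<partial>lborel) =
        (\<integral>y. (\<Sum>v\<in>UNIV. P x v * (indicator {0<..} y * (H x y * pos (U k G w) v (y + f v)))) \<partial>lborel)"
      by (intro Bochner_Integration.integral_cong refl)
         (auto simp: U_def sum_distrib_left indicator_def intro!: sum.cong)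
    also have "\<dots> = (\<Sum>v\<in>UNIV. P x v * (\<integral>y. indicator {0<..} y * (H x y * pos (U k G w) v (y + f v)) \<partial>lborel))"
      by (subst Bochner_Integration.integral_sum) (auto intro!: integrable_mult_right ish)
    finally have "\<nu> x * (\<integral>y. H x y * pos (U (Suc k) G w) x y \<partial>lborel) = (\<Sum>v\<in>UNIV. \<nu> x * P x v *
        (\<integral>z. indicator {0<..} (z - f v) * (H x (z - f v) * pos (U k G w) v z) \<partial>lborel))"
      unfolding sh by (simp add: sum_distrib_left mult.assoc)
    moreover have "\<nu> x * P x v = \<nu> v * dual P \<nu> v x" for v using nu_pos[of v] by (simp add: dual_def)
    ultimately show ?thesis by simp
  qed
  have "(\<Sum>x\<in>UNIV. \<nu> x * (\<integral>y. H x y * pos (U (Suc k) G w) x y \<partial>lborel)) =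
     (\<Sum>v\<in>UNIV. \<Sum>x\<in>UNIV. \<nu> v * dual P \<nu> v x * (\<integral>z. indicator {0<..} (z - f v) * (H x (z - f v) * pos (U k G w) v z) \<partial>lborel))"
    unfolding step by (rule sum.swap)
  also have "\<dots> = (\<Sum>v\<in>UNIV. \<nu> v * (\<integral>z. H' v z * pos (U k G w) v z \<partial>lborel))"
  proof (intro sum.cong refl)
    fix v
    have "(\<integral>z. H' v z * pos (U k G w) v z \<partial>lborel) = (\<integral>z. (\<Sum>x\<in>UNIV. dual P \<nu> v x * (indicator {0<..} (z - f v) * (H x (z - f v) * pos (U k G w) v z))) \<partial>lborel)"
      unfolding H'_def by (intro Bochner_Integration.integral_cong refl) (simp add: sum_distrib_left sum_distrib_right mult_ac)
    also have "\<dots> = (\<Sum>x\<in>UNIV. dual P \<nu> v x * (\<integral>z. indicator {0<..} (z - f v) * (H x (z - f v) * pos (U k G w) v z) \<partial>lborel))"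
      by (subst Bochner_Integration.integral_sum) (auto intro!: integrable_mult_right iU)
    finally show "(\<Sum>x\<in>UNIV. \<nu> v * dual P \<nu> v x * (\<integral>z. indicator {0<..} (z - f v) * (H x (z - f v) * pos (U k G w) v z) \<partial>lborel)) = \<nu> v * (\<integral>z. H' v z * pos (U k G w) v z \<partial>lborel)"
      by (simp add: sum_distrib_left mult.assoc)
  qed
  also have "\<dots> = \<nu> w * (\<integral>z. G z * EDd k (\<lambda>x z. \<Sum>v\<in>UNIV. dual P \<nu> x v * H' v z) w z \<partial>lborel)"
    by (rule Suc.IH[OF H'm H'b])
  also have "(\<lambda>x z. \<Sum>v\<in>UNIV. dual P \<nu> x v * H' v z) = EDd (Suc 0) (\<lambda>x z. \<Sum>v\<in>UNIV. dual P \<nu> x v * H v z)"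
    by (intro ext) (auto simp: H'_def indicator_def intro!: sum.cong)
  also have "(\<lambda>z. G z * EDd k (EDd (Suc 0) (\<lambda>x z. \<Sum>v\<in>UNIV. dual P \<nu> x v * H v z)) w z) = (\<lambda>z. G z * EDd (Suc k) (\<lambda>x z. \<Sum>v\<in>UNIV. dual P \<nu> x v * H v z) w z)"
    unfolding EE_Suc_right[of _ _ _ k] ..
  finally show ?case .
qed

lemma duality:
  assumes G: "adm G" and H: "H \<in> borel_measurable borel" "\<And>z. \<bar>H z\<bar> \<le> B"
  shows "(\<Sum>x\<in>UNIV. \<nu> x * (\<integral>y. H y * pos (U k G w) x y \<partial>lborel)) = \<nu> w * (\<integral>z. G z * EDd k (\<lambda>_. H) w z \<partial>lborel)"
proof -
  interpret d: mwalk "dual P \<nu>" "\<lambda>u. - f u" \<nu> by (rule dual_mwalk)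
  have "(\<lambda>x z. \<Sum>v\<in>UNIV. dual P \<nu> x v * H z) = (\<lambda>_. H)"
    by (simp add: sum_distrib_right[symmetric] d.P_sum)
  then show ?thesis using duality_gen[OF G, of "\<lambda>_. H" B k w] H by simp
qed

section \<open>A priori bounds for the smoothed and the killed functionals\<close>

abbreviation qd :: "nat \<Rightarrow> 'x \<Rightarrow> real \<Rightarrow> real" where
  "qd k w z \<equiv> EDd k (\<lambda>_ _. 1) w z"

lemma qd_bound: "\<exists>K>0. \<forall>k\<ge>1. \<forall>w z. 0 \<le> qd k w z \<and> qd k w z \<le> K * (1 + max z 0) / sqrt k"
proof -
  interpret d: mwalk "dual P \<nu>" "\<lambda>u. - f u" \<nu> by (rule dual_mwalk)
  show ?thesis using d.qn_bound d.qn_nonneg unfolding d.qn_def by meson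
qed

lemma qd_measurable: "(\<lambda>z. qd k w z) \<in> borel_measurable borel"
  by (rule EE_measurable) auto

lemma G_qd_bound:
  "\<exists>K>0. \<forall>k\<ge>1. \<forall>w G. adm G \<longrightarrow> integrable lborel (\<lambda>z. G z * qd k w z) \<and> (\<integral>z. G z * qd k w z \<partial>lborel) \<le> K * mass G / sqrt k"
proof -
  obtain K where K: "0 < K" "\<And>k w z. 1 \<le> k \<Longrightarrow> 0 \<le> qd k w z \<and> qd k w z \<le> K * (1 + max z 0) / sqrt k"
    using qd_bound by auto
  have "integrable lborel (\<lambda>z. G z * qd k w z) \<and> (\<integral>z. G z * qd k w z \<partial>lborel) \<le> K * mass G / sqrt k" if "1 \<le> k" "adm G" for k w G
  proof -
    have b: "\<bar>qd k w z\<bar> \<le> K / sqrt k * (1 + \<bar>z\<bar>)" if "0 \<le> z" for z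
      using K(2)[OF \<open>1 \<le> k\<close>, of w z] that by simp
    show ?thesis using adm_weighted[OF \<open>adm G\<close> qd_measurable b] by auto
  qed
  then show ?thesis using K(1) by blast
qed

text \<open>The kernel of the free part is at most C / sqrt j. By duality, the \<nu>-total of the
  killed part is the integral of \<open>G\<close> against dual survival probabilities, of order 1 /
  sqrt k.\<close>

lemma Lam_bound:
  assumes T: "0 < T"
  shows "\<exists>C>0. \<forall>j\<ge>1. \<forall>k\<ge>1. \<forall>a G w x y. adm G \<longrightarrow> Lam T a j k G w x y \<le> C * mass G / (sqrt j * sqrt k)"
proof -
  obtain C where C: "0 < C" "\<And>j a x w y u. 1 \<le> j \<Longrightarrow> Kf T a j x w y u \<le> C / sqrt j" using Kf_sqrt_bound[OF T] by auto
  obtain K where K: "0 < K" "\<And>k w G. 1 \<le> k \<Longrightarrow> adm G \<Longrightarrow> (\<integral>z. G z * qd k w z \<partial>lborel) \<le> K * mass G / sqrt k"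
    using G_qd_bound by blast
  \<comment> \<open>Allows the unweighted sum over middle states to be replaced by the
    \<nu>-weighted one that duality evaluates.\<close>
  define N where "N = (\<Sum>x\<in>UNIV. 1 / \<nu> x)"
  have N: "1 / \<nu> x \<le> N" for x unfolding N_def by (rule member_le_sum) (auto simp: nu_pos less_imp_le)
  have N0: "0 < N" using N[of undefined] nu_pos[of undefined] by (meson divide_pos_pos less_le_trans zero_less_one)
  have "Lam T a j k G w x y \<le> (C * N * K) * mass G / (sqrt j * sqrt k)" if j: "1 \<le> j" and k: "1 \<le> k" and G: "adm G" for j k a G w x y
  proof -
    note g = admD[OF G]
    have pU: "0 \<le> pos (U k G w) v u" for v u by (simp add: U_nonneg g(2))
    have "Lam T a j k G w x y = (\<Sum>v\<in>UNIV. \<integral>u. Kf T a j x v y u * pos (U k G w) v u \<partial>lborel)" by (rule Lam_eq[OF T g(5)])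
    also have "\<dots> \<le> (\<Sum>v\<in>UNIV. (C / sqrt j * N) * (\<nu> v * (\<integral>u. 1 * pos (U k G w) v u \<partial>lborel)))"
    proof (rule sum_mono)
      fix v
      have "(\<integral>u. Kf T a j x v y u * pos (U k G w) v u \<partial>lborel) \<le> (\<integral>u. (C / sqrt j) * pos (U k G w) v u \<partial>lborel)"
      proof (rule integral_mono)
        show "integrable lborel (\<lambda>u. Kf T a j x v y u * pos (U k G w) v u)"
          by (rule integrable_mult_bounded[OF pos_U_integrable[OF g(5)] Kf_measurable]) (use Kf_nonneg[OF T] Kf_le[OF T] in simp)
        show "integrable lborel (\<lambda>u. (C / sqrt j) * pos (U k G w) v u)" using pos_U_integrable[OF g(5)] by simp
      qed (intro mult_right_mono C(2) j pU)
      also have "\<dots> = C / sqrt j * (\<integral>u. 1 * pos (U k G w) v u \<partial>lborel)" by simp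
      also have "\<dots> \<le> C / sqrt j * ((N * \<nu> v) * (\<integral>u. 1 * pos (U k G w) v u \<partial>lborel))"
      proof (rule mult_left_mono)
        have "1 \<le> N * \<nu> v" using N[of v] nu_pos[of v] by (simp add: field_simps)
        moreover have "0 \<le> (\<integral>u. 1 * pos (U k G w) v u \<partial>lborel)" using pU by (intro Bochner_Integration.integral_nonneg) auto
        ultimately show "(\<integral>u. 1 * pos (U k G w) v u \<partial>lborel) \<le> (N * \<nu> v) * (\<integral>u. 1 * pos (U k G w) v u \<partial>lborel)"
          using mult_right_mono[of 1 "N * \<nu> v" "\<integral>u. 1 * pos (U k G w) v u \<partial>lborel"] by simp
      qed (use C in simp)
      finally show "(\<integral>u. Kf T a j x v y u * pos (U k G w) v u \<partial>lborel) \<le> (C / sqrt j * N) * (\<nu> v * (\<integral>u. 1 * pos (U k G w) v u \<partial>lborel))"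
        by (simp only: mult_ac)
    qed
    also have "\<dots> = (C / sqrt j * N) * (\<nu> w * (\<integral>z. G z * qd k w z \<partial>lborel))"
      unfolding sum_distrib_left[symmetric] by (subst duality[OF G, of "\<lambda>_. 1" 1]) auto
    also have "\<dots> \<le> (C / sqrt j * N) * (1 * (K * mass G / sqrt k))"
    proof (intro mult_left_mono mult_mono nu_le_1 K(2) k G)
      show "0 \<le> (\<integral>z. G z * qd k w z \<partial>lborel)"
      proof (intro Bochner_Integration.integral_nonneg mult_nonneg_nonneg g(2))
        interpret d: mwalk "dual P \<nu>" "\<lambda>u. - f u" \<nu> by (rule dual_mwalk)
        show "0 \<le> qd k w z" for z by (rule d.EE_nonneg) simp
      qed
    qed (use C N0 in auto)
    finally show ?thesis by (simp add: mult_ac)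
  qed
  then show ?thesis using C N0 K by (intro exI[of _ "C * N * K"]) auto
qed

text \<open>\<open>smooth_upper\<close> followed by \<open>Lam_bound\<close>, with k cut into
  halves.\<close>

lemma U_sup_bound:
  assumes h: "0 < h"
  shows "\<exists>C>0. \<forall>k\<ge>2. \<forall>G G' w x y. adm G \<longrightarrow> adm G' \<longrightarrow> shifts h G G' \<longrightarrow>
     U k G w x y \<le> C * mass G' / k"
proof -
  \<comment> \<open>Makes the Fejer mass outside the window at most 1/2, so smoothing costs a factor
    2.\<close>
  define T where "T = 16 / (pi * h)"
  have T: "0 < T" using h by (simp add: T_def)
  have T2: "8 / (pi * T * h) = 1 / 2" using h by (simp add: T_def)
  obtain C where C: "0 < C" "\<And>j k a G w x y. 1 \<le> j \<Longrightarrow> 1 \<le> k \<Longrightarrow> adm G \<Longrightarrow> Lam T a j k G w x y \<le> C * mass G / (sqrt j * sqrt k)"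
    using Lam_bound[OF T] by blast
  have "U k G w x y \<le> (8 * C) * mass G' / k"
    if k: "2 \<le> k" and G: "adm G" and G': "adm G'" and R: "shifts h G G'" for k G G' w x y
  proof -
    define m l where "m = k div 2" and "l = k - k div 2"
    note hb = half_bounds[OF k, folded m_def l_def]
    have sk: "0 < sqrt k" using k by simp
    have l2: "sqrt k / 2 \<le> sqrt l"
    proof -
      have "sqrt k / 2 \<le> sqrt k / sqrt 2" by (intro divide_left_mono) (auto simp: real_le_lsqrt)
      then show ?thesis using hb(4) by linarith
    qed
    have "(1 / 2) * U (m + l) G w x y \<le> Lam T (h / 2) m l G' w x y"
      using smooth_upper[OF T h G G' R, of m l w x y] hb(1) unfolding T2 by simp
    also have "\<dots> \<le> C * mass G' / (sqrt m * sqrt l)" by (rule C(2)[OF hb(1,2) G'])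
    also have "\<dots> \<le> C * mass G' / (sqrt k / 2 * (sqrt k / 2))"
      using hb(1,2,3) l2 C(1) admD(6)[OF G'] sk by (intro divide_left_mono mult_mono mult_pos_pos mult_nonneg_nonneg) auto
    also have "\<dots> = 4 * C * mass G' / k" by simp
    finally show ?thesis using hb(5) by simp
  qed
  then show ?thesis using C by (intro exI[of _ "8 * C"]) auto
qed

text \<open>Survival over the first half supplies a further k^(-1/2) in front of the uniform bound
  for the second half.\<close>

lemma U_bound:
  assumes h: "0 < h"
  shows "\<exists>C>0. \<forall>k\<ge>4. \<forall>G G' w x y. adm G \<longrightarrow> adm G' \<longrightarrow> shifts h G G' \<longrightarrow>
     U k G w x y \<le> C * mass G' * (1 + max y 0) / (k * sqrt k)"
proof -
  obtain C where C: "0 < C" "\<And>k G G' w x y. 2 \<le> k \<Longrightarrow> adm G \<Longrightarrow> adm G' \<Longrightarrow> shifts h G G' \<Longrightarrow>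
     U k G w x y \<le> C * mass G' / k" using U_sup_bound[OF h] by blast
  obtain K where K: "0 < K" "\<And>n x y. 1 \<le> n \<Longrightarrow> qn n x y \<le> K * (1 + max y 0) / sqrt n" using qn_bound by auto
  have "U k G w x y \<le> (4 * C * K) * mass G' * (1 + max y 0) / (k * sqrt k)"
    if k: "4 \<le> k" and G: "adm G" and G': "adm G'" and R: "shifts h G G'" for k G G' w x y
  proof -
    define m l where "m = k div 2" and "l = k - k div 2"
    have k2: "2 \<le> k" using k by simp
    note hb = half_bounds[OF k2, folded m_def l_def]
    have l2: "2 \<le> l" "real k / 2 \<le> real l" unfolding l_def using k by linarith+
    have sk: "0 < sqrt k" using k by simp
    have "U (m + l) G w x y \<le> (C * mass G' / l) * qn m x y"
      unfolding U_add by (rule ED_le_qn) (rule C(2)[OF l2(1) G G' R])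
    also have "\<dots> \<le> (C * mass G' / (k / 2)) * (K * (1 + max y 0) / (sqrt k / 2))"
    proof (rule mult_mono)
      show "C * mass G' / l \<le> C * mass G' / (k / 2)"
        using l2 k C(1) admD(6)[OF G'] by (intro divide_left_mono mult_pos_pos mult_nonneg_nonneg) auto
      have "qn m x y \<le> K * (1 + max y 0) / sqrt m" by (rule K(2)[OF hb(1)])
      also have "\<dots> \<le> K * (1 + max y 0) / (sqrt k / 2)"
        using hb(1,3) K sk by (intro divide_left_mono mult_pos_pos mult_nonneg_nonneg) auto
      finally show "qn m x y \<le> K * (1 + max y 0) / (sqrt k / 2)" .
    qed (use C(1) admD(6)[OF G'] qn_nonneg k in auto)
    also have "\<dots> = (4 * C * K) * mass G' * (1 + max y 0) / (k * sqrt k)" by simp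
    finally show ?thesis using hb(5) by simp
  qed
  then show ?thesis using C K by (intro exI[of _ "4 * C * K"]) auto
qed

text \<open>Orthogonality of the increments of the martingale S_n + r(X_n), each bounded by 3
  \<open>bd\<close>; the corrector \<open>r\<close> is bounded and costs only constants.\<close>

lemma second_moment: "EU i (\<lambda>_ z. (z - v)\<^sup>2) x v \<le> (18 * bd\<^sup>2) * (real i + 1)"
proof -
  have bd2: "0 \<le> bd\<^sup>2" by simp
  have step: "EU (Suc 0) (\<lambda>x z. (z - v + r x)\<^sup>2) x y \<le> (y - v + r x)\<^sup>2 + 9 * bd\<^sup>2" for x y
  proof -
    have "EU (Suc 0) (\<lambda>x z. (z - v + r x)\<^sup>2) x y = (\<Sum>u\<in>UNIV. P x u * (y - v + r x)\<^sup>2 + (2 * (y - v + r x)) * (P x u * (f u + r u) - P x u * r x) + P x u * (f u + r u - r x)\<^sup>2)"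
      by (simp add: power2_eq_square algebra_simps)
    also have "\<dots> = (y - v + r x)\<^sup>2 + (\<Sum>u\<in>UNIV. P x u * (f u + r u - r x)\<^sup>2)"
      unfolding sum.distrib sum_distrib_left[symmetric] sum_subtractf sum_distrib_right[symmetric] P_sum r_eq[symmetric] by simp
    also have "(\<Sum>u\<in>UNIV. P x u * (f u + r u - r x)\<^sup>2) \<le> (\<Sum>u\<in>UNIV. P x u * (9 * bd\<^sup>2))"
    proof (intro sum_mono mult_left_mono P_nonneg)
      fix u
      have "\<bar>f u + r u - r x\<bar> \<le> 3 * bd" using bd_bounds[of u] bd_bounds(2)[of x] by linarith
      then have "(f u + r u - r x)\<^sup>2 \<le> (3 * bd)\<^sup>2" by (rule abs_le_square_iff[THEN iffD1, OF order.trans[OF _ abs_ge_self]])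
      then show "(f u + r u - r x)\<^sup>2 \<le> 9 * bd\<^sup>2" by (simp add: power_mult_distrib)
    qed
    also have "\<dots> = 9 * bd\<^sup>2" by (simp add: sum_distrib_right[symmetric] P_sum)
    finally show ?thesis by simp
  qed
  have mm: "EU i (\<lambda>x z. (z - v + r x)\<^sup>2) x v \<le> bd\<^sup>2 + 9 * bd\<^sup>2 * real i" for i
  proof (induction i)
    case 0
    have "(r x)\<^sup>2 \<le> bd\<^sup>2" using bd_bounds(2)[of x] by (rule abs_le_square_iff[THEN iffD1, OF order.trans[OF _ abs_ge_self]])
    then show ?case by simp
  next
    case (Suc i)
    have "EU (Suc i) (\<lambda>x z. (z - v + r x)\<^sup>2) x v \<le> EU i (\<lambda>x z. (z - v + r x)\<^sup>2 + 9 * bd\<^sup>2) x v"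
      unfolding EE_Suc_right[of _ _ _ i] by (intro EE_mono step)
    also have "\<dots> = EU i (\<lambda>x z. (z - v + r x)\<^sup>2) x v + 9 * bd\<^sup>2" unfolding EE_add EE_UNIV_const ..
    finally show ?case using Suc by (simp add: algebra_simps)
  qed
  have "EU i (\<lambda>_ z. (z - v)\<^sup>2) x v \<le> EU i (\<lambda>x z. 2 * (z - v + r x)\<^sup>2 + 2 * bd\<^sup>2) x v"
  proof (rule EE_mono)
    fix x' z
    have "(r x')\<^sup>2 \<le> bd\<^sup>2" using bd_bounds(2)[of x'] by (rule abs_le_square_iff[THEN iffD1, OF order.trans[OF _ abs_ge_self]])
    moreover have "(z - v)\<^sup>2 \<le> 2 * (z - v + r x')\<^sup>2 + 2 * (r x')\<^sup>2"
      using zero_le_power2[of "z - v + 2 * r x'"] by (simp add: power2_eq_square algebra_simps)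
    ultimately show "(z - v)\<^sup>2 \<le> 2 * (z - v + r x')\<^sup>2 + 2 * bd\<^sup>2" by linarith
  qed
  also have "\<dots> = 2 * EU i (\<lambda>x z. (z - v + r x)\<^sup>2) x v + 2 * bd\<^sup>2" unfolding EE_add EE_cmult EE_UNIV_const ..
  also have "\<dots> \<le> 2 * (bd\<^sup>2 + 9 * bd\<^sup>2 * real i) + 2 * bd\<^sup>2" using mm[of i] by simp
  also have "\<dots> \<le> (18 * bd\<^sup>2) * (real i + 1)" using bd2 by (simp add: algebra_simps)
  finally show ?thesis .
qed

text \<open>From a nonpositive start the positive part is at most the displacement, and the
  arithmetic-geometric inequality with scale sqrt j reduces this to the second moment. It prepares
  the loss \<open>B\<close> of \<open>smooth_lower\<close>.\<close>

lemma EU_pos_part: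
  assumes "v \<le> 0" "i \<le> j" "1 \<le> j"
  shows "EU i (\<lambda>_ z. 1 + max z 0) x v \<le> 20 * bd\<^sup>2 * sqrt j"
proof -
  have sj: "1 \<le> sqrt j" using assms by simp
  have "EU i (\<lambda>_ z. 1 + max z 0) x v \<le> EU i (\<lambda>_ z. (1 + sqrt j / 2) + (1 / (2 * sqrt j)) * (z - v)\<^sup>2) x v"
  proof (rule EE_mono)
    fix z
    have "max z 0 \<le> \<bar>z - v\<bar>" using assms(1) by simp
    also have "\<dots> \<le> sqrt j / 2 + (1 / (2 * sqrt j)) * (z - v)\<^sup>2"
    proof -
      have "0 \<le> (\<bar>z - v\<bar> - sqrt j)\<^sup>2" by simp
      then have "2 * sqrt j * \<bar>z - v\<bar> \<le> sqrt j * sqrt j + (z - v)\<^sup>2" by (simp add: power2_eq_square algebra_simps)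
      then have "(2 * sqrt j * \<bar>z - v\<bar>) / (2 * sqrt j) \<le> (sqrt j * sqrt j + (z - v)\<^sup>2) / (2 * sqrt j)"
        using sj by (intro divide_right_mono) auto
      moreover have "(2 * sqrt j * \<bar>z - v\<bar>) / (2 * sqrt j) = \<bar>z - v\<bar>" using sj by simp
      moreover have "(sqrt j * sqrt j + (z - v)\<^sup>2) / (2 * sqrt j) = sqrt j / 2 + (1 / (2 * sqrt j)) * (z - v)\<^sup>2"
        using sj by (simp add: add_divide_distrib del: real_sqrt_mult_self)
      ultimately show ?thesis by simp
    qed
    finally show "1 + max z 0 \<le> (1 + sqrt j / 2) + (1 / (2 * sqrt j)) * (z - v)\<^sup>2" by simp
  qed
  also have "\<dots> = (1 + sqrt j / 2) + (1 / (2 * sqrt j)) * EU i (\<lambda>_ z. (z - v)\<^sup>2) x v" unfolding EE_add EE_cmult EE_UNIV_const ..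
  also have "\<dots> \<le> (1 + sqrt j / 2) + (1 / (2 * sqrt j)) * ((18 * bd\<^sup>2) * (real j + real j))"
  proof -
    have "(18 * bd\<^sup>2) * (real i + 1) \<le> (18 * bd\<^sup>2) * (real j + real j)" using assms by (intro mult_left_mono) auto
    then have "EU i (\<lambda>_ z. (z - v)\<^sup>2) x v \<le> (18 * bd\<^sup>2) * (real j + real j)"
      by (rule order.trans[OF second_moment])
    then show ?thesis using sj by (intro add_left_mono mult_left_mono[of "EU i (\<lambda>_ z. (z - v)\<^sup>2) x v"]) auto
  qed
  also have "\<dots> = 1 + sqrt j / 2 + 18 * bd\<^sup>2 * sqrt j"
  proof -
    have "real j = sqrt j * sqrt j" by simp
    then have "(1 / (2 * sqrt j)) * ((18 * bd\<^sup>2) * (real j + real j)) = (1 / (2 * sqrt j)) * ((18 * bd\<^sup>2) * (2 * (sqrt j * sqrt j)))" by simp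
    also have "\<dots> = 18 * bd\<^sup>2 * sqrt j" using sj by (simp del: real_sqrt_mult_self)
    finally show ?thesis by simp
  qed
  also have "\<dots> \<le> 20 * bd\<^sup>2 * sqrt j"
  proof -
    have "1 \<le> bd\<^sup>2" using bd_ge_1 by simp
    then have "1 * sqrt j \<le> bd\<^sup>2 * sqrt j" using sj by (intro mult_right_mono) auto
    then show ?thesis using sj by linarith
  qed
  finally show ?thesis .
qed

end

section \<open>Splitting the time interval\<close>

text \<open>Lengths of the initial and the final piece. The middle piece has \<open>n div p\<close>
  steps, so p fixes its share 1 / p of the time, and the remainder is halved.\<close>

definition s1 :: "nat \<Rightarrow> nat \<Rightarrow> nat" where "s1 p n = (n - n div p) div 2"
definition s2 :: "nat \<Rightarrow> nat \<Rightarrow> nat" where "s2 p n = n - n div p - s1 p n"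

lemma split_bounds:
  assumes p: "8 \<le> p" and n: "p \<le> n"
  shows "s1 p n + (n div p + s2 p n) = n" "n \<le> 4 * s1 p n" "n \<le> 4 * s2 p n" "p * (n div p) \<le> n" "n \<le> 2 * p * (n div p)" "1 \<le> n div p"
    "2 \<le> s1 p n" "2 \<le> s2 p n"
proof -
  have "8 * (n div p) \<le> p * (n div p)" using p by simp
  also have "\<dots> \<le> n" by simp
  finally have j: "8 * (n div p) \<le> n" .
  show "s1 p n + (n div p + s2 p n) = n" unfolding s2_def s1_def using j by linarith
  have n8: "8 \<le> n" using p n by simp
  show a: "n \<le> 4 * s1 p n" unfolding s1_def using j n8 by linarith
  have "s1 p n \<le> s2 p n" unfolding s2_def s1_def by linarith
  then show "n \<le> 4 * s2 p n" using a by linarith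
  then show "2 \<le> s2 p n" using n8 by linarith
  show "2 \<le> s1 p n" using a n8 by linarith
  show "p * (n div p) \<le> n" by simp
  have "p \<noteq> 0" using p by auto
  then show 1: "1 \<le> n div p" using n by (simp add: div_greater_zero_iff Suc_le_eq)
  have "n < p + p * (n div p)" using \<open>p \<noteq> 0\<close> by (intro dividend_less_times_div) auto
  also have "\<dots> \<le> p * (n div p) + p * (n div p)" using 1 by simp
  finally show "n \<le> 2 * p * (n div p)" by simp
qed

lemma split_sqrt:
  assumes "8 \<le> p" "p \<le> n"
  shows "0 < sqrt (real n)" "sqrt (real n) / 2 \<le> sqrt (real (s1 p n))" "sqrt (real n) / 2 \<le> sqrt (real (s2 p n))"
proof -
  show "0 < sqrt (real n)" using assms by simp
  have "real n / 4 \<le> real (s1 p n)" "real n / 4 \<le> real (s2 p n)" using split_bounds(2,3)[OF assms] by linarith+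
  then have "sqrt (real n / 4) \<le> sqrt (real (s1 p n))" "sqrt (real n / 4) \<le> sqrt (real (s2 p n))" by (auto intro: real_sqrt_le_mono)
  then show "sqrt (real n) / 2 \<le> sqrt (real (s1 p n))" "sqrt (real n) / 2 \<le> sqrt (real (s2 p n))" by (simp_all add: real_sqrt_divide)
qed

lemma ratio_limits:
  assumes p: "8 \<le> p"
  shows "(\<lambda>n. real (n div p) / real n) \<longlonglongrightarrow> 1 / p"
    and "(\<lambda>n. real (s1 p n) / real n) \<longlonglongrightarrow> (1 - 1 / p) / 2"
    and "(\<lambda>n. real (s2 p n) / real n) \<longlonglongrightarrow> (1 - 1 / p) / 2"
proof -
  have inv: "(\<lambda>n. 1 / real n) \<longlonglongrightarrow> 0" by (rule lim_1_over_n)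
  show j: "(\<lambda>n. real (n div p) / real n) \<longlonglongrightarrow> 1 / p"
  proof (rule tendsto_sandwich[of "\<lambda>n. 1 / p - 1 / real n" _ _ "\<lambda>n. 1 / real p"])
    show "(\<lambda>n. 1 / real p - 1 / real n) \<longlonglongrightarrow> 1 / p" using tendsto_diff[OF tendsto_const inv, of "1 / real p"] by simp
    show "\<forall>\<^sub>F n in sequentially. 1 / real p - 1 / real n \<le> real (n div p) / real n"
      using eventually_gt_at_top[of 0]
    proof eventually_elim
      case (elim n)
      have "real n \<le> real p + real p * real (n div p)"
        using dividend_less_times_div[of p n] p by (metis of_nat_add of_nat_le_iff of_nat_mult less_imp_le gr0I not_numeral_le_zero)
      then have "real n / real p - 1 \<le> real (n div p)" using p by (simp add: field_simps)
      then have "(real n / real p - 1) / real n \<le> real (n div p) / real n" by (intro divide_right_mono) auto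
      then show ?case using elim by (simp add: diff_divide_distrib)
    qed
    show "\<forall>\<^sub>F n in sequentially. real (n div p) / real n \<le> 1 / real p"
      using eventually_gt_at_top[of 0]
    proof eventually_elim
      case (elim n)
      have "real p * real (n div p) \<le> real n" by (metis of_nat_mult of_nat_le_iff times_div_less_eq_dividend)
      then show ?case using elim p by (simp add: field_simps)
    qed
  qed simp
  show 1: "(\<lambda>n. real (s1 p n) / real n) \<longlonglongrightarrow> (1 - 1 / p) / 2"
  proof (rule tendsto_sandwich[of "\<lambda>n. (1 - real (n div p) / real n) / 2 - 1 / real n" _ _ "\<lambda>n. (1 - real (n div p) / real n) / 2"])
    have "(\<lambda>n. (1 - real (n div p) / real n) / 2 - 1 / real n) \<longlonglongrightarrow> (1 - 1 / p) / 2 - 0"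
      by (intro tendsto_intros j inv) simp
    then show "(\<lambda>n. (1 - real (n div p) / real n) / 2 - 1 / real n) \<longlonglongrightarrow> (1 - 1 / p) / 2" by simp
    show "(\<lambda>n. (1 - real (n div p) / real n) / 2) \<longlonglongrightarrow> (1 - 1 / p) / 2"
      by (intro tendsto_intros j) simp
    have le: "n div p \<le> n" for n by simp
    show "\<forall>\<^sub>F n in sequentially. (1 - real (n div p) / real n) / 2 - 1 / real n \<le> real (s1 p n) / real n"
      using eventually_gt_at_top[of 0]
    proof eventually_elim
      case (elim n)
      have "n \<le> 2 * s1 p n + 1 + n div p" unfolding s1_def by linarith
      then have "real n \<le> real (2 * s1 p n + 1 + n div p)" by (simp only: of_nat_le_iff)
      then have "real n \<le> 2 * real (s1 p n) + 1 + real (n div p)" by simp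
      then have "(real n - real (n div p)) / 2 - 1 \<le> real (s1 p n)" by argo
      then have "((real n - real (n div p)) / 2 - 1) / real n \<le> real (s1 p n) / real n" by (intro divide_right_mono) auto
      then show ?case using elim by (simp add: diff_divide_distrib)
    qed
    show "\<forall>\<^sub>F n in sequentially. real (s1 p n) / real n \<le> (1 - real (n div p) / real n) / 2"
      using eventually_gt_at_top[of 0]
    proof eventually_elim
      case (elim n)
      have "2 * s1 p n + n div p \<le> n" unfolding s1_def using le[of n] by linarith
      then have "real (2 * s1 p n + n div p) \<le> real n" by (simp only: of_nat_le_iff)
      then have "real (s1 p n) \<le> (real n - real (n div p)) / 2" by simp
      then have "real (s1 p n) / real n \<le> (real n - real (n div p)) / 2 / real n" by (intro divide_right_mono) auto
      then show ?case using elim by (simp add: diff_divide_distrib)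
    qed
  qed
  show "(\<lambda>n. real (s2 p n) / real n) \<longlonglongrightarrow> (1 - 1 / p) / 2"
  proof (rule Lim_transform_eventually)
    have "(\<lambda>n. 1 - real (n div p) / real n - real (s1 p n) / real n) \<longlonglongrightarrow> 1 - 1 / p - (1 - 1 / p) / 2"
      by (intro tendsto_intros j 1)
    then show "(\<lambda>n. 1 - real (n div p) / real n - real (s1 p n) / real n) \<longlonglongrightarrow> (1 - 1 / p) / 2" by (simp add: field_simps)
    show "\<forall>\<^sub>F n in sequentially. 1 - real (n div p) / real n - real (s1 p n) / real n = real (s2 p n) / real n"
      using eventually_ge_at_top[of p]
    proof eventually_elim
      case (elim n)
      have "real (s2 p n) = real n - real (n div p) - real (s1 p n)" using split_bounds(1)[OF p elim] by linarith
      moreover have "0 < n" using p elim by simp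
      ultimately show ?case by (simp add: diff_divide_distrib)
    qed
  qed
qed

lemma exp_minus_le_cube: "0 < u \<Longrightarrow> exp (- u) \<le> 27 / u ^ 3" for u :: real
proof -
  assume u: "0 < u"
  have "u / 3 \<le> exp (u / 3)" using exp_ge_add_one_self[of "u / 3"] by linarith
  then have "(u / 3) ^ 3 \<le> exp (u / 3) ^ 3" using u by (intro power_mono) auto
  also have "exp (u / 3) ^ 3 = exp u" by (simp add: exp_of_nat_mult[symmetric])
  finally have "u ^ 3 / 27 \<le> exp u" by (simp add: power_divide)
  then have "inverse (exp u) \<le> inverse (u ^ 3 / 27)" using u by (intro le_imp_inverse_le) auto
  then show ?thesis by (simp add: exp_minus)
qed

text \<open>The product formula for sines. It separates b from u under the integral, so the two
  killed pieces can be evaluated independently at each frequency.\<close>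

lemma gk_diff_fourier:
  assumes "0 < \<kappa>"
  shows "integrable lborel (\<lambda>t. exp (- \<kappa> * t\<^sup>2 / 2) * (sin (t * b) * sin (t * u)))"
    and "gk \<kappa> (u - b) - gk \<kappa> (u + b) = 1 / pi * (\<integral>t. exp (- \<kappa> * t\<^sup>2 / 2) * (sin (t * b) * sin (t * u)) \<partial>lborel)"
proof -
  have i: "integrable lborel (\<lambda>t. exp (- \<kappa> * t\<^sup>2 / 2) * cos (t * u))" for u by (rule gauss_cos_integrable[OF assms])
  have eq: "exp (- \<kappa> * t\<^sup>2 / 2) * (sin (t * b) * sin (t * u)) =
     (1 / 2) * (exp (- \<kappa> * t\<^sup>2 / 2) * cos (t * (u - b)) - exp (- \<kappa> * t\<^sup>2 / 2) * cos (t * (u + b)))" for t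
    by (simp add: cos_diff cos_add algebra_simps)
  show "integrable lborel (\<lambda>t. exp (- \<kappa> * t\<^sup>2 / 2) * (sin (t * b) * sin (t * u)))"
    unfolding eq by (intro integrable_mult_right Bochner_Integration.integrable_diff i)
  have "(\<integral>t. exp (- \<kappa> * t\<^sup>2 / 2) * (sin (t * b) * sin (t * u)) \<partial>lborel) =
     (1 / 2) * ((\<integral>t. exp (- \<kappa> * t\<^sup>2 / 2) * cos (t * (u - b)) \<partial>lborel) - (\<integral>t. exp (- \<kappa> * t\<^sup>2 / 2) * cos (t * (u + b)) \<partial>lborel))"
    unfolding eq integral_mult_right_zero by (subst Bochner_Integration.integral_diff[OF i i]) simp
  then show "gk \<kappa> (u - b) - gk \<kappa> (u + b) = 1 / pi * (\<integral>t. exp (- \<kappa> * t\<^sup>2 / 2) * (sin (t * b) * sin (t * u)) \<partial>lborel)"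
    unfolding gk_fourier[OF assms] by (simp add: right_diff_distrib diff_divide_distrib)
qed

section \<open>Gaussian bridge between the two killed pieces\<close>

context mwalk
begin

text \<open>Sign and linear growth are inherited from the survival probabilities through
  \<open>survival_limit\<close>.\<close>

lemma V0_bounds: "\<exists>C>0. \<forall>x y. 0 \<le> V0 x y \<and> V0 x y \<le> C * (1 + max y 0)"
proof -
  obtain K where K: "0 < K" "\<And>n x y. 1 \<le> n \<Longrightarrow> qn n x y \<le> K * (1 + max y 0) / sqrt n" using qn_bound by auto
  define c where "c = 2 / (sqrt (2 * pi) * sqrt sg2)"
  have c: "0 < c" unfolding c_def using sg2_pos by simp
  have "0 \<le> V0 x y \<and> V0 x y \<le> (K / c) * (1 + max y 0)" for x y
  proof -
    have lim: "(\<lambda>n. sqrt n * qn n x y) \<longlonglongrightarrow> c * V0 x y" unfolding c_def by (rule survival_limit)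
    have "0 \<le> c * V0 x y" by (rule tendsto_lowerbound[OF lim]) (auto simp: qn_nonneg)
    moreover have "c * V0 x y \<le> K * (1 + max y 0)"
    proof (rule tendsto_upperbound[OF lim])
      show "\<forall>\<^sub>F n in sequentially. sqrt n * qn n x y \<le> K * (1 + max y 0)"
        using eventually_ge_at_top[of 1]
      proof eventually_elim
        case (elim n)
        have "sqrt n * qn n x y \<le> sqrt n * (K * (1 + max y 0) / sqrt n)" by (intro mult_left_mono K(2) elim) auto
        then show ?case using elim by simp
      qed
    qed simp
    ultimately show ?thesis using c by (auto simp: zero_le_mult_iff field_simps)
  qed
  then show ?thesis using K c by (intro exI[of _ "K / c"]) auto
qed

lemma V0_measurable: "V0 x \<in> borel_measurable borel"
proof -
  define c where "c = 2 / (sqrt (2 * pi) * sqrt sg2)"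
  have c: "0 < c" unfolding c_def using sg2_pos by simp
  have "(\<lambda>y. c * V0 x y) \<in> borel_measurable borel"
  proof (rule borel_measurable_LIMSEQ_real)
    show "(\<lambda>n. sqrt n * qn n x y) \<longlonglongrightarrow> c * V0 x y" for y unfolding c_def by (rule survival_limit)
    show "(\<lambda>y. sqrt n * qn n x y) \<in> borel_measurable borel" for n :: nat
      unfolding qn_def by (intro borel_measurable_times borel_measurable_const EE_measurable) auto
  qed
  then have "(\<lambda>y. (1 / c) * (c * V0 x y)) \<in> borel_measurable borel"
    by (rule borel_measurable_times[OF borel_measurable_const])
  moreover have "(\<lambda>y. (1 / c) * (c * V0 x y)) = V0 x" using c by auto
  ultimately show ?thesis by (simp only:)
qed

text \<open>The Gaussian kernel between the two ends is split as \<open>gk (u - b) = (gk (u - b) - gk (u + b)) + gk (u + b)\<close>: the reflected difference is a superposition of products of sines and carries the limit, the remainder is small because both ends are typically of order \<open>sqrt n\<close> away from the origin.\<close>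

definition JM :: "'x \<Rightarrow> real \<Rightarrow> 'x \<Rightarrow> nat \<Rightarrow> nat \<Rightarrow> real \<Rightarrow> real" where
  "JM x y w p n z = ED (s1 p n) (\<lambda>_ b. EDd (s2 p n) (\<lambda>_ u. gk (sg2 * (n div p)) (u - b) - gk (sg2 * (n div p)) (u + b)) w z) x y"

definition JP :: "'x \<Rightarrow> real \<Rightarrow> 'x \<Rightarrow> nat \<Rightarrow> nat \<Rightarrow> real \<Rightarrow> real" where
  "JP x y w p n z = ED (s1 p n) (\<lambda>_ b. EDd (s2 p n) (\<lambda>_ u. gk (sg2 * (n div p)) (u + b)) w z) x y"

lemma JM_eq:
  assumes "0 < n div p"
  shows "JM x y w p n z = 1 / pi * (\<integral>t. exp (- (sg2 * (n div p)) * t\<^sup>2 / 2) *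
     (ED (s1 p n) (\<lambda>_ b. sin (t * b)) x y * EDd (s2 p n) (\<lambda>_ u. sin (t * u)) w z) \<partial>lborel)"
proof -
  define \<kappa> where "\<kappa> = sg2 * (n div p)"
  have k: "0 < \<kappa>" unfolding \<kappa>_def using assms sg2_pos by simp
  define N1 N2 where "N1 = s1 p n" and "N2 = s2 p n"
  define S where "S t = EDd N2 (\<lambda>_ u. sin (t * u)) w z" for t
  define F where "F t = ED N1 (\<lambda>_ b. sin (t * b)) x y" for t
  have in1: "integrable lborel (\<lambda>t. EDd N2 (\<lambda>_ u. exp (- \<kappa> * t\<^sup>2 / 2) * (sin (t * b) * sin (t * u))) w z)"
    and eq1: "EDd N2 (\<lambda>_ u. \<integral>t. exp (- \<kappa> * t\<^sup>2 / 2) * (sin (t * b) * sin (t * u)) \<partial>lborel) w z =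
      (\<integral>t. EDd N2 (\<lambda>_ u. exp (- \<kappa> * t\<^sup>2 / 2) * (sin (t * b) * sin (t * u))) w z \<partial>lborel)" for b
    using EE_integral[of lborel "\<lambda>t _ u. exp (- \<kappa> * t\<^sup>2 / 2) * (sin (t * b) * sin (t * u))"] gk_diff_fourier(1)[OF k] by blast+
  have e1: "EDd N2 (\<lambda>_ u. exp (- \<kappa> * t\<^sup>2 / 2) * (sin (t * b) * sin (t * u))) w z = (exp (- \<kappa> * t\<^sup>2 / 2) * S t) * sin (t * b)" for t b
    unfolding EE_cmult S_def by simp
  have in2: "integrable lborel (\<lambda>t. (exp (- \<kappa> * t\<^sup>2 / 2) * S t) * sin (t * b))" for b using in1[of b] unfolding e1 .
  have "EDd N2 (\<lambda>_ u. gk \<kappa> (u - b) - gk \<kappa> (u + b)) w z = 1 / pi * (\<integral>t. (exp (- \<kappa> * t\<^sup>2 / 2) * S t) * sin (t * b) \<partial>lborel)" for b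
  proof -
    have "EDd N2 (\<lambda>_ u. 1 / pi * (\<integral>t. exp (- \<kappa> * t\<^sup>2 / 2) * (sin (t * b) * sin (t * u)) \<partial>lborel)) w z
      = 1 / pi * EDd N2 (\<lambda>_ u. \<integral>t. exp (- \<kappa> * t\<^sup>2 / 2) * (sin (t * b) * sin (t * u)) \<partial>lborel) w z" by (rule EE_cmult)
    then show ?thesis unfolding gk_diff_fourier(2)[OF k] eq1 e1 .
  qed
  then have "JM x y w p n z = ED N1 (\<lambda>_ b. 1 / pi * (\<integral>t. (exp (- \<kappa> * t\<^sup>2 / 2) * S t) * sin (t * b) \<partial>lborel)) x y"
    unfolding JM_def N1_def[symmetric] N2_def[symmetric] \<kappa>_def[symmetric] by (simp only:)
  also have "\<dots> = 1 / pi * ED N1 (\<lambda>_ b. \<integral>t. (exp (- \<kappa> * t\<^sup>2 / 2) * S t) * sin (t * b) \<partial>lborel) x y" by (rule EE_cmult)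
  also have "ED N1 (\<lambda>_ b. \<integral>t. (exp (- \<kappa> * t\<^sup>2 / 2) * S t) * sin (t * b) \<partial>lborel) x y = (\<integral>t. ED N1 (\<lambda>_ b. (exp (- \<kappa> * t\<^sup>2 / 2) * S t) * sin (t * b)) x y \<partial>lborel)"
    by (rule EE_integral[THEN conjunct2]) (rule in2)
  also have "(\<lambda>t. ED N1 (\<lambda>_ b. (exp (- \<kappa> * t\<^sup>2 / 2) * S t) * sin (t * b)) x y) = (\<lambda>t. exp (- \<kappa> * t\<^sup>2 / 2) * (F t * S t))"
    unfolding EE_cmult F_def by (simp add: mult_ac)
  finally show ?thesis unfolding F_def S_def N1_def N2_def \<kappa>_def .
qed

lemma JM_scaled:
  assumes "0 < n div p" "0 < n"
  shows "real n * sqrt n * JM x y w p n z = 1 / pi * (\<integral>t. exp (- sg2 * (real (n div p) / n) * t\<^sup>2 / 2) *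
     (n * (ED (s1 p n) (\<lambda>_ b. sin (t / sqrt n * b)) x y * EDd (s2 p n) (\<lambda>_ u. sin (t / sqrt n * u)) w z)) \<partial>lborel)"
proof -
  define g where "g t = exp (- (sg2 * (n div p)) * t\<^sup>2 / 2) *
     (ED (s1 p n) (\<lambda>_ b. sin (t * b)) x y * EDd (s2 p n) (\<lambda>_ u. sin (t * u)) w z)" for t
  have sn: "0 < sqrt n" using assms by simp
  have "(\<integral>t. g t \<partial>lborel) = \<bar>1 / sqrt n\<bar> *\<^sub>R (\<integral>t. g (0 + 1 / sqrt n * t) \<partial>lborel)"
    by (rule lborel_integral_real_affine) (use sn in simp)
  then have "real n * sqrt n * (\<integral>t. g t \<partial>lborel) = n * (\<integral>t. g (t / sqrt n) \<partial>lborel)" using sn by simp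
  also have "\<dots> = (\<integral>t. n * g (t / sqrt n) \<partial>lborel)" by simp
  also have "(\<lambda>t. n * g (t / sqrt n)) = (\<lambda>t. exp (- sg2 * (real (n div p) / n) * t\<^sup>2 / 2) *
     (n * (ED (s1 p n) (\<lambda>_ b. sin (t / sqrt n * b)) x y * EDd (s2 p n) (\<lambda>_ u. sin (t / sqrt n * u)) w z)))"
    unfolding g_def by (intro ext) (simp add: power_divide mult_ac)
  finally have "1 / pi * (real n * sqrt n * (\<integral>t. g t \<partial>lborel)) = 1 / pi * (\<integral>t. exp (- sg2 * (real (n div p) / n) * t\<^sup>2 / 2) *
     (n * (ED (s1 p n) (\<lambda>_ b. sin (t / sqrt n * b)) x y * EDd (s2 p n) (\<lambda>_ u. sin (t / sqrt n * u)) w z)) \<partial>lborel)" by simp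
  moreover have "1 / pi * (real n * sqrt n * (\<integral>t. g t \<partial>lborel)) = real n * sqrt n * JM x y w p n z"
    unfolding JM_eq[OF assms(1)] g_def by (simp only: mult_ac)
  ultimately show ?thesis by simp
qed

text \<open>The constant is uniform in p because both outer pieces have at least n / 4
  steps.\<close>

lemma qq_bound:
  "\<exists>C>0. \<forall>p\<ge>8. \<forall>n\<ge>p. \<forall>w z. n * (qn (s1 p n) x y * qd (s2 p n) w z) \<le> C * (1 + max z 0)"
proof -
  obtain K where K: "0 < K" "\<And>n x y. 1 \<le> n \<Longrightarrow> qn n x y \<le> K * (1 + max y 0) / sqrt n" using qn_bound by auto
  obtain K' where K': "0 < K'" "\<And>k w z. 1 \<le> k \<Longrightarrow> 0 \<le> qd k w z \<and> qd k w z \<le> K' * (1 + max z 0) / sqrt k" using qd_bound by auto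
  have "n * (qn (s1 p n) x y * qd (s2 p n) w z) \<le> (4 * K * K' * (1 + max y 0)) * (1 + max z 0)" if p: "8 \<le> p" and n: "p \<le> n" for p n w z
  proof -
    note sb = split_bounds[OF p n] and ss = split_sqrt[OF p n]
    have 1: "qn (s1 p n) x y \<le> K * (1 + max y 0) / (sqrt n / 2)"
    proof (rule order.trans[OF K(2)])
      show "K * (1 + max y 0) / sqrt (s1 p n) \<le> K * (1 + max y 0) / (sqrt n / 2)"
        using ss sb(7) K(1) by (intro divide_left_mono mult_nonneg_nonneg mult_pos_pos) auto
    qed (use sb(7) in simp)
    have 2: "qd (s2 p n) w z \<le> K' * (1 + max z 0) / (sqrt n / 2)"
    proof (rule order.trans[OF conjunct2[OF K'(2)]])
      show "K' * (1 + max z 0) / sqrt (s2 p n) \<le> K' * (1 + max z 0) / (sqrt n / 2)"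
        using ss sb(8) K'(1) by (intro divide_left_mono mult_nonneg_nonneg mult_pos_pos) auto
    qed (use sb(8) in simp)
    have "n * (qn (s1 p n) x y * qd (s2 p n) w z) \<le> n * ((K * (1 + max y 0) / (sqrt n / 2)) * (K' * (1 + max z 0) / (sqrt n / 2)))"
      using K'(2)[of "s2 p n" w z] sb(8) K(1) ss(1) by (intro mult_left_mono mult_mono 1 2) auto
    also have "\<dots> = (real n / (sqrt n * sqrt n)) * ((4 * K * K' * (1 + max y 0)) * (1 + max z 0))"
      by (simp add: field_simps)
    also have "real n / (sqrt n * sqrt n) = 1" using ss(1) by simp
    finally show ?thesis by simp
  qed
  then show ?thesis using K K' by (intro exI[of _ "4 * K * K' * (1 + max y 0)"]) (auto intro!: mult_pos_pos add_pos_nonneg)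
qed

lemma sin_ED_le: "\<bar>ED k (\<lambda>_ b. sin (s * b)) x y\<bar> \<le> qn k x y"
proof -
  have "norm (ED k (\<lambda>_ b. sin (s * b)) x y) \<le> ED k (\<lambda>_ _. 1) x y" by (rule EE_norm_le) simp
  then show ?thesis by (simp add: qn_def)
qed

text \<open>At frequency t / sqrt n both sine functionals converge by \<open>sine_tendsto\<close>,
  each with a factor t. Their exponentials combine with that of the middle piece to exp (- sg2 t^2 /
  2) for every p, and the Gaussian second moment gives the constant.\<close>

lemma JM_limit:
  assumes p: "8 \<le> p"
  defines "Vd \<equiv> mwalk.V0 (dual P \<nu>) (\<lambda>u. - f u)"
  shows "(\<lambda>n. real n * sqrt n * JM x y w p n z) \<longlonglongrightarrow> 2 / (sqrt (2 * pi) * sqrt sg2 ^ 3) * (V0 x y * Vd w z)"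
    and "\<exists>C. \<forall>n\<ge>p. \<forall>z. \<bar>real n * sqrt n * JM x y w p n z\<bar> \<le> C * (1 + max z 0)"
proof -
  interpret d: mwalk "dual P \<nu>" "\<lambda>u. - f u" \<nu> by (rule dual_mwalk)
  obtain C where C: "0 < C" "\<And>p n w z. 8 \<le> p \<Longrightarrow> p \<le> n \<Longrightarrow> n * (qn (s1 p n) x y * qd (s2 p n) w z) \<le> C * (1 + max z 0)"
    using qq_bound[of x y] by blast
  define h where "h n z t = exp (- sg2 * (real (n div p) / n) * t\<^sup>2 / 2) *
     (n * (ED (s1 p n) (\<lambda>_ b. sin (t / sqrt n * b)) x y * EDd (s2 p n) (\<lambda>_ u. sin (t / sqrt n * u)) w z))" for n z t
  \<comment> \<open>Majorant: the middle piece has at least n / (2 p) steps, so its Gaussian factor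
    is dominated uniformly in n.\<close>
  define g where "g t = exp (- (sg2 * (1 / (2 * p))) * t\<^sup>2 / 2)" for t :: real
  have gi: "integrable lborel g" unfolding g_def using sg2_pos p by (intro gauss_integrable) simp
  have hb: "\<bar>h n z t\<bar> \<le> g t * (C * (1 + max z 0))" if n: "p \<le> n" for n z t
  proof -
    note sb = split_bounds[OF p n]
    have "1 / (2 * p) \<le> real (n div p) / n"
    proof -
      have "real n \<le> 2 * real p * real (n div p)" using sb(5) by (metis of_nat_le_iff of_nat_mult of_nat_numeral)
      then show ?thesis using p n by (simp add: field_simps)
    qed
    then have "sg2 * (1 / (2 * p)) * t\<^sup>2 \<le> sg2 * (real (n div p) / n) * t\<^sup>2"
      using sg2_pos by (intro mult_right_mono mult_left_mono) auto
    then have e: "exp (- sg2 * (real (n div p) / n) * t\<^sup>2 / 2) \<le> g t"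
      unfolding g_def exp_le_cancel_iff mult_minus_left by (intro divide_right_mono le_imp_neg_le) auto
    have "\<bar>ED (s1 p n) (\<lambda>_ b. sin (t / sqrt n * b)) x y * EDd (s2 p n) (\<lambda>_ u. sin (t / sqrt n * u)) w z\<bar> \<le> qn (s1 p n) x y * qd (s2 p n) w z"
      unfolding abs_mult by (intro mult_mono sin_ED_le d.sin_ED_le[unfolded d.qn_def] qn_nonneg abs_ge_zero)
    then have "\<bar>n * (ED (s1 p n) (\<lambda>_ b. sin (t / sqrt n * b)) x y * EDd (s2 p n) (\<lambda>_ u. sin (t / sqrt n * u)) w z)\<bar> \<le> n * (qn (s1 p n) x y * qd (s2 p n) w z)"
      unfolding abs_mult[of "real n"] by (intro mult_mono) auto
    also have "\<dots> \<le> C * (1 + max z 0)" by (rule C(2)[OF p n])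
    finally have "\<bar>n * (ED (s1 p n) (\<lambda>_ b. sin (t / sqrt n * b)) x y * EDd (s2 p n) (\<lambda>_ u. sin (t / sqrt n * u)) w z)\<bar> \<le> C * (1 + max z 0)" .
    then show ?thesis unfolding h_def abs_mult[of "exp _"] using e by (intro mult_mono) (auto simp: g_def)
  qed
  have hm: "h n z \<in> borel_measurable lborel" for n z
  proof -
    have [measurable]: "(\<lambda>t. ED (s1 p n) (\<lambda>_ b. sin (t / sqrt n * b)) x y) \<in> borel_measurable lborel"
      by (rule EE_measurable_param) simp
    have [measurable]: "(\<lambda>t. EDd (s2 p n) (\<lambda>_ u. sin (t / sqrt n * u)) w z) \<in> borel_measurable lborel"
      by (rule EE_measurable_param) simp
    show ?thesis unfolding h_def by measurable
  qed
  have hi: "integrable lborel (h n z)" if n: "p \<le> n" for n z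
  proof (rule Bochner_Integration.integrable_bound[OF integrable_mult_left[OF gi, of "C * (1 + max z 0)"] hm])
    show "AE t in lborel. norm (h n z t) \<le> norm (g t * (C * (1 + max z 0)))"
      by (rule AE_I2, unfold real_norm_def, rule order.trans[OF hb[OF n] abs_ge_self])
  qed
  have sc: "real n * sqrt n * JM x y w p n z = 1 / pi * (\<integral>t. h n z t \<partial>lborel)" if n: "p \<le> n" for n z
    unfolding h_def by (rule JM_scaled) (use split_bounds(6)[OF p n] p n in auto)
  show "\<exists>C. \<forall>n\<ge>p. \<forall>z. \<bar>real n * sqrt n * JM x y w p n z\<bar> \<le> C * (1 + max z 0)"
  proof (intro exI allI impI)
    fix n z assume n: "p \<le> n"
    have "\<bar>\<integral>t. h n z t \<partial>lborel\<bar> \<le> (\<integral>t. \<bar>h n z t\<bar> \<partial>lborel)" by (rule integral_abs_bound)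
    also have "\<dots> \<le> (\<integral>t. g t * (C * (1 + max z 0)) \<partial>lborel)"
      by (rule integral_mono) (use hi[OF n] gi hb[OF n] in auto)
    also have "\<dots> = (\<integral>t. g t \<partial>lborel) * (C * (1 + max z 0))" by simp
    finally have "1 / pi * \<bar>\<integral>t. h n z t \<partial>lborel\<bar> \<le> 1 / pi * ((\<integral>t. g t \<partial>lborel) * (C * (1 + max z 0)))"
      by (intro mult_left_mono) auto
    then show "\<bar>real n * sqrt n * JM x y w p n z\<bar> \<le> (1 / pi * (\<integral>t. g t \<partial>lborel) * C) * (1 + max z 0)"
      unfolding sc[OF n] by (simp add: abs_mult mult_ac)
  qed
  \<comment> \<open>Limiting share of each outer piece; 1 / p + 2 \<kappa> = 1.\<close>
  define \<kappa> where "\<kappa> = (1 - 1 / p) / 2"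
  define L where "L t = V0 x y * Vd w z * (exp (- sg2 * t\<^sup>2 / 2) * t\<^sup>2)" for t
  have "(\<lambda>i. \<integral>t. h (i + p) z t \<partial>lborel) \<longlonglongrightarrow> (\<integral>t. L t \<partial>lborel)"
  proof (rule integral_dominated_convergence)
    show "integrable lborel (\<lambda>t. g t * (C * (1 + max z 0)))" using gi by simp
    show "h (i + p) z \<in> borel_measurable lborel" for i by (rule hm)
    show "L \<in> borel_measurable lborel" unfolding L_def by measurable
    show "AE t in lborel. norm (h (i + p) z t) \<le> g t * (C * (1 + max z 0))" for i
      using hb[of "i + p"] by (intro AE_I2) simp
    show "AE t in lborel. (\<lambda>i. h (i + p) z t) \<longlonglongrightarrow> L t"
      using AE_lborel_singleton[of 0]
    proof eventually_elim
      case (elim t)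
      define s where "s i = t / sqrt (real (i + p))" for i
      have ip: "0 < real (i + p)" for i using p by simp
      have ipt: "filterlim (\<lambda>i. i + p) at_top sequentially" by (rule filterlim_add_const_nat_at_top)
      have s: "s \<longlonglongrightarrow> 0" unfolding s_def
        by (intro tendsto_divide_0[OF tendsto_const] filterlim_at_top_imp_at_infinity
            filterlim_compose[OF sqrt_at_top] filterlim_compose[OF filterlim_real_sequentially ipt])
      have s0: "s i \<noteq> 0" for i unfolding s_def using elim ip[of i] by simp
      have sq: "(s i)\<^sup>2 * real N = t\<^sup>2 * (real N / real (i + p))" for i N
        unfolding s_def using ip[of i] by (simp add: power_divide)
      have l1: "filterlim (\<lambda>i. s1 p (i + p)) at_top sequentially" and l2: "filterlim (\<lambda>i. s2 p (i + p)) at_top sequentially"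
      proof -
        have "\<forall>i. i \<le> 4 * s1 p (i + p)" "\<forall>i. i \<le> 4 * s2 p (i + p)"
          using split_bounds(2,3)[OF p, of "_ + p"] by (auto intro: order.trans[OF le_add1[of _ p]])
        then have "Z \<le> s1 p (i + p)" "Z \<le> s2 p (i + p)" if "4 * Z \<le> i" for i Z
          using that by (auto simp: le_iff_add) (metis le_add1 order.trans mult_le_cancel1 zero_less_numeral le_iff_add)+
        then show "filterlim (\<lambda>i. s1 p (i + p)) at_top sequentially" "filterlim (\<lambda>i. s2 p (i + p)) at_top sequentially"
          unfolding filterlim_at_top eventually_sequentially by blast+
      qed
      have k1: "(\<lambda>i. (s i)\<^sup>2 * real (s1 p (i + p))) \<longlonglongrightarrow> t\<^sup>2 * \<kappa>"
        unfolding sq \<kappa>_def by (intro tendsto_mult_left filterlim_compose[OF ratio_limits(2)[OF p] ipt])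
      have k2: "(\<lambda>i. (s i)\<^sup>2 * real (s2 p (i + p))) \<longlonglongrightarrow> t\<^sup>2 * \<kappa>"
        unfolding sq \<kappa>_def by (intro tendsto_mult_left filterlim_compose[OF ratio_limits(3)[OF p] ipt])
      have e: "(\<lambda>i. exp (- sg2 * (real ((i + p) div p) / real (i + p)) * t\<^sup>2 / 2)) \<longlonglongrightarrow> exp (- sg2 * (1 / p) * t\<^sup>2 / 2)"
        by (intro tendsto_intros filterlim_compose[OF ratio_limits(1)[OF p] ipt]) simp
      have "(\<lambda>i. exp (- sg2 * (real ((i + p) div p) / real (i + p)) * t\<^sup>2 / 2) *
         (t\<^sup>2 * ((ED (s1 p (i + p)) (\<lambda>_ b. sin (s i * b)) x y / s i) * (EDd (s2 p (i + p)) (\<lambda>_ u. sin (s i * u)) w z / s i))))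
         \<longlonglongrightarrow> exp (- sg2 * (1 / p) * t\<^sup>2 / 2) * (t\<^sup>2 * ((V0 x y * exp (- sg2 * (t\<^sup>2 * \<kappa>) / 2)) * (Vd w z * exp (- sg2 * (t\<^sup>2 * \<kappa>) / 2))))"
        using d.sine_tendsto[OF s s0 l2 k2, of w z] unfolding sg2_dual Vd_def
        by (intro tendsto_mult e tendsto_const sine_tendsto[OF s s0 l1 k1])
      also have "exp (- sg2 * (1 / p) * t\<^sup>2 / 2) * (t\<^sup>2 * ((V0 x y * exp (- sg2 * (t\<^sup>2 * \<kappa>) / 2)) * (Vd w z * exp (- sg2 * (t\<^sup>2 * \<kappa>) / 2)))) = L t"
      proof -
        have "exp (- sg2 * (1 / p) * t\<^sup>2 / 2) * (exp (- sg2 * (t\<^sup>2 * \<kappa>) / 2) * exp (- sg2 * (t\<^sup>2 * \<kappa>) / 2)) = exp (- sg2 * t\<^sup>2 / 2)"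
          unfolding exp_add[symmetric] \<kappa>_def using p by (simp add: field_simps)
        moreover have "e0 * (t\<^sup>2 * ((v1 * e1) * (v2 * e1))) = v1 * v2 * ((e0 * (e1 * e1)) * t\<^sup>2)" for e0 e1 v1 v2 :: real
          by (simp add: mult_ac)
        ultimately show ?thesis unfolding L_def by simp
      qed
      finally show ?case
      proof (rule Lim_transform_eventually, intro always_eventually allI)
        fix i
        have "t\<^sup>2 = real (i + p) * (s i * s i)" unfolding s_def using ip[of i] by (simp add: power2_eq_square)
        then have "t\<^sup>2 * ((a / s i) * (b / s i)) = real (i + p) * (a * b)" for a b using s0[of i] by simp
        then show "exp (- sg2 * (real ((i + p) div p) / real (i + p)) * t\<^sup>2 / 2) *
         (t\<^sup>2 * ((ED (s1 p (i + p)) (\<lambda>_ b. sin (s i * b)) x y / s i) * (EDd (s2 p (i + p)) (\<lambda>_ u. sin (s i * u)) w z / s i))) = h (i + p) z t"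
          unfolding h_def s_def[symmetric] by (simp only:)
      qed
    qed
  qed
  then have "(\<lambda>i. 1 / pi * (\<integral>t. h (i + p) z t \<partial>lborel)) \<longlonglongrightarrow> 1 / pi * (\<integral>t. L t \<partial>lborel)" by (intro tendsto_intros)
  also have "1 / pi * (\<integral>t. L t \<partial>lborel) = 2 / (sqrt (2 * pi) * sqrt sg2 ^ 3) * (V0 x y * Vd w z)"
  proof -
    have e: "sqrt (2 * pi) / pi = 2 / sqrt (2 * pi)" by (simp add: field_simps)
    have "1 / pi * (\<integral>t. L t \<partial>lborel) = (sqrt (2 * pi) / pi) * (V0 x y * Vd w z / sqrt sg2 ^ 3)"
      unfolding L_def integral_mult_right_zero gauss_second_moment[OF sg2_pos] by simp
    then show ?thesis unfolding e by simp
  qed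
  finally have "(\<lambda>i. real (i + p) * sqrt (i + p) * JM x y w p (i + p) z) \<longlonglongrightarrow> 2 / (sqrt (2 * pi) * sqrt sg2 ^ 3) * (V0 x y * Vd w z)"
    by (simp only: sc[OF le_add2])
  then show "(\<lambda>n. real n * sqrt n * JM x y w p n z) \<longlonglongrightarrow> 2 / (sqrt (2 * pi) * sqrt sg2 ^ 3) * (V0 x y * Vd w z)"
    by (rule LIMSEQ_offset[where k=p])
qed

end

context mwalk
begin

text \<open>The middle piece has length about \<open>n / i^8\<close>; cutting at height \<open>sqrt n / i^3\<close> makes both the window term and the Gaussian tail of order \<open>1 / i^2\<close>.\<close>

lemma JP_bound:
  "\<exists>C>0. \<forall>i\<ge>2. \<forall>n\<ge>i^8. \<forall>z. 0 \<le> JP x y w (i^8) n z \<and> n * sqrt n * JP x y w (i^8) n z \<le> C / i\<^sup>2 * (1 + max z 0)"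
proof -
  interpret d: mwalk "dual P \<nu>" "\<lambda>u. - f u" \<nu> by (rule dual_mwalk)
  obtain Q where Q: "0 < Q" "\<And>p n w z. 8 \<le> p \<Longrightarrow> p \<le> n \<Longrightarrow> n * (qn (s1 p n) x y * qd (s2 p n) w z) \<le> Q * (1 + max z 0)"
    using qq_bound[of x y] by blast
  obtain W where W: "0 < W" "\<And>n L x y. 2 \<le> n \<Longrightarrow> 1 \<le> L \<Longrightarrow> ED n (win L) x y \<le> W * (1 + max y 0) * L / n"
    using window_bound by auto
  obtain W' where W': "0 < W'" "\<And>n L x y. 2 \<le> n \<Longrightarrow> 1 \<le> L \<Longrightarrow> EDd n (win L) x y \<le> W' * (1 + max y 0) * L / n"
    using d.window_bound by auto
  define c1 where "c1 = sqrt (2 / sg2)"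
  define C where "C = c1 * (16 * W * W' * (1 + max y 0) + 216 * sg2 ^ 3 * Q)"
  have c1: "0 < c1" unfolding c1_def using sg2_pos by simp
  have C: "0 < C" 
  proof -
    have "0 < 16 * W * W' * (1 + max y 0)" using W(1) W'(1) by (intro mult_pos_pos add_pos_nonneg) auto
    moreover have "0 < 216 * sg2 ^ 3 * Q" using Q(1) sg2_pos by (intro mult_pos_pos zero_less_power) auto
    ultimately show ?thesis unfolding C_def by (rule mult_pos_pos[OF c1 add_pos_pos])
  qed
  have "0 \<le> JP x y w (i^8) n z \<and> n * sqrt n * JP x y w (i^8) n z \<le> C / i\<^sup>2 * (1 + max z 0)" if i: "2 \<le> i" and n: "i^8 \<le> n" for i n z
  proof -
    define p where "p = i^8"
    have "2 ^ 8 \<le> p" unfolding p_def using i by (intro power_mono) auto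
    then have p8: "8 \<le> p" by simp
    have pn: "p \<le> n" using n by (simp add: p_def)
    note sb = split_bounds[OF p8 pn] and ss = split_sqrt[OF p8 pn]
    define j N1 N2 where "j = n div p" and "N1 = s1 p n" and "N2 = s2 p n"
    note defs = j_def[symmetric] N1_def[symmetric] N2_def[symmetric]
    note sb = sb[unfolded defs] and ss = ss[unfolded defs]
    have i0: "0 < real i" using i by simp
    have n0: "0 < real n" using ss(1) by simp
    define L where "L = sqrt n / i ^ 3"
    have L1: "1 \<le> L"
    proof -
      have "(real i ^ 3)\<^sup>2 \<le> real i ^ 8" using i by (simp flip: power_mult)
      also have "\<dots> \<le> n" using n by (metis of_nat_le_iff of_nat_power)
      finally have "real i ^ 3 \<le> sqrt n" by (rule real_le_rsqrt)
      then show ?thesis unfolding L_def using i0 by simp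
    qed
    have L2: "L\<^sup>2 = n / i ^ 6" unfolding L_def by (simp add: power_divide flip: power_mult)
    define \<kappa> where "\<kappa> = sg2 * j"
    have k: "0 < \<kappa>" unfolding \<kappa>_def using sb(6) sg2_pos by simp
    define Kc E0 where "Kc = 1 / sqrt (2 * pi * \<kappa>)" and "E0 = exp (- L\<^sup>2 / (2 * \<kappa>))"
    have Kc0: "0 \<le> Kc" unfolding Kc_def using k by simp
    \<comment> \<open>Unless both heights lie in the window, u + b is at least L and the Gaussian
      factor is at most E0.\<close>
    have gk_le: "gk \<kappa> (u + b) \<le> Kc * (indicator {0<..L} b * indicator {0<..L} u + E0 * 1)" if "0 < u" "0 < b" for u b
    proof -
      have "exp (- (u + b)\<^sup>2 / (2 * \<kappa>)) \<le> indicator {0<..L} b * indicator {0<..L} u + E0 * 1"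
      proof (cases "b \<le> L \<and> u \<le> L")
        case True
        have "exp (- (u + b)\<^sup>2 / (2 * \<kappa>)) \<le> 1" using k by simp
        then show ?thesis using True that unfolding E0_def by (simp add: add_increasing2)
      next
        case False
        then have "L \<le> u + b" using that by linarith
        then have "L\<^sup>2 \<le> (u + b)\<^sup>2" using L1 by (intro power_mono) auto
        then have "L\<^sup>2 / (2 * \<kappa>) \<le> (u + b)\<^sup>2 / (2 * \<kappa>)" using k by (intro divide_right_mono) auto
        then have "exp (- (u + b)\<^sup>2 / (2 * \<kappa>)) \<le> E0" unfolding E0_def by simp
        then show ?thesis using False by (auto simp: indicator_def)
      qed
      then have "Kc * exp (- (u + b)\<^sup>2 / (2 * \<kappa>)) \<le> Kc * (indicator {0<..L} b * indicator {0<..L} u + E0 * 1)"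
        by (intro mult_left_mono Kc0)
      then show ?thesis unfolding gk_def Kc_def by simp
    qed
    define A where "A = EDd N2 (win L) w z"
    define B where "B = qd N2 w z"
    have in_le: "EDd N2 (\<lambda>_ u. gk \<kappa> (u + b)) w z \<le> Kc * (indicator {0<..L} b * A + (E0 * B) * 1)" if "0 < b" for b
    proof -
      have "EDd N2 (\<lambda>_ u. gk \<kappa> (u + b)) w z \<le> EDd N2 (\<lambda>_ u. Kc * (indicator {0<..L} b * indicator {0<..L} u + E0 * 1)) w z"
        by (rule d.EE_mono_pos) (use gk_le that sb(8) in auto)
      also have "\<dots> = Kc * (indicator {0<..L} b * A + (E0 * B) * 1)"
        unfolding A_def B_def by (simp only: EE_cmult EE_add) simp
      finally show ?thesis .
    qed
    have JPe: "JP x y w p n z = ED N1 (\<lambda>_ b. EDd N2 (\<lambda>_ u. gk \<kappa> (u + b)) w z) x y"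
      unfolding JP_def defs \<kappa>_def ..
    have nonneg: "0 \<le> JP x y w p n z" unfolding JPe
      by (intro EE_nonneg d.EE_nonneg gk_nonneg k)
    have "JP x y w p n z \<le> ED N1 (\<lambda>_ b. Kc * (indicator {0<..L} b * A + (E0 * B) * 1)) x y"
      unfolding JPe by (rule EE_mono_pos) (use in_le sb(7) in auto)
    also have "\<dots> = Kc * (ED N1 (win L) x y * A + E0 * (qn N1 x y * B))"
      unfolding qn_def by (simp only: EE_cmult EE_add EE_multc) (simp add: mult_ac)
    finally have "n * sqrt n * JP x y w p n z \<le> n * sqrt n * (Kc * (ED N1 (win L) x y * A + E0 * (qn N1 x y * B)))"
      by (intro mult_left_mono) auto
    also have "\<dots> = (sqrt n * Kc) * (n * (ED N1 (win L) x y * A) + E0 * (n * (qn N1 x y * B)))"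
      by (simp add: algebra_simps)
    \<comment> \<open>The prefactor is at most c1 i^4 because the middle piece has at least n / (2
      i^8) steps. The two windows give L^2 / n = i^-6, and E0 is at most a multiple of i^-6, which
      leaves i^-2.\<close>
    also have "\<dots> \<le> (c1 * i ^ 4) * ((16 * W * W' * (1 + max y 0)) * (1 + max z 0) / i ^ 6 + (216 * sg2 ^ 3 / i ^ 6) * (Q * (1 + max z 0)))"
    proof -
      have "sqrt n * Kc \<le> sqrt n * (1 / sqrt \<kappa>)" unfolding Kc_def using k pi_gt3
        by (intro mult_left_mono divide_left_mono real_sqrt_le_mono) auto
      also have "\<dots> = sqrt (n / \<kappa>)" by (simp add: real_sqrt_divide)
      also have "\<dots> \<le> sqrt ((2 / sg2) * (real i ^ 4)\<^sup>2)"
      proof (rule real_sqrt_le_mono)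
        have "real n \<le> 2 * real p * real j" using sb(5) by (metis of_nat_le_iff of_nat_mult of_nat_numeral)
        then have "n / \<kappa> \<le> 2 * real p * real j / \<kappa>" using k by (intro divide_right_mono) auto
        also have "\<dots> = (2 / sg2) * real p" unfolding \<kappa>_def using sb(6) by simp
        finally show "n / \<kappa> \<le> (2 / sg2) * (real i ^ 4)\<^sup>2" unfolding p_def by (simp flip: power_mult)
      qed
      also have "\<dots> = c1 * i ^ 4" unfolding c1_def by (simp only: real_sqrt_mult real_sqrt_abs) simp
      finally have m1: "sqrt n * Kc \<le> c1 * i ^ 4" .
      have a1: "ED N1 (win L) x y \<le> W * (1 + max y 0) * L * (4 / n)"
      proof (rule order.trans[OF W(2)[OF sb(7) L1]])
        have "1 / real N1 \<le> 4 / n" using sb(2,7) n0 by (simp add: field_simps)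
        then have "W * (1 + max y 0) * L * (1 / real N1) \<le> W * (1 + max y 0) * L * (4 / n)" using W L1 by (intro mult_left_mono) auto
        then show "W * (1 + max y 0) * L / real N1 \<le> W * (1 + max y 0) * L * (4 / n)" by simp
      qed
      have a2: "A \<le> W' * (1 + max z 0) * L * (4 / n)" unfolding A_def
      proof (rule order.trans[OF W'(2)[OF sb(8) L1]])
        have "1 / real N2 \<le> 4 / n" using sb(3,8) n0 by (simp add: field_simps)
        then have "W' * (1 + max z 0) * L * (1 / real N2) \<le> W' * (1 + max z 0) * L * (4 / n)" using W' L1 by (intro mult_left_mono) auto
        then show "W' * (1 + max z 0) * L / real N2 \<le> W' * (1 + max z 0) * L * (4 / n)" by simp
      qed
      have A0: "0 \<le> A" unfolding A_def by (rule d.EE_nonneg) simp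
      have "n * (ED N1 (win L) x y * A) \<le> n * ((W * (1 + max y 0) * L * (4 / n)) * (W' * (1 + max z 0) * L * (4 / n)))"
        using A0 W L1 by (intro mult_left_mono mult_mono a1 a2) auto
      also have "\<dots> = (16 * W * W' * (1 + max y 0)) * (1 + max z 0) * (L\<^sup>2 / n)"
        using n0 by (simp add: power2_eq_square field_simps)
      also have "L\<^sup>2 / n = 1 / i ^ 6" unfolding L2 using n0 by simp
      finally have m2: "n * (ED N1 (win L) x y * A) \<le> (16 * W * W' * (1 + max y 0)) * (1 + max z 0) / i ^ 6" by simp
      have "i\<^sup>2 / (2 * sg2) \<le> L\<^sup>2 / (2 * \<kappa>)"
      proof -
        have "real p * real j \<le> real n" using sb(4) by (metis of_nat_le_iff of_nat_mult)
        then have "real i ^ 8 * j \<le> n" unfolding p_def by simp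
        then have "real i ^ 8 / i ^ 6 * j \<le> n / i ^ 6" using i0 by (simp add: divide_right_mono)
        moreover have "real i ^ 8 / real i ^ 6 = real i ^ 2" using i0 by (simp flip: power_diff)
        ultimately have "real i ^ 2 * j \<le> L\<^sup>2" unfolding L2 by simp
        then have "real i ^ 2 * j / (2 * \<kappa>) \<le> L\<^sup>2 / (2 * \<kappa>)" using k by (intro divide_right_mono) auto
        then show ?thesis unfolding \<kappa>_def using sb(6) by simp
      qed
      then have "E0 \<le> exp (- (i\<^sup>2 / (2 * sg2)))" unfolding E0_def by simp
      also have "\<dots> \<le> 27 / (i\<^sup>2 / (2 * sg2)) ^ 3" using i0 sg2_pos by (intro exp_minus_le_cube) simp
      also have "\<dots> = 216 * sg2 ^ 3 / i ^ 6" by (simp add: power_divide power_mult_distrib flip: power_mult)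
      finally have m3: "E0 \<le> 216 * sg2 ^ 3 / i ^ 6" .
      have m4: "n * (qn N1 x y * B) \<le> Q * (1 + max z 0)" unfolding B_def N1_def N2_def by (rule Q(2)[OF p8 pn])
      have m5: "0 \<le> n * (ED N1 (win L) x y * A) + E0 * (n * (qn N1 x y * B))"
        using A0 by (intro add_nonneg_nonneg mult_nonneg_nonneg EE_nonneg qn_nonneg) (auto simp: E0_def B_def intro!: d.EE_nonneg)
      have m6: "0 \<le> n * (qn N1 x y * B)" using qn_nonneg by (intro mult_nonneg_nonneg) (auto simp: B_def intro!: d.EE_nonneg)
      have m7: "0 \<le> 216 * sg2 ^ 3 / i ^ 6" "0 \<le> c1 * i ^ 4" using c1 sg2_pos by auto
      show ?thesis by (rule mult_mono[OF m1 add_mono[OF m2 mult_mono[OF m3 m4 m7(1) m6]] m7(2) m5])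
    qed
    also have "\<dots> = (c1 * (16 * W * W' * (1 + max y 0)) + c1 * (216 * sg2 ^ 3 * Q)) * (1 + max z 0) * (i ^ 4 / i ^ 6)"
      by (simp add: algebra_simps add_divide_distrib)
    also have "real (i ^ 4) / real (i ^ 6) = 1 / i\<^sup>2" using i0 by (simp add: field_simps flip: power_add)
    finally show ?thesis using nonneg unfolding C_def p_def by (simp add: algebra_simps add_divide_distrib)
  qed
  then show ?thesis using C by blast
qed

lemma JM_JP:
  assumes "0 < n div p"
  shows "(\<lambda>z. JM x y w p n z) \<in> borel_measurable borel" "(\<lambda>z. JP x y w p n z) \<in> borel_measurable borel"
    "ED (s1 p n) (\<lambda>_ b. EDd (s2 p n) (\<lambda>_ u. gk (sg2 * (n div p)) (u - b)) w z) x y = JM x y w p n z + JP x y w p n z"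
proof -
  show "(\<lambda>z. JM x y w p n z) \<in> borel_measurable borel" "(\<lambda>z. JP x y w p n z) \<in> borel_measurable borel"
    unfolding JM_def JP_def by (intro EE_measurable_param EE_measurable; measurable)+
  show "ED (s1 p n) (\<lambda>_ b. EDd (s2 p n) (\<lambda>_ u. gk (sg2 * (n div p)) (u - b)) w z) x y = JM x y w p n z + JP x y w p n z"
    unfolding JM_def JP_def by (simp only: EE_diff diff_add_cancel)
qed

text \<open>Duality turns the Gaussian part into a functional of the dual walk. The local limit
  error carries the factor \<nu> v, so it too is summed by duality, to a dual survival
  integral.\<close>

lemma Lam_approx:
  assumes T: "0 < T" and G: "adm G" and j: "1 \<le> j"
    and e: "\<And>x w y u. \<bar>Kf T a j x w y u - \<nu> w * gk (sg2 * j) (u - y)\<bar> \<le> \<nu> w * e / sqrt j"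
  shows "\<bar>Lam T a j k G w x y - \<nu> w * (\<integral>z. G z * EDd k (\<lambda>_ u. gk (sg2 * j) (u - y)) w z \<partial>lborel)\<bar>
    \<le> e / sqrt j * (\<nu> w * (\<integral>z. G z * qd k w z \<partial>lborel))"
proof -
  define \<kappa> where "\<kappa> = sg2 * j"
  have k: "0 < \<kappa>" using sg2_pos j by (simp add: \<kappa>_def)
  let ?U = "pos (U k G w)"
  have Ui: "integrable lborel (?U v)" for v by (rule pos_U_integrable) (rule admD(5)[OF G])
  have Un: "0 \<le> ?U v u" for v u using U_nonneg[of G k w v u] admD(2)[OF G] by simp
  have gkb: "\<bar>gk \<kappa> u\<bar> \<le> 1 / sqrt (2 * pi * \<kappa>)" for u using gk_le[OF k, of u] gk_nonneg[OF k, of u] by simp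
  have m: "(\<lambda>u. gk \<kappa> (u - y)) \<in> borel_measurable borel" by measurable
  have d1: "\<nu> w * (\<integral>z. G z * EDd k (\<lambda>_ u. gk \<kappa> (u - y)) w z \<partial>lborel) = (\<Sum>v\<in>UNIV. \<nu> v * (\<integral>u. gk \<kappa> (u - y) * ?U v u \<partial>lborel))"
    by (rule duality[OF G m gkb, symmetric])
  have d2: "\<nu> w * (\<integral>z. G z * qd k w z \<partial>lborel) = (\<Sum>v\<in>UNIV. \<nu> v * (\<integral>u. 1 * ?U v u \<partial>lborel))"
    by (rule duality[OF G, of "\<lambda>_. 1" 1, symmetric]) auto
  have i1: "integrable lborel (\<lambda>u. Kf T a j x v y u * ?U v u)" for v
    by (rule integrable_mult_bounded[OF Ui Kf_measurable, where B = "T / (2 * pi)"]) (use Kf_nonneg[OF T] Kf_le[OF T] in simp)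
  have i2: "integrable lborel (\<lambda>u. gk \<kappa> (u - y) * ?U v u)" for v
    by (rule integrable_mult_bounded[OF Ui m gkb])
  have eq: "Lam T a j k G w x y - \<nu> w * (\<integral>z. G z * EDd k (\<lambda>_ u. gk \<kappa> (u - y)) w z \<partial>lborel)
      = (\<Sum>v\<in>UNIV. \<integral>u. (Kf T a j x v y u - \<nu> v * gk \<kappa> (u - y)) * ?U v u \<partial>lborel)"
    unfolding d1 Lam_eq[OF T admD(5)[OF G]] sum_subtractf[symmetric]
  proof (rule sum.cong[OF refl])
    fix v
    have "\<nu> v * (\<integral>u. gk \<kappa> (u - y) * ?U v u \<partial>lborel) = (\<integral>u. \<nu> v * (gk \<kappa> (u - y) * ?U v u) \<partial>lborel)" by simp
    then show "(\<integral>u. Kf T a j x v y u * ?U v u \<partial>lborel) - \<nu> v * (\<integral>u. gk \<kappa> (u - y) * ?U v u \<partial>lborel) =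
        (\<integral>u. (Kf T a j x v y u - \<nu> v * gk \<kappa> (u - y)) * ?U v u \<partial>lborel)"
      using Bochner_Integration.integral_diff[OF i1[of v] integrable_mult_right[OF i2[of v], where c = "\<nu> v"]]
      by (simp add: algebra_simps)
  qed
  have "\<bar>\<Sum>v\<in>UNIV. \<integral>u. (Kf T a j x v y u - \<nu> v * gk \<kappa> (u - y)) * ?U v u \<partial>lborel\<bar>
      \<le> (\<Sum>v\<in>UNIV. e / sqrt j * (\<nu> v * (\<integral>u. 1 * ?U v u \<partial>lborel)))"
  proof (rule order.trans[OF sum_abs], rule sum_mono)
    fix v
    have ii: "integrable lborel (\<lambda>u. (Kf T a j x v y u - \<nu> v * gk \<kappa> (u - y)) * ?U v u)"
      using Bochner_Integration.integrable_diff[OF i1[of v] integrable_mult_right[OF i2[of v], where c = "\<nu> v"]]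
      by (simp add: algebra_simps)
    have "\<bar>\<integral>u. (Kf T a j x v y u - \<nu> v * gk \<kappa> (u - y)) * ?U v u \<partial>lborel\<bar> \<le> (\<integral>u. \<bar>(Kf T a j x v y u - \<nu> v * gk \<kappa> (u - y)) * ?U v u\<bar> \<partial>lborel)"
      by (rule integral_abs_bound)
    also have "\<dots> \<le> (\<integral>u. (\<nu> v * e / sqrt j) * ?U v u \<partial>lborel)"
    proof (rule integral_mono)
      show "integrable lborel (\<lambda>u. \<bar>(Kf T a j x v y u - \<nu> v * gk \<kappa> (u - y)) * ?U v u\<bar>)" using ii by (rule integrable_abs)
      show "integrable lborel (\<lambda>u. (\<nu> v * e / sqrt j) * ?U v u)" using Ui by (rule integrable_mult_right)
      fix u show "\<bar>(Kf T a j x v y u - \<nu> v * gk \<kappa> (u - y)) * ?U v u\<bar> \<le> (\<nu> v * e / sqrt j) * ?U v u"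
        unfolding \<kappa>_def by (subst abs_mult, subst abs_of_nonneg[OF Un], rule mult_right_mono[OF e Un])
    qed
    also have "\<dots> = e / sqrt j * (\<nu> v * (\<integral>u. 1 * ?U v u \<partial>lborel))" by simp
    finally show "\<bar>\<integral>u. (Kf T a j x v y u - \<nu> v * gk \<kappa> (u - y)) * ?U v u \<partial>lborel\<bar> \<le> e / sqrt j * (\<nu> v * (\<integral>u. 1 * ?U v u \<partial>lborel))" .
  qed
  then show ?thesis unfolding \<kappa>_def[symmetric] eq d2 sum_distrib_left by (simp add: mult_ac)
qed

abbreviation Vd :: "'x \<Rightarrow> real \<Rightarrow> real" where "Vd \<equiv> mwalk.V0 (dual P \<nu>) (\<lambda>u. - f u)"

text \<open>1 / pi from the product formula times the Gaussian second moment sqrt (2 pi) /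
  \<sigma>^3.\<close>

definition c0 :: real where "c0 = 2 / (sqrt (2 * pi) * sqrt sg2 ^ 3)"

text \<open>\<open>JM\<close> provides the limit, and \<open>JP\<close>, being nonnegative, enters
  only the upper bound, with a term of order i^-2. The constant is independent of i, T, a, G and e,
  so i may be chosen after it.\<close>

lemma free_limit:
  "\<exists>C>0. \<forall>i\<ge>2. \<forall>T>0. \<forall>a G e. adm G \<longrightarrow> 0 < e \<longrightarrow> (\<forall>\<^sub>F n in sequentially.
     c0 * V0 x y * (\<nu> w * (\<integral>z. G z * Vd w z \<partial>lborel)) - e \<le> n * sqrt n * ED (s1 (i^8) n) (Lam T a (n div i^8) (s2 (i^8) n) G w) x y \<and>
     n * sqrt n * ED (s1 (i^8) n) (Lam T a (n div i^8) (s2 (i^8) n) G w) x y \<le> c0 * V0 x y * (\<nu> w * (\<integral>z. G z * Vd w z \<partial>lborel)) + C * mass G / (real i)\<^sup>2 + e)"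
proof -
  interpret d: mwalk "dual P \<nu>" "\<lambda>u. - f u" \<nu> by (rule dual_mwalk)
  obtain C0 where C0: "0 < C0" "\<forall>i\<ge>2. \<forall>n\<ge>i^8. \<forall>z. 0 \<le> JP x y w (i^8) n z \<and> n * sqrt n * JP x y w (i^8) n z \<le> C0 / i\<^sup>2 * (1 + max z 0)"
    using JP_bound by blast
  obtain Q where Q: "0 < Q" "\<forall>p\<ge>8. \<forall>n\<ge>p. \<forall>w z. n * (qn (s1 p n) x y * qd (s2 p n) w z) \<le> Q * (1 + max z 0)"
    using qq_bound[of x y] by blast
  have main: "\<forall>\<^sub>F n in sequentially.
     c0 * V0 x y * (\<nu> w * (\<integral>z. G z * Vd w z \<partial>lborel)) - e \<le> n * sqrt n * ED (s1 (i^8) n) (Lam T a (n div i^8) (s2 (i^8) n) G w) x y \<and>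
     n * sqrt n * ED (s1 (i^8) n) (Lam T a (n div i^8) (s2 (i^8) n) G w) x y \<le> c0 * V0 x y * (\<nu> w * (\<integral>z. G z * Vd w z \<partial>lborel)) + (\<nu> w * C0) * mass G / (real i)\<^sup>2 + e"
    if i: "2 \<le> i" and T: "0 < T" and G: "adm G" and e: "0 < e" for i :: nat and T a G e
  proof -
    define p where "p = i^8"
    have "2 ^ 8 \<le> p" unfolding p_def using i by (intro power_mono) auto
    then have p8: "8 \<le> p" by simp
    obtain \<epsilon> where \<epsilon>: "\<epsilon> \<longlonglongrightarrow> 0" "\<forall>j\<ge>1. \<forall>x w y u. \<bar>Kf T a j x w y u - \<nu> w * gk (sg2 * j) (u - y)\<bar> \<le> \<nu> w * \<epsilon> j / sqrt j"
      using local_limit[OF T] by blast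
    obtain CM where CM: "\<forall>n\<ge>p. \<forall>z. \<bar>real n * sqrt n * JM x y w p n z\<bar> \<le> CM * (1 + max z 0)"
      using JM_limit(2)[OF p8] by blast
    have maxabs: "c * (1 + max z 0) = c * (1 + \<bar>z\<bar>)" if "0 \<le> z" for c z :: real using that by (simp add: max_def)
    define X where "X n = real n * sqrt n * ED (s1 p n) (Lam T a (n div p) (s2 p n) G w) x y" for n
    define A where "A n = (\<integral>z. G z * (real n * sqrt n * JM x y w p n z) \<partial>lborel)" for n
    define B where "B n = (\<integral>z. G z * (real n * sqrt n * JP x y w p n z) \<partial>lborel)" for n
    \<comment> \<open>Local limit error: for fixed p the ratio sqrt (n / j) is at most sqrt (2 p),
      so the bound vanishes with \<epsilon>.\<close>
    define R where "R n = sqrt (2 * p) * (Q * mass G * \<nu> w) * \<bar>\<epsilon> (n div p)\<bar>" for n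
    have est: "\<bar>X n - \<nu> w * (A n + B n)\<bar> \<le> R n \<and> 0 \<le> B n \<and> B n \<le> C0 / i\<^sup>2 * mass G" if n: "p \<le> n" for n
    proof -
      note sb = split_bounds[OF p8 n]
      have j0: "0 < n div p" using sb(6) by simp
      define j N1 N2 where "j = n div p" and "N1 = s1 p n" and "N2 = s2 p n"
      note defs = j_def[symmetric] N1_def[symmetric] N2_def[symmetric]
      note sb = sb[unfolded defs] and JJ = JM_JP[OF j0, unfolded defs]
      define \<kappa> where "\<kappa> = sg2 * j"
      have k: "0 < \<kappa>" unfolding \<kappa>_def using sb(6) sg2_pos by simp
      define q where "q = (\<integral>z. G z * qd N2 w z \<partial>lborel)"
      define H where "H z b = G z * EDd N2 (\<lambda>_ u. gk \<kappa> (u - b)) w z" for z b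
      have gkb: "\<bar>gk \<kappa> u\<bar> \<le> 1 / sqrt (2 * pi * \<kappa>)" for u using gk_le[OF k, of u] gk_nonneg[OF k, of u] by simp
      have Hi: "integrable lborel (\<lambda>z. H z b)" for b
      proof -
        have "integrable lborel (\<lambda>z. EDd N2 (\<lambda>_ u. gk \<kappa> (u - b)) w z * G z)"
        proof (rule integrable_mult_bounded[OF admD(5)[OF G]])
          show "(\<lambda>z. EDd N2 (\<lambda>_ u. gk \<kappa> (u - b)) w z) \<in> borel_measurable borel" by (intro EE_measurable; measurable)
          fix z
          have "norm (EDd N2 (\<lambda>_ u. gk \<kappa> (u - b)) w z) \<le> EDd N2 (\<lambda>_ _. 1 / sqrt (2 * pi * \<kappa>)) w z" by (rule d.EE_norm_le) (use gkb in simp)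
          also have "\<dots> \<le> EE (dual P \<nu>) (\<lambda>u. - f u) UNIV N2 (\<lambda>_ _. 1 / sqrt (2 * pi * \<kappa>)) w z" using k by (intro d.EE_le_UNIV) simp
          also have "\<dots> = 1 / sqrt (2 * pi * \<kappa>)" by (rule d.EE_UNIV_const)
          finally show "\<bar>EDd N2 (\<lambda>_ u. gk \<kappa> (u - b)) w z\<bar> \<le> 1 / sqrt (2 * pi * \<kappa>)" by simp
        qed
        then show ?thesis unfolding H_def by (simp add: mult.commute)
      qed
      have La: "\<bar>Lam T a j N2 G w x' b - \<nu> w * (\<integral>z. H z b \<partial>lborel)\<bar> \<le> \<epsilon> j / sqrt j * (\<nu> w * q)" for x' b
        unfolding H_def q_def \<kappa>_def using \<epsilon>(2) sb(6) by (intro Lam_approx[OF T G]) auto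
      have "norm (ED N1 (\<lambda>x' b. Lam T a j N2 G w x' b - \<nu> w * (\<integral>z. H z b \<partial>lborel)) x y) \<le> ED N1 (\<lambda>_ _. \<epsilon> j / sqrt j * (\<nu> w * q)) x y"
        by (rule EE_norm_le) (use La in simp)
      moreover have "ED N1 (\<lambda>x' b. Lam T a j N2 G w x' b - \<nu> w * (\<integral>z. H z b \<partial>lborel)) x y
          = ED N1 (Lam T a j N2 G w) x y - \<nu> w * (\<integral>z. ED N1 (\<lambda>_. H z) x y \<partial>lborel)"
        unfolding EE_diff EE_cmult using EE_integral[of lborel "\<lambda>z _ b. H z b" P f "{0<..}" N1 x y] Hi by simp
      moreover have "ED N1 (\<lambda>_ _. \<epsilon> j / sqrt j * (\<nu> w * q)) x y = \<epsilon> j / sqrt j * (\<nu> w * q) * qn N1 x y"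
        unfolding qn_def EE_cmult[symmetric] by simp
      ultimately have d1: "\<bar>ED N1 (Lam T a j N2 G w) x y - \<nu> w * (\<integral>z. ED N1 (\<lambda>_. H z) x y \<partial>lborel)\<bar> \<le> \<epsilon> j / sqrt j * (\<nu> w * q) * qn N1 x y" by simp
      have H2: "ED N1 (\<lambda>_. H z) x y = G z * JM x y w p n z + G z * JP x y w p n z" for z
        unfolding H_def EE_cmult \<kappa>_def JJ(3) by (simp add: algebra_simps)
      have JPb: "0 \<le> JP x y w p n z" "n * sqrt n * JP x y w p n z \<le> C0 / i\<^sup>2 * (1 + max z 0)" for z
        using C0(2) i n unfolding p_def by auto
      have Ai: "integrable lborel (\<lambda>z. G z * (real n * sqrt n * JM x y w p n z))"
      proof (rule adm_weighted(1)[OF G])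
        show "(\<lambda>z. real n * sqrt n * JM x y w p n z) \<in> borel_measurable borel" using JJ(1) by measurable
        fix z :: real assume z: "0 \<le> z"
        have "\<bar>real n * sqrt n * JM x y w p n z\<bar> \<le> CM * (1 + max z 0)" using CM n by blast
        then show "\<bar>real n * sqrt n * JM x y w p n z\<bar> \<le> CM * (1 + \<bar>z\<bar>)" unfolding maxabs[OF z] .
      qed
      have Bi: "integrable lborel (\<lambda>z. G z * (real n * sqrt n * JP x y w p n z))" and
        Bb: "\<bar>\<integral>z. G z * (real n * sqrt n * JP x y w p n z) \<partial>lborel\<bar> \<le> C0 / i\<^sup>2 * mass G"
      proof -
        have m: "(\<lambda>z. real n * sqrt n * JP x y w p n z) \<in> borel_measurable borel" using JJ(2) by measurable
        have b: "\<bar>real n * sqrt n * JP x y w p n z\<bar> \<le> C0 / i\<^sup>2 * (1 + \<bar>z\<bar>)" if "0 \<le> z" for z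
        proof -
          have "\<bar>real n * sqrt n * JP x y w p n z\<bar> = real n * sqrt n * JP x y w p n z" using JPb(1)[of z] by (simp add: abs_mult)
          then show ?thesis using JPb(2)[of z] unfolding maxabs[OF that] by simp
        qed
        show "integrable lborel (\<lambda>z. G z * (real n * sqrt n * JP x y w p n z))" by (rule adm_weighted(1)[OF G m b])
        show "\<bar>\<integral>z. G z * (real n * sqrt n * JP x y w p n z) \<partial>lborel\<bar> \<le> C0 / i\<^sup>2 * mass G" by (rule adm_weighted(2)[OF G m b])
      qed
      have AB: "n * sqrt n * (\<integral>z. ED N1 (\<lambda>_. H z) x y \<partial>lborel) = A n + B n"
      proof -
        have "n * sqrt n * (\<integral>z. ED N1 (\<lambda>_. H z) x y \<partial>lborel) = (\<integral>z. n * sqrt n * ED N1 (\<lambda>_. H z) x y \<partial>lborel)" by simp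
        also have "\<dots> = (\<integral>z. G z * (real n * sqrt n * JM x y w p n z) + G z * (real n * sqrt n * JP x y w p n z) \<partial>lborel)"
          unfolding H2 by (simp add: algebra_simps)
        also have "\<dots> = A n + B n" unfolding A_def B_def by (rule Bochner_Integration.integral_add[OF Ai Bi])
        finally show ?thesis .
      qed
      have B0: "0 \<le> B n" unfolding B_def using JPb(1) admD(2)[OF G] by (intro Bochner_Integration.integral_nonneg) simp
      have qq: "n * (qn N1 x y * q) \<le> Q * mass G"
      proof -
        have m: "(\<lambda>z. n * (qn N1 x y * qd N2 w z)) \<in> borel_measurable borel" using qd_measurable[of N2 w] by measurable
        have b: "\<bar>n * (qn N1 x y * qd N2 w z)\<bar> \<le> Q * (1 + \<bar>z\<bar>)" if "0 \<le> z" for z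
        proof -
          have "0 \<le> qd N2 w z" by (rule d.EE_nonneg) simp
          then have "\<bar>n * (qn N1 x y * qd N2 w z)\<bar> = n * (qn N1 x y * qd N2 w z)" using qn_nonneg by (simp add: abs_mult)
          also have "\<dots> \<le> Q * (1 + max z 0)" unfolding N1_def N2_def using Q(2) p8 n by blast
          finally show ?thesis using maxabs[OF that] by simp
        qed
        have "(\<integral>z. G z * (n * (qn N1 x y * qd N2 w z)) \<partial>lborel) \<le> Q * mass G" using adm_weighted(2)[OF G m b] by simp
        moreover have "(\<integral>z. G z * (n * (qn N1 x y * qd N2 w z)) \<partial>lborel) = (\<integral>z. (n * qn N1 x y) * (G z * qd N2 w z) \<partial>lborel)" by (simp add: mult_ac)
        moreover have "\<dots> = (n * qn N1 x y) * q" unfolding q_def by (rule integral_mult_right_zero)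
        ultimately show ?thesis by (metis mult.assoc)
      qed
      have q0: "0 \<le> q" unfolding q_def using admD(2)[OF G] by (intro Bochner_Integration.integral_nonneg mult_nonneg_nonneg d.EE_nonneg) auto
      have sq: "sqrt n / sqrt j \<le> sqrt (2 * p)"
      proof -
        have "real n \<le> 2 * real p * real j" using sb(5) by (metis of_nat_le_iff of_nat_mult of_nat_numeral)
        then have "sqrt n \<le> sqrt (2 * real p) * sqrt j" by (metis real_sqrt_le_mono real_sqrt_mult)
        then show ?thesis using sb(6) by (simp add: divide_le_eq)
      qed
      have "X n - \<nu> w * (A n + B n) = n * sqrt n * (ED N1 (Lam T a j N2 G w) x y - \<nu> w * (\<integral>z. ED N1 (\<lambda>_. H z) x y \<partial>lborel))"
        unfolding AB[symmetric] X_def N1_def N2_def j_def by (simp add: algebra_simps)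
      then have "\<bar>X n - \<nu> w * (A n + B n)\<bar> = n * sqrt n * \<bar>ED N1 (Lam T a j N2 G w) x y - \<nu> w * (\<integral>z. ED N1 (\<lambda>_. H z) x y \<partial>lborel)\<bar>"
        by (simp add: abs_mult)
      moreover have "n * sqrt n * \<bar>ED N1 (Lam T a j N2 G w) x y - \<nu> w * (\<integral>z. ED N1 (\<lambda>_. H z) x y \<partial>lborel)\<bar> \<le> n * sqrt n * (\<epsilon> j / sqrt j * (\<nu> w * q) * qn N1 x y)"
        by (intro mult_left_mono d1) simp
      moreover have "n * sqrt n * (\<epsilon> j / sqrt j * (\<nu> w * q) * qn N1 x y) = (sqrt n / sqrt j) * ((n * (qn N1 x y * q)) * \<nu> w) * \<epsilon> j" by simp
      moreover have "(sqrt n / sqrt j) * ((n * (qn N1 x y * q)) * \<nu> w) * \<epsilon> j \<le> sqrt (2 * p) * (Q * mass G * \<nu> w) * \<bar>\<epsilon> j\<bar>"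
      proof (rule order.trans[OF mult_left_mono[OF abs_ge_self]])
        show "0 \<le> (sqrt n / sqrt j) * ((n * (qn N1 x y * q)) * \<nu> w)" using q0 qn_nonneg nu_pos[of w] by simp
        show "(sqrt n / sqrt j) * ((n * (qn N1 x y * q)) * \<nu> w) * \<bar>\<epsilon> j\<bar> \<le> sqrt (2 * p) * (Q * mass G * \<nu> w) * \<bar>\<epsilon> j\<bar>"
          using q0 qn_nonneg nu_pos[of w] by (intro mult_right_mono mult_mono sq qq) auto
      qed
      ultimately have "\<bar>X n - \<nu> w * (A n + B n)\<bar> \<le> R n" unfolding R_def j_def by linarith
      then show ?thesis using B0 Bb unfolding B_def by simp
    qed
    have Alim: "A \<longlonglongrightarrow> (\<integral>z. G z * (c0 * (V0 x y * Vd w z)) \<partial>lborel)"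
    proof (rule LIMSEQ_offset[of _ p], unfold A_def)
      have JMm: "(\<lambda>z. JM x y w p (n + p) z) \<in> borel_measurable borel" for n by (rule JM_JP(1)) (use p8 in \<open>simp add: div_greater_zero_iff\<close>)
      note [measurable] = JMm admD(1)[OF G] d.V0_measurable
      show "(\<lambda>n. \<integral>z. G z * (real (n + p) * sqrt (real (n + p)) * JM x y w p (n + p) z) \<partial>lborel) \<longlonglongrightarrow> (\<integral>z. G z * (c0 * (V0 x y * Vd w z)) \<partial>lborel)"
      proof (rule integral_dominated_convergence[where w = "\<lambda>z. CM * ((1 + \<bar>z\<bar>) * G z)"])
        show "integrable lborel (\<lambda>z. CM * ((1 + \<bar>z\<bar>) * G z))" using admD(4)[OF G] by (rule integrable_mult_right)
        show "AE z in lborel. (\<lambda>n. G z * (real (n + p) * sqrt (real (n + p)) * JM x y w p (n + p) z)) \<longlonglongrightarrow> G z * (c0 * (V0 x y * Vd w z))"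
          unfolding c0_def by (intro AE_I2 tendsto_mult_left LIMSEQ_ignore_initial_segment[OF JM_limit(1)[OF p8, of x y w]])
        show "AE z in lborel. norm (G z * (real (n + p) * sqrt (real (n + p)) * JM x y w p (n + p) z)) \<le> CM * ((1 + \<bar>z\<bar>) * G z)" for n
        proof (intro AE_I2)
          fix z
          show "norm (G z * (real (n + p) * sqrt (real (n + p)) * JM x y w p (n + p) z)) \<le> CM * ((1 + \<bar>z\<bar>) * G z)"
          proof (cases "z \<le> 0")
            case True then show ?thesis using admD(3)[OF G] by simp
          next
            case False
            have "\<bar>real (n + p) * sqrt (real (n + p)) * JM x y w p (n + p) z\<bar> \<le> CM * (1 + max z 0)" using CM[rule_format, of "n + p" z] by simp
            then have "\<bar>real (n + p) * sqrt (real (n + p)) * JM x y w p (n + p) z\<bar> \<le> CM * (1 + \<bar>z\<bar>)" using maxabs[of z CM] False by simp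
            from mult_left_mono[OF this admD(2)[OF G, of z]] show ?thesis
              using admD(2)[OF G, of z] by (simp only: real_norm_def abs_mult abs_of_nonneg mult_ac)
          qed
        qed
      qed measurable
    qed
    have "(\<integral>z. G z * (c0 * (V0 x y * Vd w z)) \<partial>lborel) = (\<integral>z. (c0 * V0 x y) * (G z * Vd w z) \<partial>lborel)" by (simp add: mult_ac)
    also have "\<dots> = (c0 * V0 x y) * (\<integral>z. G z * Vd w z \<partial>lborel)" by (rule integral_mult_right_zero)
    finally have Ieq: "(\<integral>z. G z * (c0 * (V0 x y * Vd w z)) \<partial>lborel) = (c0 * V0 x y) * (\<integral>z. G z * Vd w z \<partial>lborel)" .
    have A2: "(\<lambda>n. \<nu> w * A n) \<longlonglongrightarrow> c0 * V0 x y * (\<nu> w * (\<integral>z. G z * Vd w z \<partial>lborel))"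
      using tendsto_mult_left[OF Alim, of "\<nu> w"] unfolding Ieq by (simp add: mult_ac)
    have dv: "filterlim (\<lambda>n. n div p) at_top sequentially"
      unfolding filterlim_at_top
    proof
      fix Z :: nat
      show "\<forall>\<^sub>F n in sequentially. Z \<le> n div p"
        using eventually_ge_at_top[of "Z * p"] by eventually_elim (use p8 in \<open>simp add: less_eq_div_iff_mult_less_eq\<close>)
    qed
    have R0: "R \<longlonglongrightarrow> 0"
      unfolding R_def using tendsto_mult_left[OF tendsto_rabs[OF filterlim_compose[OF \<epsilon>(1) dv]], of "sqrt (2 * p) * (Q * mass G * \<nu> w)"] by simp
    have ev1: "\<forall>\<^sub>F n in sequentially. dist (\<nu> w * A n) (c0 * V0 x y * (\<nu> w * (\<integral>z. G z * Vd w z \<partial>lborel))) < e / 2"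
      using A2 e by (intro tendstoD) auto
    have ev2: "\<forall>\<^sub>F n in sequentially. R n < e / 2" using R0 e by (intro order_tendstoD(2)[of R 0]) auto
    show ?thesis
      using ev1 ev2 eventually_ge_at_top[of p]
    proof eventually_elim
      case (elim n)
      note es = est[OF elim(3)]
      define L where "L = c0 * V0 x y * (\<nu> w * (\<integral>z. G z * Vd w z \<partial>lborel))"
      have 1: "\<bar>\<nu> w * A n - L\<bar> < e / 2" using elim(1) by (simp add: L_def dist_real_def)
      have 2: "0 \<le> \<nu> w * B n" "\<nu> w * B n \<le> \<nu> w * (C0 / i\<^sup>2 * mass G)" 
        using mult_left_mono[OF conjunct2[OF conjunct2[OF es]] less_imp_le[OF nu_pos[of w]]] mult_nonneg_nonneg[OF less_imp_le[OF nu_pos[of w]] conjunct1[OF conjunct2[OF es]]] by blast+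
      have 3: "\<bar>X n - (\<nu> w * A n + \<nu> w * B n)\<bar> < e / 2" using es elim(2) by (simp add: distrib_left)
      have 4: "\<nu> w * (C0 / i\<^sup>2 * mass G) = (\<nu> w * C0) * mass G / (real i)\<^sup>2" by simp
      show ?case using 1 2 3 unfolding 4 X_def p_def L_def[symmetric] by linarith
    qed
  qed
  have "0 < \<nu> w * C0" using C0(1) nu_pos[of w] by simp
  with main show ?thesis by (intro exI[of _ "\<nu> w * C0"] conjI allI impI) auto
qed

end

section \<open>Two-sided asymptotic bounds for the killed functional\<close>

context mwalk
begin

lemma V0_nonneg: "0 \<le> V0 x y" using V0_bounds by blast

lemma limit_nonneg:
  assumes "adm G" shows "0 \<le> c0 * V0 x y * (\<nu> w * (\<integral>z. G z * Vd w z \<partial>lborel))"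
proof -
  interpret d: mwalk "dual P \<nu>" "\<lambda>u. - f u" \<nu> by (rule dual_mwalk)
  have "0 \<le> c0" unfolding c0_def using sg2_pos by simp
  moreover have "0 \<le> (\<integral>z. G z * Vd w z \<partial>lborel)"
    using admD(2)[OF assms] d.V0_nonneg by (intro Bochner_Integration.integral_nonneg) simp
  ultimately show ?thesis using nu_pos[of w] V0_nonneg by (intro mult_nonneg_nonneg) auto
qed

text \<open>After the initial killed piece, \<open>smooth_upper\<close> applies pointwise. First i
  is taken large to absorb the reflected Gaussian term, then T to make the smoothing loss \<theta>
  small; n tends to infinity last.\<close>

lemma upper_limit:
  assumes G: "adm G" and G': "adm G'" and h: "0 < h" and R: "shifts h G G'" and e: "0 < e"
  shows "\<forall>\<^sub>F n in sequentially. n * sqrt n * U n G w x y \<le> c0 * V0 x y * (\<nu> w * (\<integral>z. G' z * Vd w z \<partial>lborel)) + e"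
proof -
  define A where "A = c0 * V0 x y * (\<nu> w * (\<integral>z. G' z * Vd w z \<partial>lborel))"
  have A: "0 \<le> A" unfolding A_def by (rule limit_nonneg[OF G'])
  obtain C where C: "0 < C" "\<forall>i\<ge>2. \<forall>T>0. \<forall>a G e. adm G \<longrightarrow> 0 < e \<longrightarrow> (\<forall>\<^sub>F n in sequentially.
     c0 * V0 x y * (\<nu> w * (\<integral>z. G z * Vd w z \<partial>lborel)) - e \<le> n * sqrt n * ED (s1 (i^8) n) (Lam T a (n div i^8) (s2 (i^8) n) G w) x y \<and>
     n * sqrt n * ED (s1 (i^8) n) (Lam T a (n div i^8) (s2 (i^8) n) G w) x y \<le> c0 * V0 x y * (\<nu> w * (\<integral>z. G z * Vd w z \<partial>lborel)) + C * mass G / (real i)\<^sup>2 + e)"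
    using free_limit[of x y w] by (elim exE conjE)
  have m0: "0 \<le> C * mass G'" using C(1) admD(6)[OF G'] by simp
  obtain i0 :: nat where i0: "4 * (C * mass G') / e \<le> real i0" using real_arch_simple by blast
  define i where "i = max 2 i0"
  have i: "2 \<le> i" by (simp add: i_def)
  have ie: "C * mass G' / (real i)\<^sup>2 \<le> e / 4"
  proof -
    have "4 * (C * mass G') \<le> e * real i" using i0 e unfolding i_def by (simp add: divide_le_eq mult.commute max_def mult_left_mono order.trans[of _ "e * real i0"])
    also have "real i \<le> real i ^ 2" using i by (simp add: power2_eq_square)
    finally have "4 * (C * mass G') \<le> e * (real i)\<^sup>2" using e by (simp add: mult_left_mono)
    then show ?thesis using i by (simp add: field_simps)
  qed
  \<comment> \<open>Chosen so that (1 - \<theta>) (A + e) = A + e / 2.\<close>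
  define \<theta> where "\<theta> = e / (2 * (A + e))"
  have \<theta>: "0 < \<theta>" "\<theta> \<le> 1 / 2" unfolding \<theta>_def using A e by (auto simp: divide_le_eq)
  have \<theta>2: "\<theta> * (A + e) = e / 2" unfolding \<theta>_def using A e by (simp add: field_simps)
  define T where "T = 8 / (pi * h * \<theta>)"
  have T: "0 < T" unfolding T_def using h \<theta> by simp
  have T\<theta>: "8 / (pi * T * h) = \<theta>" unfolding T_def using h \<theta> by simp
  define p where "p = i^8"
  have "2 ^ 8 \<le> p" unfolding p_def using i by (intro power_mono) auto
  then have p8: "8 \<le> p" by simp
  have "\<forall>\<^sub>F n in sequentially.
     c0 * V0 x y * (\<nu> w * (\<integral>z. G' z * Vd w z \<partial>lborel)) - e / 4 \<le> n * sqrt n * ED (s1 (i^8) n) (Lam T (h / 2) (n div i^8) (s2 (i^8) n) G' w) x y \<and>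
     n * sqrt n * ED (s1 (i^8) n) (Lam T (h / 2) (n div i^8) (s2 (i^8) n) G' w) x y \<le> c0 * V0 x y * (\<nu> w * (\<integral>z. G' z * Vd w z \<partial>lborel)) + C * mass G' / (real i)\<^sup>2 + e / 4"
    by (rule C(2)[rule_format, OF i T G']) (use e in simp)
  then show ?thesis using eventually_ge_at_top[of p]
  proof eventually_elim
    case (elim n)
    note sb = split_bounds[OF p8 elim(2)]
    have "U n G w x y = ED (s1 p n) (U (n div p + s2 p n) G w) x y" using U_add[of "s1 p n" "n div p + s2 p n" G w x y] unfolding sb(1) .
    then have "(1 - \<theta>) * U n G w x y = ED (s1 p n) (\<lambda>x' b. (1 - \<theta>) * U (n div p + s2 p n) G w x' b) x y" by (simp add: EE_cmult)
    also have "\<dots> \<le> ED (s1 p n) (Lam T (h / 2) (n div p) (s2 p n) G' w) x y"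
      by (rule EE_mono) (use smooth_upper[OF T h G G' R, of "n div p" "s2 p n" w] sb(6) T\<theta> in auto)
    finally have le: "n * sqrt n * ((1 - \<theta>) * U n G w x y) \<le> n * sqrt n * ED (s1 p n) (Lam T (h / 2) (n div p) (s2 p n) G' w) x y"
      by (intro mult_left_mono) auto
    have 1: "(1 - \<theta>) * (n * sqrt n * U n G w x y) \<le> A + e / 2"
    proof -
      have "n * sqrt n * ED (s1 p n) (Lam T (h / 2) (n div p) (s2 p n) G' w) x y \<le> A + C * mass G' / (real i)\<^sup>2 + e / 4"
        using elim(1) unfolding A_def p_def by blast
      moreover have "(1 - \<theta>) * (n * sqrt n * U n G w x y) = n * sqrt n * ((1 - \<theta>) * U n G w x y)" by simp
      ultimately show ?thesis using le ie by linarith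
    qed
    also have "A + e / 2 = (1 - \<theta>) * (A + e)" using \<theta>2 by (simp add: algebra_simps)
    finally show ?case unfolding A_def[symmetric] using \<theta> by (simp add: mult_le_cancel_left)
  qed
qed

text \<open>\<open>smooth_lower\<close> under the initial killed piece. Restoring the killing in the
  middle costs order i^-4 after scaling by n^(3/2), and the Fejer mass outside the window costs
  order \<theta>; the reflected Gaussian term has a favourable sign.\<close>

lemma lower_limit:
  assumes G: "adm G" and G': "adm G'" and h: "0 < h" and R: "shifts h G' G" and e: "0 < e"
  shows "\<forall>\<^sub>F n in sequentially. c0 * V0 x y * (\<nu> w * (\<integral>z. G' z * Vd w z \<partial>lborel)) - e \<le> n * sqrt n * U n G w x y"
proof -
  obtain C where C: "0 < C" "\<forall>i\<ge>2. \<forall>T>0. \<forall>a G e. adm G \<longrightarrow> 0 < e \<longrightarrow> (\<forall>\<^sub>F n in sequentially.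
     c0 * V0 x y * (\<nu> w * (\<integral>z. G z * Vd w z \<partial>lborel)) - e \<le> n * sqrt n * ED (s1 (i^8) n) (Lam T a (n div i^8) (s2 (i^8) n) G w) x y \<and>
     n * sqrt n * ED (s1 (i^8) n) (Lam T a (n div i^8) (s2 (i^8) n) G w) x y \<le> c0 * V0 x y * (\<nu> w * (\<integral>z. G z * Vd w z \<partial>lborel)) + C * mass G / (real i)\<^sup>2 + e)"
    using free_limit[of x y w] by (elim exE conjE)
  obtain C1 where C1: "0 < C1" "\<forall>k\<ge>2. \<forall>G G' w x y. adm G \<longrightarrow> adm G' \<longrightarrow> shifts h G G' \<longrightarrow> U k G w x y \<le> C1 * mass G' / k"
    using U_sup_bound[OF h] by (elim exE conjE)
  obtain C2 where C2: "0 < C2" "\<forall>k\<ge>4. \<forall>G G' w x y. adm G \<longrightarrow> adm G' \<longrightarrow> shifts h G G' \<longrightarrow>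
     U k G w x y \<le> C2 * mass G' * (1 + max y 0) / (k * sqrt k)"
    using U_bound[OF h] by (elim exE conjE)
  obtain K where K: "0 < K" "\<forall>n\<ge>1. \<forall>x y. qn n x y \<le> K * (1 + max y 0) / sqrt n" using qn_bound by (elim exE conjE)
  define Y where "Y = K * (1 + max y 0)"
  have Y: "0 \<le> Y" unfolding Y_def using K(1) by simp
  define M where "M = mass G"
  have M: "0 \<le> M" unfolding M_def by (rule admD(6)[OF G])
  \<comment> \<open>Scaled coefficients of the two losses: M1 multiplies \<theta>, and M2 multiplies
    i^-4.\<close>
  define M1 M2 where "M1 = 8 * C1 * Y * M" and "M2 = 320 * C2 * Y * M * bd\<^sup>2"
  have M12: "0 \<le> M1" "0 \<le> M2" unfolding M1_def M2_def using C1(1) C2(1) Y M by auto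
  obtain i0 :: nat where i0: "3 * M2 / e \<le> real i0" using real_arch_simple by blast
  define i where "i = max 2 i0"
  have i: "2 \<le> i" by (simp add: i_def)
  have ie: "M2 / i ^ 4 \<le> e / 3"
  proof -
    have "3 * M2 / e \<le> real i" using i0 unfolding i_def by simp
    then have "3 * M2 \<le> e * real i" using e by (simp add: divide_le_eq mult.commute)
    also have "\<dots> \<le> e * real i ^ 4" using i e by (intro mult_left_mono self_le_power) auto
    finally show ?thesis using i by (simp add: field_simps)
  qed
  define \<theta> where "\<theta> = e / (3 * (M1 + 1))"
  have \<theta>: "0 < \<theta>" unfolding \<theta>_def using M12 e by simp
  have \<theta>2: "\<theta> * M1 \<le> e / 3"
  proof -
    have "\<theta> * M1 \<le> \<theta> * (M1 + 1)" using \<theta> by simp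
    also have "\<dots> = e / 3" unfolding \<theta>_def using M12 by (simp add: field_simps)
    finally show ?thesis .
  qed
  define T where "T = 8 / (pi * h * \<theta>)"
  have T: "0 < T" unfolding T_def using h \<theta> by simp
  have T\<theta>: "8 / (pi * T * h) = \<theta>" unfolding T_def using h \<theta> by simp
  define p where "p = i^8"
  have p0: "2 ^ 8 \<le> p" unfolding p_def using i by (intro power_mono) auto
  then have p8: "8 \<le> p" by simp
  have "\<forall>\<^sub>F n in sequentially.
     c0 * V0 x y * (\<nu> w * (\<integral>z. G' z * Vd w z \<partial>lborel)) - e / 3 \<le> n * sqrt n * ED (s1 (i^8) n) (Lam T (- h / 2) (n div i^8) (s2 (i^8) n) G' w) x y \<and>
     n * sqrt n * ED (s1 (i^8) n) (Lam T (- h / 2) (n div i^8) (s2 (i^8) n) G' w) x y \<le> c0 * V0 x y * (\<nu> w * (\<integral>z. G' z * Vd w z \<partial>lborel)) + C * mass G' / (real i)\<^sup>2 + e / 3"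
    by (rule C(2)[rule_format, OF i T G']) (use e in simp)
  then show ?thesis using eventually_ge_at_top[of p]
  proof eventually_elim
    case (elim n)
    note sb = split_bounds[OF p8 elim(2)] and ss = split_sqrt[OF p8 elim(2)]
    define j N1 N2 where "j = n div p" and "N1 = s1 p n" and "N2 = s2 p n"
    note defs = j_def[symmetric] N1_def[symmetric] N2_def[symmetric]
    note sb = sb[unfolded defs] and ss = ss[unfolded defs]
    have n0: "0 < real n" using ss(1) by simp
    have N24: "4 \<le> N2" using sb(3) elim(2) p0 by simp
    define S where "S = C1 * M * (4 / n)"
    \<comment> \<open>The final piece is worth at most a multiple of (1 + z) n^(-3/2). After a visit
      to the nonpositive half-line the expected height is of order sqrt j, at most sqrt n / i^4
      because i^8 j \<le> n.\<close>
    define B where "B = C2 * M * (8 / (n * sqrt n)) * (20 * bd\<^sup>2 * (sqrt n / i ^ 4))"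
    have S: "U (j + N2) G' w x' y' \<le> S" for x' y'
    proof -
      have "2 \<le> j + N2" using sb(8) by simp
      then have "U (j + N2) G' w x' y' \<le> C1 * M * (1 / real (j + N2))" using C1(2) G' G R unfolding M_def by fastforce
      also have "\<dots> \<le> S" unfolding S_def
      proof (intro mult_left_mono)
        have "real n \<le> 4 * real (j + N2)" using sb(3) by (metis add.commute mult.commute of_nat_le_iff of_nat_mult of_nat_numeral trans_le_add1 add_mult_distrib)
        then show "1 / real (j + N2) \<le> 4 / n" using n0 sb(8) by (simp add: field_simps)
      qed (use C1(1) M in simp)
      finally show ?thesis .
    qed
    have B: "EU i' (pos (U N2 G' w)) x' v \<le> B" if "i' \<le> j" "v \<le> 0" for i' x' v
    proof -
      define c where "c = C2 * M * (8 / (n * sqrt n))"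
      have c: "0 \<le> c" unfolding c_def using C2(1) M by simp
      have "EU i' (pos (U N2 G' w)) x' v \<le> EU i' (\<lambda>_ z. c * (1 + max z 0)) x' v"
      proof (rule EE_mono)
        fix x'' z
        have "U N2 G' w x'' z \<le> C2 * mass G * (1 + max z 0) / (N2 * sqrt N2)" using C2(2) N24 G' G R by blast
        also have "\<dots> = C2 * M * (1 / (N2 * sqrt N2)) * (1 + max z 0)" by (simp add: M_def)
        also have "\<dots> \<le> c * (1 + max z 0)" unfolding c_def
        proof (intro mult_right_mono mult_left_mono)
          have a: "real n / 4 \<le> N2" using sb(3) by linarith
          have "real n / 4 * (sqrt n / 2) \<le> N2 * sqrt N2" by (rule mult_mono[OF a ss(3)]) auto
          then have "1 / (N2 * sqrt N2) \<le> 1 / (real n / 4 * (sqrt n / 2))" using n0 by (intro divide_left_mono) (use N24 in auto)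
          then show "1 / (N2 * sqrt N2) \<le> 8 / (n * sqrt n)" by simp
        qed (use C2(1) M in auto)
        finally have "U N2 G' w x'' z \<le> c * (1 + max z 0)" .
        then show "indicator {0<..} z * U N2 G' w x'' z \<le> c * (1 + max z 0)" using c mult_nonneg_nonneg[OF c, of "1 + max z 0"] by (auto simp: indicator_def)
      qed
      also have "\<dots> = c * EU i' (\<lambda>_ z. 1 + max z 0) x' v" by (rule EE_cmult)
      also have "\<dots> \<le> c * (20 * bd\<^sup>2 * sqrt j)" by (intro mult_left_mono c EU_pos_part that sb(6))
      also have "\<dots> \<le> c * (20 * bd\<^sup>2 * (sqrt n / i ^ 4))"
      proof (intro mult_left_mono c)
        have "real p * real j \<le> real n" using sb(4) by (metis of_nat_le_iff of_nat_mult)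
        then have "sqrt (real p) * sqrt j \<le> sqrt n" by (metis real_sqrt_le_mono real_sqrt_mult)
        moreover have "sqrt (real p) = real i ^ 4"
          by (rule real_sqrt_unique) (simp_all add: p_def flip: power_mult)
        ultimately show "sqrt j \<le> sqrt n / real (i ^ 4)" using i by (simp add: field_simps)
      qed simp
      finally show ?thesis unfolding B_def c_def .
    qed
    have B0: "0 \<le> B" unfolding B_def using C2(1) M by simp
    have S0: "0 \<le> S" unfolding S_def using C1(1) M by simp
    have pt: "Lam T (- h / 2) j N2 G' w x' b - (B + \<theta> * S) \<le> U (j + N2) G w x' b" for x' b
      using smooth_lower[OF T h G G' R _ S B0 B, of x' b] sb(6) unfolding T\<theta> by simp
    have "ED N1 (\<lambda>x' b. Lam T (- h / 2) j N2 G' w x' b - (B + \<theta> * S)) x y \<le> ED N1 (U (j + N2) G w) x y"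
      by (rule EE_mono) (use pt in simp)
    moreover have "ED N1 (\<lambda>x' b. Lam T (- h / 2) j N2 G' w x' b - (B + \<theta> * S) * 1) x y = ED N1 (Lam T (- h / 2) j N2 G' w) x y - (B + \<theta> * S) * qn N1 x y"
      unfolding qn_def EE_diff EE_cmult ..
    moreover have "U n G w x y = ED N1 (U (j + N2) G w) x y" using U_add[of N1 "j + N2" G w x y] unfolding sb(1) .
    ultimately have 1: "ED N1 (Lam T (- h / 2) j N2 G' w) x y - (B + \<theta> * S) * qn N1 x y \<le> U n G w x y" by simp
    have q: "qn N1 x y \<le> Y * (2 / sqrt n)"
    proof -
      have "qn N1 x y \<le> K * (1 + max y 0) / sqrt N1" using K(2) sb(7) by simp
      also have "\<dots> = Y * (1 / sqrt N1)" by (simp add: Y_def)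
      also have "\<dots> \<le> Y * (2 / sqrt n)"
      proof (intro mult_left_mono Y)
        have "1 / sqrt N1 \<le> 1 / (sqrt n / 2)" using ss sb(7) by (intro divide_left_mono) auto
        then show "1 / sqrt N1 \<le> 2 / sqrt n" by simp
      qed
      finally show ?thesis .
    qed
    have "n * sqrt n * ((B + \<theta> * S) * qn N1 x y) \<le> n * sqrt n * ((B + \<theta> * S) * (Y * (2 / sqrt n)))"
      using B0 S0 \<theta> by (intro mult_left_mono q) auto
    also have "\<dots> = 2 * Y * (n * B) + \<theta> * (2 * Y * (n * S))" using ss(1) by (simp add: field_simps)
    also have "n * S = 4 * C1 * M" unfolding S_def using n0 by simp
    also have "n * B = 160 * C2 * M * bd\<^sup>2 / i ^ 4" unfolding B_def using n0 by simp
    also have "2 * Y * (160 * C2 * M * bd\<^sup>2 / i ^ 4) + \<theta> * (2 * Y * (4 * C1 * M)) = M2 / i ^ 4 + \<theta> * M1"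
      unfolding M1_def M2_def by simp
    finally have err: "n * sqrt n * ((B + \<theta> * S) * qn N1 x y) \<le> 2 * (e / 3)" using ie \<theta>2 by linarith
    have "n * sqrt n * (ED N1 (Lam T (- h / 2) j N2 G' w) x y - (B + \<theta> * S) * qn N1 x y) \<le> n * sqrt n * U n G w x y"
      by (intro mult_left_mono 1) simp
    moreover have "c0 * V0 x y * (\<nu> w * (\<integral>z. G' z * Vd w z \<partial>lborel)) - e / 3 \<le> n * sqrt n * ED N1 (Lam T (- h / 2) j N2 G' w) x y"
      using elim(1) unfolding N1_def N2_def j_def p_def by blast
    ultimately show ?case using err unfolding right_diff_distrib by linarith
  qed
qed

end

section \<open>Approximation by step functions\<close>

lemma powr_tail_integrable:
  fixes e :: real
  assumes e: "0 < e"
  shows "integrable lborel (\<lambda>z::real. (1 + z) powr (- (1 + e)) * indicator {0..} z)"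
proof (rule integrableI_nn_integral_finite)
  have "(\<integral>\<^sup>+z. ennreal ((1 + z) powr (- (1 + e))) * indicator {0..} z \<partial>lborel) = ennreal (0 - (- ((1 + 0) powr (- e) / e)))"
  proof (rule nn_integral_FTC_atLeast[where F = "\<lambda>z. - ((1 + z) powr (- e) / e)"])
    show "((\<lambda>z. - ((1 + z) powr (- e) / e)) has_real_derivative (1 + z) powr (- (1 + e))) (at z)" if "0 \<le> z" for z :: real
    proof -
      have "((\<lambda>z. (1 + z) powr (- e)) has_real_derivative (- e) * (1 + z) powr (- e - of_nat 1) * 1) (at z)"
        by (rule DERIV_fun_powr) (use that in \<open>auto intro!: derivative_eq_intros\<close>)
      moreover have "- e - of_nat 1 = - (1 + e)" by simp
      ultimately have "((\<lambda>z. (1 + z) powr (- e)) has_real_derivative (- e) * (1 + z) powr (- (1 + e)) * 1) (at z)" by metis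
      from DERIV_minus[OF DERIV_cdivide[OF this, of e]] show ?thesis using e by simp
    qed
    have "((\<lambda>z. (1 + z) powr (- e)) \<longlongrightarrow> 0) at_top"
      by (rule tendsto_neg_powr) (use e in \<open>auto intro!: filterlim_tendsto_add_at_top[OF tendsto_const filterlim_ident]\<close>)
    from tendsto_minus[OF tendsto_divide[OF this tendsto_const, of e]] e
    show "((\<lambda>z. - ((1 + z) powr (- e) / e)) \<longlongrightarrow> 0) at_top" by simp
  qed auto
  then show "(\<integral>\<^sup>+z. ennreal ((1 + z) powr (- (1 + e)) * indicator {0..} z) \<partial>lborel) = ennreal (1 / e)"
    by (simp add: ennreal_mult' ennreal_indicator)
qed (use e in auto)

text \<open>The weight 1 + |z| consumes one power of the decay, and the exponent 1 + e that remains
  is integrable.\<close>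

lemma adm_powr_tail:
  fixes F :: "real \<Rightarrow> real"
  assumes e: "0 < e" and F: "F \<in> borel_measurable borel" "\<And>z. 0 \<le> F z" "\<And>z. z \<le> 0 \<Longrightarrow> F z = 0"
    and b: "\<And>z. 0 < z \<Longrightarrow> F z \<le> C * (1 + z) powr (- (2 + e))"
  shows "adm F"
proof -
  have "integrable lborel (\<lambda>z. (1 + \<bar>z\<bar>) * F z)"
  proof (rule Bochner_Integration.integrable_bound[OF integrable_mult_right[OF powr_tail_integrable[OF e], of C]])
    show "(\<lambda>z. (1 + \<bar>z\<bar>) * F z) \<in> borel_measurable lborel" using F(1) by measurable
    show "AE z in lborel. norm ((1 + \<bar>z\<bar>) * F z) \<le> norm (C * ((1 + z) powr (- (1 + e)) * indicator {0..} z))"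
    proof (intro AE_I2)
      fix z :: real
      show "norm ((1 + \<bar>z\<bar>) * F z) \<le> norm (C * ((1 + z) powr (- (1 + e)) * indicator {0..} z))"
      proof (cases "z \<le> 0")
        case False
        have "(1 + z) * F z \<le> (1 + z) * (C * (1 + z) powr (- (2 + e)))" using False b by (intro mult_left_mono) auto
        also have "\<dots> = C * ((1 + z) powr 1 * (1 + z) powr (- (2 + e)))" using False by simp
        also have "(1 + z) powr 1 * (1 + z) powr (- (2 + e)) = (1 + z) powr (- (1 + e))" by (simp only: powr_add[symmetric]) (simp add: algebra_simps)
        also have "C * (1 + z) powr (- (1 + e)) \<le> \<bar>C\<bar> * (1 + z) powr (- (1 + e))" by (intro mult_right_mono) auto
        finally show ?thesis using False F(2)[of z] by (simp add: abs_mult)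
      qed (use F(3) in simp)
    qed
  qed
  then show ?thesis unfolding adm_def using F by auto
qed

text \<open>The cell of z together with its left neighbour contains every z - s with 0 \<le> s \<le>
  h, as \<open>shifts\<close> requires; \<open>cell_inf\<close> takes the right neighbour instead.
  Apart from the sign of z, the dependence on z is through a floor only, so both are Borel for
  arbitrary \<open>G\<close>.\<close>

definition cell_sup :: "(real \<Rightarrow> real) \<Rightarrow> real \<Rightarrow> real \<Rightarrow> real" where
  "cell_sup G h z = (if z \<le> 0 then 0 else Sup (G ` {(of_int \<lfloor>z / h\<rfloor> - 1) * h..(of_int \<lfloor>z / h\<rfloor> + 1) * h}))"

definition cell_inf :: "(real \<Rightarrow> real) \<Rightarrow> real \<Rightarrow> real \<Rightarrow> real" where
  "cell_inf G h z = (if z \<le> 0 then 0 else Inf (G ` {of_int \<lfloor>z / h\<rfloor> * h..(of_int \<lfloor>z / h\<rfloor> + 2) * h}))"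

lemma cell_measurable: "cell_sup G h \<in> borel_measurable borel" "cell_inf G h \<in> borel_measurable borel"
proof -
  have "(\<lambda>z. Sup (G ` {(of_int \<lfloor>z / h\<rfloor> - 1) * h..(of_int \<lfloor>z / h\<rfloor> + 1) * h})) \<in> borel_measurable borel"
    by (rule measurable_compose[where f = "\<lambda>z. \<lfloor>z / h\<rfloor>" and g = "\<lambda>k. Sup (G ` {(of_int k - 1) * h..(of_int k + 1) * h})" and N = "count_space UNIV"]) auto
  then show "cell_sup G h \<in> borel_measurable borel" unfolding cell_sup_def[abs_def] by measurable
  have "(\<lambda>z. Inf (G ` {of_int \<lfloor>z / h\<rfloor> * h..(of_int \<lfloor>z / h\<rfloor> + 2) * h})) \<in> borel_measurable borel"
    by (rule measurable_compose[where f = "\<lambda>z. \<lfloor>z / h\<rfloor>" and g = "\<lambda>k. Inf (G ` {of_int k * h..(of_int k + 2) * h})" and N = "count_space UNIV"]) auto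
  then show "cell_inf G h \<in> borel_measurable borel" unfolding cell_inf_def[abs_def] by measurable
qed

lemma cell_bounds:
  fixes z h :: real
  assumes "0 < h"
  shows "of_int \<lfloor>z / h\<rfloor> * h \<le> z" "z < (of_int \<lfloor>z / h\<rfloor> + 1) * h"
proof -
  have a: "of_int \<lfloor>z / h\<rfloor> \<le> z / h" "z / h < of_int \<lfloor>z / h\<rfloor> + 1" by linarith+
  show "of_int \<lfloor>z / h\<rfloor> * h \<le> z" by (rule pos_le_divide_eq[OF assms, THEN iffD1, OF a(1)])
  show "z < (of_int \<lfloor>z / h\<rfloor> + 1) * h" by (rule pos_divide_less_eq[OF assms, THEN iffD1, OF a(2)])
qed

lemma cell_shifts:
  assumes h: "0 < h" and G: "\<And>z. 0 \<le> G z" "\<And>z. G z \<le> C"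
  shows "shifts h G (cell_sup G h)" "shifts h (cell_inf G h) G"
proof -
  have ba: "bdd_above (G ` X)" for X using G(2) by (intro bdd_aboveI[of _ C]) auto
  have bb: "bdd_below (G ` X)" for X using G(1) by (intro bdd_belowI[of _ 0]) auto
  show "shifts h G (cell_sup G h)" unfolding shifts_def
  proof (intro allI impI)
    fix z s :: real assume a: "0 < z" "0 \<le> s" "s \<le> h"
    have "G z \<le> Sup (G ` {(of_int \<lfloor>(z + s) / h\<rfloor> - 1) * h..(of_int \<lfloor>(z + s) / h\<rfloor> + 1) * h})"
    proof (rule cSup_upper[OF _ ba], rule imageI)
      show "z \<in> {(of_int \<lfloor>(z + s) / h\<rfloor> - 1) * h..(of_int \<lfloor>(z + s) / h\<rfloor> + 1) * h}"
        using cell_bounds[OF h, of "z + s"] a by (auto simp: algebra_simps)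
    qed
    then show "G z \<le> cell_sup G h (z + s)" unfolding cell_sup_def using a by simp
  qed
  show "shifts h (cell_inf G h) G" unfolding shifts_def
  proof (intro allI impI)
    fix z s :: real assume a: "0 < z" "0 \<le> s" "s \<le> h"
    have "Inf (G ` {of_int \<lfloor>z / h\<rfloor> * h..(of_int \<lfloor>z / h\<rfloor> + 2) * h}) \<le> G (z + s)"
    proof (rule cInf_lower[OF _ bb], rule imageI)
      show "z + s \<in> {of_int \<lfloor>z / h\<rfloor> * h..(of_int \<lfloor>z / h\<rfloor> + 2) * h}"
        using cell_bounds[OF h, of z] a by (auto simp: algebra_simps)
    qed
    then show "cell_inf G h z \<le> G (z + s)" unfolding cell_inf_def using a by simp
  qed
qed

lemma cell_close:
  assumes h: "0 < h" and z: "0 < z" and d: "\<And>u. \<bar>u - z\<bar> \<le> 2 * h \<Longrightarrow> \<bar>G u - G z\<bar> \<le> e"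
  shows "\<bar>cell_sup G h z - G z\<bar> \<le> e" "\<bar>cell_inf G h z - G z\<bar> \<le> e"
proof -
  have "\<bar>Sup (G ` {(of_int \<lfloor>z / h\<rfloor> - 1) * h..(of_int \<lfloor>z / h\<rfloor> + 1) * h}) - G z\<bar> \<le> e"
  proof (rule cSup_asclose)
    show "G ` {(of_int \<lfloor>z / h\<rfloor> - 1) * h..(of_int \<lfloor>z / h\<rfloor> + 1) * h} \<noteq> {}" using h by simp
    show "\<forall>v\<in>G ` {(of_int \<lfloor>z / h\<rfloor> - 1) * h..(of_int \<lfloor>z / h\<rfloor> + 1) * h}. \<bar>v - G z\<bar> \<le> e"
    proof
      fix v assume "v \<in> G ` {(of_int \<lfloor>z / h\<rfloor> - 1) * h..(of_int \<lfloor>z / h\<rfloor> + 1) * h}"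
      then obtain u where u: "v = G u" "u \<in> {(of_int \<lfloor>z / h\<rfloor> - 1) * h..(of_int \<lfloor>z / h\<rfloor> + 1) * h}" by blast
      have "\<bar>u - z\<bar> \<le> 2 * h" using u(2) cell_bounds[OF h, of z] by (auto simp: algebra_simps abs_le_iff)
      then show "\<bar>v - G z\<bar> \<le> e" unfolding u(1) by (rule d)
    qed
  qed
  then show "\<bar>cell_sup G h z - G z\<bar> \<le> e" unfolding cell_sup_def using z by simp
  have "\<bar>Inf (G ` {of_int \<lfloor>z / h\<rfloor> * h..(of_int \<lfloor>z / h\<rfloor> + 2) * h}) - G z\<bar> \<le> e"
  proof (rule cInf_asclose)
    show "G ` {of_int \<lfloor>z / h\<rfloor> * h..(of_int \<lfloor>z / h\<rfloor> + 2) * h} \<noteq> {}" using h by simp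
    show "\<forall>v\<in>G ` {of_int \<lfloor>z / h\<rfloor> * h..(of_int \<lfloor>z / h\<rfloor> + 2) * h}. \<bar>v - G z\<bar> \<le> e"
    proof
      fix v assume "v \<in> G ` {of_int \<lfloor>z / h\<rfloor> * h..(of_int \<lfloor>z / h\<rfloor> + 2) * h}"
      then obtain u where u: "v = G u" "u \<in> {of_int \<lfloor>z / h\<rfloor> * h..(of_int \<lfloor>z / h\<rfloor> + 2) * h}" by blast
      have "\<bar>u - z\<bar> \<le> 2 * h" using u(2) cell_bounds[OF h, of z] by (auto simp: algebra_simps abs_le_iff)
      then show "\<bar>v - G z\<bar> \<le> e" unfolding u(1) by (rule d)
    qed
  qed
  then show "\<bar>cell_inf G h z - G z\<bar> \<le> e" unfolding cell_inf_def using z by simp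
qed

text \<open>For h \<le> 1 all points involved exceed z - 2, and 1 + u is at least (1 + z) / 3 for
  such positive u; hence the factor 3 to the power 2 + e, uniform in h.\<close>

lemma cell_tail:
  fixes h :: real
  assumes h: "0 < h" "h \<le> 1" and e: "0 < e" and G: "\<And>z. 0 \<le> G z" "\<And>z. z \<le> 0 \<Longrightarrow> G z = 0"
    and b: "\<And>z. 0 < z \<Longrightarrow> G z \<le> C * (1 + z) powr (- (2 + e))" and C: "0 \<le> C" and z: "0 < z"
  shows "cell_sup G h z \<le> C * 3 powr (2 + e) * (1 + z) powr (- (2 + e))" "cell_inf G h z \<le> C * 3 powr (2 + e) * (1 + z) powr (- (2 + e))"
    "0 \<le> cell_sup G h z" "0 \<le> cell_inf G h z"
proof -
  have near: "G u \<le> C * 3 powr (2 + e) * (1 + z) powr (- (2 + e))" if "z - 2 \<le> u" for u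
  proof (cases "u \<le> 0")
    case False
    have "(1 + u) powr (- (2 + e)) \<le> ((1 + z) / 3) powr (- (2 + e))" using False that e z by (intro powr_mono2') auto
    also have "\<dots> = (1 + z) powr (- (2 + e)) / 3 powr (- (2 + e))" by (rule powr_divide)
    also have "\<dots> = 3 powr (2 + e) * (1 + z) powr (- (2 + e))" unfolding powr_minus_divide[of 3] by simp
    finally have "C * (1 + u) powr (- (2 + e)) \<le> C * (3 powr (2 + e) * (1 + z) powr (- (2 + e)))" using C by (rule mult_left_mono)
    then show ?thesis using b[of u] False by (simp add: mult_ac)
  qed (use G C in simp)
  have "Sup (G ` {(of_int \<lfloor>z / h\<rfloor> - 1) * h..(of_int \<lfloor>z / h\<rfloor> + 1) * h}) \<le> C * 3 powr (2 + e) * (1 + z) powr (- (2 + e))"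
  proof (rule cSup_least)
    show "G ` {(of_int \<lfloor>z / h\<rfloor> - 1) * h..(of_int \<lfloor>z / h\<rfloor> + 1) * h} \<noteq> {}" using h by simp
    fix v assume "v \<in> G ` {(of_int \<lfloor>z / h\<rfloor> - 1) * h..(of_int \<lfloor>z / h\<rfloor> + 1) * h}"
    then obtain u where u: "v = G u" "u \<in> {(of_int \<lfloor>z / h\<rfloor> - 1) * h..(of_int \<lfloor>z / h\<rfloor> + 1) * h}" by blast
    have "z - 2 \<le> u" using u(2) cell_bounds[OF h(1), of z] h by (auto simp: algebra_simps)
    then show "v \<le> C * 3 powr (2 + e) * (1 + z) powr (- (2 + e))" unfolding u(1) by (rule near)
  qed
  then show "cell_sup G h z \<le> C * 3 powr (2 + e) * (1 + z) powr (- (2 + e))" unfolding cell_sup_def using z by simp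
  have c3: "C * (1 + u) powr (- (2 + e)) \<le> C" if "0 < u" for u
  proof -
    have "(1 + u) powr (- (2 + e)) \<le> 1 powr (- (2 + e))" using that e by (intro powr_mono2') auto
    then show ?thesis using C mult_left_mono[of "(1 + u) powr (- (2 + e))" 1 C] by simp
  qed
  have GC: "G u \<le> C" for u using b[of u] c3[of u] G(2)[of u] C by (cases "u \<le> 0") auto
  have "cell_inf G h z \<le> G (z + 0)" by (rule shiftsD[OF cell_shifts(2)[OF h(1) G(1) GC] z order.refl less_imp_le[OF h(1)]])
  then show "cell_inf G h z \<le> C * 3 powr (2 + e) * (1 + z) powr (- (2 + e))" using near[of z] by simp
  have "G z \<le> cell_sup G h (z + 0)" by (rule shiftsD[OF cell_shifts(1)[OF h(1) G(1) GC] z order.refl less_imp_le[OF h(1)]])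
  then show "0 \<le> cell_sup G h z" using G(1)[of z] by simp
  have "0 \<le> Inf (G ` {of_int \<lfloor>z / h\<rfloor> * h..(of_int \<lfloor>z / h\<rfloor> + 2) * h})" using h G(1) by (intro cInf_greatest) auto
  then show "0 \<le> cell_inf G h z" unfolding cell_inf_def by simp
qed

lemma cell_tendsto:
  assumes z: "0 < z" and c: "isCont G z"
  shows "(\<lambda>k. cell_sup G (1 / real (Suc k)) z) \<longlonglongrightarrow> G z" "(\<lambda>k. cell_inf G (1 / real (Suc k)) z) \<longlonglongrightarrow> G z"
proof -
  have ev: "\<forall>\<^sub>F k in sequentially. dist (cell_sup G (1 / real (Suc k)) z) (G z) < e \<and> dist (cell_inf G (1 / real (Suc k)) z) (G z) < e" if e0: "0 < e" for e
  proof -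
    obtain d where d: "0 < d" "\<forall>u. dist u z < d \<longrightarrow> dist (G u) (G z) < e / 2"
      using c half_gt_zero[OF e0] unfolding continuous_at_eps_delta by blast
    have "(\<lambda>k. 2 * (1 / real (Suc k))) \<longlonglongrightarrow> 2 * 0" by (intro tendsto_mult_left LIMSEQ_Suc lim_1_over_n)
    then have "\<forall>\<^sub>F k in sequentially. 2 * (1 / real (Suc k)) < d" using d(1) by (intro order_tendstoD(2)) auto
    then show ?thesis
    proof eventually_elim
      case (elim k)
      have a: "\<bar>G u - G z\<bar> \<le> e / 2" if "\<bar>u - z\<bar> \<le> 2 * (1 / real (Suc k))" for u
        using d(2)[rule_format, of u] that elim by (simp add: dist_real_def)
      show ?case using cell_close[where h = "1 / real (Suc k)" and G = G and e = "e / 2", OF _ z a] e0 by (simp add: dist_real_def)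
    qed
  qed
  show "(\<lambda>k. cell_sup G (1 / real (Suc k)) z) \<longlonglongrightarrow> G z"
    by (rule tendstoI, drule ev, erule eventually_mono, erule conjunct1)
  show "(\<lambda>k. cell_inf G (1 / real (Suc k)) z) \<longlonglongrightarrow> G z"
    by (rule tendstoI, drule ev, erule eventually_mono, erule conjunct2)
qed

context mwalk
begin

text \<open>The upper bound for \<open>cell_sup\<close> and the lower bound for
  \<open>cell_inf\<close> close up as the mesh shrinks: both step functions converge to
  \<open>G\<close> off the finite set \<open>X\<close>, under a common majorant.\<close>

lemma base_limit:
  assumes e: "0 < e" and G: "G \<in> borel_measurable borel" "\<And>z. 0 \<le> G z" "\<And>z. z \<le> 0 \<Longrightarrow> G z = 0"
    and b: "\<And>z. 0 < z \<Longrightarrow> G z \<le> C * (1 + z) powr (- (2 + e))"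
    and X: "finite X" and cont: "\<And>z. 0 < z \<Longrightarrow> z \<notin> X \<Longrightarrow> isCont G z"
  shows "(\<lambda>n. n * sqrt n * U n G w x y) \<longlonglongrightarrow> c0 * V0 x y * (\<nu> w * (\<integral>z. G z * Vd w z \<partial>lborel))"
proof -
  interpret d: mwalk "dual P \<nu>" "\<lambda>u. - f u" \<nu> by (rule dual_mwalk)
  have "0 \<le> C * (1 + 1) powr (- (2 + e))" using b[of 1] G(2)[of 1] by simp
  then have C: "0 \<le> C" by (simp add: zero_le_mult_iff)
  \<comment> \<open>Majorant for all meshes at once; it is admissible, hence integrable against the
    linearly growing \<open>Vd\<close>.\<close>
  define D where "D z = (if z \<le> 0 then 0 else C * 3 powr (2 + e) * (1 + z) powr (- (2 + e)))" for z :: real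
  define h where "h k = 1 / real (Suc k)" for k
  have h: "0 < h k" "h k \<le> 1" for k unfolding h_def by auto
  note tail = cell_tail[OF h e G(2,3) b C]
  have Dm: "D \<in> borel_measurable borel" unfolding D_def[abs_def] by measurable
  have admD': "adm D" by (rule adm_powr_tail[OF e Dm, where C = "C * 3 powr (2 + e)"]) (auto simp: D_def C)
  have admG: "adm G" by (rule adm_powr_tail[OF e G b])
  have adm_s: "adm (cell_sup G (h k))" for k
    by (rule adm_powr_tail[OF e cell_measurable(1) _ _ tail(1)]) (use tail(3) in \<open>auto simp: cell_sup_def\<close>)
  have adm_i: "adm (cell_inf G (h k))" for k
    by (rule adm_powr_tail[OF e cell_measurable(2) _ _ tail(2)]) (use tail(4) in \<open>auto simp: cell_inf_def\<close>)
  have GC: "G u \<le> C" for u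
  proof (cases "u \<le> 0")
    case False
    have "(1 + u) powr (- (2 + e)) \<le> 1 powr (- (2 + e))" using False e by (intro powr_mono2') auto
    then show ?thesis using b[of u] C False mult_left_mono[of "(1 + u) powr (- (2 + e))" 1 C] by simp
  qed (use G C in simp)
  note sh = cell_shifts[OF h(1) G(2) GC]
  obtain CV where CV: "0 < CV" "\<forall>w z. 0 \<le> Vd w z \<and> Vd w z \<le> CV * (1 + max z 0)" using d.V0_bounds by blast
  note [measurable] = d.V0_measurable G(1) cell_measurable
  have dct: "(\<lambda>k. \<integral>z. F k z * Vd w z \<partial>lborel) \<longlonglongrightarrow> (\<integral>z. G z * Vd w z \<partial>lborel)"
    if F: "\<And>k. F k \<in> borel_measurable borel" "\<And>k z. 0 \<le> F k z" "\<And>k z. F k z \<le> D z"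
      and lim: "\<And>z. 0 < z \<Longrightarrow> z \<notin> X \<Longrightarrow> (\<lambda>k. F k z) \<longlonglongrightarrow> G z" for F
  proof (rule integral_dominated_convergence[where w = "\<lambda>z. CV * ((1 + \<bar>z\<bar>) * D z)"])
    show "integrable lborel (\<lambda>z. CV * ((1 + \<bar>z\<bar>) * D z))" using admD(4)[OF admD'] by (rule integrable_mult_right)
    show "AE z in lborel. (\<lambda>k. F k z * Vd w z) \<longlonglongrightarrow> G z * Vd w z"
    proof (rule AE_mp[OF AE_not_in[OF finite_imp_null_set_lborel[OF X]]], intro AE_I2 impI)
      fix z assume "z \<notin> X"
      show "(\<lambda>k. F k z * Vd w z) \<longlonglongrightarrow> G z * Vd w z"
      proof (cases "z \<le> 0")
        case True
        then have "F k z = 0" for k using F(2,3)[of k z] by (simp add: D_def)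
        then show ?thesis using G(3)[OF True] by simp
      qed (use lim \<open>z \<notin> X\<close> in \<open>auto intro!: tendsto_mult_right\<close>)
    qed
    show "AE z in lborel. norm (F k z * Vd w z) \<le> CV * ((1 + \<bar>z\<bar>) * D z)" for k
    proof (intro AE_I2)
      fix z
      have "F k z * Vd w z \<le> D z * (CV * (1 + max z 0))" using CV F(2,3)[of k z] by (intro mult_mono) auto
      also have "\<dots> \<le> D z * (CV * (1 + \<bar>z\<bar>))" using admD(2)[OF admD', of z] CV(1) by (intro mult_left_mono) auto
      finally show "norm (F k z * Vd w z) \<le> CV * ((1 + \<bar>z\<bar>) * D z)" using CV(2) F(2)[of k z] by (simp add: mult_ac)
    qed
  qed (use F(1) in measurable)
  have ls: "(\<lambda>k. \<integral>z. cell_sup G (h k) z * Vd w z \<partial>lborel) \<longlonglongrightarrow> (\<integral>z. G z * Vd w z \<partial>lborel)"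
  proof (rule dct)
    show "0 \<le> cell_sup G (h k) z" "cell_sup G (h k) z \<le> D z" for k z using tail(1,3)[of z k] by (cases "z \<le> 0"; simp add: cell_sup_def D_def)+
    show "(\<lambda>k. cell_sup G (h k) z) \<longlonglongrightarrow> G z" if "0 < z" "z \<notin> X" for z unfolding h_def by (rule cell_tendsto(1)[OF that(1) cont[OF that]])
  qed (rule cell_measurable)
  have li: "(\<lambda>k. \<integral>z. cell_inf G (h k) z * Vd w z \<partial>lborel) \<longlonglongrightarrow> (\<integral>z. G z * Vd w z \<partial>lborel)"
  proof (rule dct)
    show "0 \<le> cell_inf G (h k) z" "cell_inf G (h k) z \<le> D z" for k z using tail(2,4)[of z k] by (cases "z \<le> 0"; simp add: cell_inf_def D_def)+
    show "(\<lambda>k. cell_inf G (h k) z) \<longlonglongrightarrow> G z" if "0 < z" "z \<notin> X" for z unfolding h_def by (rule cell_tendsto(2)[OF that(1) cont[OF that]])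
  qed (rule cell_measurable)
  define L where "L F = c0 * V0 x y * (\<nu> w * (\<integral>z. F z * Vd w z \<partial>lborel))" for F
  have ls': "(\<lambda>k. L (cell_sup G (h k))) \<longlonglongrightarrow> L G" and li': "(\<lambda>k. L (cell_inf G (h k))) \<longlonglongrightarrow> L G"
    unfolding L_def by (intro tendsto_mult_left ls li)+
  show ?thesis unfolding L_def[symmetric]
  proof (rule tendstoI)
    fix \<eta> :: real assume \<eta>: "0 < \<eta>"
    have "\<forall>\<^sub>F k in sequentially. L (cell_sup G (h k)) < L G + \<eta> / 2 \<and> L G - \<eta> / 2 < L (cell_inf G (h k))"
      using order_tendstoD(2)[OF ls', of "L G + \<eta> / 2"] order_tendstoD(1)[OF li', of "L G - \<eta> / 2"] \<eta> by (simp add: eventually_conj)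
    then obtain k where k: "L (cell_sup G (h k)) < L G + \<eta> / 2" "L G - \<eta> / 2 < L (cell_inf G (h k))"
      using eventually_happens'[OF sequentially_bot] by blast
    have u: "\<forall>\<^sub>F n in sequentially. n * sqrt n * U n G w x y \<le> L (cell_sup G (h k)) + \<eta> / 2"
      unfolding L_def by (rule upper_limit[OF admG adm_s h(1) sh(1)]) (use \<eta> in simp)
    have l: "\<forall>\<^sub>F n in sequentially. L (cell_inf G (h k)) - \<eta> / 2 \<le> n * sqrt n * U n G w x y"
      unfolding L_def by (rule lower_limit[OF admG adm_i h(1) sh(2)]) (use \<eta> in simp)
    show "\<forall>\<^sub>F n in sequentially. dist (n * sqrt n * U n G w x y) (L G) < \<eta>"
      using u l by eventually_elim (use k in \<open>simp add: dist_real_def abs_less_iff; linarith\<close>)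
  qed
qed

end

section \<open>Trajectories and the boundary blocks\<close>

lemma sum_paths_0: "(\<Sum>xs\<in>paths 0. h xs) = h []"
  by (simp add: paths_def)

lemma sum_paths_Suc: "(\<Sum>xs\<in>paths (Suc n). h xs) = (\<Sum>v\<in>UNIV. \<Sum>xs\<in>paths n. h (v # xs))"
  for h :: "'x::finite list \<Rightarrow> 'a::comm_monoid_add"
proof -
  have "(\<Sum>v\<in>UNIV. \<Sum>xs\<in>paths n. h (v # xs)) = (\<Sum>(v, xs)\<in>UNIV \<times> paths n. h (v # xs))"
    by (rule sum.cartesian_product)
  also have "\<dots> = (\<Sum>xs\<in>paths (Suc n). h xs)"
    by (rule sum.reindex_bij_witness[where j = "\<lambda>(v, xs). v # xs" and i = "\<lambda>xs. (hd xs, tl xs)"])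
      (auto simp: paths_def length_Suc_conv)
  finally show ?thesis by simp
qed

lemma sum_paths_add: "(\<Sum>xs\<in>paths (a + b). h xs) = (\<Sum>xs\<in>paths a. \<Sum>ys\<in>paths b. h (xs @ ys))"
  for h :: "'x::finite list \<Rightarrow> 'a::comm_monoid_add"
  by (induction a arbitrary: h) (simp_all add: sum_paths_0 sum_paths_Suc)

lemma sum_paths_rev: "(\<Sum>xs\<in>paths n. h (rev xs)) = (\<Sum>xs\<in>paths n. h xs)"
  by (rule sum.reindex_bij_witness[where i = rev and j = rev]) (auto simp: paths_def)

lemma path_prob_append: "path_prob P x (xs @ ys) = path_prob P x xs * path_prob P (last (x # xs)) ys"
  by (induction xs arbitrary: x) auto

lemma Ssum_Cons: "Ssum f (v # xs) (Suc k) = f v + Ssum f xs k"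
  unfolding Ssum_def by (subst sum.lessThan_Suc_shift) simp

lemma Ssum_append: "Ssum f (xs @ ys) (length xs + k) = Ssum f xs (length xs) + Ssum f ys k"
proof (induction xs)
  case Nil then show ?case by (simp add: Ssum_def)
next
  case (Cons v xs) then show ?case by (simp add: Ssum_Cons)
qed

lemma tau_gt_0: "tau_gt f y xs 0"
  by (simp add: tau_gt_def)

lemma tau_gt_Cons: "tau_gt f y (v # xs) (Suc n) \<longleftrightarrow> 0 < y + f v \<and> tau_gt f (y + f v) xs n"
proof -
  have "tau_gt f y (v # xs) (Suc n) \<longleftrightarrow> (\<forall>j\<in>{0..n}. 0 < y + Ssum f (v # xs) (Suc j))"
    unfolding tau_gt_def by (simp add: image_Suc_atLeastAtMost[symmetric] del: image_Suc_atLeastAtMost)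
  also have "\<dots> \<longleftrightarrow> (\<forall>j\<in>{0..n}. 0 < y + f v + Ssum f xs j)" by (simp add: Ssum_Cons add.assoc)
  also have "{0..n} = insert 0 {1..n}" by auto
  finally show ?thesis unfolding tau_gt_def by (simp add: Ssum_def)
qed

lemma tau_gt_append:
  "tau_gt f y (xs @ ys) (length xs + k) \<longleftrightarrow> tau_gt f y xs (length xs) \<and> tau_gt f (y + Ssum f xs (length xs)) ys k"
proof (induction xs arbitrary: y)
  case Nil then show ?case by (simp add: tau_gt_0 Ssum_def)
next
  case (Cons v xs) then show ?case by (simp add: tau_gt_Cons Ssum_Cons add.assoc)
qed

text \<open>Passage from sums over trajectory lists to the recursive expectation; prefixing
  \<open>x\<close> makes \<open>last\<close> return the initial state when there are no
  steps.\<close>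

lemma Exp_EE:
  "(\<Sum>xs\<in>paths n. path_prob P x xs * (if tau_gt f y xs n then F (last (x # xs)) (y + Ssum f xs n) else 0)) = EE P f {0<..} n F x y"
  for F :: "'x::finite \<Rightarrow> real \<Rightarrow> real"
proof (induction n arbitrary: x y)
  case 0
  then show ?case by (simp add: sum_paths_0 tau_gt_0 Ssum_def)
next
  case (Suc n)
  have "(\<Sum>xs\<in>paths n. path_prob P x (v # xs) * (if tau_gt f y (v # xs) (Suc n) then F (last (x # v # xs)) (y + Ssum f (v # xs) (Suc n)) else 0))
      = P x v *\<^sub>R (if y + f v \<in> {0<..} then EE P f {0<..} n F v (y + f v) else 0)" for v
  proof (cases "0 < y + f v")
    case True
    then show ?thesis unfolding Suc.IH[symmetric] by (simp add: tau_gt_Cons Ssum_Cons sum_distrib_left mult.assoc add.assoc cong: if_cong)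
  qed (simp add: tau_gt_Cons)
  then show ?case unfolding sum_paths_Suc EE.simps by (intro sum.cong refl)
qed

lemma surv_EE: "surv P f x y n = EE P f {0<..} n (\<lambda>_ _. 1) x y"
  unfolding surv_def Exp_def by (rule Exp_EE)

text \<open>Markov property at times l and l + k. The transition into the final block stays inside
  the middle functional as \<open>P x' (hd zs)\<close>, the form required by \<open>U\<close>; m
  \<ge> 1 makes \<open>hd zs\<close> meaningful, and l \<ge> 1 makes \<open>last xs\<close> the
  state at time l.\<close>

lemma Exp_split:
  fixes P :: "'x::finite \<Rightarrow> 'x \<Rightarrow> real"
  assumes l: "1 \<le> l" and m: "1 \<le> m"
  shows "Exp P x (l + (k + m)) (\<lambda>xs. if tau_gt f y xs (l + (k + m)) then g (take l xs @ drop (l + (k + m) - m) xs) (y + Ssum f xs (l + (k + m))) else 0)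
    = (\<Sum>xs\<in>paths l. \<Sum>zs\<in>paths m. path_prob P x xs * (if tau_gt f y xs l then 1 else 0) * path_prob P (hd zs) (tl zs) *
        EE P f {0<..} k (\<lambda>x' z. P x' (hd zs) * (if tau_gt f z zs m then g (xs @ zs) (z + Ssum f zs m) else 0)) (last xs) (y + Ssum f xs l))"
proof -
  define I where "I b = (if b then 1 else 0 :: real)" for b
  define h where "h xs zs z = (if tau_gt f z zs m then g (xs @ zs) (z + Ssum f zs m) else 0)" for xs zs z
  have "Exp P x (l + (k + m)) (\<lambda>xs. if tau_gt f y xs (l + (k + m)) then g (take l xs @ drop (l + (k + m) - m) xs) (y + Ssum f xs (l + (k + m))) else 0)
    = (\<Sum>xs\<in>paths l. \<Sum>us\<in>paths k. \<Sum>zs\<in>paths m. path_prob P x xs * (if tau_gt f y xs l then 1 else 0) * (path_prob P (last xs) us *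
        (if tau_gt f (y + Ssum f xs l) us k then path_prob P (last (last xs # us)) zs * h xs zs (y + Ssum f xs l + Ssum f us k) else 0)))"
    unfolding Exp_def sum_paths_add
  proof (intro sum.cong refl)
    fix xs us zs :: "'x list" assume len: "xs \<in> paths l" "us \<in> paths k" "zs \<in> paths m"
    then have ln: "length xs = l" "length us = k" "length zs = m" by (auto simp: paths_def)
    have ne: "xs \<noteq> []" using ln l by auto
    have t: "tau_gt f y (xs @ us @ zs) (l + (k + m)) \<longleftrightarrow> tau_gt f y xs l \<and> tau_gt f (y + Ssum f xs l) us k \<and> tau_gt f (y + Ssum f xs l + Ssum f us k) zs m"
      using tau_gt_append[of f y xs "us @ zs" "k + m"] tau_gt_append[of f "y + Ssum f xs l" us zs m] ln by simp
    have s: "Ssum f (xs @ us @ zs) (l + (k + m)) = Ssum f xs l + (Ssum f us k + Ssum f zs m)"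
      using Ssum_append[of f xs "us @ zs" "k + m"] Ssum_append[of f us zs m] ln by simp
    have d: "take l (xs @ us @ zs) @ drop (l + (k + m) - m) (xs @ us @ zs) = xs @ zs" using ln by simp
    have p: "path_prob P x (xs @ us @ zs) = path_prob P x xs * (path_prob P (last xs) us * path_prob P (last (last xs # us)) zs)"
      unfolding path_prob_append using ne by simp
    show "path_prob P x (xs @ us @ zs) * (if tau_gt f y (xs @ us @ zs) (l + (k + m)) then g (take l (xs @ us @ zs) @ drop (l + (k + m) - m) (xs @ us @ zs)) (y + Ssum f (xs @ us @ zs) (l + (k + m))) else 0)
      = path_prob P x xs * (if tau_gt f y xs l then 1 else 0) * (path_prob P (last xs) us *
        (if tau_gt f (y + Ssum f xs l) us k then path_prob P (last (last xs # us)) zs * h xs zs (y + Ssum f xs l + Ssum f us k) else 0))"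
      unfolding t s d p h_def by (simp add: add.assoc)
  qed
  also have "\<dots> = (\<Sum>xs\<in>paths l. \<Sum>zs\<in>paths m. path_prob P x xs * (if tau_gt f y xs l then 1 else 0) * path_prob P (hd zs) (tl zs) *
        EE P f {0<..} k (\<lambda>x' z. P x' (hd zs) * h xs zs z) (last xs) (y + Ssum f xs l))"
  proof (rule sum.cong[OF refl], subst sum.swap, rule sum.cong[OF refl])
    fix xs zs :: "'x list" assume len: "xs \<in> paths l" "zs \<in> paths m"
    then obtain v vs where zs: "zs = v # vs" using m by (cases zs) (auto simp: paths_def)
    have "path_prob P (hd zs) (tl zs) * EE P f {0<..} k (\<lambda>x' z. P x' (hd zs) * h xs zs z) (last xs) (y + Ssum f xs l)
       = (\<Sum>us\<in>paths k. path_prob P (last xs) us * (if tau_gt f (y + Ssum f xs l) us k then path_prob P (last (last xs # us)) zs * h xs zs (y + Ssum f xs l + Ssum f us k) else 0))"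
      unfolding Exp_EE[symmetric] sum_distrib_left by (rule sum.cong) (auto simp: zs)
    then show "(\<Sum>us\<in>paths k. path_prob P x xs * (if tau_gt f y xs l then 1 else 0) * (path_prob P (last xs) us *
        (if tau_gt f (y + Ssum f xs l) us k then path_prob P (last (last xs # us)) zs * h xs zs (y + Ssum f xs l + Ssum f us k) else 0)))
      = path_prob P x xs * (if tau_gt f y xs l then 1 else 0) * path_prob P (hd zs) (tl zs) * EE P f {0<..} k (\<lambda>x' z. P x' (hd zs) * h xs zs z) (last xs) (y + Ssum f xs l)"
      by (simp only: sum_distrib_left[symmetric] mult.assoc)
  qed
  finally show ?thesis unfolding h_def .
qed

text \<open>The \<nu>-ratios telescope along the trajectory; read backwards it starts at
  \<open>last ys\<close> and ends in the former starting state x.\<close>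

lemma path_prob_dual:
  assumes "\<And>x. \<nu> x \<noteq> (0::real)" "ys \<noteq> []"
  shows "\<nu> x * path_prob (dual P \<nu>) x ys = \<nu> (last ys) * path_prob P (last ys) (tl (rev ys) @ [x])"
  using assms(2)
proof (induction ys arbitrary: x)
  case (Cons v vs)
  have "\<nu> x * path_prob (dual P \<nu>) x (v # vs) = P v x * (\<nu> v * path_prob (dual P \<nu>) v vs)"
    using assms(1)[of x] by (simp add: dual_def)
  also have "\<dots> = \<nu> (last (v # vs)) * path_prob P (last (v # vs)) (tl (rev (v # vs)) @ [x])"
  proof (cases "vs = []")
    case False
    then have ne: "rev vs \<noteq> []" by simp
    have "path_prob P (last vs) (tl (rev vs) @ [v] @ [x]) = path_prob P (last vs) (tl (rev vs) @ [v]) * P v x"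
      using path_prob_append[of P "last vs" "tl (rev vs) @ [v]" "[x]"] by simp
    then show ?thesis using Cons.IH[OF False] False ne by simp
  qed simp
  finally show ?case .
qed simp

lemma Ssum_rev:
  assumes "length zs = m" "j \<le> m"
  shows "Ssum f zs m = Ssum f (rev zs) j + Ssum f zs (m - j)"
proof -
  have "Ssum f (rev zs) j = (\<Sum>i<j. f (zs ! (m - Suc i)))" unfolding Ssum_def using assms by (intro sum.cong) (auto simp: rev_nth)
  also have "\<dots> = (\<Sum>i\<in>{m - j..<m}. f (zs ! i))"
    by (rule sum.reindex_bij_witness[where i = "\<lambda>i. m - Suc i" and j = "\<lambda>i. m - Suc i"]) (use assms in auto)
  finally have "Ssum f (rev zs) j + Ssum f zs (m - j) = (\<Sum>i\<in>{..<m - j}. f (zs ! i)) + (\<Sum>i\<in>{m - j..<m}. f (zs ! i))" unfolding Ssum_def by simp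
  also have "\<dots> = Ssum f zs m" unfolding Ssum_def
    by (subst sum.union_disjoint[symmetric]) (auto intro!: sum.cong)
  finally show ?thesis by simp
qed

lemma Ssum_minus: "Ssum (\<lambda>u. - f u) xs k = - Ssum f xs k"
  by (simp add: Ssum_def sum_negf)

text \<open>With z as terminal height, both walks visit the same m + 1 heights in opposite order.
  The separate positivity conditions supply the time-0 height that \<open>tau_gt\<close> does not
  test.\<close>

lemma tau_gt_reversed:
  assumes m: "length zs = m"
  shows "0 < z \<and> tau_gt (\<lambda>u. - f u) z (rev zs) m \<longleftrightarrow> 0 < z - Ssum f zs m \<and> tau_gt f (z - Ssum f zs m) zs m"
proof -
  have s: "z + Ssum (\<lambda>u. - f u) (rev zs) j = z - Ssum f zs m + Ssum f zs (m - j)" if "j \<le> m" for j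
    using Ssum_rev[OF m that, of f] by (simp add: Ssum_minus)
  have "0 < z \<and> tau_gt (\<lambda>u. - f u) z (rev zs) m \<longleftrightarrow> (\<forall>j\<in>{0..m}. 0 < z + Ssum (\<lambda>u. - f u) (rev zs) j)"
  proof -
    have "{0..m} = insert 0 {1..m}" by auto
    then show ?thesis unfolding tau_gt_def by (simp add: Ssum_def)
  qed
  also have "\<dots> \<longleftrightarrow> (\<forall>j\<in>{0..m}. 0 < z - Ssum f zs m + Ssum f zs (m - j))"
  proof (rule ball_cong[OF refl])
    fix j assume "j \<in> {0..m}"
    then have "j \<le> m" by simp
    then show "0 < z + Ssum (\<lambda>u. - f u) (rev zs) j \<longleftrightarrow> 0 < z - Ssum f zs m + Ssum f zs (m - j)" by (simp only: s)
  qed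
  also have "\<dots> \<longleftrightarrow> (\<forall>j\<in>{0..m}. 0 < z - Ssum f zs m + Ssum f zs j)"
    by (metis atLeastAtMost_iff diff_diff_cancel diff_le_self le0)
  also have "\<dots> \<longleftrightarrow> 0 < z - Ssum f zs m \<and> tau_gt f (z - Ssum f zs m) zs m"
  proof -
    have "{0..m} = insert 0 {1..m}" by auto
    then show ?thesis unfolding tau_gt_def by (simp add: Ssum_def)
  qed
  finally show ?thesis .
qed

text \<open>Applied at 0, which belongs to the domain of integration while the reversed final block
  requires z > 0. Measurability of \<open>A\<close> follows from that of \<open>B\<close>, as they
  differ at a single point.\<close>

lemma integral_eq_off_point:
  fixes A B :: "real \<Rightarrow> real"
  assumes "\<And>z. z \<noteq> a \<Longrightarrow> A z = B z" and B: "B \<in> borel_measurable borel"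
  shows "integral\<^sup>L lborel A = integral\<^sup>L lborel B"
proof (rule integral_cong_AE)
  have eq: "A = (\<lambda>z. if z = a then A a else B z)" using assms(1) by auto
  have "(\<lambda>z. if z = a then A a else B z) \<in> borel_measurable borel" using B by measurable
  then show "A \<in> borel_measurable lborel" by (subst eq) simp
  show "B \<in> borel_measurable lborel" using B by simp
  show "AE z in lborel. A z = B z" using AE_lborel_singleton[of a] by eventually_elim (rule assms(1))
qed

lemma tau_gt_measurable [measurable]: "Measurable.pred borel (\<lambda>z. tau_gt f z zs m)"
  unfolding tau_gt_def by measurable

text \<open>The final block seen from the height z at which it starts. Discontinuities occur only
  where a partial sum brings the walk exactly to 0, and the decay of \<open>g\<close> survives the
  shift by \<open>S\<close> because 1 + z is at most (1 + |S|) (1 + z + S) when z + S > 0.\<close>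

lemma tail_function:
  fixes g :: "real \<Rightarrow> real" and f :: "'x \<Rightarrow> real" and zs :: "'x list" and m :: nat
  assumes g: "continuous_on {0..} g" "\<And>z. 0 \<le> z \<Longrightarrow> 0 \<le> g z" and e: "0 < e"
    and b: "\<And>z. 0 \<le> z \<Longrightarrow> g z * (1 + z) powr (2 + e) \<le> C"
  defines "S \<equiv> Ssum f zs m"
  defines "G \<equiv> \<lambda>z. if 0 < z \<and> tau_gt f z zs m then g (z + S) else 0"
  assumes m: "1 \<le> m"
  shows "G \<in> borel_measurable borel" "\<And>z. 0 \<le> G z" "\<And>z. z \<le> 0 \<Longrightarrow> G z = 0"
    "\<And>z. 0 < z \<Longrightarrow> G z \<le> C * (1 + \<bar>S\<bar>) powr (2 + e) * (1 + z) powr (- (2 + e))"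
    "finite ((\<lambda>k. - Ssum f zs k) ` {..m})"
    "\<And>z. 0 < z \<Longrightarrow> z \<notin> (\<lambda>k. - Ssum f zs k) ` {..m} \<Longrightarrow> isCont G z"
proof -
  have pos: "0 < z + S" if "tau_gt f z zs m" for z using that m unfolding tau_gt_def S_def by simp
  have C: "0 \<le> C" using b[of 0] g(2)[of 0] by simp
  \<comment> \<open>\<open>g\<close> is controlled on the nonnegative half-line only; its extension
    by zero is Borel and agrees with it at z + S, which is positive whenever the block
    survives.\<close>
  define gi where "gi z = indicator {0..} z * g z" for z
  have gm [measurable]: "gi \<in> borel_measurable borel"
    unfolding gi_def using borel_measurable_continuous_on_indicator[OF _ g(1)] by simp
  have eq: "G = (\<lambda>z. if 0 < z \<and> tau_gt f z zs m then gi (z + S) else 0)"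
    unfolding G_def gi_def using pos by (auto simp: fun_eq_iff less_imp_le)
  show "G \<in> borel_measurable borel" unfolding eq by measurable
  show "0 \<le> G z" for z unfolding G_def using pos[of z] g(2)[of "z + S"] by auto
  show "G z = 0" if "z \<le> 0" for z using that unfolding G_def by simp
  show "G z \<le> C * (1 + \<bar>S\<bar>) powr (2 + e) * (1 + z) powr (- (2 + e))" if z: "0 < z" for z
  proof (cases "tau_gt f z zs m")
    case True
    define u where "u = z + S"
    have u: "0 < u" unfolding u_def by (rule pos[OF True])
    have "1 + z \<le> 1 + u + \<bar>S\<bar>" unfolding u_def by simp
    also have "\<dots> \<le> (1 + \<bar>S\<bar>) * (1 + u)" using u by (simp add: algebra_simps)
    finally have "(1 + z) powr (2 + e) \<le> ((1 + \<bar>S\<bar>) * (1 + u)) powr (2 + e)" using z e by (intro powr_mono2) auto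
    also have "\<dots> = (1 + \<bar>S\<bar>) powr (2 + e) * (1 + u) powr (2 + e)" by (rule powr_mult)
    finally have "g u * (1 + z) powr (2 + e) \<le> g u * ((1 + \<bar>S\<bar>) powr (2 + e) * (1 + u) powr (2 + e))" using g(2) u by (intro mult_left_mono) auto
    also have "\<dots> = (g u * (1 + u) powr (2 + e)) * (1 + \<bar>S\<bar>) powr (2 + e)" by simp
    also have "\<dots> \<le> C * (1 + \<bar>S\<bar>) powr (2 + e)" using b u by (intro mult_right_mono) auto
    finally have "g u \<le> C * (1 + \<bar>S\<bar>) powr (2 + e) / (1 + z) powr (2 + e)" using z by (simp add: pos_le_divide_eq)
    also have "\<dots> = C * (1 + \<bar>S\<bar>) powr (2 + e) * (1 + z) powr (- (2 + e))" unfolding powr_minus_divide by simp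
    finally show ?thesis unfolding G_def u_def using True z by simp
  qed (use C in \<open>simp add: G_def\<close>)
  show "finite ((\<lambda>k. - Ssum f zs k) ` {..m})" by simp
  show "isCont G z" if z: "0 < z" "z \<notin> (\<lambda>k. - Ssum f zs k) ` {..m}" for z
  proof (cases "tau_gt f z zs m")
    case True
    have "\<forall>\<^sub>F u in nhds z. 0 < u" by (rule order_tendstoD(1)[OF filterlim_ident z(1)])
    moreover have "\<forall>\<^sub>F u in nhds z. \<forall>j\<in>{1..m}. 0 < u + Ssum f zs j"
    proof (rule eventually_ball_finite)
      show "\<forall>j\<in>{1..m}. \<forall>\<^sub>F u in nhds z. 0 < u + Ssum f zs j"
      proof
        fix j assume "j \<in> {1..m}"
        then have "0 < z + Ssum f zs j" using True unfolding tau_gt_def by blast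
        then show "\<forall>\<^sub>F u in nhds z. 0 < u + Ssum f zs j" by (rule order_tendstoD(1)[OF tendsto_add[OF filterlim_ident tendsto_const]])
      qed
    qed simp
    ultimately have ev: "\<forall>\<^sub>F u in nhds z. G u = g (u + S)"
      by eventually_elim (simp add: G_def tau_gt_def)
    have "isCont g (z + S)"
      by (rule continuous_on_interior[OF g(1)]) (use pos[OF True] in simp)
    then have "isCont (\<lambda>u. g (u + S)) z" by (intro isCont_o2[of z "\<lambda>u. u + S" g]) auto
    then show ?thesis using isCont_cong[OF ev] by simp
  next
    case False
    then obtain j where j: "j \<in> {1..m}" "z + Ssum f zs j \<le> 0" unfolding tau_gt_def by (auto simp: not_less)
    have "z + Ssum f zs j \<noteq> 0" using z(2) j(1) by force
    with j(2) have "z + Ssum f zs j < 0" by simp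
    then have "\<forall>\<^sub>F u in nhds z. u + Ssum f zs j < 0" by (rule order_tendstoD(2)[OF tendsto_add[OF filterlim_ident tendsto_const]])
    then have ev: "\<forall>\<^sub>F u in nhds z. G u = 0"
    proof eventually_elim
      case (elim u)
      then have "\<not> tau_gt f u zs m" using j(1) unfolding tau_gt_def by (meson not_less_iff_gr_or_eq)
      then show ?case by (simp add: G_def)
    qed
    then show ?thesis using isCont_cong[OF ev] by simp
  qed
qed

context mwalk
begin

lemma Vfun_V0: "Vfun P f (sigma P \<nu> f) x y = V0 x y"
proof -
  have "(\<lambda>n. sqrt (real n) * surv P f x y n) \<longlonglongrightarrow> 2 / (sqrt (2 * pi) * sqrt sg2) * V0 x y"
    using survival_limit[of x y] unfolding surv_EE qn_def .
  then have "lim (\<lambda>n. sqrt (real n) * surv P f x y n) = 2 / (sqrt (2 * pi) * sqrt sg2) * V0 x y" by (rule limI)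
  then show ?thesis unfolding Vfun_def sigma_def using sg2_pos by simp
qed

lemma Vfun_dual: "Vfun (dual P \<nu>) (\<lambda>u. - f u) (sigma P \<nu> f) x y = Vd x y"
proof -
  interpret d: mwalk "dual P \<nu>" "\<lambda>u. - f u" \<nu> by (rule dual_mwalk)
  have "sigma P \<nu> f = sigma (dual P \<nu>) \<nu> (\<lambda>u. - f u)" unfolding sigma_def sg2_dual ..
  then show ?thesis using d.Vfun_V0 by simp
qed

text \<open>In the reversed picture x' is the state that follows the final block, and it is summed
  out by row normalisation of \<open>P\<close>.\<close>

lemma sum_dual_path:
  assumes "zs \<noteq> []"
  shows "(\<Sum>x'\<in>UNIV. \<nu> x' * path_prob (dual P \<nu>) x' (rev zs)) = \<nu> (hd zs) * path_prob P (hd zs) (tl zs)"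
proof -
  have nz: "\<nu> x \<noteq> 0" for x using nu_pos[of x] by simp
  have "(\<Sum>x'\<in>UNIV. \<nu> x' * path_prob (dual P \<nu>) x' (rev zs)) = (\<Sum>x'\<in>UNIV. \<nu> (hd zs) * (path_prob P (hd zs) (tl zs) * P (last (hd zs # tl zs)) x'))"
    using path_prob_dual[where \<nu> = \<nu> and P = P and ys = "rev zs", OF nz] assms by (simp add: last_rev path_prob_append)
  also have "\<dots> = \<nu> (hd zs) * path_prob P (hd zs) (tl zs)" by (simp only: sum_distrib_left[symmetric] P_sum mult_1_right)
  finally show ?thesis .
qed

text \<open>The two boundary blocks range over finite sets, so \<open>base_limit\<close> applies to
  each pair separately. Reversing the final block then turns its weights into those of the dual
  chain started from \<nu>.\<close>

lemma main_limit:
  assumes l: "1 \<le> l" and m: "1 \<le> m" and g: "Cplus (l + m) g"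
  shows "(\<lambda>n. real n powr (3/2) *
            Exp P x n (\<lambda>xs. if tau_gt f y xs n
                             then g (take l xs @ drop (n - m) xs) (y + Ssum f xs n) else 0))
         \<longlonglongrightarrow>
         2 / (sqrt (2 * pi) * sigma P \<nu> f ^ 3) *
         (LBINT z:{0..}.
            (\<Sum>x'\<in>UNIV.
               (\<Sum>xs\<in>paths l. \<Sum>ys\<in>paths m.
                  path_prob P x xs * path_prob (dual P \<nu>) x' ys *
                  (if tau_gt f y xs l \<and> tau_gt (\<lambda>u. - f u) z ys m
                   then g (take l xs @ rev ys) z
                        * Vfun P f (sigma P \<nu> f) (last xs) (y + Ssum f xs l)
                        * Vfun (dual P \<nu>) (\<lambda>u. - f u) (sigma P \<nu> f) (last ys)
                               (z + Ssum (\<lambda>u. - f u) ys m)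
                   else 0))
               * \<nu> x'))"
proof -
  interpret d: mwalk "dual P \<nu>" "\<lambda>u. - f u" \<nu> by (rule dual_mwalk)
  obtain e C where eC: "0 < e" "\<forall>xs. length xs = l + m \<longrightarrow> (\<forall>z\<ge>0. g xs z * (1 + z) powr (2 + e) \<le> C)"
    using g unfolding Cplus_def by blast
  have gc: "0 < e" "\<And>xs. length xs = l + m \<Longrightarrow> continuous_on {0..} (g xs)" "\<And>xs z. length xs = l + m \<Longrightarrow> 0 \<le> z \<Longrightarrow> 0 \<le> g xs z"
    "\<And>xs z. length xs = l + m \<Longrightarrow> 0 \<le> z \<Longrightarrow> g xs z * (1 + z) powr (2 + e) \<le> C"
    using g eC unfolding Cplus_def by blast+
  define I where "I xs = path_prob P x xs * (if tau_gt f y xs l then 1 else 0 :: real)" for xs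
  define G where "G xs zs z = (if 0 < z \<and> tau_gt f z zs m then g (xs @ zs) (z + Ssum f zs m) else 0)" for xs zs z
  define pp where "pp zs = path_prob P (hd zs) (tl zs)" for zs
  have len: "length (xs @ zs) = l + m" if "xs \<in> paths l" "zs \<in> paths m" for xs zs :: "'x list" using that by (simp add: paths_def)
  have tf: "G xs zs \<in> borel_measurable borel" "\<And>z. 0 \<le> G xs zs z" "\<And>z. z \<le> 0 \<Longrightarrow> G xs zs z = 0"
    "\<And>z. 0 < z \<Longrightarrow> G xs zs z \<le> C * (1 + \<bar>Ssum f zs m\<bar>) powr (2 + e) * (1 + z) powr (- (2 + e))"
    "finite ((\<lambda>k. - Ssum f zs k) ` {..m})"
    "\<And>z. 0 < z \<Longrightarrow> z \<notin> (\<lambda>k. - Ssum f zs k) ` {..m} \<Longrightarrow> isCont (G xs zs) z" if "xs \<in> paths l" "zs \<in> paths m" for xs zs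
    unfolding G_def by (rule tail_function[OF gc(2)[OF len[OF that]] gc(3)[OF len[OF that]] gc(1) gc(4)[OF len[OF that]] m]; assumption?)+
  have bl: "(\<lambda>k. k * sqrt k * U k (G xs zs) (hd zs) (last xs) (y + Ssum f xs l)) \<longlonglongrightarrow>
      c0 * V0 (last xs) (y + Ssum f xs l) * (\<nu> (hd zs) * (\<integral>z. G xs zs z * Vd (hd zs) z \<partial>lborel))" if "xs \<in> paths l" "zs \<in> paths m" for xs zs
    by (rule base_limit[OF gc(1) tf[OF that]])
  define E where "E n = Exp P x n (\<lambda>xs. if tau_gt f y xs n then g (take l xs @ drop (n - m) xs) (y + Ssum f xs n) else 0)" for n
  have Eeq: "E (k + (l + m)) = (\<Sum>xs\<in>paths l. \<Sum>zs\<in>paths m. I xs * pp zs * U k (G xs zs) (hd zs) (last xs) (y + Ssum f xs l))" if k: "0 < k" for k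
  proof -
    have "U k (G xs zs) (hd zs) (last xs) v = ED k (\<lambda>x' z. P x' (hd zs) * (if tau_gt f z zs m then g (xs @ zs) (z + Ssum f zs m) else 0)) (last xs) v" for xs zs v
      unfolding U_def G_def by (intro antisym EE_mono_pos k) auto
    moreover have "k + (l + m) = l + (k + m)" by simp
    ultimately show ?thesis unfolding E_def I_def pp_def by (simp only: Exp_split[OF l m])
  qed
  define Lim where "Lim = (\<Sum>xs\<in>paths l. \<Sum>zs\<in>paths m. I xs * pp zs * (c0 * V0 (last xs) (y + Ssum f xs l) * (\<nu> (hd zs) * (\<integral>z. G xs zs z * Vd (hd zs) z \<partial>lborel))))"
  have lim1: "(\<lambda>k. k * sqrt k * E (k + (l + m))) \<longlonglongrightarrow> Lim"
  proof (rule Lim_transform_eventually)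
    show "(\<lambda>k. \<Sum>xs\<in>paths l. \<Sum>zs\<in>paths m. I xs * pp zs * (k * sqrt k * U k (G xs zs) (hd zs) (last xs) (y + Ssum f xs l))) \<longlonglongrightarrow> Lim"
      unfolding Lim_def by (intro tendsto_sum tendsto_mult_left bl)
    show "\<forall>\<^sub>F k in sequentially. (\<Sum>xs\<in>paths l. \<Sum>zs\<in>paths m. I xs * pp zs * (k * sqrt k * U k (G xs zs) (hd zs) (last xs) (y + Ssum f xs l))) = k * sqrt k * E (k + (l + m))"
      using eventually_gt_at_top[of 0] by eventually_elim (simp add: Eeq sum_distrib_left mult_ac)
  qed
  \<comment> \<open>The middle functional has k = n - l - m steps; the ratio n / k tends to 1, so
    the normalisation k^(3/2) may be replaced by n^(3/2).\<close>
  have lim2: "(\<lambda>n. real n powr (3/2) * E n) \<longlonglongrightarrow> Lim"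
  proof (rule LIMSEQ_offset[of _ "l + m"], rule Lim_transform_eventually)
    have "(\<lambda>k. real (k + (l + m)) / real k) \<longlonglongrightarrow> 1 + 0"
    proof (rule Lim_transform_eventually)
      show "(\<lambda>k. 1 + real (l + m) / real k) \<longlonglongrightarrow> 1 + 0" by (intro tendsto_add tendsto_const lim_const_over_n)
      show "\<forall>\<^sub>F k in sequentially. 1 + real (l + m) / real k = real (k + (l + m)) / real k"
        using eventually_gt_at_top[of 0] by eventually_elim (simp add: field_simps)
    qed
    then have "(\<lambda>k. (real (k + (l + m)) / real k) powr (3/2)) \<longlonglongrightarrow> 1 powr (3/2)" by (intro tendsto_powr) auto
    from tendsto_mult[OF this lim1]
    show "(\<lambda>k. (real (k + (l + m)) / real k) powr (3/2) * (k * sqrt k * E (k + (l + m)))) \<longlonglongrightarrow> Lim" by simp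
    show "\<forall>\<^sub>F k in sequentially. (real (k + (l + m)) / real k) powr (3/2) * (k * sqrt k * E (k + (l + m))) = real (k + (l + m)) powr (3/2) * E (k + (l + m))"
      using eventually_gt_at_top[of 0]
    proof eventually_elim
      case (elim k)
      have "real k * sqrt k = real k powr 1 * real k powr (1/2)" using elim by (simp add: powr_half_sqrt)
      also have "\<dots> = real k powr (3/2)" unfolding powr_add[symmetric] by simp
      finally have kk: "real k * sqrt k = real k powr (3/2)" .
      have "(real (k + (l + m)) / real k) powr (3/2) = real (k + (l + m)) powr (3/2) / real k powr (3/2)" by (rule powr_divide)
      then show ?case unfolding kk using elim by simp
    qed
  qed
  define S where "S zs = Ssum f zs m" for zs
  \<comment> \<open>Translation by S passes from the height at which the final block starts to the
    terminal height z, the variable of integration in the claim.\<close>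
  define \<Phi> where "\<Phi> xs zs z = G xs zs (z - S zs) * Vd (hd zs) (z - S zs)" for xs zs z
  have ne: "zs \<noteq> []" if "zs \<in> paths m" for zs :: "'x list" using that m by (auto simp: paths_def)
  obtain CV where CV: "0 < CV" "\<forall>w z. 0 \<le> Vd w z \<and> Vd w z \<le> CV * (1 + max z 0)" using d.V0_bounds by blast
  have GV: "integrable lborel (\<lambda>z. G xs zs z * Vd (hd zs) z)" if p: "xs \<in> paths l" "zs \<in> paths m" for xs zs
  proof (rule adm_weighted(1)[OF adm_powr_tail[OF gc(1) tf(1-4)[OF p]] d.V0_measurable])
    fix z :: real assume "0 \<le> z"
    then show "\<bar>Vd (hd zs) z\<bar> \<le> CV * (1 + \<bar>z\<bar>)" using CV(2)[rule_format, of "hd zs" z] by (simp add: max_def)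
  qed
  have \<Phi>: "integrable lborel (\<Phi> xs zs)" "(\<integral>z. \<Phi> xs zs z \<partial>lborel) = (\<integral>z. G xs zs z * Vd (hd zs) z \<partial>lborel)" if "xs \<in> paths l" "zs \<in> paths m" for xs zs
    unfolding \<Phi>_def using integrable_shift[OF GV[OF that], of "- S zs"] integral_shift[of "\<lambda>z. G xs zs z * Vd (hd zs) z" "- S zs"] by simp_all
  have integrand: "indicator {0..} z *\<^sub>R (\<Sum>x'\<in>UNIV.
               (\<Sum>xs\<in>paths l. \<Sum>ys\<in>paths m.
                  path_prob P x xs * path_prob (dual P \<nu>) x' ys *
                  (if tau_gt f y xs l \<and> tau_gt (\<lambda>u. - f u) z ys m
                   then g (take l xs @ rev ys) z
                        * Vfun P f (sigma P \<nu> f) (last xs) (y + Ssum f xs l)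
                        * Vfun (dual P \<nu>) (\<lambda>u. - f u) (sigma P \<nu> f) (last ys)
                               (z + Ssum (\<lambda>u. - f u) ys m)
                   else 0))
               * \<nu> x') = (\<Sum>xs\<in>paths l. \<Sum>zs\<in>paths m. I xs * pp zs * V0 (last xs) (y + Ssum f xs l) * \<nu> (hd zs) * \<Phi> xs zs z)" if z: "z \<noteq> 0" for z
  proof -
    \<comment> \<open>The same block written with the reversed trajectory; by
      \<open>tau_gt_reversed\<close> it coincides with \<open>\<Phi>\<close>.\<close>
    define T where "T xs zs = (if 0 < z \<and> tau_gt (\<lambda>u. - f u) z (rev zs) m then g (xs @ zs) z * Vd (hd zs) (z - S zs) else 0)" for xs zs
    have T\<Phi>: "T xs zs = \<Phi> xs zs z" if "zs \<in> paths m" for xs zs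
      using tau_gt_reversed[of zs m z f] that unfolding T_def \<Phi>_def G_def S_def by (simp add: paths_def)
    have Srev: "Ssum f (rev zs) m = S zs" if "zs \<in> paths m" for zs
      using Ssum_rev[of zs m m f] that by (simp add: paths_def S_def Ssum_def)
    have "indicator {0..} z *\<^sub>R (\<Sum>x'\<in>UNIV.
               (\<Sum>xs\<in>paths l. \<Sum>ys\<in>paths m.
                  path_prob P x xs * path_prob (dual P \<nu>) x' ys *
                  (if tau_gt f y xs l \<and> tau_gt (\<lambda>u. - f u) z ys m
                   then g (take l xs @ rev ys) z
                        * Vfun P f (sigma P \<nu> f) (last xs) (y + Ssum f xs l)
                        * Vfun (dual P \<nu>) (\<lambda>u. - f u) (sigma P \<nu> f) (last ys)
                               (z + Ssum (\<lambda>u. - f u) ys m)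
                   else 0))
               * \<nu> x') = (\<Sum>x'\<in>UNIV. \<Sum>xs\<in>paths l. \<Sum>ys\<in>paths m. I xs * V0 (last xs) (y + Ssum f xs l) * T xs (rev ys) * (\<nu> x' * path_prob (dual P \<nu>) x' ys))"
      unfolding Vfun_V0 Vfun_dual real_scaleR_def sum_distrib_left sum_distrib_right
    proof (intro sum.cong refl)
      fix x' :: 'x and xs ys :: "'x list" assume p: "xs \<in> paths l" "ys \<in> paths m"
      have "rev ys \<in> paths m" using p by (simp add: paths_def)
      then have a: "Ssum f ys m = S (rev ys)" using Srev[of "rev ys"] by simp
      have b: "hd (rev ys) = last ys" using ne[OF p(2)] by (simp add: hd_rev)
      have c: "take l xs = xs" using p by (simp add: paths_def)
      have "0 \<le> z \<longleftrightarrow> 0 < z" using z by auto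
      then show "indicator {0..} z * (path_prob P x xs * path_prob (dual P \<nu>) x' ys *
                  (if tau_gt f y xs l \<and> tau_gt (\<lambda>u. - f u) z ys m
                   then g (take l xs @ rev ys) z * V0 (last xs) (y + Ssum f xs l) * Vd (last ys) (z + Ssum (\<lambda>u. - f u) ys m) else 0) * \<nu> x')
          = I xs * V0 (last xs) (y + Ssum f xs l) * T xs (rev ys) * (\<nu> x' * path_prob (dual P \<nu>) x' ys)"
        unfolding I_def T_def c b Ssum_minus a rev_rev_ident by (auto simp: indicator_def)
    qed
    also have "\<dots> = (\<Sum>x'\<in>UNIV. \<Sum>xs\<in>paths l. \<Sum>zs\<in>paths m. I xs * V0 (last xs) (y + Ssum f xs l) * T xs zs * (\<nu> x' * path_prob (dual P \<nu>) x' (rev zs)))"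
    proof (rule sum.cong[OF refl], rule sum.cong[OF refl])
      fix x' :: 'x and xs :: "'x list"
      show "(\<Sum>ys\<in>paths m. I xs * V0 (last xs) (y + Ssum f xs l) * T xs (rev ys) * (\<nu> x' * path_prob (dual P \<nu>) x' ys)) =
        (\<Sum>zs\<in>paths m. I xs * V0 (last xs) (y + Ssum f xs l) * T xs zs * (\<nu> x' * path_prob (dual P \<nu>) x' (rev zs)))"
        using sum_paths_rev[of "\<lambda>zs. I xs * V0 (last xs) (y + Ssum f xs l) * T xs zs * (\<nu> x' * path_prob (dual P \<nu>) x' (rev zs))" m] by simp
    qed
    also have "\<dots> = (\<Sum>xs\<in>paths l. \<Sum>zs\<in>paths m. I xs * V0 (last xs) (y + Ssum f xs l) * T xs zs * (\<Sum>x'\<in>UNIV. \<nu> x' * path_prob (dual P \<nu>) x' (rev zs)))"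
      unfolding sum_distrib_left by (subst sum.swap, rule sum.cong[OF refl], rule sum.swap)
    also have "\<dots> = (\<Sum>xs\<in>paths l. \<Sum>zs\<in>paths m. I xs * pp zs * V0 (last xs) (y + Ssum f xs l) * \<nu> (hd zs) * \<Phi> xs zs z)"
      by (intro sum.cong refl) (simp add: sum_dual_path ne T\<Phi> pp_def)
    finally show ?thesis .
  qed
  have J: "(LBINT z:{0..}.
            (\<Sum>x'\<in>UNIV.
               (\<Sum>xs\<in>paths l. \<Sum>ys\<in>paths m.
                  path_prob P x xs * path_prob (dual P \<nu>) x' ys *
                  (if tau_gt f y xs l \<and> tau_gt (\<lambda>u. - f u) z ys m
                   then g (take l xs @ rev ys) z
                        * Vfun P f (sigma P \<nu> f) (last xs) (y + Ssum f xs l)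
                        * Vfun (dual P \<nu>) (\<lambda>u. - f u) (sigma P \<nu> f) (last ys)
                               (z + Ssum (\<lambda>u. - f u) ys m)
                   else 0))
               * \<nu> x')) = (\<integral>z. (\<Sum>xs\<in>paths l. \<Sum>zs\<in>paths m. I xs * pp zs * V0 (last xs) (y + Ssum f xs l) * \<nu> (hd zs) * \<Phi> xs zs z) \<partial>lborel)"
    (is "?J = integral\<^sup>L lborel ?R") unfolding set_lebesgue_integral_def
  proof (rule integral_eq_off_point[where a = 0])
    show "?R \<in> borel_measurable borel"
      using \<Phi>(1) by (intro borel_measurable_sum borel_measurable_times borel_measurable_const) (auto dest: borel_measurable_integrable)
  qed (rule integrand)
  have "?J = (\<Sum>xs\<in>paths l. \<integral>z. (\<Sum>zs\<in>paths m. I xs * pp zs * V0 (last xs) (y + Ssum f xs l) * \<nu> (hd zs) * \<Phi> xs zs z) \<partial>lborel)"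
    unfolding J by (rule Bochner_Integration.integral_sum) (intro Bochner_Integration.integrable_sum integrable_mult_right \<Phi>)
  also have "\<dots> = (\<Sum>xs\<in>paths l. \<Sum>zs\<in>paths m. I xs * pp zs * V0 (last xs) (y + Ssum f xs l) * \<nu> (hd zs) * (\<integral>z. \<Phi> xs zs z \<partial>lborel))"
  proof (rule sum.cong[OF refl])
    fix xs :: "'x list" assume xs: "xs \<in> paths l"
    have "(\<integral>z. (\<Sum>zs\<in>paths m. I xs * pp zs * V0 (last xs) (y + Ssum f xs l) * \<nu> (hd zs) * \<Phi> xs zs z) \<partial>lborel)
      = (\<Sum>zs\<in>paths m. \<integral>z. I xs * pp zs * V0 (last xs) (y + Ssum f xs l) * \<nu> (hd zs) * \<Phi> xs zs z \<partial>lborel)"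
      by (rule Bochner_Integration.integral_sum) (intro integrable_mult_right \<Phi> xs)
    then show "(\<integral>z. (\<Sum>zs\<in>paths m. I xs * pp zs * V0 (last xs) (y + Ssum f xs l) * \<nu> (hd zs) * \<Phi> xs zs z) \<partial>lborel)
      = (\<Sum>zs\<in>paths m. I xs * pp zs * V0 (last xs) (y + Ssum f xs l) * \<nu> (hd zs) * (\<integral>z. \<Phi> xs zs z \<partial>lborel))"
      by (simp only: integral_mult_right_zero)
  qed
  finally have "c0 * ?J = Lim" unfolding Lim_def sum_distrib_left
    by (simp only:) (simp add: sum_distrib_left \<Phi>(2) mult_ac)
  then show ?thesis using lim2 unfolding E_def c0_def sigma_def by simp
qed

end

theorem theorem2p7:
  fixes P :: "'x::finite \<Rightarrow> 'x \<Rightarrow> real" and \<nu> :: "'x \<Rightarrow> real" and f :: "'x \<Rightarrow> real"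
    and g :: "'x list \<Rightarrow> real \<Rightarrow> real"
    and x :: 'x and y :: real and l m :: nat
  assumes stoch: "stochastic P"
    and inv: "invariant_prob P \<nu>"
    and h1: "H1 P" and h2: "H2 \<nu> f" and h3: "H3 P f"
    and l: "l \<ge> 1" and m: "m \<ge> 1"
    and g: "Cplus (l + m) g"
  shows "(\<lambda>n. real n powr (3/2) *
            Exp P x n (\<lambda>xs. if tau_gt f y xs n
                             then g (take l xs @ drop (n - m) xs) (y + Ssum f xs n) else 0))
         \<longlonglongrightarrow>
         2 / (sqrt (2 * pi) * sigma P \<nu> f ^ 3) *
         (LBINT z:{0..}.
            (\<Sum>x'\<in>UNIV.
               (\<Sum>xs\<in>paths l. \<Sum>ys\<in>paths m.
                  path_prob P x xs * path_prob (dual P \<nu>) x' ys *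
                  (if tau_gt f y xs l \<and> tau_gt (\<lambda>u. - f u) z ys m
                   then g (take l xs @ rev ys) z
                        * Vfun P f (sigma P \<nu> f) (last xs) (y + Ssum f xs l)
                        * Vfun (dual P \<nu>) (\<lambda>u. - f u) (sigma P \<nu> f) (last ys)
                               (z + Ssum (\<lambda>u. - f u) ys m)
                   else 0))
               * \<nu> x'))"
proof -
  interpret mwalk P f \<nu> by (rule mwalk_of_hyps[OF stoch inv h1 h2 h3])
  show ?thesis by (rule main_limit[OF l m g])
qed

end
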